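(* Let $k,d$ be positive integers with $k\geq 3$ and let $\mathbb{F}\in\{\mathbb{R},\mathbb{C}\}$. Then, asymptotically almost surely (as $n\to\infty$), the random $k$-partite $k$-graph $G(n,M_{d+1})\subseteq K_n^k$ is globally rigid in $\mathbb{F}^d$.
   Context: A $k$-graph is a $k$-uniform hypergraph. $K_n^k$ is the complete $k$-partite $k$-graph with vertex classes $V_1,\dots,V_k$, each of size $n$ (edges are all sets meeting each $V_i$ in exactly one vertex); $N=kn$ is its number of vertices. Subgraphs $G\subseteq K_n^k$ are taken on the full vertex set $V=V_1\cup\dots\cup V_k$. Random graphs: order the $n^k$ edges of $K_n^k$ uniformly at random and let $G(n,m)$ be the subgraph of $K_n^k$ on the full vertex set formed by the first $m$ edges. $M_s=\min\{m:\text{the minimum degree of }G(n,m)\text{ is at least }s\}$, where the degree of a vertex is the number of edges containing it; $G(n,M_s)$ is the graph of this process at the random time $M_s$. A property holds asymptotically almost surely if its probability tends to $1$ as $n\to\infty$. Rigidity: a $d$-dimensional point configuration is $\mathbf p=(p_v)_{v\in V}\in(\mathbb{F}^d)^N$, with $p_{v,j}$ the $j$-th coordinate of $p_v$; it is generic if its $dN$ coordinates are algebraically independent over $\mathbb{Q}$. The rigidity map is $f_G^d(\mathbf p)=\big(\sum_{j=1}^d\prod_{v\in e}p_{v,j}\big)_{e\in E(G)}$. Two configurations $\mathbf p,\mathbf q$ are congruent if there are a permutation matrix $\Sigma$ and invertible diagonal matrices $D_1,\dots,D_k$ in $GL(d,\mathbb{F})$ with $\prod_{i=1}^kD_i=I_d$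 such that $q_v=D_i\Sigma p_v$ for all $v\in V_i$ and all $i$. $(G,\mathbf p)$ is globally rigid if every $\mathbf q\in(\mathbb{F}^d)^N$ with $f_G^d(\mathbf q)=f_G^d(\mathbf p)$ is congruent to $\mathbf p$. $G$ is globally rigid in $\mathbb{F}^d$ if $(G,\mathbf p)$ is globally rigid for all generic $\mathbf p\in(\mathbb{F}^d)^N$. *)

theory Defs
  imports
    "HOL-Probability.Probability"
    "HOL-Combinatorics.Multiset_Permutations"
    "HOL-Library.Poly_Mapping"
    "Jordan_Normal_Form.Matrix"
begin

section \<open>The complete k-partite k-graph\<close>

text \<open>
  The vertex \<open>(i, a)\<close> with \<open>i < k\<close> and \<open>a < n\<close> is the \<open>a\<close>-th vertex of the \<open>i\<close>-th class (classes
  are indexed from 0). Every subgraph is taken on the full vertex set, so that it is represented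
  by its edge set alone.
\<close>

type_synonym vertex = "nat \<times> nat"
type_synonym edge = "vertex set"

definition vertex_class :: "nat \<Rightarrow> nat \<Rightarrow> vertex set" where
  "vertex_class n i = {i} \<times> {..<n}"

definition vertices :: "nat \<Rightarrow> nat \<Rightarrow> vertex set" where
  "vertices k n = (\<Union>i<k. vertex_class n i)"

definition complete_edges :: "nat \<Rightarrow> nat \<Rightarrow> edge set" where
  "complete_edges k n =
     {e. e \<subseteq> vertices k n \<and> (\<forall>i<k. card (e \<inter> vertex_class n i) = 1)}"

definition degree_in :: "edge set \<Rightarrow> vertex \<Rightarrow> nat" where
  "degree_in G v = card {e \<in> G. v \<in> e}"

definition min_degree :: "nat \<Rightarrow> nat \<Rightarrow> edge set \<Rightarrow> nat" where
  "min_degree k n G = Min (degree_in G ` vertices k n)"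


section \<open>The random graph process\<close>

definition edge_ordering :: "nat \<Rightarrow> nat \<Rightarrow> edge list pmf" where
  "edge_ordering k n = pmf_of_set (permutations_of_set (complete_edges k n))"

definition process_graph :: "edge list \<Rightarrow> nat \<Rightarrow> edge set" where
  "process_graph es m = set (take m es)"

text \<open>
  The following minimum exists as soon as \<open>n > 0\<close> and \<open>s \<le> n ^ (k - 1)\<close>, hence, for
  \<open>k \<ge> 2\<close> and fixed \<open>s\<close>, for all but finitely many \<open>n\<close>; its value for the remaining \<open>n\<close> is irrelevant
  for asymptotic statements.
\<close>

definition min_degree_time :: "nat \<Rightarrow> nat \<Rightarrow> nat \<Rightarrow> edge list \<Rightarrow> nat" where
  "min_degree_time k n s es = (LEAST m. min_degree k n (process_graph es m) \<ge> s)"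

text \<open>The distribution of the random graph $G(n, M_s)$.\<close>

definition stopped_graph :: "nat \<Rightarrow> nat \<Rightarrow> nat \<Rightarrow> edge set pmf" where
  "stopped_graph k n s =
     map_pmf (\<lambda>es. process_graph es (min_degree_time k n s es)) (edge_ordering k n)"

text \<open>\<open>P n\<close> is the property under consideration for the \<open>n\<close>-th random object \<open>X n\<close>.\<close>

definition asymptotically_almost_surely :: "(nat \<Rightarrow> 'g pmf) \<Rightarrow> (nat \<Rightarrow> 'g \<Rightarrow> bool) \<Rightarrow> bool" where
  "asymptotically_almost_surely X P \<longleftrightarrow>
     (\<lambda>n. measure_pmf.prob (X n) {G. P n G}) \<longlonglongrightarrow> 1"


section \<open>Algebraic independence over the rationals\<close>

text \<open>
  Polynomials with rational coefficients in indeterminates indexed by \<open>'i\<close> are finitely supported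
  maps from monomials (finitely supported exponent maps) to coefficients.
\<close>

type_synonym 'i rat_mpoly = "('i \<Rightarrow>\<^sub>0 nat) \<Rightarrow>\<^sub>0 rat"

definition eval_mpoly :: "('i \<Rightarrow> 'a::field_char_0) \<Rightarrow> 'i rat_mpoly \<Rightarrow> 'a" where
  "eval_mpoly x P =
     (\<Sum>m\<in>Poly_Mapping.keys P. of_rat (Poly_Mapping.lookup P m) *
        (\<Prod>i\<in>Poly_Mapping.keys m. x i ^ Poly_Mapping.lookup m i))"

definition algebraically_independent :: "'i set \<Rightarrow> ('i \<Rightarrow> 'a::field_char_0) \<Rightarrow> bool" where
  "algebraically_independent I x \<longleftrightarrow>
     (\<forall>P :: 'i rat_mpoly.
        (\<forall>m\<in>Poly_Mapping.keys P. Poly_Mapping.keys m \<subseteq> I) \<and> eval_mpoly x P = 0 \<longrightarrow> P = 0)"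


section \<open>Rigidity\<close>

text \<open>
  A configuration assigns a vector of length \<open>d\<close> to every vertex; its values outside
  \<open>vertices k n\<close> are never inspected. Coordinates are indexed from 0. The type of vectors is written
  with its qualified name, and \<open>vec_index\<close> is used in place of its infix form, because
  \<open>HOL-Analysis\<close> uses the same names for vectors indexed by a finite type.
\<close>

type_synonym 'a configuration = "vertex \<Rightarrow> 'a Matrix.vec"

definition configurations :: "nat \<Rightarrow> nat \<Rightarrow> nat \<Rightarrow> 'a configuration set" where
  "configurations k n d = {p. \<forall>v\<in>vertices k n. p v \<in> carrier_vec d}"

definition generic :: "nat \<Rightarrow> nat \<Rightarrow> nat \<Rightarrow> ('a::field_char_0) configuration \<Rightarrow> bool" where
  "generic k n d p \<longleftrightarrow>
     algebraically_independent (vertices k n \<times> {..<d}) (\<lambda>(v, j). vec_index (p v) j)"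

definition rigidity_map ::
    "nat \<Rightarrow> edge set \<Rightarrow> ('a::field_char_0) configuration \<Rightarrow> edge \<Rightarrow> 'a" where
  "rigidity_map d G p = (\<lambda>e\<in>G. \<Sum>j<d. \<Prod>v\<in>e. vec_index (p v) j)"

definition permutation_matrix :: "nat \<Rightarrow> ('a::field_char_0) Matrix.mat \<Rightarrow> bool" where
  "permutation_matrix d S \<longleftrightarrow>
     (\<exists>\<sigma>. \<sigma> permutes {..<d} \<and> S = Matrix.mat d d (\<lambda>(i, j). if i = \<sigma> j then 1 else 0))"

text \<open>
  The class of matrices is not a monoid (the identity depends on the dimension), so the product
  of the diagonal matrices is written as a fold.
\<close>

definition congruent_configurations ::
    "nat \<Rightarrow> nat \<Rightarrow> nat \<Rightarrow> ('a::field_char_0) configuration \<Rightarrow> 'a configuration \<Rightarrow> bool" where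
  "congruent_configurations k n d p q \<longleftrightarrow>
     (\<exists>S D. permutation_matrix d S \<and>
        (\<forall>i<k. D i \<in> carrier_mat d d \<and> diagonal_mat (D i) \<and> invertible_mat (D i)) \<and>
        foldr (*) (map D [0..<k]) (1\<^sub>m d) = 1\<^sub>m d \<and>
        (\<forall>i<k. \<forall>v\<in>vertex_class n i. q v = D i *\<^sub>v (S *\<^sub>v p v)))"

definition globally_rigid_configuration ::
    "nat \<Rightarrow> nat \<Rightarrow> nat \<Rightarrow> edge set \<Rightarrow> ('a::field_char_0) configuration \<Rightarrow> bool" where
  "globally_rigid_configuration k n d G p \<longleftrightarrow>
     (\<forall>q \<in> configurations k n d.
        rigidity_map d G q = rigidity_map d G p \<longrightarrow> congruent_configurations k n d p q)"

text \<open>The type argument selects the field.\<close>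

definition globally_rigid ::
    "('a::field_char_0) itself \<Rightarrow> nat \<Rightarrow> nat \<Rightarrow> nat \<Rightarrow> edge set \<Rightarrow> bool" where
  "globally_rigid F k n d G \<longleftrightarrow>
     (\<forall>p :: 'a configuration.
        p \<in> configurations k n d \<and> generic k n d p \<longrightarrow> globally_rigid_configuration k n d G p)"

end

theory Submission
  imports
    Defs
    "HOL-Computational_Algebra.Polynomial"
    "HOL-Library.Nat_Bijection"
    "HOL-Number_Theory.Cong"
    "HOL-Real_Asymp.Real_Asymp"
    "Jordan_Normal_Form.Determinant"
begin

text \<open>
  Let \<open>q\<close> have the same edge values as the generic configuration \<open>p\<close>. Since the coordinates of \<open>p\<close>
  are algebraically independent, there is for every coordinate a derivation \<open>\<delta> v j\<close> of the field that
  sends this coordinate of \<open>p\<close> to 1 and the others to 0 (\<open>derivation_dual_to_coordinate\<close>). Applied to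
  the equations between the edge values, it turns them into linear equations: the Jacobian at \<open>q\<close>
  maps the derivatives of \<open>q\<close> to what the Jacobian at \<open>p\<close> makes of the unit vectors. Suppose that \<open>G\<close>
  stays infinitesimally rigid when any one vertex is removed. Then, once the scalings are normalised,
  \<open>q v\<close> is a constant linear image \<open>R v\<close> of \<open>p v\<close>, for all but boundedly many vertices \<open>v\<close>, and along
  every edge between such vertices these linear maps preserve the unit tensor of rank \<open>d\<close>. For tensors with at least three
  factors this forces the maps to be monomial matrices with a common permutation and with entries of
  product 1 (\<open>unit_tensor_stabiliser\<close>). So such an edge sees \<open>q\<close> as a permuted and rescaled copy of \<open>p\<close>.

  It remains to see that the scaling factors depend on the class of the vertex only. If \<open>G\<close> has an edge
  in every box of linear side, comparing edges through lower and upper quantiles of the logarithms shows that the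
  factors are constant on most of each class (\<open>almost_congruent\<close>). The exceptional vertices are
  then treated one at a time: every small vertex set contains a vertex with \<open>d\<close> edges that avoid the
  rest of the set, and these edges determine that vertex (\<open>congruent_everywhere\<close>). The result is the
  deterministic criterion \<open>globally_rigidI\<close>.

  The rigidity that the criterion asks for follows from the same absorption property, provided that
  the edges of \<open>G\<close> generate almost all edges in the rigidity matroid: then some translate of a block of
  \<open>d\<close> vertices per class is contained in the generated set together with most of its surroundings, which
  makes any infinitesimal motion trivial off a small set (\<open>vertex_redundantly_rigidI\<close>). A set of
  edges that spans too little would confine all later edges; since the rank is at most \<open>d k n\<close> and
  the number of edges is of order \<open>n log n\<close>, a union bound over spanning sets excludes it.

  For the random graph, write \<open>L = ln n\<close>. The stopping time lies between \<open>9/10 n L\<close>, when an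
  isolated vertex is still present, and \<open>2 n L\<close>, when all degrees exceed \<open>d\<close>. Increasing properties are
  proved at the early time and decreasing ones at the late time. Absorption needs both: vertices of
  degree at most \<open>L / 50\<close> at the early time are pairwise far apart at the late time, and no small set
  meets many edges more than once then (\<open>absorbingI\<close>). Every estimate is for a uniformly random ordering of the edges
  and comes from a bound on successive draws (\<open>average_hits_misses\<close>), except for the isolated vertex,
  which is found by the second moment method (\<open>prob_all_hit\<close>).
\<close>

section \<open>Evaluation of rational polynomials\<close>

definition monomial_value :: "('i \<Rightarrow> 'r::comm_ring_1) \<Rightarrow> ('i \<Rightarrow>\<^sub>0 nat) \<Rightarrow> 'r" where
  "monomial_value x m = (\<Prod>i\<in>Poly_Mapping.keys m. x i ^ Poly_Mapping.lookup m i)"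

lemma monomial_value_superset:
  assumes "finite K" "Poly_Mapping.keys m \<subseteq> K"
  shows "monomial_value x m = (\<Prod>i\<in>K. x i ^ Poly_Mapping.lookup m i)"
  unfolding monomial_value_def using assms
  by (intro prod.mono_neutral_left) (auto simp: in_keys_iff)

lemma monomial_value_add: "monomial_value x (m + m') = monomial_value x m * monomial_value x m'"
proof -
  let ?K = "Poly_Mapping.keys m \<union> Poly_Mapping.keys m'"
  have "Poly_Mapping.keys (m + m') \<subseteq> ?K" by (rule Poly_Mapping.keys_add)
  then show ?thesis
    by (subst (1 2 3) monomial_value_superset[where K = ?K])
       (auto simp: lookup_add power_add prod.distrib)
qed

text \<open>
  The coefficients are sent to the target ring by a homomorphism \<open>\<phi>\<close>, so that polynomials can
  also be evaluated in dual numbers.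
\<close>

definition evaluate :: "(rat \<Rightarrow> 'r::comm_ring_1) \<Rightarrow> ('i \<Rightarrow> 'r) \<Rightarrow> 'i rat_mpoly \<Rightarrow> 'r" where
  "evaluate \<phi> x P =
     (\<Sum>m\<in>Poly_Mapping.keys P. \<phi> (Poly_Mapping.lookup P m) * monomial_value x m)"

locale rat_hom =
  fixes \<phi> :: "rat \<Rightarrow> 'r::comm_ring_1"
  assumes hom_add: "\<phi> (a + b) = \<phi> a + \<phi> b" and hom_mult: "\<phi> (a * b) = \<phi> a * \<phi> b"
    and hom_one: "\<phi> 1 = 1"
begin

lemma hom_zero: "\<phi> 0 = 0"
  using hom_add[of 0 0] by simp

lemma evaluate_superset:
  assumes "finite K" "Poly_Mapping.keys P \<subseteq> K"
  shows "evaluate \<phi> x P = (\<Sum>m\<in>K. \<phi> (Poly_Mapping.lookup P m) * monomial_value x m)"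
  unfolding evaluate_def using assms
  by (intro sum.mono_neutral_left) (auto simp: in_keys_iff hom_zero)

lemma evaluate_zero: "evaluate \<phi> x 0 = 0"
  by (simp add: evaluate_def)

lemma evaluate_add: "evaluate \<phi> x (P + Q) = evaluate \<phi> x P + evaluate \<phi> x Q"
proof -
  let ?K = "Poly_Mapping.keys P \<union> Poly_Mapping.keys Q"
  have "Poly_Mapping.keys (P + Q) \<subseteq> ?K" by (rule Poly_Mapping.keys_add)
  then show ?thesis
    by (subst (1 2 3) evaluate_superset[where K = ?K])
       (auto simp: lookup_add hom_add distrib_right sum.distrib)
qed

lemma evaluate_sum: "evaluate \<phi> x (\<Sum>a\<in>A. f a) = (\<Sum>a\<in>A. evaluate \<phi> x (f a))"
  by (induction A rule: infinite_finite_induct) (simp_all add: evaluate_zero evaluate_add)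

lemma evaluate_single: "evaluate \<phi> x (Poly_Mapping.single m c) = \<phi> c * monomial_value x m"
  by (subst evaluate_superset[where K = "{m}"]) auto

lemma sum_of_singles:
  "P = (\<Sum>m\<in>Poly_Mapping.keys P. Poly_Mapping.single m (Poly_Mapping.lookup P m))"
  by (rule poly_mapping_eqI)
     (auto simp: lookup_sum lookup_single when_def in_keys_iff)

lemma evaluate_mult: "evaluate \<phi> x (P * Q) = evaluate \<phi> x P * evaluate \<phi> x Q"
proof -
  let ?s = "\<lambda>P m. Poly_Mapping.single m (Poly_Mapping.lookup P m)"
  have "P * Q = (\<Sum>m\<in>Poly_Mapping.keys P. ?s P m) * (\<Sum>m\<in>Poly_Mapping.keys Q. ?s Q m)"
    using sum_of_singles[of P] sum_of_singles[of Q] by simp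
  also have "\<dots> = (\<Sum>m\<in>Poly_Mapping.keys P. \<Sum>m'\<in>Poly_Mapping.keys Q.
      Poly_Mapping.single (m + m') (Poly_Mapping.lookup P m * Poly_Mapping.lookup Q m'))"
    by (simp add: sum_product mult_single)
  finally show ?thesis
    by (simp add: evaluate_sum evaluate_single monomial_value_add hom_mult)
       (simp add: evaluate_def sum_product mult_ac)
qed

lemma evaluate_const: "evaluate \<phi> x (Poly_Mapping.single 0 c) = \<phi> c"
  by (simp add: evaluate_single monomial_value_def)

lemma evaluate_var: "evaluate \<phi> x (Poly_Mapping.single (Poly_Mapping.single i 1) 1) = x i"
  by (simp add: evaluate_single hom_one monomial_value_def)

end

lemma rat_hom_of_rat: "rat_hom (of_rat :: rat \<Rightarrow> 'a::field_char_0)"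
  by unfold_locales (simp_all add: of_rat_add of_rat_mult)

lemma eval_mpoly_eq_evaluate: "eval_mpoly x P = evaluate of_rat x P"
  by (simp add: eval_mpoly_def evaluate_def monomial_value_def)

definition mpoly_over :: "'i set \<Rightarrow> 'i rat_mpoly set" where
  "mpoly_over I = {P. \<forall>m\<in>Poly_Mapping.keys P. Poly_Mapping.keys m \<subseteq> I}"

lemma mpoly_over_add: "P \<in> mpoly_over I \<Longrightarrow> Q \<in> mpoly_over I \<Longrightarrow> P + Q \<in> mpoly_over I"
  using Poly_Mapping.keys_add[of P Q] by (fastforce simp: mpoly_over_def)

lemma mpoly_over_mult: "P \<in> mpoly_over I \<Longrightarrow> Q \<in> mpoly_over I \<Longrightarrow> P * Q \<in> mpoly_over I"
  unfolding mpoly_over_def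
proof safe
  fix m i assume PQ: "\<forall>m\<in>Poly_Mapping.keys P. Poly_Mapping.keys m \<subseteq> I"
    "\<forall>m\<in>Poly_Mapping.keys Q. Poly_Mapping.keys m \<subseteq> I"
    and m: "m \<in> Poly_Mapping.keys (P * Q)" and i: "i \<in> Poly_Mapping.keys m"
  from m keys_mult[of P Q] obtain a b
    where ab: "a \<in> Poly_Mapping.keys P" "b \<in> Poly_Mapping.keys Q" "m = a + b" by blast
  with i Poly_Mapping.keys_add[of a b] PQ show "i \<in> I" by blast
qed

lemma mpoly_over_const: "Poly_Mapping.single 0 c \<in> mpoly_over I"
  by (auto simp: mpoly_over_def)

lemma mpoly_over_var: "i \<in> I \<Longrightarrow> Poly_Mapping.single (Poly_Mapping.single i 1) 1 \<in> mpoly_over I"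
  by (auto simp: mpoly_over_def)

lemma algebraically_independentD:
  "algebraically_independent I x \<Longrightarrow> P \<in> mpoly_over I \<Longrightarrow> eval_mpoly x P = 0 \<Longrightarrow> P = 0"
  by (auto simp: algebraically_independent_def mpoly_over_def)

section \<open>Derivations\<close>

text \<open>
  A derivation \<open>D\<close> is the same as a ring homomorphism \<open>a \<mapsto> a + D a \<epsilon>\<close> into the dual numbers, where
  \<open>\<epsilon>\<^sup>2 = 0\<close>. So derivations can be extended like homomorphisms.
\<close>

datatype 'a dual = Dual (re: 'a) (du: 'a)

instantiation dual :: (comm_ring_1) comm_ring_1
begin
definition "0 = Dual 0 0"
definition "1 = Dual 1 0"
definition "x + y = Dual (re x + re y) (du x + du y)"
definition "x - y = Dual (re x - re y) (du x - du y)"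
definition "- x = Dual (- re x) (- du x)"
definition "x * y = Dual (re x * re y) (re x * du y + du x * re y)"
instance
  by intro_classes
     (auto simp: zero_dual_def one_dual_def plus_dual_def minus_dual_def uminus_dual_def
        times_dual_def algebra_simps)
end

lemma dual_simps [simp]:
  "re 0 = 0" "du 0 = 0" "re 1 = 1" "du 1 = 0" "re (x + y) = re x + re y" "du (x + y) = du x + du y"
  "re (x - y) = re x - re y" "du (x - y) = du x - du y" "re (- x) = - re x" "du (- x) = - du x"
  "re (x * y) = re x * re y" "du (x * y) = re x * du y + du x * re y"
  by (simp_all add: zero_dual_def one_dual_def plus_dual_def minus_dual_def uminus_dual_def
        times_dual_def)

lemma dual_eq_iff: "x = y \<longleftrightarrow> re x = re y \<and> du x = du y"
  by (cases x; cases y) auto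

lemma re_power [simp]: "re (x ^ n) = re x ^ n"
  by (induction n) auto

lemma re_prod [simp]: "re (\<Prod>a\<in>A. f a) = (\<Prod>a\<in>A. re (f a))"
  by (induction A rule: infinite_finite_induct) auto

lemma re_sum [simp]: "re (\<Sum>a\<in>A. f a) = (\<Sum>a\<in>A. re (f a))"
  by (induction A rule: infinite_finite_induct) auto

definition derivation :: "('a::field \<Rightarrow> 'a) \<Rightarrow> bool" where
  "derivation D \<longleftrightarrow> (\<forall>a b. D (a + b) = D a + D b) \<and> (\<forall>a b. D (a * b) = a * D b + D a * b)"

text \<open>
  The graph \<open>{a + D a \<epsilon>}\<close> of a derivation on a subring. Single-valuedness is the last conjunct, since
  the graph is closed under differences.
\<close>

definition partial_derivation :: "'a::field dual set \<Rightarrow> bool" where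
  "partial_derivation R \<longleftrightarrow> 1 \<in> R \<and> (\<forall>x\<in>R. - x \<in> R) \<and> (\<forall>x\<in>R. \<forall>y\<in>R. x + y \<in> R \<and> x * y \<in> R) \<and>
     (\<forall>x\<in>R. re x = 0 \<longrightarrow> x = 0)"

lemma partial_derivationD:
  assumes "partial_derivation R"
  shows "1 \<in> R" "0 \<in> R" "x \<in> R \<Longrightarrow> - x \<in> R" "x \<in> R \<Longrightarrow> y \<in> R \<Longrightarrow> x + y \<in> R"
    "x \<in> R \<Longrightarrow> y \<in> R \<Longrightarrow> x - y \<in> R" "x \<in> R \<Longrightarrow> y \<in> R \<Longrightarrow> x * y \<in> R" "x \<in> R \<Longrightarrow> re x = 0 \<Longrightarrow> x = 0"
    "x \<in> R \<Longrightarrow> x ^ n \<in> R" "(\<And>a. a \<in> A \<Longrightarrow> f a \<in> R) \<Longrightarrow> (\<Sum>a\<in>A. f a) \<in> R"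
proof -
  note R = assms[unfolded partial_derivation_def]
  show 1: "1 \<in> R" "\<And>x. x \<in> R \<Longrightarrow> - x \<in> R" "\<And>x y. x \<in> R \<Longrightarrow> y \<in> R \<Longrightarrow> x + y \<in> R"
     "\<And>x y. x \<in> R \<Longrightarrow> y \<in> R \<Longrightarrow> x * y \<in> R" "x \<in> R \<Longrightarrow> re x = 0 \<Longrightarrow> x = 0"
    using R by auto
  have "1 + - 1 \<in> R" using 1 by blast
  then show 0: "0 \<in> R" by simp
  show "x \<in> R \<Longrightarrow> y \<in> R \<Longrightarrow> x - y \<in> R" using 1(2,3) by (metis diff_conv_add_uminus)
  show "x \<in> R \<Longrightarrow> x ^ n \<in> R" by (induction n) (auto intro: 1)
  show "(\<And>a. a \<in> A \<Longrightarrow> f a \<in> R) \<Longrightarrow> (\<Sum>a\<in>A. f a) \<in> R"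
    by (induction A rule: infinite_finite_induct) (auto intro: 0 1)
qed

definition poly_over :: "'r::comm_ring_1 set \<Rightarrow> 'r poly set" where
  "poly_over R = {G. \<forall>i. coeff G i \<in> R}"

lemma poly_over_ring:
  assumes "partial_derivation R" "G \<in> poly_over R" "H \<in> poly_over R"
  shows "G + H \<in> poly_over R" "- G \<in> poly_over R" "G * H \<in> poly_over R" "G - H \<in> poly_over R"
  using assms by (auto simp: poly_over_def coeff_mult intro!: partial_derivationD[OF assms(1)])

text \<open>
  A value at a new element is admissible as soon as every polynomial relation satisfied by the
  element also holds for the pair of element and value.
\<close>

lemma partial_derivation_adjoin:
  assumes R: "partial_derivation R"
    and sv: "\<And>G. G \<in> poly_over R \<Longrightarrow> re (poly G \<tau>) = 0 \<Longrightarrow> poly G \<tau> = 0"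
  defines "R' \<equiv> (\<lambda>G. poly G \<tau>) ` poly_over R"
  shows "partial_derivation R'" "R \<subseteq> R'" "\<tau> \<in> R'"
proof -
  note RD = partial_derivationD[OF R]
  have c: "[:c:] \<in> poly_over R" if "c \<in> R" for c
    using that RD(2) by (auto simp: poly_over_def coeff_pCons split: nat.splits)
  have X: "[:0, 1:] \<in> poly_over R"
    using RD(1,2) by (auto simp: poly_over_def coeff_pCons split: nat.splits)
  show "R \<subseteq> R'" using c by (force simp: R'_def)
  moreover show "\<tau> \<in> R'" using X unfolding R'_def by (intro image_eqI[OF _ X]) simp
  ultimately show "partial_derivation R'"
    unfolding partial_derivation_def
    using RD(1) sv poly_over_ring[OF R]
    by (auto simp: R'_def simp flip: poly_add poly_mult poly_minus)
qed

definition formal_deriv :: "'r::comm_ring_1 poly \<Rightarrow> 'r poly" where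
  "formal_deriv p = (\<Sum>i<degree p. monom (of_nat (Suc i) * coeff p (Suc i)) i)"

lemma coeff_formal_deriv: "coeff (formal_deriv p) i = of_nat (Suc i) * coeff p (Suc i)"
proof -
  have "coeff (formal_deriv p) i =
      (\<Sum>j<degree p. if j = i then of_nat (Suc j) * coeff p (Suc j) else 0)"
    unfolding formal_deriv_def coeff_sum by (intro sum.cong) auto
  also have "\<dots> = of_nat (Suc i) * coeff p (Suc i)"
    by (simp add: coeff_eq_0 del: of_nat_Suc)
  finally show ?thesis .
qed

lemma formal_deriv_pCons: "formal_deriv (pCons a p) = p + pCons 0 (formal_deriv p)"
  by (rule poly_eqI) (auto simp: coeff_formal_deriv coeff_pCons algebra_simps split: nat.splits)

lemma poly_add_square_zero:
  fixes x e :: "'r::comm_ring_1"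
  assumes "e * e = 0"
  shows "poly p (x + e) = poly p x + e * poly (formal_deriv p) x"
proof (induction p)
  case (pCons a p)
  have z: "e * (e * y) = 0" for y using assms by (simp flip: mult.assoc)
  have "poly (pCons a p) (x + e) = a + (x + e) * (poly p x + e * poly (formal_deriv p) x)"
    by (simp add: pCons.IH)
  also have "\<dots> = a + x * poly p x + e * (poly p x + x * poly (formal_deriv p) x)"
  proof -
    have "(x + e) * (P + e * Q) = x * P + e * (P + x * Q) + e * (e * Q)" for P Q
      by (simp add: algebra_simps)
    then show ?thesis by (simp add: z)
  qed
  finally show ?case by (simp add: formal_deriv_pCons)
qed (simp add: formal_deriv_def)

lemma re_poly: "re (poly G x) = poly (map_poly re G) (re x)"
  by (induction G) (auto simp: map_poly_pCons)

lemma re_poly_cong: "re x = re y \<Longrightarrow> re (poly G x) = re (poly G y)"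
  by (simp add: re_poly)

text \<open>Dividing by a monic polynomial, one leading term at a time.\<close>

lemma reduce_mod_monic:
  fixes m G :: "'a::field dual poly"
  assumes R: "partial_derivation R" and m: "m \<in> poly_over R" "coeff m (degree m) = 1" "degree m > 0"
    and "G \<in> poly_over R"
  shows "\<exists>H\<in>poly_over R. \<exists>Q\<in>poly_over R. G = H + Q * m \<and> (\<forall>i\<ge>degree m. coeff H i = 0)"
  using assms(5)
proof (induction "degree G" arbitrary: G rule: less_induct)
  case less
  note RD = partial_derivationD[OF R] and PR = poly_over_ring[OF R]
  have z: "0 \<in> poly_over R" using RD(2) by (simp add: poly_over_def)
  show ?case
  proof (cases "degree G < degree m")
    case True
    then show ?thesis using less.prems z
      by (intro bexI[of _ G] bexI[of _ 0]) (auto simp: coeff_eq_0)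
  next
    case False
    let ?c = "monom (coeff G (degree G)) (degree G - degree m)"
    let ?G = "G - ?c * m"
    have c: "?c \<in> poly_over R" using less.prems RD(2) by (auto simp: poly_over_def)
    have G: "?G \<in> poly_over R" by (rule PR(4)[OF less.prems PR(3)[OF c m(1)]])
    have top: "coeff ?G (degree G) = 0" using False m(2)
      by (simp add: coeff_monom_mult)
    have le: "degree ?G \<le> degree G"
    proof (rule degree_le, intro allI impI)
      fix i assume i: "i > degree G"
      then show "coeff ?G i = 0" using False
        by (simp add: coeff_monom_mult coeff_eq_0)
    qed
    have "degree ?G < degree G"
    proof (rule ccontr)
      assume "\<not> ?thesis"
      with le have e: "degree ?G = degree G" by simp
      with top have "coeff ?G (degree ?G) = 0" by simp
      then have "?G = 0" by (simp only: leading_coeff_0_iff)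
      then have "degree G = 0" using e by simp
      with False m(3) show False by simp
    qed
    from less.hyps[OF this G] obtain H Q where HQ: "H \<in> poly_over R" "Q \<in> poly_over R"
      "?G = H + Q * m" "\<forall>i\<ge>degree m. coeff H i = 0" by blast
    have "G = ?G + ?c * m" by simp
    also have "\<dots> = H + (Q + ?c) * m" unfolding HQ(3) by (simp only: distrib_right add.assoc)
    finally have "G = H + (Q + ?c) * m" .
    then show ?thesis using HQ(1,4) PR(1)[OF HQ(2) c] by blast
  qed
qed

text \<open>
  The quotient rule extends a derivation to the fractions with denominator a power of \<open>a\<close>, so a
  maximal one is defined on a field.
\<close>

lemma partial_derivation_fractions:
  assumes R: "partial_derivation R" and maxR: "\<And>R'. partial_derivation R' \<Longrightarrow> R \<subseteq> R' \<Longrightarrow> R' = R"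
    and a: "a \<in> R" "re a \<noteq> 0"
  shows "\<exists>b\<in>R. b * a = 1"
proof -
  note RD = partial_derivationD[OF R]
  define R' where "R' = {x. \<exists>n. x * a ^ n \<in> R}"
  have sub: "R \<subseteq> R'" by (auto simp: R'_def intro!: exI[of _ 0])
  have "partial_derivation R'"
    unfolding partial_derivation_def
  proof (intro conjI ballI impI)
    show "1 \<in> R'" using sub RD(1) by blast
  next
    fix x assume "x \<in> R'"
    then obtain n where n: "x * a ^ n \<in> R" by (auto simp: R'_def)
    then show "- x \<in> R'" using RD(3)[OF n] by (auto simp: R'_def)
    {
      fix y assume "y \<in> R'"
      then obtain l where l: "y * a ^ l \<in> R" by (auto simp: R'_def)
      have "(x + y) * a ^ (n + l) = (x * a ^ n) * a ^ l + (y * a ^ l) * a ^ n"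
        by (simp add: algebra_simps power_add)
      also have "\<dots> \<in> R" by (intro RD(4) RD(6) RD(8) n l a)
      finally show "x + y \<in> R'" unfolding R'_def by blast
      have "(x * y) * a ^ (n + l) = (x * a ^ n) * (y * a ^ l)"
        by (simp add: algebra_simps power_add)
      also have "\<dots> \<in> R" by (intro RD(6) n l)
      finally show "x * y \<in> R'" unfolding R'_def by blast
    }
    assume "re x = 0"
    then have "x * a ^ n = 0" using RD(7)[OF n] by simp
    then have "du (x * a ^ n) = 0" by simp
    then show "x = 0" using \<open>re x = 0\<close> a(2) by (simp add: dual_eq_iff)
  qed
  then have "R' = R" using maxR sub by blast
  let ?b = "Dual (1 / re a) (- du a / (re a * re a))"
  have "?b * a = 1" using a(2) by (simp add: dual_eq_iff field_simps)
  moreover from this have "?b \<in> R'" using RD(1) by (auto simp: R'_def intro!: exI[of _ 1])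
  ultimately show ?thesis using \<open>R' = R\<close> by blast
qed

text \<open>
  A transcendental element may be given any derivative. For an algebraic one, the minimal polynomial
  determines the derivative; its formal derivative does not vanish there in characteristic 0.
\<close>

lemma partial_derivation_total:
  fixes R :: "'a::field_char_0 dual set"
  assumes R: "partial_derivation R" and maxR: "\<And>R'. partial_derivation R' \<Longrightarrow> R \<subseteq> R' \<Longrightarrow> R' = R"
  shows "\<exists>t'. Dual t t' \<in> R"
proof -
  note RD = partial_derivationD[OF R] and PR = poly_over_ring[OF R]
  have inv: "\<exists>b\<in>R. b * a = 1" if "a \<in> R" "re a \<noteq> 0" for a
    by (rule partial_derivation_fractions[OF R _ that]) (rule maxR)
  define alg where "alg G \<longleftrightarrow> G \<in> poly_over R \<and> G \<noteq> 0 \<and> re (poly G (Dual t 0)) = 0" for G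
  have suff: "\<exists>t'. Dual t t' \<in> R"
    if "\<And>G. G \<in> poly_over R \<Longrightarrow> re (poly G (Dual t t')) = 0 \<Longrightarrow> poly G (Dual t t') = 0" for t'
    using partial_derivation_adjoin(3)[OF R that]
      maxR[OF partial_derivation_adjoin(1,2)[OF R that]] by blast
  show ?thesis
  proof (cases "\<exists>G. alg G")
    case False
    have "G = 0" if "G \<in> poly_over R" "re (poly G (Dual t 0)) = 0" for G
      using False that by (auto simp: alg_def)
    then show ?thesis using suff[of 0] by force
  next
    case True
    define G0 where "G0 = arg_min degree alg"
    have G0: "alg G0" and G0min: "\<And>G. alg G \<Longrightarrow> degree G0 \<le> degree G"
      using True by (auto simp: G0_def intro: arg_min_natI arg_min_nat_le)
    have lc: "coeff G0 (degree G0) \<in> R" "coeff G0 (degree G0) \<noteq> 0"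
      using G0 by (auto simp: alg_def poly_over_def)
    then have "re (coeff G0 (degree G0)) \<noteq> 0" using RD(7) by blast
    from inv[OF lc(1) this] obtain b where b: "b \<in> R" "b * coeff G0 (degree G0) = 1" by blast
    define m where "m = Polynomial.smult b G0"
    have degm: "degree m = degree G0"
    proof (rule antisym)
      show "degree m \<le> degree G0" by (simp add: m_def degree_smult_le)
      show "degree G0 \<le> degree m" using b by (intro le_degree) (simp add: m_def)
    qed
    have mR: "m \<in> poly_over R" using G0 b RD by (auto simp: m_def poly_over_def alg_def)
    have m1: "coeff m (degree m) = 1" using b by (simp add: degm) (simp add: m_def)
    have m0: "re (poly m (Dual t s)) = 0" for s
      using G0 re_poly_cong[of "Dual t s" "Dual t 0" G0] by (simp add: m_def alg_def)
    have mpos: "degree m > 0"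
    proof (rule ccontr)
      assume "\<not> ?thesis"
      then have "degree m = 0" by simp
      then have "m = [:1:]" using m1 by (metis degree_0_id)
      then show False using m0[of 0] by simp
    qed
    have small: "H = 0" if "H \<in> poly_over R" "re (poly H (Dual t 0)) = 0"
      "\<forall>i\<ge>degree m. coeff H i = 0" for H
    proof (rule ccontr)
      assume "H \<noteq> 0"
      then have "alg H" using that by (auto simp: alg_def)
      then have "degree m \<le> degree H" using G0min degm by simp
      then have "coeff H (degree H) = 0" using that(3) by blast
      then show False using \<open>H \<noteq> 0\<close> by simp
    qed
    let ?p = "formal_deriv m"
    have pR: "?p \<in> poly_over R"
    proof -
      have "of_nat n * x \<in> R" if "x \<in> R" for n x
        using that RD by (induction n) (auto simp: algebra_simps)
      then show ?thesis using mR by (simp add: poly_over_def coeff_formal_deriv del: of_nat_Suc)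
    qed
    have re_of_nat: "re (of_nat n :: 'a dual) = of_nat n" for n by (induction n) auto
    have B: "re (poly ?p (Dual t 0)) \<noteq> 0"
    proof
      assume "re (poly ?p (Dual t 0)) = 0"
      then have "?p = 0" using pR by (intro small) (auto simp: coeff_formal_deriv coeff_eq_0)
      then have "coeff ?p (degree m - 1) = 0" by simp
      then have "re (of_nat (degree m) :: 'a dual) = 0"
        using mpos m1 by (simp add: coeff_formal_deriv)
      then show False using mpos re_of_nat by simp
    qed
    \<comment> \<open>the value for which differentiating the relation \<open>m(t) = 0\<close> gives 0\<close>
    define t' where "t' = - du (poly m (Dual t 0)) / re (poly ?p (Dual t 0))"
    have "Dual t t' = Dual t 0 + Dual 0 t'" by (simp add: dual_eq_iff)
    then have "poly m (Dual t t') = poly m (Dual t 0) + Dual 0 t' * poly ?p (Dual t 0)"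
      by (simp only:) (rule poly_add_square_zero, simp add: dual_eq_iff)
    then have mt: "poly m (Dual t t') = 0" using B m0 by (simp add: dual_eq_iff t'_def)
    show ?thesis
    proof (rule suff)
      fix G assume G: "G \<in> poly_over R" "re (poly G (Dual t t')) = 0"
      from reduce_mod_monic[OF R mR m1 mpos G(1)] obtain H Q where
        HQ: "H \<in> poly_over R" "G = H + Q * m" "\<forall>i\<ge>degree m. coeff H i = 0" by blast
      have "re (poly H (Dual t t')) = 0" using G(2) HQ(2) mt by simp
      then have "H = 0" using HQ re_poly_cong[of "Dual t 0" "Dual t t'" H] by (intro small) auto
      then show "poly G (Dual t t') = 0" using HQ(2) mt by simp
    qed
  qed
qed

text \<open>
  By Zorn's lemma there is a maximal extension, and a maximal one is defined everywhere.
\<close>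

theorem derivation_extends:
  fixes R :: "'a::field_char_0 dual set"
  assumes "partial_derivation R"
  shows "\<exists>D. derivation D \<and> (\<forall>x\<in>R. D (re x) = du x)"
proof -
  define A where "A = {S. partial_derivation S \<and> R \<subseteq> S}"
  have "\<exists>M\<in>A. \<forall>X\<in>A. M \<subseteq> X \<longrightarrow> X = M"
  proof (rule subset_Zorn_nonempty)
    show "A \<noteq> {}" using assms by (auto simp: A_def)
  next
    fix C assume C: "C \<noteq> {}" "subset.chain A C"
    have CA: "C \<subseteq> A" using C(2) by (simp add: subset_chain_def)
    have pd: "partial_derivation S" and sub: "R \<subseteq> S" if "S \<in> C" for S
      using subsetD[OF CA that] by (simp_all add: A_def)
    have two: "\<exists>S\<in>C. x \<in> S \<and> y \<in> S" if "x \<in> \<Union>C" "y \<in> \<Union>C" for x y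
    proof -
    obtain S S' where S: "S \<in> C" "S' \<in> C" "x \<in> S" "y \<in> S'" using \<open>x \<in> \<Union>C\<close> \<open>y \<in> \<Union>C\<close> by auto
    then have "S \<subseteq> S' \<or> S' \<subseteq> S" using C(2) by (simp add: subset_chain_def)
    then show ?thesis using S by blast
  qed
    have "partial_derivation (\<Union>C)"
      unfolding partial_derivation_def
    proof (intro conjI ballI impI)
      from C(1) obtain S where "S \<in> C" by blast
      then show "1 \<in> \<Union>C" using partial_derivationD(1)[OF pd] by blast
      fix x assume x: "x \<in> \<Union>C"
      then obtain S where "S \<in> C" "x \<in> S" by blast
      then show "- x \<in> \<Union>C" using partial_derivationD(3)[OF pd] by blast
      show "x = 0" if "re x = 0"
        using \<open>S \<in> C\<close> \<open>x \<in> S\<close> that partial_derivationD(7)[OF pd] by blast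
      fix y assume y: "y \<in> \<Union>C"
      from two[OF x y] obtain S where "S \<in> C" "x \<in> S" "y \<in> S" by blast
      then show "x + y \<in> \<Union>C" "x * y \<in> \<Union>C"
        using partial_derivationD(4,6)[OF pd] by blast+
    qed
    moreover have "R \<subseteq> \<Union>C" using C(1) sub by blast
    ultimately show "\<Union>C \<in> A" unfolding A_def by blast
  qed
  then obtain M where MA: "M \<in> A" and Mmax: "\<forall>X\<in>A. M \<subseteq> X \<longrightarrow> X = M" by blast
  have M: "partial_derivation M" "R \<subseteq> M" using MA by (simp_all add: A_def)
  have M3: "X = M" if "partial_derivation X" "M \<subseteq> X" for X
    using Mmax that M(2) unfolding A_def by blast
  note MD = partial_derivationD[OF M(1)]
  have ex: "\<exists>t'. Dual t t' \<in> M" for t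
    by (rule partial_derivation_total[OF M(1)]) (rule M3)
  define D where "D t = (SOME t'. Dual t t' \<in> M)" for t
  have D: "Dual t (D t) \<in> M" for t unfolding D_def using ex[of t] by (rule someI_ex)
  have uniq: "x = Dual (re x) (D (re x))" if "x \<in> M" for x
    using MD(7)[OF MD(5)[OF that D[of "re x"]]] by simp
  have "derivation D"
    unfolding derivation_def
  proof (intro conjI allI)
    fix a b
    show "D (a + b) = D a + D b" using uniq[OF MD(4)[OF D[of a] D[of b]]] by (simp add: dual_eq_iff)
    show "D (a * b) = a * D b + D a * b"
      using uniq[OF MD(6)[OF D[of a] D[of b]]] by (simp add: dual_eq_iff)
  qed
  moreover have "D (re x) = du x" if "x \<in> R" for x
    using uniq[of x] that M(2) by (auto simp: dual_eq_iff)
  ultimately show ?thesis by blast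
qed

text \<open>
  By algebraic independence, the partial derivative with respect to the coordinate is well defined on
  the ring generated by all coordinates.
\<close>

lemma derivation_dual_to_coordinate:
  fixes x :: "'i \<Rightarrow> 'a::field_char_0"
  assumes ai: "algebraically_independent I x"
  shows "\<exists>D. derivation D \<and> (\<forall>j\<in>I. D (x j) = (if j = i then 1 else 0))"
proof -
  let ?\<phi> = "\<lambda>c. Dual (of_rat c) (0::'a)" and ?\<xi> = "\<lambda>j. Dual (x j) (if j = i then 1 else 0)"
  interpret rat_hom ?\<phi> by unfold_locales (auto simp: dual_eq_iff of_rat_add of_rat_mult)
  define R where "R = evaluate ?\<phi> ?\<xi> ` mpoly_over I"
  have re: "re (evaluate ?\<phi> ?\<xi> P) = eval_mpoly x P" for P
    unfolding evaluate_def eval_mpoly_def monomial_value_def re_sum by simp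
  have c: "?\<phi> c \<in> R" for c
    unfolding R_def by (rule image_eqI[OF _ mpoly_over_const]) (simp only: evaluate_const)
  have v: "?\<xi> j \<in> R" if "j \<in> I" for j
    unfolding R_def by (rule image_eqI[OF _ mpoly_over_var[OF that]]) (simp only: evaluate_var)
  have add: "a + b \<in> R" if "a \<in> R" "b \<in> R" for a b
  proof -
    from that obtain P Q where "P \<in> mpoly_over I" "Q \<in> mpoly_over I"
      "a = evaluate ?\<phi> ?\<xi> P" "b = evaluate ?\<phi> ?\<xi> Q" unfolding R_def by blast
    then show ?thesis unfolding R_def
      by (intro image_eqI[of _ _ "P + Q"]) (simp_all only: evaluate_add mpoly_over_add)
  qed
  have mult: "a * b \<in> R" if "a \<in> R" "b \<in> R" for a b
  proof -
    from that obtain P Q where "P \<in> mpoly_over I" "Q \<in> mpoly_over I"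
      "a = evaluate ?\<phi> ?\<xi> P" "b = evaluate ?\<phi> ?\<xi> Q" unfolding R_def by blast
    then show ?thesis unfolding R_def
      by (intro image_eqI[of _ _ "P * Q"]) (simp_all only: evaluate_mult mpoly_over_mult)
  qed
  have one: "?\<phi> 1 = 1" "?\<phi> (- 1) = - 1" by (auto simp: dual_eq_iff)
  have "partial_derivation R"
    unfolding partial_derivation_def
  proof (intro conjI ballI impI add mult)
    show "1 \<in> R" using c[of 1] unfolding one .
    fix a assume a: "a \<in> R"
    have "- 1 \<in> R" using c[of "- 1"] unfolding one .
    from mult[OF this a] show "- a \<in> R" by simp
    show "a = 0" if "re a = 0"
    proof -
      from a obtain P where P: "P \<in> mpoly_over I" "a = evaluate ?\<phi> ?\<xi> P" by (auto simp: R_def)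
      then have "P = 0" using algebraically_independentD[OF ai P(1)] that re by simp
      then show ?thesis using P by (simp add: evaluate_zero)
    qed
  qed
  from derivation_extends[OF this] obtain D where "derivation D" "\<forall>x\<in>R. D (re x) = du x" by blast
  moreover from bspec[OF this(2) v] have "\<forall>j\<in>I. D (x j) = (if j = i then 1 else 0)" by simp
  ultimately show ?thesis by blast
qed

section \<open>Polynomial conditions on generic points\<close>

text \<open>
  Membership only records that \<open>f\<close> is given by some rational polynomial. This suffices for arguments
  by vanishing and avoids computations with polynomials.
\<close>

definition polyfun :: "'i set \<Rightarrow> (('i \<Rightarrow> 'a::field_char_0) \<Rightarrow> 'a) set" where
  "polyfun I = {f. \<exists>P\<in>mpoly_over I. \<forall>x. f x = eval_mpoly x P}"

lemma polyfunI: "P \<in> mpoly_over I \<Longrightarrow> (\<And>x. f x = eval_mpoly x P) \<Longrightarrow> f \<in> polyfun I"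
  by (auto simp: polyfun_def)

lemma polyfunE:
  assumes "f \<in> polyfun I" obtains P where "P \<in> mpoly_over I" "\<And>x. f x = eval_mpoly x P"
  using assms unfolding polyfun_def by blast

lemma polyfun_const: "(\<lambda>x. of_rat c) \<in> polyfun I"
  by (rule polyfunI[OF mpoly_over_const[of c]])
     (simp add: eval_mpoly_eq_evaluate rat_hom.evaluate_const[OF rat_hom_of_rat])

lemma polyfun_of_int: "(\<lambda>x. of_int c) \<in> polyfun I"
  using polyfun_const[of "of_int c"] by simp

lemma polyfun_var: "i \<in> I \<Longrightarrow> (\<lambda>x. x i) \<in> polyfun I"
  by (rule polyfunI[OF mpoly_over_var])
     (simp_all only: eval_mpoly_eq_evaluate rat_hom.evaluate_var[OF rat_hom_of_rat])

lemma polyfun_add: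
  assumes "f \<in> polyfun I" "g \<in> polyfun I" shows "(\<lambda>x. f x + g x) \<in> polyfun I"
proof -
  from assms obtain P Q where "P \<in> mpoly_over I" "\<And>x. f x = eval_mpoly x P"
    "Q \<in> mpoly_over I" "\<And>x. g x = eval_mpoly x Q" by (metis polyfunE)
  then show ?thesis
    by (intro polyfunI[of "P + Q"] mpoly_over_add)
       (simp_all add: eval_mpoly_eq_evaluate rat_hom.evaluate_add[OF rat_hom_of_rat])
qed

lemma polyfun_mult:
  assumes "f \<in> polyfun I" "g \<in> polyfun I" shows "(\<lambda>x. f x * g x) \<in> polyfun I"
proof -
  from assms obtain P Q where "P \<in> mpoly_over I" "\<And>x. f x = eval_mpoly x P"
    "Q \<in> mpoly_over I" "\<And>x. g x = eval_mpoly x Q" by (metis polyfunE)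
  then show ?thesis
    by (intro polyfunI[of "P * Q"] mpoly_over_mult)
       (simp_all add: eval_mpoly_eq_evaluate rat_hom.evaluate_mult[OF rat_hom_of_rat])
qed

lemma polyfun_diff:
  assumes "f \<in> polyfun I" "g \<in> polyfun I" shows "(\<lambda>x. f x - g x) \<in> polyfun I"
  using polyfun_add[OF assms(1) polyfun_mult[OF polyfun_of_int[of "- 1"] assms(2)]] by simp

lemma polyfun_sum: "(\<And>a. a \<in> A \<Longrightarrow> f a \<in> polyfun I) \<Longrightarrow> (\<lambda>x. \<Sum>a\<in>A. f a x) \<in> polyfun I"
  using polyfun_of_int[of 0 I]
  by (induction A rule: infinite_finite_induct) (auto intro!: polyfun_add)

lemma polyfun_prod: "(\<And>a. a \<in> A \<Longrightarrow> f a \<in> polyfun I) \<Longrightarrow> (\<lambda>x. \<Prod>a\<in>A. f a x) \<in> polyfun I"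
  using polyfun_of_int[of 1 I]
  by (induction A rule: infinite_finite_induct) (auto intro!: polyfun_mult)

text \<open>
  Vanishing at a generic point forces the polynomial to be zero, and with it all its values.
\<close>

lemma polyfun_vanishes:
  assumes "algebraically_independent I x" "f \<in> polyfun I" "f x = 0"
  shows "f y = 0"
proof -
  from assms(2) obtain P where P: "P \<in> mpoly_over I" "\<And>x. f x = eval_mpoly x P"
    unfolding polyfun_def by blast
  then have "P = 0" using algebraically_independentD[OF assms(1) P(1)] assms(3) by simp
  then show ?thesis using P(2) by (simp add: eval_mpoly_def)
qed

lemma det_zero_iff_kernel:
  fixes M :: "nat \<Rightarrow> nat \<Rightarrow> 'a::field"
  shows "det (Matrix.mat d d (\<lambda>(a, j). M a j)) = 0 \<longleftrightarrow>
    (\<exists>c. (\<exists>j<d. c j \<noteq> 0) \<and> (\<forall>a<d. (\<Sum>j<d. M a j * c j) = 0))" (is "?l = ?r")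
proof -
  let ?A = "Matrix.mat d d (\<lambda>(a, j). M a j)"
  have A: "?A \<in> carrier_mat d d" by simp
  have mv: "?A *\<^sub>v Matrix.vec d c = 0\<^sub>v d \<longleftrightarrow> (\<forall>a<d. (\<Sum>j<d. M a j * c j) = 0)" for c
    by (auto simp: vec_eq_iff scalar_prod_def lessThan_atLeast0)
  have nz: "Matrix.vec d c \<noteq> 0\<^sub>v d \<longleftrightarrow> (\<exists>j<d. c j \<noteq> 0)" for c :: "nat \<Rightarrow> 'a"
    by (auto simp: vec_eq_iff)
  have "?l \<longleftrightarrow> (\<exists>v\<in>carrier_vec d. v \<noteq> 0\<^sub>v d \<and> ?A *\<^sub>v v = 0\<^sub>v d)"
    using det_0_iff_vec_prod_zero[OF A] by blast
  also have "\<dots> \<longleftrightarrow> (\<exists>c. Matrix.vec d c \<noteq> 0\<^sub>v d \<and> ?A *\<^sub>v Matrix.vec d c = 0\<^sub>v d)"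
  proof
    assume "\<exists>v\<in>carrier_vec d. v \<noteq> 0\<^sub>v d \<and> ?A *\<^sub>v v = 0\<^sub>v d"
    then obtain v where v: "v \<in> carrier_vec d" "v \<noteq> 0\<^sub>v d \<and> ?A *\<^sub>v v = 0\<^sub>v d" by blast
    then have "v = Matrix.vec d (vec_index v)" by (auto simp: vec_eq_iff)
    then show "\<exists>c. Matrix.vec d c \<noteq> 0\<^sub>v d \<and> ?A *\<^sub>v Matrix.vec d c = 0\<^sub>v d"
      using v(2) by (intro exI[of _ "vec_index v"]) simp
  next
    assume "\<exists>c. Matrix.vec d c \<noteq> 0\<^sub>v d \<and> ?A *\<^sub>v Matrix.vec d c = 0\<^sub>v d"
    then obtain c where "Matrix.vec d c \<noteq> 0\<^sub>v d \<and> ?A *\<^sub>v Matrix.vec d c = 0\<^sub>v d" by blast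
    then show "\<exists>v\<in>carrier_vec d. v \<noteq> 0\<^sub>v d \<and> ?A *\<^sub>v v = 0\<^sub>v d"
      by (intro bexI[of _ "Matrix.vec d c"]) auto
  qed
  also have "\<dots> = ?r" by (simp only: mv nz)
  finally show ?thesis .
qed

lemma transposed_kernel:
  fixes M :: "nat \<Rightarrow> nat \<Rightarrow> 'a::field"
  assumes "\<And>c. (\<And>a. a < d \<Longrightarrow> (\<Sum>j<d. M a j * c j) = 0) \<Longrightarrow> \<forall>j<d. c j = 0"
    and "\<And>j. j < d \<Longrightarrow> (\<Sum>a<d. M a j * c a) = 0"
  shows "\<forall>a<d. c a = 0"
proof -
  let ?A = "Matrix.mat d d (\<lambda>(a, j). M a j)" and ?B = "Matrix.mat d d (\<lambda>(a, j). M j a)"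
  have "det ?A \<noteq> 0" using assms(1) unfolding det_zero_iff_kernel by blast
  moreover have "det ?B = det ?A"
  proof -
    have "?B = transpose_mat ?A" by (rule eq_matI) auto
    then show ?thesis using det_transpose[of ?A d] by simp
  qed
  ultimately have "det ?B \<noteq> 0" by simp
  then show ?thesis using assms(2) det_zero_iff_kernel[of d "\<lambda>a j. M j a"] by blast
qed

lemma left_inverse_of_trivial_kernel:
  fixes M :: "nat \<Rightarrow> nat \<Rightarrow> 'a::field"
  assumes "\<And>c. (\<And>a. a < d \<Longrightarrow> (\<Sum>j<d. M a j * c j) = 0) \<Longrightarrow> \<forall>j<d. c j = 0"
  shows "\<exists>N. \<forall>i<d. \<forall>j<d. (\<Sum>a<d. N i a * M a j) = (if i = j then 1 else 0)"
proof -
  let ?A = "Matrix.mat d d (\<lambda>(a, j). M a j)"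
  have A: "?A \<in> carrier_mat d d" by simp
  have "det ?A \<noteq> 0" using assms unfolding det_zero_iff_kernel by blast
  from det_non_zero_imp_unit[OF A this] obtain B where
    B: "B \<in> carrier_mat d d" "B * ?A = 1\<^sub>m d" by (auto simp: Units_def ring_mat_def)
  have "(\<Sum>a<d. B $$ (i, a) * M a j) = (if i = j then 1 else 0)" if "i < d" "j < d" for i j
  proof -
    have "(B * ?A) $$ (i, j) = (\<Sum>a<d. B $$ (i, a) * M a j)"
      using that B(1) by (auto simp: scalar_prod_def lessThan_atLeast0)
    then show ?thesis using B(2) that by simp
  qed
  then show ?thesis by (intro exI[of _ "\<lambda>i a. B $$ (i, a)"]) simp
qed

text \<open>
  Nonsingularity is the nonvanishing of a polynomial, so it holds at a generic point if it holds
  anywhere.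
\<close>

lemma generic_trivial_kernel:
  fixes M :: "nat \<Rightarrow> nat \<Rightarrow> ('i \<Rightarrow> 'a::field_char_0) \<Rightarrow> 'a"
  assumes ai: "algebraically_independent I x"
    and M: "\<And>a j. a < d \<Longrightarrow> j < d \<Longrightarrow> M a j \<in> polyfun I"
    and y: "\<And>c. (\<And>a. a < d \<Longrightarrow> (\<Sum>j<d. M a j y * c j) = 0) \<Longrightarrow> \<forall>j<d. c j = 0"
    and c: "\<And>a. a < d \<Longrightarrow> (\<Sum>j<d. M a j x * c j) = 0"
  shows "\<forall>j<d. c j = 0"
proof (rule ccontr)
  assume nt: "\<not> (\<forall>j<d. c j = 0)"
  let ?A = "\<lambda>x. Matrix.mat d d (\<lambda>(a, j). M a j x)"
  have "(\<lambda>x. det (?A x)) \<in> polyfun I"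
  proof -
    have "(\<lambda>x. \<Sum>p | p permutes {0..<d}. of_int (sign p) * (\<Prod>i = 0..<d. M i (p i) x)) \<in> polyfun I"
      by (intro polyfun_sum polyfun_mult polyfun_of_int polyfun_prod M)
         (use permutes_in_image[of _ "{0..<d}"] in auto)
    moreover have "det (?A x) =
      (\<Sum>p | p permutes {0..<d}. of_int (sign p) * (\<Prod>i = 0..<d. M i (p i) x))" for x
      by (auto simp: Determinant.det_def intro!: sum.cong prod.cong)
    ultimately show ?thesis by simp
  qed
  moreover have "det (?A x) = 0" using nt c unfolding det_zero_iff_kernel by blast
  ultimately have "det (?A y) = 0" using polyfun_vanishes[OF ai] by blast
  then show False using y unfolding det_zero_iff_kernel by blast
qed

text \<open>
  Fraction-free elimination: whether one linear form depends on others is decided by the vanishing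
  of integral polynomial expressions in the coefficients. So it has the same answer for two systems
  whose coefficients satisfy the same polynomial relations.
\<close>

lemma linear_independence_transfer:
  fixes M :: "'e \<Rightarrow> 'x \<Rightarrow> 'a::field" and M' :: "'e \<Rightarrow> 'x \<Rightarrow> 'b::field"
  assumes Z: "\<And>a a' b b'. (a, a') \<in> Z \<Longrightarrow> (b, b') \<in> Z \<Longrightarrow> (a * b, a' * b') \<in> Z"
    "\<And>a a' b b'. (a, a') \<in> Z \<Longrightarrow> (b, b') \<in> Z \<Longrightarrow> (a - b, a' - b') \<in> Z"
    "\<And>a a'. (a, a') \<in> Z \<Longrightarrow> a = 0 \<longleftrightarrow> a' = 0"
    and "finite X" "\<And>e v. e \<in> insert s E \<Longrightarrow> v \<in> X \<Longrightarrow> (M e v, M' e v) \<in> Z"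
    and "(\<Sum>v\<in>X. M s v * c v) \<noteq> 0" "\<And>e. e \<in> E \<Longrightarrow> (\<Sum>v\<in>X. M e v * c v) = 0"
  shows "\<exists>c'. (\<Sum>v\<in>X. M' s v * c' v) \<noteq> 0 \<and> (\<forall>e\<in>E. (\<Sum>v\<in>X. M' e v * c' v) = 0)"
  using assms(4-)
proof (induction "card X" arbitrary: X M M' c)
  case 0
  then show ?case by auto
next
  case (Suc n)
  then obtain v0 where v0: "v0 \<in> X" by fastforce
  have fin: "finite (X - {v0})" "n = card (X - {v0})" using Suc.hyps(2) Suc.prems(1) v0 by auto
  have split: "(\<Sum>v\<in>X. f v) = f v0 + (\<Sum>v\<in>X - {v0}. f v)" for f :: "'x \<Rightarrow> 'z::comm_monoid_add"
    using sum.remove[OF Suc.prems(1) v0] .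
  have Z0: "M e v0 = 0 \<longleftrightarrow> M' e v0 = 0" if "e \<in> insert s E" for e
    using Z(3)[OF Suc.prems(2)[OF that v0]] .
  \<comment> \<open>eliminate the variable \<open>v0\<close>, if necessary with a pivot \<open>e0\<close>\<close>
  consider "\<forall>e\<in>E. M e v0 = 0" "M s v0 \<noteq> 0" | "\<forall>e\<in>insert s E. M e v0 = 0" | "\<exists>e\<in>E. M e v0 \<noteq> 0"
    by blast
  then show ?case
  proof cases
    case 1
    then have "\<forall>e\<in>E. M' e v0 = 0" "M' s v0 \<noteq> 0" using Z0 by auto
    then show ?thesis
      by (intro exI[of _ "\<lambda>v. if v = v0 then 1 else 0"]) (simp add: split)
  next
    case 2
    have "\<exists>c'. (\<Sum>v\<in>X - {v0}. M' s v * c' v) \<noteq> 0 \<and> (\<forall>e\<in>E. (\<Sum>v\<in>X - {v0}. M' e v * c' v) = 0)"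
    proof (rule Suc.hyps(1)[OF fin(2,1)])
      show "(\<Sum>v\<in>X - {v0}. M s v * c v) \<noteq> 0" using Suc.prems(3) 2 by (simp add: split)
      show "(\<Sum>v\<in>X - {v0}. M e v * c v) = 0" if "e \<in> E" for e
        using Suc.prems(4)[OF that] 2 that by (simp add: split)
    qed (use Suc.prems(2) in blast)
    moreover have "\<forall>e\<in>insert s E. M' e v0 = 0" using 2 Z0 by simp
    ultimately show ?thesis by (simp add: split)
  next
    case 3
    then obtain e0 where e0: "e0 \<in> E" "M e0 v0 \<noteq> 0" by blast
    then have e0': "M' e0 v0 \<noteq> 0" using Z0 by simp
    define N where "N e v = M e0 v0 * M e v - M e v0 * M e0 v" for e v
    define N' where "N' e v = M' e0 v0 * M' e v - M' e v0 * M' e0 v" for e v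
    have Nsum: "(\<Sum>v\<in>X - {v0}. N e v * c v) = M e0 v0 * (\<Sum>v\<in>X. M e v * c v)" for e
    proof -
      have s: "(\<Sum>v\<in>X - {v0}. M e0 v * c v) = - (M e0 v0 * c v0)"
        using Suc.prems(4)[OF e0(1)] by (simp add: split eq_neg_iff_add_eq_0 add.commute)
      have "(\<Sum>v\<in>X - {v0}. N e v * c v) =
          M e0 v0 * (\<Sum>v\<in>X - {v0}. M e v * c v) - M e v0 * (\<Sum>v\<in>X - {v0}. M e0 v * c v)"
        by (simp add: N_def sum_distrib_left sum_subtractf algebra_simps)
      then show ?thesis unfolding s by (simp add: split algebra_simps)
    qed
    have "\<exists>c'. (\<Sum>v\<in>X - {v0}. N' s v * c' v) \<noteq> 0 \<and> (\<forall>e\<in>E. (\<Sum>v\<in>X - {v0}. N' e v * c' v) = 0)"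
    proof (rule Suc.hyps(1)[OF fin(2,1)])
      show "(N e v, N' e v) \<in> Z" if "e \<in> insert s E" "v \<in> X - {v0}" for e v
        unfolding N_def N'_def using that e0(1) v0 by (intro Z(1,2) Suc.prems(2)) auto
      show "(\<Sum>v\<in>X - {v0}. N s v * c v) \<noteq> 0" using Suc.prems(3) e0(2) by (simp add: Nsum)
      show "(\<Sum>v\<in>X - {v0}. N e v * c v) = 0" if "e \<in> E" for e
        using Suc.prems(4)[OF that] by (simp add: Nsum)
    qed
    then obtain c' where c': "(\<Sum>v\<in>X - {v0}. N' s v * c' v) \<noteq> 0"
      "\<forall>e\<in>E. (\<Sum>v\<in>X - {v0}. N' e v * c' v) = 0" by blast
    define t where "t = (\<Sum>v\<in>X - {v0}. M' e0 v * c' v)"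
    define c'' where "c'' v = (if v = v0 then - t / M' e0 v0 else c' v)" for v
    have eq: "M' e0 v0 * (\<Sum>v\<in>X. M' e v * c'' v) = (\<Sum>v\<in>X - {v0}. N' e v * c' v)" for e
    proof -
      have "(\<Sum>v\<in>X - {v0}. M' e v * c'' v) = (\<Sum>v\<in>X - {v0}. M' e v * c' v)"
        by (intro sum.cong) (auto simp: c''_def)
      then have "M' e0 v0 * (\<Sum>v\<in>X. M' e v * c'' v) =
          M' e0 v0 * (\<Sum>v\<in>X - {v0}. M' e v * c' v) - M' e v0 * t"
        using e0' by (simp add: split) (simp add: c''_def algebra_simps)
      also have "\<dots> = (\<Sum>v\<in>X - {v0}. N' e v * c' v)"
        by (simp add: N'_def t_def sum_distrib_left sum_subtractf algebra_simps)
      finally show ?thesis .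
    qed
    have "(\<Sum>v\<in>X. M' s v * c'' v) \<noteq> 0" using eq[of s] c'(1) by auto
    moreover have "(\<Sum>v\<in>X. M' e v * c'' v) = 0" if "e \<in> E" for e
      using eq[of e] c'(2) that e0' by simp
    ultimately show ?thesis by blast
  qed
qed

text \<open>
  The relation between the two systems consists of the pairs of values of a common polynomial at the
  two generic points.
\<close>

lemma generic_independence_transfer:
  fixes M :: "'e \<Rightarrow> 'x \<Rightarrow> ('i \<Rightarrow> 'a::field_char_0) \<Rightarrow> 'a"
  assumes "algebraically_independent I x" "algebraically_independent I x'"
    and "finite X" "\<And>e v. e \<in> insert s E \<Longrightarrow> v \<in> X \<Longrightarrow> M e v \<in> polyfun I"
    and "(\<Sum>v\<in>X. M s v x * c v) \<noteq> 0" "\<And>e. e \<in> E \<Longrightarrow> (\<Sum>v\<in>X. M e v x * c v) = 0"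
  shows "\<exists>c'. (\<Sum>v\<in>X. M s v x' * c' v) \<noteq> 0 \<and> (\<forall>e\<in>E. (\<Sum>v\<in>X. M e v x' * c' v) = 0)"
proof (rule linear_independence_transfer[where Z = "(\<lambda>f. (f x, f x')) ` polyfun I" and X = X and c = c
      and M = "\<lambda>e v. M e v x"])
  show "(a * b, a' * b') \<in> (\<lambda>f. (f x, f x')) ` polyfun I"
    if "(a, a') \<in> (\<lambda>f. (f x, f x')) ` polyfun I" "(b, b') \<in> (\<lambda>f. (f x, f x')) ` polyfun I" for a a' b b'
  proof -
    from that obtain f g where "f \<in> polyfun I" "g \<in> polyfun I" "a = f x" "a' = f x'" "b = g x" "b' = g x'"
      by blast
    then show ?thesis by (intro image_eqI[OF _ polyfun_mult[of f I g]]) auto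
  qed
  show "(a - b, a' - b') \<in> (\<lambda>f. (f x, f x')) ` polyfun I"
    if "(a, a') \<in> (\<lambda>f. (f x, f x')) ` polyfun I" "(b, b') \<in> (\<lambda>f. (f x, f x')) ` polyfun I" for a a' b b'
  proof -
    from that obtain f g where "f \<in> polyfun I" "g \<in> polyfun I" "a = f x" "a' = f x'" "b = g x" "b' = g x'"
      by blast
    then show ?thesis by (intro image_eqI[OF _ polyfun_diff[of f I g]]) auto
  qed
  show "a = 0 \<longleftrightarrow> a' = 0" if "(a, a') \<in> (\<lambda>f. (f x, f x')) ` polyfun I" for a a'
  proof -
    from that obtain f where f: "f \<in> polyfun I" "a = f x" "a' = f x'" by blast
    then show ?thesis
      using polyfun_vanishes[OF assms(1) f(1), of x'] polyfun_vanishes[OF assms(2) f(1), of x] by auto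
  qed
  show "(M e v x, M e v x') \<in> (\<lambda>f. (f x, f x')) ` polyfun I" if "e \<in> insert s E" "v \<in> X" for e v
    using assms(4)[OF that] by blast
qed (use assms in auto)

text \<open>
  A single point with trivial kernel suffices. At \<open>x\<^sub>u\<^sub>,\<^sub>j = z\<^sub>u\<^sup>j\<close> the matrix is a Vandermonde
  matrix, whose nodes are distinct when \<open>z\<^sub>u\<close> runs through suitable powers of 2.
\<close>

lemma generic_monomials_trivial_kernel:
  fixes x :: "(nat \<times> nat) \<times> nat \<Rightarrow> 'a::field_char_0" and s :: "nat \<Rightarrow> (nat \<times> nat) set"
  assumes ai: "algebraically_independent (V \<times> {..<d}) x"
    and s: "inj_on s {..<d}" "\<And>a. a < d \<Longrightarrow> finite (s a)" "\<And>a. a < d \<Longrightarrow> s a \<subseteq> V"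
    and c: "\<And>a. a < d \<Longrightarrow> (\<Sum>j<d. (\<Prod>u\<in>s a. x (u, j)) * c j) = 0"
  shows "\<forall>j<d. c j = 0"
proof (rule generic_trivial_kernel[OF ai, where M = "\<lambda>a j x. \<Prod>u\<in>s a. x (u, j)"])
  show "(\<lambda>x. \<Prod>u\<in>s a. x (u, j)) \<in> polyfun (V \<times> {..<d})" if "a < d" "j < d" for a j
    using s(3)[OF that(1)] that(2) by (intro polyfun_prod polyfun_var) auto
  \<comment> \<open>a product of distinct \<open>z u\<close> has as exponent the binary encoding of the set of factors\<close>
  define z :: "nat \<times> nat \<Rightarrow> 'a" where "z u = 2 ^ (2 ^ prod_encode u)" for u
  define Z where "Z a = (\<Prod>u\<in>s a. z u)" for a
  have Z: "Z a = 2 ^ set_encode (prod_encode ` s a)" if "a < d" for a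
    by (simp add: Z_def z_def set_encode_def sum.reindex inj_prod_encode inj_on_subset
          flip: power_sum)
  have injZ: "inj_on Z {..<d}"
  proof (rule inj_onI)
    fix a b assume ab: "a \<in> {..<d}" "b \<in> {..<d}" "Z a = Z b"
    then have "(2::'a) ^ set_encode (prod_encode ` s a) = 2 ^ set_encode (prod_encode ` s b)"
      by (simp add: Z)
    then have "of_nat (2 ^ set_encode (prod_encode ` s a)) =
        (of_nat (2 ^ set_encode (prod_encode ` s b)) :: 'a)" by simp
    then have "(2::nat) ^ set_encode (prod_encode ` s a) = 2 ^ set_encode (prod_encode ` s b)"
      by (simp only: of_nat_eq_iff)
    then have "set_encode (prod_encode ` s a) = set_encode (prod_encode ` s b)" by simp
    then have "prod_encode ` s a = prod_encode ` s b"
      using set_encode_eq s(2) ab by auto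
    then have "s a = s b" using inj_image_eq_iff[OF inj_prod_encode] by blast
    then show "a = b" using s(1) ab by (auto dest: inj_onD)
  qed
  fix c assume c: "\<And>a. a < d \<Longrightarrow> (\<Sum>j<d. (\<Prod>u\<in>s a. (\<lambda>(u, j). z u ^ j) (u, j)) * c j) = 0"
  define p where "p = (\<Sum>j<d. monom (c j) j)"
  have coeff: "coeff p j = (if j < d then c j else 0)" for j
    by (simp add: p_def coeff_sum if_distrib cong: if_cong)
  have roots: "Z ` {..<d} \<subseteq> {t. poly p t = 0}"
    using c by (auto simp: p_def poly_sum poly_monom Z_def prod_power_distrib mult.commute)
  have "p = 0"
  proof (rule ccontr)
    assume p: "p \<noteq> 0"
    have "d = card (Z ` {..<d})" using injZ by (simp add: card_image)
    also have "\<dots> \<le> card {t. poly p t = 0}" using roots p by (intro card_mono poly_roots_finite)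
    also have "\<dots> \<le> degree p" using p by (rule card_poly_roots_bound)
    finally have "coeff p (degree p) = 0" using coeff by simp
    then show False using p by simp
  qed
  then show "\<forall>j<d. c j = 0" using coeff by (metis coeff_0)
qed (use c in auto)

section \<open>Edges\<close>

lemma vertices_iff: "v \<in> vertices k n \<longleftrightarrow> fst v < k \<and> snd v < n"
  by (cases v) (auto simp: vertices_def vertex_class_def)

lemma vertex_class_iff: "v \<in> vertex_class n i \<longleftrightarrow> fst v = i \<and> snd v < n"
  by (cases v) (auto simp: vertex_class_def)

lemma finite_vertices [simp]: "finite (vertices k n)"
  by (simp add: vertices_def vertex_class_def)

lemma card_vertices: "card (vertices k n) = k * n"
proof -
  have "vertices k n = {..<k} \<times> {..<n}" by (auto simp: vertices_iff)
  then show ?thesis by simp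
qed

lemma edge_facts:
  assumes "e \<in> complete_edges k n"
  shows "e \<subseteq> vertices k n" "finite e" "bij_betw fst e {..<k}" "card e = k"
proof -
  show e: "e \<subseteq> vertices k n" using assms by (simp add: complete_edges_def)
  then show fin: "finite e" using finite_subset finite_vertices by blast
  have one: "\<exists>!v. v \<in> e \<and> fst v = i" if "i < k" for i
  proof -
    have "card (e \<inter> vertex_class n i) = 1" using assms that by (simp add: complete_edges_def)
    then obtain v where v: "e \<inter> vertex_class n i = {v}" by (auto simp: card_1_singleton_iff)
    have "w \<in> e \<and> fst w = i \<longleftrightarrow> w = v" for w
    proof -
      have "w \<in> e \<and> fst w = i \<longleftrightarrow> w \<in> e \<inter> vertex_class n i"
        using e by (auto simp: vertex_class_iff vertices_iff)
      then show ?thesis using v by simp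
    qed
    then show ?thesis by (intro ex1I[of _ v]) simp_all
  qed
  show bij: "bij_betw fst e {..<k}"
    unfolding bij_betw_def
  proof
    show "inj_on fst e"
    proof (rule inj_onI)
      fix v w assume "v \<in> e" "w \<in> e" "fst v = fst w"
      moreover have "fst v < k" using e \<open>v \<in> e\<close> by (auto simp: vertices_iff)
      ultimately show "v = w" using one[of "fst v"] by (metis (no_types))
    qed
    show "fst ` e = {..<k}"
    proof (intro equalityI subsetI)
      show "i \<in> {..<k}" if "i \<in> fst ` e" for i using that e by (auto simp: vertices_iff)
      show "i \<in> fst ` e" if i: "i \<in> {..<k}" for i
      proof -
        from one[of i] i obtain v where "v \<in> e" "fst v = i" by blast
        then show ?thesis by blast
      qed
    qed
  qed
  show "card e = k" using bij_betw_same_card[OF bij] by simp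
qed

lemma prod_edge_class:
  assumes "e \<in> complete_edges k n"
  shows "(\<Prod>v\<in>e. g (fst v)) = (\<Prod>i<k. g i)"
  using prod.reindex_bij_betw[OF edge_facts(3)[OF assms], of g] .

lemma sum_edge_class:
  assumes "e \<in> complete_edges k n"
  shows "(\<Sum>v\<in>e. g (fst v)) = (\<Sum>i<k. g i)"
  using sum.reindex_bij_betw[OF edge_facts(3)[OF assms], of g] .

section \<open>Linear algebra\<close>

lemma underdetermined_system:
  fixes M :: "'e \<Rightarrow> 'x \<Rightarrow> 'a::field"
  assumes "finite X" "finite E" "card E < card X"
  shows "\<exists>c. (\<exists>v\<in>X. c v \<noteq> 0) \<and> (\<forall>e\<in>E. (\<Sum>v\<in>X. M e v * c v) = 0)"
  using assms(2,1,3)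
proof (induction E arbitrary: X M rule: finite_induct)
  case empty
  then have "X \<noteq> {}" by auto
  then obtain v where "v \<in> X" by blast
  then show ?case by (intro exI[of _ "\<lambda>_. 1"]) auto
next
  case (insert e0 E)
  show ?case
  proof (cases "\<forall>v\<in>X. M e0 v = 0")
    case True
    have "card E < card X" using insert.prems(2) insert.hyps by simp
    from insert.IH[OF insert.prems(1) this, of M] obtain c where
      "\<exists>v\<in>X. c v \<noteq> 0" "\<forall>e\<in>E. (\<Sum>v\<in>X. M e v * c v) = 0" by blast
    then show ?thesis using True by (intro exI[of _ c]) auto
  next
    case False
    then obtain v0 where v0: "v0 \<in> X" "M e0 v0 \<noteq> 0" by blast
    have split: "(\<Sum>v\<in>X. f v) = f v0 + (\<Sum>v\<in>X - {v0}. f v)" for f :: "'x \<Rightarrow> 'a"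
      using sum.remove[OF insert.prems(1) v0(1)] .
    define N where "N e v = M e v - M e v0 * M e0 v / M e0 v0" for e v
    have "card E < card (X - {v0})" using insert.prems insert.hyps v0 by simp
    from insert.IH[OF _ this, of N] insert.prems(1) obtain c where
      c: "\<exists>v\<in>X - {v0}. c v \<noteq> 0" "\<And>e. e \<in> E \<Longrightarrow> (\<Sum>v\<in>X - {v0}. N e v * c v) = 0" by auto
    define s where "s = (\<Sum>v\<in>X - {v0}. M e0 v * c v)"
    define c' where "c' v = (if v = v0 then - s / M e0 v0 else c v)" for v
    have eq: "(\<Sum>v\<in>X - {v0}. M e v * c' v) = (\<Sum>v\<in>X - {v0}. M e v * c v)" for e
      by (intro sum.cong) (auto simp: c'_def)
    have "(\<Sum>v\<in>X. M e v * c' v) = 0" if e: "e \<in> insert e0 E" for e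
    proof (cases "e = e0")
      case True
      then show ?thesis using v0(2) by (simp add: split eq) (simp add: c'_def s_def)
    next
      case False
      then have "0 = (\<Sum>v\<in>X - {v0}. N e v * c v)" using c(2) e by simp
      also have "\<dots> = (\<Sum>v\<in>X - {v0}. M e v * c v) - M e v0 * s / M e0 v0"
        by (simp add: N_def s_def left_diff_distrib sum_subtractf sum_distrib_left
              sum_divide_distrib mult.assoc)
      finally show ?thesis by (simp add: split eq) (simp add: c'_def)
    qed
    moreover have "\<exists>v\<in>X. c' v \<noteq> 0" using c(1) by (auto simp: c'_def)
    ultimately show ?thesis by blast
  qed
qed

text \<open>
  A square system can be solved up to a scalar \<open>t\<close>, which may vanish only if the solution does not.
\<close>

lemma square_system_up_to_scalar:
  fixes M :: "'x \<Rightarrow> 'x \<Rightarrow> 'a::field"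
  assumes "finite X"
  shows "\<exists>z t. ((\<exists>x\<in>X. z x \<noteq> 0) \<or> t \<noteq> 0) \<and> (\<forall>x\<in>X. (\<Sum>x'\<in>X. M x x' * z x') = t * y x)"
proof -
  let ?Y = "insert None (Some ` X)"
  let ?M = "\<lambda>x o'. case o' of None \<Rightarrow> - y x | Some x' \<Rightarrow> M x x'"
  have "card X < card ?Y" using assms by (simp add: card_image)
  from underdetermined_system[OF _ assms this, of ?M] assms obtain c where
    c: "\<exists>v\<in>?Y. c v \<noteq> 0" "\<And>x. x \<in> X \<Longrightarrow> (\<Sum>v\<in>?Y. ?M x v * c v) = 0" by auto
  have "(\<Sum>x'\<in>X. M x x' * c (Some x')) = c None * y x" if "x \<in> X" for x
    using c(2)[OF that] assms by (simp add: sum.reindex algebra_simps)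
  then show ?thesis using c(1) by (intro exI[of _ "\<lambda>x. c (Some x)"] exI[of _ "c None"]) auto
qed

section \<open>Tensor stabiliser\<close>

text \<open>
  If in row \<open>i\<close> two factors \<open>s\<close> and \<open>t\<close> had nonzero entries in different columns, then contracting the
  tensor with a pattern through these two entries would give zero for every column of a third factor
  \<open>w\<close>, and the injectivity of \<open>R w\<close> would make a product of nonzero entries vanish. This is where three
  factors are needed.
\<close>

lemma unit_tensor_stabiliser:
  fixes R :: "'v \<Rightarrow> nat \<Rightarrow> nat \<Rightarrow> 'a::field"
  assumes e: "finite e" "card e \<ge> 3"
    and ker: "\<And>v c. v \<in> e \<Longrightarrow> (\<And>i. i < d \<Longrightarrow> (\<Sum>j<d. R v i j * c j) = 0) \<Longrightarrow> \<forall>j<d. c j = 0"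
    and tensor: "\<And>J. (\<And>v. v \<in> e \<Longrightarrow> J v < d) \<Longrightarrow>
      (\<Sum>i<d. \<Prod>v\<in>e. R v i (J v)) = (\<Sum>j<d. if \<forall>v\<in>e. J v = j then 1 else 0)"
  shows "\<exists>\<tau>. bij_betw \<tau> {..<d} {..<d} \<and> (\<forall>v\<in>e. \<forall>i<d. \<forall>j<d. R v i j \<noteq> 0 \<longleftrightarrow> j = \<tau> i) \<and>
     (\<forall>i<d. (\<Prod>v\<in>e. R v i (\<tau> i)) = 1)"
proof -
  have tker: "\<forall>i<d. c i = 0" if "v \<in> e" "\<And>j. j < d \<Longrightarrow> (\<Sum>i<d. R v i j * c i) = 0" for v c
    using transposed_kernel[of d "R v" c] ker[OF that(1)] that(2) by blast
  have row: "\<exists>j<d. R v i j \<noteq> 0" if "v \<in> e" "i < d" for v i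
  proof (rule ccontr)
    assume "\<not> ?thesis"
    then have "\<And>j. j < d \<Longrightarrow> (\<Sum>i'<d. R v i' j * (if i' = i then 1 else 0)) = 0"
      using that(2) by (simp add: if_distrib cong: if_cong)
    from tker[OF that(1) this] that(2) show False by auto
  qed
  have single: "j = j'" if st: "s \<in> e" "t \<in> e" "s \<noteq> t" and j: "i < d" "j < d" "j' < d"
    and nz: "R s i j \<noteq> 0" "R t i j' \<noteq> 0" for s t i j j'
  proof (rule ccontr)
    assume jj: "j \<noteq> j'"
    have "card {s, t} < card e" using st e by simp
    then have "e - {s, t} \<noteq> {}" using card_mono[of "{s, t}" e] by force
    then obtain w where w: "w \<in> e" "w \<noteq> s" "w \<noteq> t" by blast
    define J0 where "J0 v = (if v = s then j else if v = t then j' else (SOME l. l < d \<and> R v i l \<noteq> 0))" for v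
    have some: "(SOME l. l < d \<and> R v i l \<noteq> 0) < d \<and> R v i (SOME l. l < d \<and> R v i l \<noteq> 0) \<noteq> 0" if "v \<in> e" for v
      using row[OF that j(1)] by (rule someI_ex)
    have J0: "J0 v < d" "R v i (J0 v) \<noteq> 0" if "v \<in> e" for v
      using some[OF that] j nz by (auto simp: J0_def)
    have "(\<Sum>i'<d. R w i' l * (\<Prod>v\<in>e - {w}. R v i' (J0 v))) = 0" if l: "l < d" for l
    proof -
      let ?J = "\<lambda>v. if v = w then l else J0 v"
      have "(\<Sum>i'<d. \<Prod>v\<in>e. R v i' (?J v)) = (\<Sum>j<d. if \<forall>v\<in>e. ?J v = j then 1 else 0)"
        using J0 l by (intro tensor) auto
      also have "\<dots> = 0"
      proof (intro sum.neutral ballI)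
        fix m assume "m \<in> {..<d}"
        have "?J s = j" "?J t = j'" using w st by (auto simp: J0_def)
        then have "\<not> (\<forall>v\<in>e. ?J v = m)" using st jj by metis
        then show "(if \<forall>v\<in>e. ?J v = m then 1 else 0) = (0::'a)" by simp
      qed
      also have "(\<Sum>i'<d. \<Prod>v\<in>e. R v i' (?J v)) = (\<Sum>i'<d. R w i' l * (\<Prod>v\<in>e - {w}. R v i' (J0 v)))"
        by (intro sum.cong refl, subst prod.remove[OF e(1) w(1)]) (auto intro!: prod.cong)
      finally show ?thesis .
    qed
    from tker[OF w(1), of "\<lambda>i'. \<Prod>v\<in>e - {w}. R v i' (J0 v)"] this j(1)
    have "(\<Prod>v\<in>e - {w}. R v i (J0 v)) = 0" by blast
    then show False using J0 e(1) by auto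
  qed
  define \<tau> where "\<tau> i = (SOME j. j < d \<and> (\<exists>v\<in>e. R v i j \<noteq> 0))" for i
  have e_ne: "e \<noteq> {}" using e by auto
  have \<tau>: "\<tau> i < d" "\<exists>v\<in>e. R v i (\<tau> i) \<noteq> 0" if "i < d" for i
  proof -
    have "\<exists>j. j < d \<and> (\<exists>v\<in>e. R v i j \<noteq> 0)" using row that e_ne by blast
    from someI_ex[OF this] show "\<tau> i < d" "\<exists>v\<in>e. R v i (\<tau> i) \<noteq> 0" by (auto simp: \<tau>_def)
  qed
  have supp: "R v i j \<noteq> 0 \<longleftrightarrow> j = \<tau> i" if v: "v \<in> e" and i: "i < d" and j: "j < d" for v i j
  proof -
    from \<tau>[OF i] obtain u where u: "u \<in> e" "R u i (\<tau> i) \<noteq> 0" by blast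
    have other: "l = \<tau> i" if "w \<in> e" "w \<noteq> u" "l < d" "R w i l \<noteq> 0" for w l
      using single[OF that(1) u(1) that(2) i that(3) \<tau>(1)[OF i] that(4) u(2)] .
    have "card {u} < card e" using e by simp
    then have "e - {u} \<noteq> {}" using card_mono[of "{u}" e] by force
    then obtain w where w: "w \<in> e" "w \<noteq> u" by blast
    have wt: "R w i (\<tau> i) \<noteq> 0" using row[OF w(1) i] other[OF w] by blast
    have all: "l = \<tau> i" if "l < d" "R v i l \<noteq> 0" for l
    proof (cases "v = u")
      case True
      then show ?thesis using single[OF v w(1) _ i that(1) \<tau>(1)[OF i] that(2) wt] w by blast
    qed (use other[OF v] that in blast)
    show ?thesis using all[OF j] row[OF v i] all by blast
  qed
  have inj: "inj_on \<tau> {..<d}"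
  proof (rule inj_onI)
    fix a b assume ab: "a \<in> {..<d}" "b \<in> {..<d}" "\<tau> a = \<tau> b"
    obtain v where v: "v \<in> e" using e_ne by blast
    show "a = b"
    proof (rule ccontr)
      assume ne: "a \<noteq> b"
      let ?x = "R v a (\<tau> a)" and ?y = "R v b (\<tau> a)"
      define c where "c i = (if i = a then ?y else if i = b then - ?x else 0)" for i
      have "(\<Sum>i<d. R v i j * c i) = 0" if j: "j < d" for j
      proof -
        have "(\<Sum>i<d. R v i j * c i) = (\<Sum>i\<in>{a, b}. R v i j * c i)"
          using ab by (intro sum.mono_neutral_right) (auto simp: c_def)
        also have "\<dots> = R v a j * ?y - R v b j * ?x" using ne by (simp add: c_def)
        also have "\<dots> = 0" using supp[OF v _ j, of a] supp[OF v _ j, of b] ab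
          by (cases "j = \<tau> a") auto
        finally show ?thesis .
      qed
      from tker[OF v this] have "c a = 0" using ab by auto
      then show False using supp[OF v _ \<tau>(1), of b b] ab by (auto simp: c_def)
    qed
  qed
  have bij: "bij_betw \<tau> {..<d} {..<d}"
    using inj \<tau>(1) endo_inj_surj[of "{..<d}" \<tau>] by (auto simp: bij_betw_def)
  have "(\<Prod>v\<in>e. R v i (\<tau> i)) = 1" if i: "i < d" for i
  proof -
    have "(\<Sum>i'<d. \<Prod>v\<in>e. R v i' (\<tau> i)) = (\<Sum>j<d. if \<forall>v\<in>e. \<tau> i = j then 1 else 0)"
      using \<tau>(1)[OF i] by (intro tensor)
    also have "\<dots> = (\<Sum>j<d. if j = \<tau> i then 1 else 0)"
      using e_ne by (intro sum.cong) auto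
    also have "\<dots> = 1" using \<tau>(1)[OF i] by simp
    also have "(\<Sum>i'<d. \<Prod>v\<in>e. R v i' (\<tau> i)) =
        (\<Sum>i'<d. if i' = i then \<Prod>v\<in>e. R v i (\<tau> i) else 0)"
    proof (intro sum.cong refl)
      fix i' assume i': "i' \<in> {..<d}"
      show "(\<Prod>v\<in>e. R v i' (\<tau> i)) = (if i' = i then \<Prod>v\<in>e. R v i (\<tau> i) else 0)"
      proof (cases "i' = i")
        case False
        obtain v where v: "v \<in> e" using e_ne by blast
        have "\<tau> i \<noteq> \<tau> i'" using inj False i i' by (auto dest: inj_onD)
        then have "R v i' (\<tau> i) = 0" using supp[OF v _ \<tau>(1)[OF i], of i'] i' by auto
        then show ?thesis using v e(1) False by auto
      qed simp
    qed
    finally show ?thesis using i by simp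
  qed
  then show ?thesis using bij supp by blast
qed

section \<open>Rigidity matrices\<close>

text \<open>
  The differential of the rigidity map at \<open>p\<close> in direction \<open>y\<close>, evaluated at the edge \<open>e\<close>.
\<close>

definition jacobian_row ::
    "nat \<Rightarrow> (vertex \<Rightarrow> nat \<Rightarrow> 'a::field) \<Rightarrow> (vertex \<Rightarrow> nat \<Rightarrow> 'a) \<Rightarrow> edge \<Rightarrow> 'a" where
  "jacobian_row d p y e = (\<Sum>j<d. \<Sum>u\<in>e. y u j * (\<Prod>w\<in>e - {u}. p w j))"

definition edge_value :: "nat \<Rightarrow> (vertex \<Rightarrow> nat \<Rightarrow> 'a::field) \<Rightarrow> edge \<Rightarrow> 'a" where
  "edge_value d p e = (\<Sum>j<d. \<Prod>u\<in>e. p u j)"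

lemma jacobian_cong:
  "(\<And>u j. u \<in> e \<Longrightarrow> j < d \<Longrightarrow> y u j = y' u j) \<Longrightarrow> jacobian_row d p y e = jacobian_row d p y' e"
  unfolding jacobian_row_def by (intro sum.cong) auto

lemma jacobian_sum:
  "jacobian_row d p (\<lambda>u j. \<Sum>x\<in>X. c x * y x u j) e = (\<Sum>x\<in>X. c x * jacobian_row d p (y x) e)"
proof -
  have "jacobian_row d p (\<lambda>u j. \<Sum>x\<in>X. c x * y x u j) e =
      (\<Sum>j<d. \<Sum>u\<in>e. \<Sum>x\<in>X. c x * (y x u j * (\<Prod>w\<in>e - {u}. p w j)))"
    by (simp add: jacobian_row_def sum_distrib_right mult.assoc)
  also have "\<dots> = (\<Sum>j<d. \<Sum>x\<in>X. \<Sum>u\<in>e. c x * (y x u j * (\<Prod>w\<in>e - {u}. p w j)))"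
    by (intro sum.cong refl sum.swap)
  also have "\<dots> = (\<Sum>x\<in>X. \<Sum>j<d. \<Sum>u\<in>e. c x * (y x u j * (\<Prod>w\<in>e - {u}. p w j)))"
    by (rule sum.swap)
  finally show ?thesis by (simp add: jacobian_row_def sum_distrib_left)
qed

lemma jacobian_scale: "jacobian_row d p (\<lambda>u j. t * y u j) e = t * jacobian_row d p y e"
  by (simp add: jacobian_row_def sum_distrib_left mult.assoc)

lemma jacobian_diff:
  "jacobian_row d p (\<lambda>u j. y u j - z u j) e = jacobian_row d p y e - jacobian_row d p z e"
  by (simp add: jacobian_row_def sum_subtractf left_diff_distrib)

lemma jacobian_single:
  assumes "finite e" "v \<in> e" "\<And>u j. u \<in> e \<Longrightarrow> u \<noteq> v \<Longrightarrow> j < d \<Longrightarrow> y u j = 0"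
  shows "jacobian_row d p y e = (\<Sum>j<d. y v j * (\<Prod>w\<in>e - {v}. p w j))"
  unfolding jacobian_row_def
proof (intro sum.cong refl)
  fix j assume "j \<in> {..<d}"
  then show "(\<Sum>u\<in>e. y u j * (\<Prod>w\<in>e - {u}. p w j)) = y v j * (\<Prod>w\<in>e - {v}. p w j)"
    using assms by (subst sum.remove[OF assms(1,2)]) (simp add: sum.neutral)
qed

lemma derivation_zero: "derivation D \<Longrightarrow> D 0 = 0"
  unfolding derivation_def by (metis add_cancel_right_right)

lemma derivation_one: "derivation D \<Longrightarrow> D 1 = 0"
  unfolding derivation_def by (metis add_cancel_right_right mult_1 mult_1_right)

lemma derivation_add: "derivation D \<Longrightarrow> D (a + b) = D a + D b"
  and derivation_mult: "derivation D \<Longrightarrow> D (a * b) = a * D b + D a * b"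
  by (auto simp: derivation_def)

lemma derivation_sum: "derivation D \<Longrightarrow> D (\<Sum>a\<in>A. f a) = (\<Sum>a\<in>A. D (f a))"
  by (induction A rule: infinite_finite_induct) (auto simp: derivation_zero derivation_add)

lemma derivation_prod:
  assumes "derivation D" "finite A"
  shows "D (\<Prod>a\<in>A. f a) = (\<Sum>a\<in>A. D (f a) * (\<Prod>b\<in>A - {a}. f b))"
  using assms(2)
proof (induction A rule: finite_induct)
  case empty
  then show ?case by (simp add: derivation_one[OF assms(1)])
next
  case (insert x A)
  have "(\<Prod>b\<in>insert x A - {a}. f b) = f x * (\<Prod>b\<in>A - {a}. f b)" if "a \<in> A" for a
  proof -
    have "insert x A - {a} = insert x (A - {a})" using insert.hyps that by auto
    then show ?thesis using insert.hyps by simp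
  qed
  then have "(\<Sum>a\<in>A. D (f a) * (\<Prod>b\<in>insert x A - {a}. f b)) =
      f x * (\<Sum>a\<in>A. D (f a) * (\<Prod>b\<in>A - {a}. f b))"
    by (simp add: sum_distrib_left algebra_simps)
  then show ?case using insert by (simp add: derivation_mult[OF assms(1)] algebra_simps)
qed

lemma derivation_prod_zero:
  assumes "derivation D" "finite A" "\<And>a. a \<in> A \<Longrightarrow> D (f a) = 0"
  shows "D (\<Prod>a\<in>A. f a) = 0"
  using assms by (simp add: derivation_prod)

lemma derivation_edge_value:
  assumes "derivation D" "finite e"
  shows "D (edge_value d p e) = jacobian_row d p (\<lambda>u j. D (p u j)) e"
  by (simp add: edge_value_def jacobian_row_def derivation_sum[OF assms(1)] derivation_prod[OF assms])

text \<open>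
  The infinitesimal scalings of the coordinates within each class. They preserve all edge values to
  first order because the rates \<open>a i j\<close> sum to 0 over the classes.
\<close>

definition trivial_motion ::
    "nat \<Rightarrow> nat \<Rightarrow> (vertex \<Rightarrow> nat \<Rightarrow> 'a::field) \<Rightarrow> vertex set \<Rightarrow> (vertex \<Rightarrow> nat \<Rightarrow> 'a) \<Rightarrow> bool" where
  "trivial_motion k d p U y \<longleftrightarrow>
     (\<exists>a. (\<forall>j<d. (\<Sum>i<k. a i j) = 0) \<and> (\<forall>u\<in>U. \<forall>j<d. y u j = a (fst u) j * p u j))"

text \<open>
  The edges that avoid \<open>v\<close> do not involve the coordinates of \<open>v\<close>, so a motion is only determined on the
  remaining vertices.
\<close>

definition vertex_redundantly_rigid ::
    "nat \<Rightarrow> nat \<Rightarrow> nat \<Rightarrow> edge set \<Rightarrow> (vertex \<Rightarrow> nat \<Rightarrow> 'a::field) \<Rightarrow> bool" where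
  "vertex_redundantly_rigid k n d G p \<longleftrightarrow>
     (\<forall>v\<in>vertices k n. \<forall>y. (\<forall>e\<in>G. v \<notin> e \<longrightarrow> jacobian_row d p y e = 0) \<longrightarrow>
        trivial_motion k d p (vertices k n - {v}) y)"

section \<open>Differentiating the equations between edge values\<close>

text \<open>
  Genericity of \<open>p\<close> enters only through the derivations \<open>\<delta> v j\<close> dual to its coordinates and through the
  fact that no coordinate is 0.
\<close>

locale equivalent_configurations =
  fixes k n d :: nat and G :: "edge set" and p q :: "vertex \<Rightarrow> nat \<Rightarrow> 'a::field_char_0"
    and \<delta> :: "vertex \<Rightarrow> nat \<Rightarrow> 'a \<Rightarrow> 'a"
  assumes k3: "k \<ge> 3" and d1: "d \<ge> 1" and nd: "n \<ge> d + 2" and G: "G \<subseteq> complete_edges k n"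
    and p0: "\<And>v j. v \<in> vertices k n \<Longrightarrow> j < d \<Longrightarrow> p v j \<noteq> 0"
    and der: "\<And>v j. v \<in> vertices k n \<Longrightarrow> j < d \<Longrightarrow> derivation (\<delta> v j)"
    and der_p: "\<And>v j u i. v \<in> vertices k n \<Longrightarrow> j < d \<Longrightarrow> u \<in> vertices k n \<Longrightarrow> i < d \<Longrightarrow>
       \<delta> v j (p u i) = (if u = v \<and> i = j then 1 else 0)"
    and rigid: "vertex_redundantly_rigid k n d G p"
    and same: "\<And>e. e \<in> G \<Longrightarrow> edge_value d q e = edge_value d p e"
begin

lemma edge: "e \<in> G \<Longrightarrow> finite e" "e \<in> G \<Longrightarrow> e \<subseteq> vertices k n" "e \<in> G \<Longrightarrow> card e = k"
  using edge_facts[of e k n] G by auto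

lemma jacobian_der:
  assumes "v \<in> vertices k n" "j < d" "e \<in> G"
  shows "jacobian_row d q (\<lambda>u i. \<delta> v j (q u i)) e = jacobian_row d p (\<lambda>u i. \<delta> v j (p u i)) e"
  unfolding derivation_edge_value[OF der[OF assms(1,2)] edge(1)[OF assms(3)], symmetric]
    same[OF assms(3)] ..

text \<open>
  The chain rule for a derivation \<open>\<Sum>x. c x \<delta>\<^sub>x\<close>, applied to both sides of the equations between the
  edge values.
\<close>

lemma jacobian_der_combination:
  assumes "finite X" "X \<subseteq> vertices k n \<times> {..<d}" "e \<in> G"
  shows "jacobian_row d q (\<lambda>u i. \<Sum>x\<in>X. c x * \<delta> (fst x) (snd x) (q u i)) e =
    jacobian_row d p (\<lambda>u i. if (u, i) \<in> X then c (u, i) else 0) e"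
proof -
  have "jacobian_row d q (\<lambda>u i. \<Sum>x\<in>X. c x * \<delta> (fst x) (snd x) (q u i)) e =
      (\<Sum>x\<in>X. c x * jacobian_row d q (\<lambda>u i. \<delta> (fst x) (snd x) (q u i)) e)"
    by (rule jacobian_sum)
  also have "\<dots> = (\<Sum>x\<in>X. c x * jacobian_row d p (\<lambda>u i. \<delta> (fst x) (snd x) (p u i)) e)"
    using assms by (intro sum.cong refl arg_cong2[where f = "(*)"] jacobian_der) auto
  also have "\<dots> = jacobian_row d p (\<lambda>u i. \<Sum>x\<in>X. c x * \<delta> (fst x) (snd x) (p u i)) e"
    by (rule jacobian_sum[symmetric])
  also have "\<dots> = jacobian_row d p (\<lambda>u i. if (u, i) \<in> X then c (u, i) else 0) e"
  proof (rule jacobian_cong)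
    fix u i assume u: "u \<in> e" "i < d"
    then have uV: "u \<in> vertices k n" using edge(2)[OF assms(3)] by auto
    have "(\<Sum>x\<in>X. c x * \<delta> (fst x) (snd x) (p u i)) = (\<Sum>x\<in>X. if x = (u, i) then c (u, i) else 0)"
    proof (intro sum.cong refl)
      fix x assume "x \<in> X"
      then have "\<delta> (fst x) (snd x) (p u i) = (if u = fst x \<and> i = snd x then 1 else 0)"
        using assms(2) by (intro der_p uV u(2)) auto
      then show "c x * \<delta> (fst x) (snd x) (p u i) = (if x = (u, i) then c (u, i) else 0)"
        by (cases x) auto
    qed
    then show "(\<Sum>x\<in>X. c x * \<delta> (fst x) (snd x) (p u i)) = (if (u, i) \<in> X then c (u, i) else 0)"
      using assms(1) by simp
  qed
  finally show ?thesis .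
qed

lemma rigidD:
  assumes "v \<in> vertices k n" "\<And>e. e \<in> G \<Longrightarrow> v \<notin> e \<Longrightarrow> jacobian_row d p y e = 0"
  shows "\<exists>a. (\<forall>j<d. (\<Sum>i<k. a i j) = 0) \<and>
    (\<forall>u\<in>vertices k n - {v}. \<forall>j<d. y u j = a (fst u) j * p u j)"
  using rigid assms by (simp add: vertex_redundantly_rigid_def trivial_motion_def)

text \<open>A motion that fixes one coordinate in each direction of scaling vanishes.\<close>

lemma pinned_motion:
  assumes v: "v \<in> vertices k n" and y: "\<And>e. e \<in> G \<Longrightarrow> v \<notin> e \<Longrightarrow> jacobian_row d p y e = 0"
    and b: "\<And>i j. i < k - 1 \<Longrightarrow> j < d \<Longrightarrow>
      b i j \<in> vertices k n \<and> fst (b i j) = i \<and> b i j \<noteq> v \<and> y (b i j) j = 0"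
    and u: "u \<in> vertices k n" "u \<noteq> v" "j < d"
  shows "y u j = 0"
proof -
  from rigidD[OF v y] obtain a where a1: "\<forall>j<d. (\<Sum>i<k. a i j) = 0"
    and a2: "\<forall>u\<in>vertices k n - {v}. \<forall>j<d. y u j = a (fst u) j * p u j" by blast
  have a: "(\<Sum>i<k. a i j) = 0" "u \<in> vertices k n \<Longrightarrow> u \<noteq> v \<Longrightarrow> y u j = a (fst u) j * p u j"
    if "j < d" for u j using a1 a2 that by simp_all
  have z: "a i j = 0" if "i < k - 1" for i
    using a(2)[OF u(3), of "b i j"] b[OF that u(3)] p0[of "b i j" j] u(3) by auto
  have "(\<Sum>i<k. a i j) = a (k - 1) j + (\<Sum>i<k - 1. a i j)"
    using k3 sum.lessThan_Suc[of "\<lambda>i. a i j" "k - 1"] by (simp add: add.commute)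
  then have "a (k - 1) j = 0" using z a(1)[OF u(3)] by simp
  moreover have "fst u < k - 1 \<or> fst u = k - 1" using u(1) by (auto simp: vertices_iff)
  ultimately show ?thesis using a(2)[OF u(3,1,2)] z by auto
qed

text \<open>
  If one coordinate vanished on a whole class, the corresponding summand of \<open>q\<close> would contribute
  nothing, and \<open>q\<close> would have too few parameters to follow all deformations of \<open>p\<close>.
\<close>

lemma nonzero_coordinate:
  assumes i0: "i0 < k" and j0: "j0 < d"
  shows "\<exists>u\<in>vertices k n. fst u = i0 \<and> q u j0 \<noteq> 0"
proof (rule ccontr)
  assume "\<not> ?thesis"
  then have q0: "\<And>u. u \<in> vertices k n \<Longrightarrow> fst u = i0 \<Longrightarrow> q u j0 = 0" by blast
  define v :: vertex where "v = (0, 0)"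
  have v: "v \<in> vertices k n" using k3 nd by (auto simp: v_def vertices_iff)
  define b :: "nat \<Rightarrow> nat \<Rightarrow> vertex" where "b i j = (i, 1)" for i j
  define Bs :: "(vertex \<times> nat) set" where "Bs = (\<lambda>(i, j). (b i j, j)) ` ({..<k - 1} \<times> {..<d})"
  define Y where "Y = (vertices k n - {v}) \<times> {..<d}"
  define X where "X = Y - Bs"
  \<comment> \<open>the coordinates of \<open>q\<close> that occur in the differential when the class \<open>i0\<close>
    contributes nothing to summand \<open>j0\<close>; in that summand only the class \<open>i0\<close> itself matters\<close>
  define E where "E = ((vertices k n - {v}) \<times> ({..<d} - {j0})) \<union> (({i0} \<times> {..<n}) \<times> {j0})"
  have fin: "finite X" "finite E"
    unfolding X_def Y_def E_def
    by (intro finite_Diff finite_UnI finite_cartesian_product finite_vertices; simp)+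
  have BsY: "Bs \<subseteq> Y" using nd by (auto simp: Bs_def Y_def b_def vertices_iff v_def)
  have cY: "card Y = (k * n - 1) * d"
    using v by (simp add: Y_def card_vertices)
  have cB: "card Bs \<le> (k - 1) * d"
    unfolding Bs_def by (rule order_trans[OF card_image_le]) auto
  have cX: "card X \<ge> (k * n - 1) * d - (k - 1) * d"
  proof -
    have "finite Y"
      unfolding Y_def by (intro finite_Diff finite_cartesian_product finite_vertices) simp
    then have "card X = card Y - card Bs"
      unfolding X_def by (intro card_Diff_subset BsY finite_subset[OF BsY])
    then show ?thesis using cB by (simp only: cY diff_le_mono2)
  qed
  have cE: "card E \<le> (k * n - 1) * (d - 1) + n"
    unfolding E_def using v j0
    by (intro order_trans[OF card_Un_le] add_mono) (auto simp: card_vertices card_cartesian_product)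
  have "(k * n - 1) * (d - 1) + n < (k * n - 1) * d - (k - 1) * d"
  proof -
    have Ad: "A * d = A * (d - 1) + A" for A using d1 by (cases d) auto
    have "(k - 1) * (d + 2) \<le> (k - 1) * n" by (rule mult_le_mono2[OF nd])
    moreover have "(k - 1) * (d + 2) = (k - 1) * d + (k - 1) * 2" by (rule distrib_left)
    moreover have "k * n = (k - 1) * n + n" using k3 by (cases k) auto
    ultimately have "n + (k - 1) * d < k * n - 1" using k3 by linarith
    then show ?thesis using Ad[of "k * n - 1"] by linarith
  qed
  then have "card E < card X" using cX cE by linarith
  \<comment> \<open>more unknowns than conditions: some nontrivial combination of derivations kills all of \<open>E\<close>\<close>
  then have "\<exists>c. (\<exists>x\<in>X. c x \<noteq> 0) \<and>
      (\<forall>x'\<in>E. (\<Sum>x\<in>X. \<delta> (fst x) (snd x) (q (fst x') (snd x')) * c x) = 0)"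
    by (rule underdetermined_system[OF fin])
  then obtain c where c: "\<exists>x\<in>X. c x \<noteq> 0"
    "\<forall>x'\<in>E. (\<Sum>x\<in>X. \<delta> (fst x) (snd x) (q (fst x') (snd x')) * c x) = 0" by blast
  define z where "z u i = (\<Sum>x\<in>X. c x * \<delta> (fst x) (snd x) (q u i))" for u i
  have z0: "z u i = 0" if "(u, i) \<in> E" for u i
    using bspec[OF c(2) that] by (simp add: z_def mult.commute)
  define y where "y u i = (if (u, i) \<in> X then c (u, i) else 0)" for u i
  have XV: "X \<subseteq> vertices k n \<times> {..<d}" by (auto simp: X_def Y_def)
  have "jacobian_row d p y e = 0" if e: "e \<in> G" "v \<notin> e" for e
  proof -
    have "jacobian_row d p y e = jacobian_row d q z e"
      unfolding y_def z_def by (rule jacobian_der_combination[symmetric]) (use fin XV e in auto)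
    also have "\<dots> = 0"
      unfolding jacobian_row_def
    proof (intro sum.neutral ballI)
      fix j u assume j: "j \<in> {..<d}" and u: "u \<in> e"
      then have uV: "u \<in> vertices k n" "u \<noteq> v" using edge(2)[OF e(1)] e(2) by auto
      show "z u j * (\<Prod>w\<in>e - {u}. q w j) = 0"
      proof (cases "j = j0 \<and> fst u \<noteq> i0")
        case False
        then have "(u, j) \<in> E" using uV j by (cases u) (auto simp: E_def vertices_iff)
        then show ?thesis using z0 by simp
      next
        case True
        have "i0 \<in> fst ` e" using edge_facts(3)[of e k n] e(1) G i0 by (auto simp: bij_betw_def)
        then obtain w where w: "w \<in> e" "fst w = i0" by blast
        then have "q w j0 = 0" using q0 edge(2)[OF e(1)] by blast
        moreover have "w \<in> e - {u}" using w True by auto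
        ultimately show ?thesis using True edge(1)[OF e(1)] by auto
      qed
    qed
    finally show ?thesis .
  qed
  note yker = this
  have yb: "b i j \<in> vertices k n \<and> fst (b i j) = i \<and> b i j \<noteq> v \<and> y (b i j) j = 0"
    if "i < k - 1" "j < d" for i j
  proof -
    have "(b i j, j) \<in> Bs" unfolding Bs_def using that by (intro image_eqI[of _ _ "(i, j)"]) auto
    then have "y (b i j) j = 0" by (simp add: y_def X_def)
    then show ?thesis using that nd by (simp add: b_def vertices_iff v_def)
  qed
  have "y u j = 0" if "u \<in> vertices k n" "u \<noteq> v" "j < d" for u j
    by (rule pinned_motion[OF v yker yb that])
  moreover obtain x where x: "x \<in> X" "c x \<noteq> 0" using c(1) by blast
  moreover have "fst x \<in> vertices k n" "fst x \<noteq> v" "snd x < d" using x(1) by (auto simp: X_def Y_def)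
  ultimately have "y (fst x) (snd x) = 0" by blast
  then show False using x by (simp add: y_def)
qed

end

text \<open>
  Every scaling is fixed by prescribing one coordinate \<open>(b i j, j)\<close> for each class but the last and
  each direction \<open>j\<close>.
\<close>

locale normalised_configurations = equivalent_configurations +
  fixes b :: "nat \<Rightarrow> nat \<Rightarrow> vertex"
  assumes b: "\<And>i j. i < k - 1 \<Longrightarrow> j < d \<Longrightarrow> b i j \<in> vertices k n \<and> fst (b i j) = i"
    and pinned: "\<And>i j. i < k - 1 \<Longrightarrow> j < d \<Longrightarrow> q (b i j) j = p (b i j) j"
begin

definition pins :: "vertex set" where
  "pins = (\<lambda>(i, j). b i j) ` ({..<k - 1} \<times> {..<d})"

lemma b_pins: "i < k - 1 \<Longrightarrow> j < d \<Longrightarrow> b i j \<in> pins"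
  unfolding pins_def by (intro image_eqI[of _ _ "(i, j)"]) auto

text \<open>
  Rigidity is transferred from \<open>p\<close> to \<open>q\<close>: the derivatives of the coordinates of \<open>q\<close> form a square
  matrix, which is invertible because a combination of derivations that kills \<open>q\<close> would be a motion
  of \<open>p\<close> with the same pinned coordinates.
\<close>

lemma pinned_motion_q:
  assumes v: "v \<in> vertices k n" "v \<notin> pins"
    and y: "\<And>e. e \<in> G \<Longrightarrow> v \<notin> e \<Longrightarrow> jacobian_row d q y e = 0"
    and yb: "\<And>i j. i < k - 1 \<Longrightarrow> j < d \<Longrightarrow> y (b i j) j = 0"
    and u: "u \<in> vertices k n" "u \<noteq> v" "j < d"
  shows "y u j = 0"
proof -
  define B where "B = {(u, j). \<exists>i<k - 1. j < d \<and> u = b i j}"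
  define X where "X = ((vertices k n - {v}) \<times> {..<d}) - B"
  have finX: "finite X"
    unfolding X_def by (intro finite_Diff finite_cartesian_product finite_vertices) simp
  have XV: "X \<subseteq> vertices k n \<times> {..<d}" by (auto simp: X_def)
  obtain z t where zt: "(\<exists>x\<in>X. z x \<noteq> 0) \<or> t \<noteq> 0"
    "\<forall>x\<in>X. (\<Sum>x'\<in>X. \<delta> (fst x') (snd x') (q (fst x) (snd x)) * z x') = t * (\<lambda>(u, j). y u j) x"
    using square_system_up_to_scalar[OF finX,
        of "\<lambda>x x'. \<delta> (fst x') (snd x') (q (fst x) (snd x))" "\<lambda>(u, j). y u j"] by blast
  define w where "w u j = (\<Sum>x\<in>X. z x * \<delta> (fst x) (snd x) (q u j))" for u j
  have w: "w u j = t * y u j" if "u \<in> vertices k n" "u \<noteq> v" "j < d" for u j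
  proof (cases "(u, j) \<in> B")
    case True
    then obtain i where i: "i < k - 1" "u = b i j" by (auto simp: B_def)
    have "w u j = 0"
      unfolding w_def
    proof (intro sum.neutral ballI)
      fix x assume x: "x \<in> X"
      then have xV: "fst x \<in> vertices k n" "snd x < d" using XV by auto
      have "\<delta> (fst x) (snd x) (q u j) = \<delta> (fst x) (snd x) (p u j)"
        using pinned[OF i(1) that(3)] i(2) by simp
      also have "\<dots> = (if u = fst x \<and> j = snd x then 1 else 0)" by (rule der_p[OF xV that(1,3)])
      also have "\<dots> = 0" using x True by (auto simp: X_def)
      finally show "z x * \<delta> (fst x) (snd x) (q u j) = 0" by simp
    qed
    then show ?thesis using yb[OF i(1) that(3)] i(2) by simp
  next
    case False
    then have "(u, j) \<in> X" using that by (auto simp: X_def)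
    from bspec[OF zt(2) this] show ?thesis by (simp add: w_def mult.commute)
  qed
  define c where "c u i = (if (u, i) \<in> X then z (u, i) else 0)" for u i
  have c0: "c u i = 0" if "u \<in> vertices k n" "u \<noteq> v" "i < d" for u i
  proof (rule pinned_motion[OF v(1) _ _ that])
    show "jacobian_row d p c e = 0" if e: "e \<in> G" "v \<notin> e" for e
    proof -
      have "jacobian_row d p c e = jacobian_row d q w e"
        unfolding c_def w_def by (rule jacobian_der_combination[OF finX XV e(1), symmetric])
      also have "\<dots> = jacobian_row d q (\<lambda>u j. t * y u j) e"
        using edge(2)[OF e(1)] e(2) by (intro jacobian_cong w) auto
      also have "\<dots> = 0" using y[OF e] by (simp add: jacobian_scale)
      finally show ?thesis .
    qed
    show "b i j \<in> vertices k n \<and> fst (b i j) = i \<and> b i j \<noteq> v \<and> c (b i j) j = 0"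
      if "i < k - 1" "j < d" for i j
    proof -
      have "(b i j, j) \<in> B" using that by (auto simp: B_def)
      then have "c (b i j) j = 0" by (simp add: c_def X_def)
      moreover have "b i j \<noteq> v" using b_pins[OF that] v(2) by auto
      ultimately show ?thesis using b[OF that] by simp
    qed
  qed
  have "z x = 0" if x: "x \<in> X" for x
  proof -
    have "c (fst x) (snd x) = 0" using x XV by (intro c0) (auto simp: X_def)
    then show ?thesis using x by (simp add: c_def)
  qed
  then have "t \<noteq> 0" "w u j = 0" using zt(1) by (auto simp: w_def)
  then show ?thesis using w[OF u] by simp
qed

text \<open>
  The matrix of derivatives of \<open>q v\<close> with respect to \<open>p v\<close>.
\<close>

definition R :: "vertex \<Rightarrow> nat \<Rightarrow> nat \<Rightarrow> 'a" where
  "R v i j = \<delta> v j (q v i)"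

text \<open>
  On the edges that avoid \<open>v\<close> the derivation \<open>\<delta> v j\<close> kills \<open>p\<close>, so it acts on \<open>q\<close> as a pinned motion.
\<close>

lemma der_q_other:
  assumes v: "v \<in> vertices k n" "v \<notin> pins" "j < d" and u: "u \<in> vertices k n" "u \<noteq> v" "i < d"
  shows "\<delta> v j (q u i) = 0"
proof (rule pinned_motion_q[OF v(1,2) _ _ u])
  show "jacobian_row d q (\<lambda>u i. \<delta> v j (q u i)) e = 0" if e: "e \<in> G" "v \<notin> e" for e
  proof -
    have "jacobian_row d q (\<lambda>u i. \<delta> v j (q u i)) e = jacobian_row d p (\<lambda>u i. \<delta> v j (p u i)) e"
      by (rule jacobian_der[OF v(1,3) e(1)])
    also have "\<dots> = jacobian_row d p (\<lambda>u i. 0) e"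
    proof (rule jacobian_cong)
      fix u i assume ui: "u \<in> e" "i < d"
      then have "u \<in> vertices k n" "u \<noteq> v" using edge(2)[OF e(1)] e(2) by auto
      then show "\<delta> v j (p u i) = 0" using der_p[OF v(1,3) _ ui(2)] by simp
    qed
    finally show ?thesis by (simp add: jacobian_row_def)
  qed
  show "\<delta> v j (q (b i l) l) = 0" if "i < k - 1" "l < d" for i l
    using pinned[OF that] b[OF that] b_pins[OF that] v der_p[OF v(1,3), of "b i l" l] that by auto
qed

text \<open>
  Only the terms at \<open>v\<close> survive when the equation between the edge values is differentiated by \<open>\<delta> v j\<close>.
\<close>

lemma link_columns:
  assumes v: "v \<in> vertices k n" "v \<notin> pins" "j < d" and e: "e \<in> G" "v \<in> e"
  shows "(\<Sum>i<d. R v i j * (\<Prod>w\<in>e - {v}. q w i)) = (\<Prod>w\<in>e - {v}. p w j)"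
proof -
  have eV: "\<And>u. u \<in> e \<Longrightarrow> u \<in> vertices k n" using edge(2)[OF e(1)] by auto
  have "(\<Sum>i<d. R v i j * (\<Prod>w\<in>e - {v}. q w i)) = jacobian_row d q (\<lambda>u i. \<delta> v j (q u i)) e"
    using der_q_other[OF v eV]
    by (subst jacobian_single[OF edge(1)[OF e(1)] e(2)]) (simp_all add: R_def)
  also have "\<dots> = jacobian_row d p (\<lambda>u i. \<delta> v j (p u i)) e" by (rule jacobian_der[OF v(1,3) e(1)])
  also have "\<dots> = (\<Sum>i<d. \<delta> v j (p v i) * (\<Prod>w\<in>e - {v}. p w i))"
    using der_p[OF v(1,3) eV] by (subst jacobian_single[OF edge(1)[OF e(1)] e(2)]) simp_all
  also have "\<dots> = (\<Sum>i<d. if i = j then \<Prod>w\<in>e - {v}. p w i else 0)"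
    using der_p[OF v(1,3,1)] by (intro sum.cong) auto
  finally show ?thesis using v(3) by simp
qed

text \<open>
  A relation between the links of \<open>v\<close> is an infinitesimal motion that moves \<open>v\<close> alone; a scaling moves
  the other vertices of the class as well.
\<close>

lemma link_p_injective:
  assumes v: "v \<in> vertices k n" and u: "u \<in> vertices k n" "u \<noteq> v"
    and c: "\<And>e. e \<in> G \<Longrightarrow> v \<in> e \<Longrightarrow> u \<notin> e \<Longrightarrow> (\<Sum>j<d. c j * (\<Prod>w\<in>e - {v}. p w j)) = 0"
  shows "\<forall>j<d. c j = 0"
proof -
  define y where "y w j = (if w = v then c j else 0)" for w j
  have "jacobian_row d p y e = 0" if e: "e \<in> G" "u \<notin> e" for e
  proof (cases "v \<in> e")
    case True
    then show ?thesis using c[OF e(1) True e(2)]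
      by (subst jacobian_single[OF edge(1)[OF e(1)] True]) (simp_all add: y_def)
  next
    case False
    then have "jacobian_row d p y e = jacobian_row d p (\<lambda>_ _. 0) e"
      by (intro jacobian_cong) (auto simp: y_def)
    then show ?thesis by (simp add: jacobian_row_def)
  qed
  from rigidD[OF u(1) this] obtain a where
    a: "\<forall>w\<in>vertices k n - {u}. \<forall>j<d. y w j = a (fst w) j * p w j" by blast
  have "\<not> {..<n} \<subseteq> {snd u, snd v}"
  proof
    assume "{..<n} \<subseteq> {snd u, snd v}"
    then have "card {..<n} \<le> card {snd u, snd v}" by (intro card_mono) auto
    also have "\<dots> \<le> 2" by (simp add: card_insert_if)
    finally show False using nd d1 by simp
  qed
  \<comment> \<open>a third vertex of the class of \<open>v\<close>, at which the scaling is seen to be 0\<close>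
  then obtain l where l: "l < n" "l \<noteq> snd u" "l \<noteq> snd v" by blast
  define w where "w = (fst v, l)"
  have w: "w \<in> vertices k n" "w \<noteq> u" "w \<noteq> v" using l v by (cases v; cases u; auto simp: w_def vertices_iff)+
  show ?thesis
  proof (intro allI impI)
    fix j assume j: "j < d"
    have "a (fst v) j * p w j = 0"
      using bspec[OF a, of w] w j by (simp add: y_def) (simp add: w_def)
    then have "a (fst v) j = 0" using p0[OF w(1) j] by simp
    then show "c j = 0" using bspec[OF a, of v] v u j by (auto simp: y_def)
  qed
qed

lemma other_vertex: "\<exists>u\<in>vertices k n. u \<noteq> v"
proof -
  have "(0, 0) \<in> vertices k n" "(0, 1) \<in> vertices k n" using k3 nd d1 by (auto simp: vertices_iff)
  then show ?thesis by (cases "v = (0, 0)") force+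
qed

lemma link_sum_R:
  assumes v: "v \<in> vertices k n" "v \<notin> pins" and e: "e \<in> G" "v \<in> e"
  shows "(\<Sum>j<d. z j * (\<Prod>w\<in>e - {v}. p w j)) =
    (\<Sum>i<d. (\<Sum>j<d. R v i j * z j) * (\<Prod>w\<in>e - {v}. q w i))"
proof -
  have "(\<Sum>j<d. z j * (\<Prod>w\<in>e - {v}. p w j)) =
      (\<Sum>j<d. \<Sum>i<d. z j * (R v i j * (\<Prod>w\<in>e - {v}. q w i)))"
    using link_columns[OF v _ e] by (simp flip: sum_distrib_left)
  also have "\<dots> = (\<Sum>i<d. \<Sum>j<d. z j * (R v i j * (\<Prod>w\<in>e - {v}. q w i)))" by (rule sum.swap)
  finally show ?thesis unfolding sum_distrib_right by (simp add: mult_ac)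
qed

lemma R_injective:
  assumes v: "v \<in> vertices k n" "v \<notin> pins" and z: "\<And>i. i < d \<Longrightarrow> (\<Sum>j<d. R v i j * z j) = 0"
  shows "\<forall>j<d. z j = 0"
proof -
  from other_vertex obtain u where u: "u \<in> vertices k n" "u \<noteq> v" by blast
  show ?thesis
    by (rule link_p_injective[OF v(1) u]) (simp add: link_sum_R[OF v] z)
qed

text \<open>
  \<open>R v\<close> is an injective square matrix, so every \<open>c\<close> is an image under it and the relation can be pulled
  back to \<open>p\<close>.
\<close>

lemma link_q_injective:
  assumes v: "v \<in> vertices k n" "v \<notin> pins" and u: "u \<in> vertices k n" "u \<noteq> v"
    and c: "\<And>e. e \<in> G \<Longrightarrow> v \<in> e \<Longrightarrow> u \<notin> e \<Longrightarrow> (\<Sum>i<d. c i * (\<Prod>w\<in>e - {v}. q w i)) = 0"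
  shows "\<forall>i<d. c i = 0"
proof -
  obtain z t where zt: "(\<exists>j\<in>{..<d}. z j \<noteq> 0) \<or> t \<noteq> 0"
    "\<forall>i\<in>{..<d}. (\<Sum>j<d. R v i j * z j) = t * c i"
    using square_system_up_to_scalar[of "{..<d}" "R v" c] by blast
  have "(\<Sum>j<d. z j * (\<Prod>w\<in>e - {v}. p w j)) = 0" if e: "e \<in> G" "v \<in> e" "u \<notin> e" for e
  proof -
    have "(\<Sum>j<d. z j * (\<Prod>w\<in>e - {v}. p w j)) = (\<Sum>i<d. t * (c i * (\<Prod>w\<in>e - {v}. q w i)))"
      unfolding link_sum_R[OF v e(1,2)] using zt(2) by (intro sum.cong) (auto simp: mult.assoc)
    also have "\<dots> = 0" using c[OF e] by (simp flip: sum_distrib_left)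
    finally show ?thesis .
  qed
  then have "\<forall>j<d. z j = 0" by (rule link_p_injective[OF v(1) u])
  then show ?thesis using zt by auto
qed

text \<open>
  Differentiate \<open>link_columns\<close> once more, using only edges that avoid \<open>u\<close>, and compare coefficients.
\<close>

lemma R_constant:
  assumes v: "v \<in> vertices k n" "v \<notin> pins" "i < d" "j < d"
    and u: "u \<in> vertices k n" "u \<notin> pins" "l < d"
  shows "\<delta> u l (R v i j) = 0"
proof -
  note D = der[OF u(1,3)]
  \<comment> \<open>the vertex to be avoided; if \<open>u = v\<close>, any other vertex does\<close>
  obtain x where x: "x \<in> vertices k n" "x \<noteq> v" "u \<noteq> v \<Longrightarrow> x = u"
    using other_vertex[of v] u(1) by metis
  have "(\<Sum>i<d. \<delta> u l (R v i j) * (\<Prod>w\<in>e - {v}. q w i)) = 0" if e: "e \<in> G" "v \<in> e" "x \<notin> e" for e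
  proof -
    have u_no: "w \<in> vertices k n" "w \<noteq> u" if "w \<in> e - {v}" for w
      using that edge(2)[OF e(1)] e(3) x(3) by auto
    have fin: "finite (e - {v})" using edge(1)[OF e(1)] by simp
    have qz: "\<delta> u l (\<Prod>w\<in>e - {v}. q w i) = 0" if "i < d" for i
      by (rule derivation_prod_zero[OF D fin]) (rule der_q_other[OF u u_no that])
    have pz: "\<delta> u l (\<Prod>w\<in>e - {v}. p w j) = 0"
      by (rule derivation_prod_zero[OF D fin]) (simp add: der_p[OF u(1,3) u_no(1) v(4)] u_no(2))
    have "\<delta> u l (\<Sum>i<d. R v i j * (\<Prod>w\<in>e - {v}. q w i)) = 0"
      unfolding link_columns[OF v(1,2,4) e(1,2)] by (rule pz)
    then show ?thesis
      unfolding derivation_sum[OF D] derivation_mult[OF D] by (simp add: qz)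
  qed
  then have "\<forall>i<d. \<delta> u l (R v i j) = 0" by (rule link_q_injective[OF v(1,2) x(1,2)])
  then show ?thesis using v(3) by simp
qed

lemma q_eq_R_p:
  assumes v: "v \<in> vertices k n" "v \<notin> pins" "i < d"
  shows "q v i = (\<Sum>j<d. R v i j * p v j)"
proof -
  from other_vertex obtain u where u: "u \<in> vertices k n" "u \<noteq> v" by blast
  have "(\<Sum>i<d. (q v i - (\<Sum>j<d. R v i j * p v j)) * (\<Prod>w\<in>e - {v}. q w i)) = 0"
    if e: "e \<in> G" "v \<in> e" for e
  proof -
    have split: "edge_value d x e = (\<Sum>i<d. x v i * (\<Prod>w\<in>e - {v}. x w i))" for x :: "vertex \<Rightarrow> nat \<Rightarrow> 'a"
      unfolding edge_value_def using edge(1)[OF e(1)] e(2) by (simp add: prod.remove)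
    show ?thesis
      using same[OF e(1)] link_sum_R[OF v(1,2) e, of "p v"]
      by (simp add: split left_diff_distrib sum_subtractf)
  qed
  then have "\<forall>i<d. q v i - (\<Sum>j<d. R v i j * p v j) = 0"
    by (intro link_q_injective[OF v(1,2) u]) blast
  then show ?thesis using v(3) by simp
qed

text \<open>
  Apply the derivations \<open>\<delta> v (J v)\<close> for the vertices \<open>v\<close> of the edge one after the other to the equation
  between the edge values. The matrices \<open>R v\<close> act like constants by \<open>R_constant\<close>.
\<close>

lemma tensor_identity:
  assumes e: "e \<in> G" "e \<inter> pins = {}" and J: "\<And>v. v \<in> e \<Longrightarrow> J v < d"
  shows "(\<Sum>i<d. \<Prod>v\<in>e. R v i (J v)) = (\<Sum>j<d. if \<forall>v\<in>e. J v = j then 1 else 0)"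
proof -
  have eV: "v \<in> vertices k n" "v \<notin> pins" if "v \<in> e" for v using that e edge(2)[OF e(1)] by auto
  have "(\<Sum>i<d. (\<Prod>v\<in>A. R v i (J v)) * (\<Prod>v\<in>e - A. q v i)) =
      (\<Sum>j<d. (if \<forall>v\<in>A. J v = j then 1 else 0) * (\<Prod>v\<in>e - A. p v j))" if "A \<subseteq> e" for A
    using finite_subset[OF that edge(1)[OF e(1)]] that
  proof (induction A rule: finite_induct)
    case empty
    then show ?case using same[OF e(1)] by (simp add: edge_value_def)
  next
    case (insert x A)
    then have x: "x \<in> e" "x \<notin> A" and A: "A \<subseteq> e" by auto
    note xV = eV[OF x(1)] J[OF x(1)]
    let ?D = "\<delta> x (J x)"
    note D = der[OF xV(1,3)]
    have fin: "finite (e - insert x A)" "finite A" using edge(1)[OF e(1)] insert by auto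
    have rem: "(\<Prod>v\<in>e - A. f v) = f x * (\<Prod>v\<in>e - insert x A. f v)" for f :: "vertex \<Rightarrow> 'a"
    proof -
      have "e - insert x A = e - A - {x}" by auto
      then show ?thesis using x edge(1)[OF e(1)] by (simp add: prod.remove)
    qed
    have rest: "v \<in> vertices k n" "v \<noteq> x" if "v \<in> e - insert x A" for v using that eV by auto
    have RA: "?D (\<Prod>v\<in>A. R v i (J v)) = 0" if "i < d" for i
      using A by (intro derivation_prod_zero[OF D fin(2)] R_constant[OF eV that J xV]) auto
    have qz: "?D (\<Prod>v\<in>e - insert x A. q v i) = 0" if "i < d" for i
      by (rule derivation_prod_zero[OF D fin(1)]) (rule der_q_other[OF xV rest that])
    have pz: "?D (\<Prod>v\<in>e - insert x A. p v i) = 0" if "i < d" for i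
      by (rule derivation_prod_zero[OF D fin(1)])
         (simp add: der_p[OF xV(1,3) rest(1) that] rest(2))
    have qx: "?D (q x i) = R x i (J x)" for i by (simp add: R_def)
    have ind: "?D (if P then 1 else 0) = 0" for P
      using derivation_zero[OF D] derivation_one[OF D] by simp
    have "?D (\<Sum>i<d. (\<Prod>v\<in>A. R v i (J v)) * (q x i * (\<Prod>v\<in>e - insert x A. q v i))) =
        ?D (\<Sum>j<d. (if \<forall>v\<in>A. J v = j then 1 else 0) * (p x j * (\<Prod>v\<in>e - insert x A. p v j)))"
      using insert.IH[OF A] by (simp add: rem)
    moreover have "?D (\<Sum>i<d. (\<Prod>v\<in>A. R v i (J v)) * (q x i * (\<Prod>v\<in>e - insert x A. q v i))) =
        (\<Sum>i<d. (\<Prod>v\<in>insert x A. R v i (J v)) * (\<Prod>v\<in>e - insert x A. q v i))"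
      unfolding derivation_sum[OF D] derivation_mult[OF D]
      using insert.hyps fin by (intro sum.cong) (auto simp: RA qz qx mult_ac)
    moreover have "?D (\<Sum>j<d. (if \<forall>v\<in>A. J v = j then 1 else 0) * (p x j * (\<Prod>v\<in>e - insert x A. p v j))) =
        (\<Sum>j<d. (if \<forall>v\<in>insert x A. J v = j then 1 else 0) * (\<Prod>v\<in>e - insert x A. p v j))"
      unfolding derivation_sum[OF D] derivation_mult[OF D]
    proof (intro sum.cong refl)
      fix j assume "j \<in> {..<d}"
      then have j: "j < d" by simp
      have "?D (p x j) = (if J x = j then 1 else 0)" using der_p[OF xV(1,3,1) j] by auto
      then show "(if \<forall>v\<in>A. J v = j then 1 else 0) *
            (p x j * ?D (\<Prod>v\<in>e - insert x A. p v j) + ?D (p x j) * (\<Prod>v\<in>e - insert x A. p v j)) +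
          ?D (if \<forall>v\<in>A. J v = j then 1 else 0) * (p x j * (\<Prod>v\<in>e - insert x A. p v j)) =
          (if \<forall>v\<in>insert x A. J v = j then 1 else 0) * (\<Prod>v\<in>e - insert x A. p v j)"
        unfolding pz[OF j] ind by simp
    qed
    ultimately show ?case by simp
  qed
  from this[of e] show ?thesis by simp
qed

lemma edge_structure:
  assumes e: "e \<in> G" "e \<inter> pins = {}"
  shows "\<exists>\<tau>. bij_betw \<tau> {..<d} {..<d} \<and> (\<forall>v\<in>e. \<forall>i<d. \<forall>j<d. R v i j \<noteq> 0 \<longleftrightarrow> j = \<tau> i) \<and>
     (\<forall>i<d. (\<Prod>v\<in>e. R v i (\<tau> i)) = 1)"
proof (rule unit_tensor_stabiliser)
  show "finite e" "3 \<le> card e" using edge[OF e(1)] k3 by auto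
  show "\<forall>j<d. c j = 0" if "v \<in> e" "\<And>i. i < d \<Longrightarrow> (\<Sum>j<d. R v i j * c j) = 0" for v c
    using that e edge(2)[OF e(1)] by (intro R_injective[of v]) auto
qed (rule tensor_identity[OF e])

end

section \<open>Hypergraphs that meet all large boxes\<close>

text \<open>
  A box is a product of subsets of size at least \<open>s\<close> of the vertex classes.
\<close>

definition meets_boxes :: "nat \<Rightarrow> nat \<Rightarrow> nat \<Rightarrow> edge set \<Rightarrow> bool" where
  "meets_boxes k n s G \<longleftrightarrow>
     (\<forall>A. (\<forall>i<k. A i \<subseteq> vertex_class n i \<and> s \<le> card (A i)) \<longrightarrow> (\<exists>e\<in>G. e \<subseteq> (\<Union>i<k. A i)))"

lemma meets_boxesD:
  assumes "meets_boxes k n s G" "\<And>i. i < k \<Longrightarrow> A i \<subseteq> vertex_class n i" "\<And>i. i < k \<Longrightarrow> s \<le> card (A i)"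
  shows "\<exists>e\<in>G. \<forall>v\<in>e. v \<in> A (fst v)"
proof -
  have "\<exists>e\<in>G. e \<subseteq> (\<Union>i<k. A i)" using assms unfolding meets_boxes_def by simp
  then obtain e where e: "e \<in> G" "e \<subseteq> (\<Union>i<k. A i)" by blast
  have "v \<in> A (fst v)" if v: "v \<in> e" for v
  proof -
    from v e(2) obtain i where i: "i < k" "v \<in> A i" by auto
    then have "fst v = i" using assms(2)[OF i(1)] by (auto simp: vertex_class_iff)
    then show ?thesis using i by simp
  qed
  then show ?thesis using e(1) by blast
qed

lemma pigeonhole_class:
  assumes "finite W" "finite C" "f ` W \<subseteq> C" "C \<noteq> {}"
  shows "\<exists>c\<in>C. card W \<le> card C * card {w \<in> W. f w = c}"
proof (rule ccontr)
  assume "\<not> ?thesis"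
  then have lt: "card C * card {w \<in> W. f w = c} < card W" if "c \<in> C" for c using that by force
  have "card W = (\<Sum>c\<in>C. card {w \<in> W. f w = c})"
    using sum.group[OF assms(1-3), of "\<lambda>_. 1 :: nat"] by simp
  then have "card C * card W = (\<Sum>c\<in>C. card C * card {w \<in> W. f w = c})"
    by (simp add: sum_distrib_left)
  also have "\<dots> < (\<Sum>c\<in>C. card W)" using assms lt by (intro sum_strict_mono) auto
  finally show False by simp
qed

lemma lower_quantile:
  fixes h :: "'v \<Rightarrow> real"
  assumes "finite U" "1 \<le> s" "s \<le> card U"
  shows "\<exists>l. s \<le> card {u \<in> U. h u \<le> l} \<and> card {u \<in> U. h u < l} < s"
proof -
  define X where "X = {x \<in> h ` U. s \<le> card {u \<in> U. h u \<le> x}}"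
  have U: "U \<noteq> {}" using assms by auto
  have "{u \<in> U. h u \<le> Max (h ` U)} = U" using assms(1) by auto
  then have "Max (h ` U) \<in> X" using assms U by (auto simp: X_def)
  moreover have fin: "finite X" using assms(1) by (simp add: X_def)
  ultimately have m: "Min X \<in> X" by (intro Min_in) auto
  have "card {u \<in> U. h u < Min X} < s"
  proof (rule ccontr)
    let ?B = "{u \<in> U. h u < Min X}"
    assume "\<not> ?thesis"
    then have B: "s \<le> card ?B" by simp
    have "card ?B \<noteq> 0" using assms(2) B by linarith
    then have finB: "finite ?B" "?B \<noteq> {}" by (rule card_ge_0_finite[OF neq0_conv[THEN iffD1]]) (use \<open>card ?B \<noteq> 0\<close> in force)
    let ?x = "Max (h ` ?B)"
    have x: "?x \<in> h ` ?B" using finB by (intro Max_in) auto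
    have "?B \<subseteq> {u \<in> U. h u \<le> ?x}" using finB by auto
    then have "card ?B \<le> card {u \<in> U. h u \<le> ?x}" using assms(1) by (intro card_mono) auto
    then have "?x \<in> X" using x B by (auto simp: X_def)
    then have "Min X \<le> ?x" using fin by simp
    then show False using x by auto
  qed
  then show ?thesis using m by (auto simp: X_def)
qed

text \<open>
  Comparing an edge through the lower quantiles with an edge through the upper quantiles shows that
  lower and upper quantiles agree.
\<close>

lemma constant_sums_imp_constant:
  fixes h :: "vertex \<Rightarrow> real"
  assumes G: "G \<subseteq> complete_edges k n" and box: "meets_boxes k n s G" and s: "1 \<le> s"
    and U: "\<And>i. i < k \<Longrightarrow> U i \<subseteq> vertex_class n i" "\<And>i. i < k \<Longrightarrow> 2 * s \<le> card (U i)"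
    and sums: "\<And>e. e \<in> G \<Longrightarrow> (\<And>v. v \<in> e \<Longrightarrow> v \<in> U (fst v)) \<Longrightarrow> (\<Sum>v\<in>e. h v) = K"
  shows "\<exists>c. \<forall>i<k. card {v \<in> U i. h v \<noteq> c i} \<le> 2 * s"
proof -
  have finU: "finite (U i)" if "i < k" for i
    using U(1)[OF that] by (rule finite_subset) (simp add: vertex_class_def)
  have "\<exists>l. s \<le> card {u \<in> U i. h u \<le> l} \<and> card {u \<in> U i. h u < l} < s" if "i < k" for i
    using lower_quantile[OF finU[OF that] s] U(2)[OF that] by force
  then have "\<forall>i\<in>{..<k}. \<exists>l. s \<le> card {u \<in> U i. h u \<le> l} \<and> card {u \<in> U i. h u < l} < s" by simp
  from bchoice[OF this] obtain l where
    "\<forall>i\<in>{..<k}. s \<le> card {u \<in> U i. h u \<le> l i} \<and> card {u \<in> U i. h u < l i} < s" by blast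
  then have l: "i < k \<Longrightarrow> s \<le> card {u \<in> U i. h u \<le> l i}"
    "i < k \<Longrightarrow> card {u \<in> U i. h u < l i} < s" for i by simp_all
  have "\<exists>l. s \<le> card {u \<in> U i. - h u \<le> l} \<and> card {u \<in> U i. - h u < l} < s" if "i < k" for i
    using lower_quantile[OF finU[OF that] s, of "\<lambda>u. - h u"] U(2)[OF that] by force
  then have "\<forall>i\<in>{..<k}. \<exists>l. s \<le> card {u \<in> U i. - h u \<le> l} \<and> card {u \<in> U i. - h u < l} < s" by simp
  from bchoice[OF this] obtain r where
    "\<forall>i\<in>{..<k}. s \<le> card {u \<in> U i. - h u \<le> r i} \<and> card {u \<in> U i. - h u < r i} < s" by blast
  then have r: "i < k \<Longrightarrow> s \<le> card {u \<in> U i. - h u \<le> r i}"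
    "i < k \<Longrightarrow> card {u \<in> U i. - h u < r i} < s" for i by simp_all
  have lr: "l i \<le> - r i" if i: "i < k" for i
  proof (rule ccontr)
    assume "\<not> ?thesis"
    then have "U i \<subseteq> {u \<in> U i. h u < l i} \<union> {u \<in> U i. - h u < r i}" by auto
    then have "card (U i) \<le> card ({u \<in> U i. h u < l i} \<union> {u \<in> U i. - h u < r i})"
      using finU[OF i] by (intro card_mono) auto
    also have "\<dots> \<le> card {u \<in> U i. h u < l i} + card {u \<in> U i. - h u < r i}" by (rule card_Un_le)
    finally show False using l(2)[OF i] r(2)[OF i] U(2)[OF i] by linarith
  qed
  have Ki: "(\<Sum>v\<in>e. g (fst v)) = (\<Sum>i<k. g i)" if "e \<in> G" for e and g :: "nat \<Rightarrow> real"
    using sum_edge_class[OF subsetD[OF G that], of g] .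
  have "\<exists>e\<in>G. \<forall>v\<in>e. v \<in> (\<lambda>i. {u \<in> U i. h u \<le> l i}) (fst v)"
  proof (rule meets_boxesD[OF box])
    show "{u \<in> U i. h u \<le> l i} \<subseteq> vertex_class n i" if "i < k" for i using U(1)[OF that] by blast
  qed (rule l(1))
  then obtain e where "e \<in> G" "\<forall>v\<in>e. v \<in> {u \<in> U (fst v). h u \<le> l (fst v)}" by blast
  then have e: "e \<in> G" "v \<in> e \<Longrightarrow> v \<in> U (fst v) \<and> h v \<le> l (fst v)" for v by simp_all
  have "K = (\<Sum>v\<in>e. h v)" using sums[OF e(1)] e(2) by simp
  also have "\<dots> \<le> (\<Sum>v\<in>e. l (fst v))" using e(2) by (intro sum_mono) blast
  finally have 1: "K \<le> (\<Sum>i<k. l i)" using Ki[OF e(1)] by simp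
  have "\<exists>e\<in>G. \<forall>v\<in>e. v \<in> (\<lambda>i. {u \<in> U i. - h u \<le> r i}) (fst v)"
  proof (rule meets_boxesD[OF box])
    show "{u \<in> U i. - h u \<le> r i} \<subseteq> vertex_class n i" if "i < k" for i using U(1)[OF that] by blast
  qed (rule r(1))
  then obtain e' where "e' \<in> G" "\<forall>v\<in>e'. v \<in> {u \<in> U (fst v). - h u \<le> r (fst v)}" by blast
  then have e': "e' \<in> G" "v \<in> e' \<Longrightarrow> v \<in> U (fst v) \<and> - h v \<le> r (fst v)" for v by simp_all
  have "(\<Sum>i<k. - r i) = (\<Sum>v\<in>e'. - r (fst v))" using Ki[OF e'(1), of "\<lambda>i. - r i"] by simp
  also have "\<dots> \<le> (\<Sum>v\<in>e'. h v)" using e'(2) by (intro sum_mono) force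
  also have "\<dots> = K" using sums[OF e'(1)] e'(2) by simp
  finally have "(\<Sum>i<k. (- r i) - l i) \<le> 0" using 1 by (simp add: sum_subtractf)
  moreover have nn: "(- r i) - l i \<ge> 0" if "i \<in> {..<k}" for i using lr that by simp
  ultimately have "(\<Sum>i<k. (- r i) - l i) = 0" using sum_nonneg[of "{..<k}" "\<lambda>i. (- r i) - l i"] by force
  then have eq: "- r i = l i" if "i < k" for i
    using sum_nonneg_eq_0_iff[of "{..<k}" "\<lambda>i. (- r i) - l i"] nn that by auto
  have "card {v \<in> U i. h v \<noteq> l i} \<le> 2 * s" if i: "i < k" for i
  proof -
    have "{v \<in> U i. h v \<noteq> l i} \<subseteq> {u \<in> U i. h u < l i} \<union> {u \<in> U i. - h u < r i}"
      using eq[OF i] by force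
    then have "card {v \<in> U i. h v \<noteq> l i} \<le> card ({u \<in> U i. h u < l i} \<union> {u \<in> U i. - h u < r i})"
      using finU[OF i] by (intro card_mono) auto
    also have "\<dots> \<le> card {u \<in> U i. h u < l i} + card {u \<in> U i. - h u < r i}" by (rule card_Un_le)
    finally show ?thesis using l(2)[OF i] r(2)[OF i] by linarith
  qed
  then show ?thesis by blast
qed

text \<open>
  Inside a sector of angle \<open>2 \<pi> / k\<close> a product of \<open>k\<close> factors determines the sum of the principal
  logarithms, so that multiplicative relations become additive ones over the reals. This is what
  excludes torsion.
\<close>

lemma constant_products_imp_constant:
  fixes z :: "vertex \<Rightarrow> complex"
  assumes G: "G \<subseteq> complete_edges k n" and box: "meets_boxes k n s G" and s: "1 \<le> s" and k: "1 \<le> k"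
    and U: "\<And>i. i < k \<Longrightarrow> U i \<subseteq> vertex_class n i" "\<And>i. i < k \<Longrightarrow> 2 * s \<le> card (U i)"
    and z: "\<And>i v. i < k \<Longrightarrow> v \<in> U i \<Longrightarrow> z v \<noteq> 0"
    and sector: "\<And>i v w. i < k \<Longrightarrow> v \<in> U i \<Longrightarrow> w \<in> U i \<Longrightarrow> \<bar>Arg (z v) - Arg (z w)\<bar> < 2 * pi / k"
    and prods: "\<And>e. e \<in> G \<Longrightarrow> (\<And>v. v \<in> e \<Longrightarrow> v \<in> U (fst v)) \<Longrightarrow> (\<Prod>v\<in>e. z v) = 1"
  shows "\<exists>c. \<forall>i<k. card {v \<in> U i. z v \<noteq> c i} \<le> 4 * s"
proof -
  define inU where "inU e \<longleftrightarrow> e \<in> G \<and> (\<forall>v\<in>e. v \<in> U (fst v))" for e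
  have inUD: "e \<in> complete_edges k n" "v \<in> e \<Longrightarrow> fst v < k" "v \<in> e \<Longrightarrow> v \<in> U (fst v)" "finite e"
    if "inU e" for e v
  proof -
    show ec: "e \<in> complete_edges k n" using that G by (auto simp: inU_def)
    show "v \<in> e \<Longrightarrow> fst v < k" using edge_facts(1)[OF ec] by (auto simp: vertices_iff)
    show "v \<in> e \<Longrightarrow> v \<in> U (fst v)" using that by (simp add: inU_def)
    show "finite e" by (rule edge_facts(2)[OF ec])
  qed
  have zne: "z v \<noteq> 0" if "inU e" "v \<in> e" for e v by (rule z[OF inUD(2,3)[OF that]])
  have exp_sum: "exp (\<Sum>v\<in>e. Ln (z v)) = 1" if "inU e" for e
  proof -
    have "exp (\<Sum>v\<in>e. Ln (z v)) = (\<Prod>v\<in>e. z v)"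
      unfolding exp_sum[OF inUD(4)[OF that]] using zne[OF that] by (intro prod.cong) simp_all
    then show ?thesis using prods that by (simp add: inU_def)
  qed
  have same: "(\<Sum>v\<in>e. Ln (z v)) = (\<Sum>v\<in>e'. Ln (z v))" if e: "inU e" "inU e'" for e e'
  proof (rule exp_complex_eqI)
    have ex: "\<exists>v. v \<in> e \<and> fst v = i" if "inU e" "i < k" for i e
    proof -
      have "i \<in> fst ` e" using edge_facts(3)[OF inUD(1)[OF that(1)]] that(2) by (auto simp: bij_betw_def)
      then show ?thesis by auto
    qed
    define f where "f e i = (SOME v. v \<in> e \<and> fst v = i)" for e :: edge and i
    have f: "f e i \<in> e \<and> fst (f e i) = i" if "inU e" "i < k" for e i
      unfolding f_def using someI_ex[OF ex[OF that]] .
    have fe: "f e (fst v) = v" if "inU e" "v \<in> e" for e v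
    proof -
      have "inj_on fst e" using edge_facts(3)[OF inUD(1)[OF that(1)]] by (simp add: bij_betw_def)
      moreover have "f e (fst v) \<in> e \<and> fst (f e (fst v)) = fst v"
        using f[OF that(1) inUD(2)[OF that]] .
      ultimately show ?thesis using that(2) by (auto dest: inj_onD)
    qed
    have reidx: "(\<Sum>v\<in>e. Im (Ln (z v))) = (\<Sum>i<k. Arg (z (f e i)))" if "inU e" for e
    proof -
      have "(\<Sum>v\<in>e. Im (Ln (z v))) = (\<Sum>v\<in>e. Arg (z (f e (fst v))))"
        using fe[OF that] zne[OF that] by (intro sum.cong) (simp_all add: Arg_eq_Im_Ln)
      then show ?thesis using sum_edge_class[OF inUD(1)[OF that], of "\<lambda>i. Arg (z (f e i))"] by simp
    qed
    have "\<bar>Im (\<Sum>v\<in>e. Ln (z v)) - Im (\<Sum>v\<in>e'. Ln (z v))\<bar> =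
        \<bar>\<Sum>i<k. Arg (z (f e i)) - Arg (z (f e' i))\<bar>"
      by (simp add: reidx e sum_subtractf)
    also have "\<dots> \<le> (\<Sum>i<k. \<bar>Arg (z (f e i)) - Arg (z (f e' i))\<bar>)" by (rule sum_abs)
    also have "\<dots> < (\<Sum>i<k. 2 * pi / k)"
    proof (rule sum_strict_mono)
      show "{..<k} \<noteq> {}" using k by (simp add: lessThan_empty_iff)
      fix i assume "i \<in> {..<k}"
      then have i: "i < k" by simp
      have "f e i \<in> U i" "f e' i \<in> U i" using f[OF e(1) i] f[OF e(2) i] inUD(3) e by metis+
      then show "\<bar>Arg (z (f e i)) - Arg (z (f e' i))\<bar> < 2 * pi / k" by (rule sector[OF i])
    qed simp
    also have "\<dots> = 2 * pi" using k by simp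
    finally show "\<bar>Im (\<Sum>v\<in>e. Ln (z v)) - Im (\<Sum>v\<in>e'. Ln (z v))\<bar> < 2 * pi" .
  qed (simp add: exp_sum e)
  define K where "K = (\<Sum>v\<in>(SOME e. inU e). Ln (z v))"
  have K: "(\<Sum>v\<in>e. Ln (z v)) = K" if "inU e" for e
    unfolding K_def using that by (intro same) (auto intro: someI)
  have "\<exists>c. \<forall>i<k. card {v \<in> U i. Re (Ln (z v)) \<noteq> c i} \<le> 2 * s"
  proof (rule constant_sums_imp_constant[OF G box s U, where K = "Re K"])
    fix e assume "e \<in> G" "\<And>v. v \<in> e \<Longrightarrow> v \<in> U (fst v)"
    then have "Re (\<Sum>v\<in>e. Ln (z v)) = Re K" using K[of e] by (simp add: inU_def)
    then show "(\<Sum>v\<in>e. Re (Ln (z v))) = Re K" by simp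
  qed
  then obtain c1 where c1: "\<forall>i<k. card {v \<in> U i. Re (Ln (z v)) \<noteq> c1 i} \<le> 2 * s" by blast
  have "\<exists>c. \<forall>i<k. card {v \<in> U i. Im (Ln (z v)) \<noteq> c i} \<le> 2 * s"
  proof (rule constant_sums_imp_constant[OF G box s U, where K = "Im K"])
    fix e assume "e \<in> G" "\<And>v. v \<in> e \<Longrightarrow> v \<in> U (fst v)"
    then have "Im (\<Sum>v\<in>e. Ln (z v)) = Im K" using K[of e] by (simp add: inU_def)
    then show "(\<Sum>v\<in>e. Im (Ln (z v))) = Im K" by simp
  qed
  then obtain c2 where c2: "\<forall>i<k. card {v \<in> U i. Im (Ln (z v)) \<noteq> c2 i} \<le> 2 * s" by blast
  have "card {v \<in> U i. z v \<noteq> exp (Complex (c1 i) (c2 i))} \<le> 4 * s" if i: "i < k" for i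
  proof -
    let ?A = "{v \<in> U i. Re (Ln (z v)) \<noteq> c1 i}" and ?B = "{v \<in> U i. Im (Ln (z v)) \<noteq> c2 i}"
    have finU: "finite (U i)"
      using U(1)[OF i] by (rule finite_subset) (simp add: vertex_class_def)
    have "z v = exp (Complex (c1 i) (c2 i))"
      if "v \<in> U i" "Re (Ln (z v)) = c1 i" "Im (Ln (z v)) = c2 i" for v
    proof -
      have "Ln (z v) = Complex (c1 i) (c2 i)" using that by (simp add: complex_eq_iff)
      then show ?thesis using exp_Ln[OF z[OF i that(1)]] by simp
    qed
    then have "{v \<in> U i. z v \<noteq> exp (Complex (c1 i) (c2 i))} \<subseteq> ?A \<union> ?B" by blast
    then have "card {v \<in> U i. z v \<noteq> exp (Complex (c1 i) (c2 i))} \<le> card (?A \<union> ?B)"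
      using finU by (intro card_mono) auto
    also have "\<dots> \<le> card ?A + card ?B" by (rule card_Un_le)
    finally show ?thesis using c1[rule_format, OF i] c2[rule_format, OF i] by linarith
  qed
  then show ?thesis by (intro exI[of _ "\<lambda>i. exp (Complex (c1 i) (c2 i))"]) simp
qed

section \<open>From most vertices to all vertices\<close>

text \<open>
  The vertex \<open>v\<close> is the one removed in \<open>vertex_redundantly_rigid\<close>. The edges counted meet \<open>S\<close> in \<open>u\<close> only,
  so what is known outside \<open>S\<close> can be propagated to \<open>u\<close>.
\<close>

definition absorbing :: "nat \<Rightarrow> nat \<Rightarrow> nat \<Rightarrow> nat \<Rightarrow> edge set \<Rightarrow> bool" where
  "absorbing k n d m G \<longleftrightarrow>
     (\<forall>v\<in>vertices k n. \<forall>S. S \<subseteq> vertices k n - {v} \<longrightarrow> S \<noteq> {} \<longrightarrow> card S \<le> m \<longrightarrow>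
        (\<exists>u\<in>S. d \<le> card {e \<in> G. e \<inter> insert v S = {u}}))"

text \<open>
  Any \<open>d\<close> edges at \<open>u\<close> determine a linear form in the coordinates of \<open>u\<close>.
\<close>

definition link_independent ::
    "nat \<Rightarrow> nat \<Rightarrow> nat \<Rightarrow> edge set \<Rightarrow> (vertex \<Rightarrow> nat \<Rightarrow> 'a::field) \<Rightarrow> bool" where
  "link_independent k n d G p \<longleftrightarrow>
     (\<forall>u\<in>vertices k n. \<forall>E c. E \<subseteq> G \<longrightarrow> d \<le> card E \<longrightarrow> (\<forall>e\<in>E. u \<in> e) \<longrightarrow>
        (\<forall>e\<in>E. (\<Sum>j<d. c j * (\<Prod>w\<in>e - {u}. p w j)) = 0) \<longrightarrow> (\<forall>j<d. c j = 0))"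

text \<open>
  The nonzero numbers with a given index lie in a sector of angle less than \<open>2 \<pi> / k\<close>, as needed in
  \<open>constant_products_imp_constant\<close>. The number 0 gets an index that no nonzero number has.
\<close>

definition sector_index :: "nat \<Rightarrow> complex \<Rightarrow> int" where
  "sector_index k z = (if z = 0 then int k + 1 else \<lfloor>Arg z * k / (2 * pi)\<rfloor>)"

lemma sector_index_range: "sector_index k z \<in> {- int k..int k + 1}"
proof (cases "z = 0")
  case False
  have "- pi < Arg z" "Arg z \<le> pi" by (simp_all add: Arg_bounded)
  then have "- (2 * pi) \<le> Arg z" "Arg z \<le> 2 * pi" using pi_gt_zero by linarith+
  then have "- (2 * pi) * k \<le> Arg z * k" "Arg z * k \<le> 2 * pi * k"
    by (intro mult_right_mono; simp)+
  then have "- real k \<le> Arg z * k / (2 * pi)" "Arg z * k / (2 * pi) \<le> real k"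
    by (simp_all add: field_simps)
  then have "- int k \<le> \<lfloor>Arg z * k / (2 * pi)\<rfloor>" "\<lfloor>Arg z * k / (2 * pi)\<rfloor> \<le> int k"
    by (simp_all add: le_floor_iff floor_le_iff)
  then show ?thesis using False by (simp add: sector_index_def)
qed (simp add: sector_index_def)

lemma sector_index_eqD:
  assumes "k \<ge> 1" "sector_index k z = sector_index k w" "z \<noteq> 0" "w \<noteq> 0"
  shows "\<bar>Arg z - Arg w\<bar> < 2 * pi / k"
proof -
  have "\<lfloor>Arg z * k / (2 * pi)\<rfloor> = \<lfloor>Arg w * k / (2 * pi)\<rfloor>" using assms by (simp add: sector_index_def)
  then have "\<bar>Arg z * k / (2 * pi) - Arg w * k / (2 * pi)\<bar> < 1" by linarith
  also have "Arg z * k / (2 * pi) - Arg w * k / (2 * pi) = (Arg z - Arg w) * (k / (2 * pi))"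
    by (simp add: field_simps)
  finally have "\<bar>Arg z - Arg w\<bar> * (k / (2 * pi)) < 1" by (simp add: abs_mult)
  then show ?thesis using assms(1) by (simp add: field_simps)
qed

text \<open>
  The number of choices for a map of the \<open>d\<close> directions and a sector for each direction.
\<close>

definition colours :: "nat \<Rightarrow> nat \<Rightarrow> nat" where
  "colours k d = d ^ d * (2 * k + 2) ^ d"

context normalised_configurations
begin

text \<open>
  If \<open>v\<close> lies on an edge without pins, \<open>R v\<close> is a monomial matrix with entry \<open>\<mu> v i\<close> at \<open>(i, \<tau> v i)\<close>.
  The default value keeps \<open>\<tau> v\<close> a map into the directions for all other vertices.
\<close>

definition \<tau> :: "vertex \<Rightarrow> nat \<Rightarrow> nat" where
  "\<tau> v i = (if \<exists>j<d. R v i j \<noteq> 0 then SOME j. j < d \<and> R v i j \<noteq> 0 else 0)"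

definition \<mu> :: "vertex \<Rightarrow> nat \<Rightarrow> 'a" where
  "\<mu> v i = R v i (\<tau> v i)"

lemma \<tau>_less: "\<tau> v i < d"
proof (cases "\<exists>j<d. R v i j \<noteq> 0")
  case True
  then have "(SOME j. j < d \<and> R v i j \<noteq> 0) < d \<and> R v i (SOME j. j < d \<and> R v i j \<noteq> 0) \<noteq> 0"
    by (rule someI_ex)
  then show ?thesis using True by (simp add: \<tau>_def)
next
  case False
  then have "\<tau> v i = 0" unfolding \<tau>_def by (rule if_not_P)
  then show ?thesis using d1 by simp
qed

lemma edge_\<tau>_\<mu>:
  assumes e: "e \<in> G" "e \<inter> pins = {}"
  shows "v \<in> e \<Longrightarrow> w \<in> e \<Longrightarrow> i < d \<Longrightarrow> \<tau> v i = \<tau> w i"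
    and "v \<in> e \<Longrightarrow> bij_betw (\<tau> v) {..<d} {..<d}"
    and "i < d \<Longrightarrow> (\<Prod>v\<in>e. \<mu> v i) = 1"
    and "v \<in> e \<Longrightarrow> i < d \<Longrightarrow> \<mu> v i \<noteq> 0"
    and "v \<in> e \<Longrightarrow> i < d \<Longrightarrow> q v i = \<mu> v i * p v (\<tau> v i)"
proof -
  from edge_structure[OF e] obtain \<sigma> where \<sigma>: "bij_betw \<sigma> {..<d} {..<d}"
    "\<forall>v\<in>e. \<forall>i<d. \<forall>j<d. R v i j \<noteq> 0 \<longleftrightarrow> j = \<sigma> i" "\<forall>i<d. (\<Prod>v\<in>e. R v i (\<sigma> i)) = 1" by blast
  have \<sigma>_less: "\<sigma> i < d" if "i < d" for i using \<sigma>(1) that by (auto simp: bij_betw_def)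
  have R: "R v i j \<noteq> 0 \<longleftrightarrow> j = \<sigma> i" if "v \<in> e" "i < d" "j < d" for v i j using \<sigma>(2) that by blast
  have \<tau>: "\<tau> v i = \<sigma> i" if "v \<in> e" "i < d" for v i
  proof -
    have ex: "\<exists>j<d. R v i j \<noteq> 0" using R[OF that \<sigma>_less[OF that(2)]] \<sigma>_less[OF that(2)] by blast
    have "(SOME j. j < d \<and> R v i j \<noteq> 0) = \<sigma> i"
      using R[OF that] \<sigma>_less[OF that(2)] by (intro some_equality) auto
    then show ?thesis using ex by (simp add: \<tau>_def)
  qed
  show "v \<in> e \<Longrightarrow> w \<in> e \<Longrightarrow> i < d \<Longrightarrow> \<tau> v i = \<tau> w i" using \<tau> by simp
  show "v \<in> e \<Longrightarrow> bij_betw (\<tau> v) {..<d} {..<d}"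
    using \<sigma>(1) \<tau> bij_betw_cong[of "{..<d}" "\<tau> v" \<sigma>] by auto
  show "i < d \<Longrightarrow> (\<Prod>v\<in>e. \<mu> v i) = 1" using \<sigma>(3) \<tau> by (simp add: \<mu>_def)
  show "\<mu> v i \<noteq> 0" if "v \<in> e" "i < d" unfolding \<mu>_def using R[OF that \<tau>_less[of v i]] \<tau>[OF that] by blast
  show "q v i = \<mu> v i * p v (\<tau> v i)" if "v \<in> e" "i < d"
  proof -
    have v: "v \<in> vertices k n" "v \<notin> pins" using that e edge(2)[OF e(1)] by auto
    have "q v i = (\<Sum>j<d. R v i j * p v j)" by (rule q_eq_R_p[OF v that(2)])
    also have "\<dots> = (\<Sum>j<d. if j = \<tau> v i then \<mu> v i * p v (\<tau> v i) else 0)"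
      using R[OF that] \<tau>[OF that] by (intro sum.cong) (auto simp: \<mu>_def)
    also have "\<dots> = \<mu> v i * p v (\<tau> v i)" using \<tau>_less by simp
    finally show ?thesis .
  qed
qed

lemma card_pins: "finite pins" "card pins \<le> k * d"
proof -
  show "finite pins" unfolding pins_def by (intro finite_imageI finite_cartesian_product) auto
  have "card pins \<le> card ({..<k - 1} \<times> {..<d})"
    unfolding pins_def by (intro card_image_le finite_cartesian_product) auto
  also have "\<dots> = (k - 1) * d" by (simp add: card_cartesian_product)
  also have "\<dots> \<le> k * d" by (intro mult_right_mono) auto
  finally show "card pins \<le> k * d" .
qed

text \<open>
  By the pigeonhole principle each class has many vertices with the same permutation and with
  scaling factors in the same sector. On them the scaling factors are essentially constant, and an
  edge from any further vertex into these sets determines its factors as well.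
\<close>

lemma almost_congruent:
  fixes \<iota> :: "'a \<Rightarrow> complex"
  assumes \<iota>: "\<iota> 0 = 0" "\<iota> 1 = 1" "inj \<iota>" "\<And>a b. \<iota> (a * b) = \<iota> a * \<iota> b"
    and box: "meets_boxes k n s G" and s: "1 \<le> s"
    and n: "colours k d * ((4 * d + 1) * s) + k * d \<le> n"
  shows "\<exists>\<sigma> \<gamma>. bij_betw \<sigma> {..<d} {..<d} \<and> (\<forall>i<d. (\<Prod>c<k. \<gamma> c i) = 1) \<and>
    card {v \<in> vertices k n. \<exists>i<d. q v i \<noteq> \<gamma> (fst v) i * p v (\<sigma> i)} \<le> k * s + k * d"
proof -
  define W where "W c = vertex_class n c - pins" for c
  define col where "col v = (restrict (\<tau> v) {..<d}, \<lambda>i\<in>{..<d}. sector_index k (\<iota> (\<mu> v i)))" for v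
  define C where "C = ({..<d} \<rightarrow>\<^sub>E {..<d}) \<times> ({..<d} \<rightarrow>\<^sub>E {- int k..int k + 1})"
  have C: "finite C" "card C = colours k d"
  proof -
    show "finite C" unfolding C_def by (intro finite_cartesian_product finite_PiE) auto
    have "card {- int k..int k + 1} = 2 * k + 2" by simp
    then show "card C = colours k d"
      unfolding C_def colours_def card_cartesian_product
      by (simp only: card_PiE[OF finite_lessThan] prod_constant card_lessThan)
  qed
  have colC: "col v \<in> C" for v
    unfolding col_def C_def using \<tau>_less sector_index_range by auto
  have finW: "finite (W c)" for c by (simp add: W_def vertex_class_def)
  have cW: "n - k * d \<le> card (W c)" for c
  proof -
    have "card (vertex_class n c) - card pins \<le> card (vertex_class n c - pins)"
      by (rule diff_card_le_card_Diff[OF card_pins(1)])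
    then show ?thesis using card_pins(2) by (simp add: W_def vertex_class_def)
  qed
  have "\<exists>x\<in>C. card (W c) \<le> card C * card {w \<in> W c. col w = x}" for c
  proof (rule pigeonhole_class[OF finW C(1)])
    show "col ` W c \<subseteq> C" using colC by (rule image_subsetI)
    show "C \<noteq> {}" using colC by (rule ex_in_conv[THEN iffD1, OF exI])
  qed
  then have "\<forall>c. \<exists>x. card (W c) \<le> card C * card {w \<in> W c. col w = x}" by blast
  from choice[OF this] obtain x where
    x: "\<forall>c. card (W c) \<le> card C * card {w \<in> W c. col w = x c}" by blast
  define U where "U c = {w \<in> W c. col w = x c}" for c
  have Upos: "(4 * d + 1) * s \<le> card (U c)" for c
  proof -
    have "card C * ((4 * d + 1) * s) \<le> card C * card (U c)"
      using spec[OF x, of c] cW[of c] n unfolding C(2) U_def by linarith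
    moreover have "card C > 0" using C(1) colC by (auto simp: card_gt_0_iff)
    ultimately show ?thesis using mult_le_cancel1 by blast
  qed
  have Usub: "U c \<subseteq> vertex_class n c" for c by (auto simp: U_def W_def)
  have Us: "s \<le> card (U c)" and U2s: "2 * s \<le> card (U c)" for c
  proof -
    have "(4 * d + 1) * s = 4 * (d * s) + s" "d * s \<ge> s" using d1 by (simp_all add: algebra_simps)
    then show "s \<le> card (U c)" "2 * s \<le> card (U c)" using Upos[of c] s by linarith+
  qed
  have nopin: "e \<inter> pins = {}" if "\<forall>v\<in>e. v \<in> A (fst v)" "\<And>c. A c \<subseteq> W c" for e A
    using that by (auto simp: W_def)
  have UW: "U c \<subseteq> W c" for c by (auto simp: U_def)
  obtain e0 where e0: "e0 \<in> G" "\<forall>v\<in>e0. v \<in> U (fst v)" using meets_boxesD[OF box Usub Us] by blast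
  note e0p = nopin[of e0 U, OF e0(2) UW]
  have e0c: "e0 \<in> complete_edges k n" using e0(1) G by blast
  have ex0: "\<exists>v. v \<in> e0 \<and> v \<in> U c" if "c < k" for c
  proof -
    have "c \<in> fst ` e0" using edge_facts(3)[OF e0c] that by (auto simp: bij_betw_def)
    then show ?thesis using e0(2) by auto
  qed
  have colD: "\<tau> v i = \<tau> w i" "sector_index k (\<iota> (\<mu> v i)) = sector_index k (\<iota> (\<mu> w i))"
    if "v \<in> U c" "w \<in> U c" "i < d" for v w c i
  proof -
    have eq: "col v = col w" using that by (simp add: U_def)
    have "restrict (\<tau> v) {..<d} i = restrict (\<tau> w) {..<d} i"
      "(\<lambda>i\<in>{..<d}. sector_index k (\<iota> (\<mu> v i))) i = (\<lambda>i\<in>{..<d}. sector_index k (\<iota> (\<mu> w i))) i"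
      using eq unfolding col_def by simp_all
    then show "\<tau> v i = \<tau> w i" "sector_index k (\<iota> (\<mu> v i)) = sector_index k (\<iota> (\<mu> w i))"
      using that(3) by simp_all
  qed
  obtain v0 where v0: "v0 \<in> e0" using ex0[of 0] k3 by auto
  define \<sigma> where "\<sigma> = \<tau> v0"
  have \<sigma>: "bij_betw \<sigma> {..<d} {..<d}" unfolding \<sigma>_def by (rule edge_\<tau>_\<mu>(2)[OF e0(1) e0p v0])
  have U\<tau>: "\<tau> v i = \<sigma> i" if v: "v \<in> U c" "c < k" "i < d" for v c i
  proof -
    from ex0[OF v(2)] obtain w where w: "w \<in> e0" "w \<in> U c" by blast
    have "\<tau> v i = \<tau> w i" by (rule colD(1)[OF v(1) w(2) v(3)])
    also have "\<dots> = \<sigma> i" unfolding \<sigma>_def by (rule edge_\<tau>_\<mu>(1)[OF e0(1) e0p w(1) v0 v(3)])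
    finally show ?thesis .
  qed
  have \<iota>0: "\<iota> a = 0 \<longleftrightarrow> a = 0" for a using inj_eq[OF \<iota>(3), of a 0] \<iota>(1) by simp
  have \<iota>prod: "\<iota> (\<Prod>v\<in>A. f v) = (\<Prod>v\<in>A. \<iota> (f v))" for A :: "vertex set" and f
    by (induction A rule: infinite_finite_induct) (simp_all add: \<iota>)
  have U\<mu>: "\<mu> v i \<noteq> 0" if v: "v \<in> U c" "c < k" "i < d" for v c i
  proof
    assume "\<mu> v i = 0"
    from ex0[OF v(2)] obtain w where w: "w \<in> e0" "w \<in> U c" by blast
    have "sector_index k (\<iota> (\<mu> w i)) = sector_index k (\<iota> (\<mu> v i))" by (rule colD(2)[OF w(2) v(1,3)])
    also have "\<dots> = int k + 1" using \<open>\<mu> v i = 0\<close> by (simp add: sector_index_def \<iota>)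
    finally have si: "sector_index k (\<iota> (\<mu> w i)) = int k + 1" .
    have "\<iota> (\<mu> w i) \<noteq> 0" using edge_\<tau>_\<mu>(4)[OF e0(1) e0p w(1) v(3)] \<iota>0 by simp
    then have "\<lfloor>Arg (\<iota> (\<mu> w i)) * k / (2 * pi)\<rfloor> = int k + 1" using si by (simp add: sector_index_def)
    then have "real k + 1 \<le> Arg (\<iota> (\<mu> w i)) * k / (2 * pi)" by linarith
    then have "(real k + 1) * (2 * pi) \<le> Arg (\<iota> (\<mu> w i)) * k" by (simp add: field_simps)
    also have "\<dots> \<le> pi * k" by (intro mult_right_mono) (auto simp: Arg_bounded)
    also have "\<dots> < (real k + 1) * (2 * pi)"
      using pi_gt_zero by (simp add: algebra_simps add_nonneg_pos)
    finally show False by simp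
  qed
  have "\<exists>c. \<forall>j<k. card {v \<in> U j. \<iota> (\<mu> v i) \<noteq> c j} \<le> 4 * s" if i: "i < d" for i
  proof (rule constant_products_imp_constant[OF G box s _ Usub U2s])
    show "\<iota> (\<mu> v i) \<noteq> 0" if "c < k" "v \<in> U c" for c v using U\<mu>[OF that(2,1) i] \<iota>0 by simp
    then show "\<bar>Arg (\<iota> (\<mu> v i)) - Arg (\<iota> (\<mu> w i))\<bar> < 2 * pi / k"
      if "c < k" "v \<in> U c" "w \<in> U c" for c v w
      using that k3 colD(2)[OF that(2,3) i] by (intro sector_index_eqD) auto
    show "(\<Prod>v\<in>e. \<iota> (\<mu> v i)) = 1" if "e \<in> G" "\<And>v. v \<in> e \<Longrightarrow> v \<in> U (fst v)" for e
    proof -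
      have "\<forall>v\<in>e. v \<in> U (fst v)" using that(2) by blast
      from edge_\<tau>_\<mu>(3)[OF that(1) nopin[of e U, OF this UW] i] have "(\<Prod>v\<in>e. \<mu> v i) = 1" .
      then show ?thesis using \<iota>prod[of "\<lambda>v. \<mu> v i" e] \<iota>(2) by simp
    qed
  qed (use k3 in auto)
  then have "\<forall>i\<in>{..<d}. \<exists>c. \<forall>j<k. card {v \<in> U j. \<iota> (\<mu> v i) \<noteq> c j} \<le> 4 * s" by simp
  from bchoice[OF this] obtain c where
    "\<forall>i\<in>{..<d}. \<forall>j<k. card {v \<in> U j. \<iota> (\<mu> v i) \<noteq> c i j} \<le> 4 * s" by blast
  then have c: "card {v \<in> U j. \<iota> (\<mu> v i) \<noteq> c i j} \<le> 4 * s" if "i < d" "j < k" for i j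
    using that by simp
  define U' where "U' j = {v \<in> U j. \<forall>i<d. \<iota> (\<mu> v i) = c i j}" for j
  have finU: "finite (U j)" for j using finite_subset[OF UW finW] .
  have U': "s \<le> card (U' j)" if j: "j < k" for j
  proof -
    let ?B = "\<Union>i\<in>{..<d}. {v \<in> U j. \<iota> (\<mu> v i) \<noteq> c i j}"
    have "card ?B \<le> (\<Sum>i<d. card {v \<in> U j. \<iota> (\<mu> v i) \<noteq> c i j})" by (intro card_UN_le) simp
    also have "\<dots> \<le> (\<Sum>i<d. 4 * s)" using c[OF _ j] by (intro sum_mono) simp
    finally have B: "card ?B \<le> d * (4 * s)" by simp
    have "finite ?B" using finU by auto
    then have "card (U j) - card ?B \<le> card (U j - ?B)" by (rule diff_card_le_card_Diff)
    moreover have "U j - ?B = U' j" by (auto simp: U'_def)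
    then have "card (U j - ?B) = card (U' j)" by simp
    moreover have "(4 * d + 1) * s = d * (4 * s) + s" by (simp add: algebra_simps)
    ultimately show ?thesis using B Upos[of j] by linarith
  qed
  have U'U: "U' j \<subseteq> U j" for j by (auto simp: U'_def)
  have U'V: "U' j \<subseteq> vertex_class n j" for j using U'U Usub by blast
  have U'W: "U' j \<subseteq> W j" for j using U'U UW by blast
  have U'_ne: "U' j \<noteq> {}" if "j < k" for j using U'[OF that] s by auto
  define \<gamma> where "\<gamma> j i = \<mu> (SOME v. v \<in> U' j) i" for j i
  have \<gamma>: "\<mu> v i = \<gamma> j i" if "v \<in> U' j" "i < d" for v i j
  proof -
    have "(SOME v. v \<in> U' j) \<in> U' j" using that(1) by (rule someI)
    then have "\<iota> (\<mu> v i) = \<iota> (\<mu> (SOME v. v \<in> U' j) i)" using that by (simp add: U'_def)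
    then show ?thesis unfolding \<gamma>_def by (rule injD[OF \<iota>(3)])
  qed
  obtain e1 where e1: "e1 \<in> G" "\<forall>v\<in>e1. v \<in> U' (fst v)" using meets_boxesD[OF box U'V U'] by blast
  note e1p = nopin[of e1 U', OF e1(2) U'W]
  have \<gamma>1: "(\<Prod>c<k. \<gamma> c i) = 1" if i: "i < d" for i
  proof -
    have "(\<Prod>v\<in>e1. \<mu> v i) = (\<Prod>v\<in>e1. \<gamma> (fst v) i)" using \<gamma>[OF _ i] e1(2) by (intro prod.cong) auto
    also have "\<dots> = (\<Prod>c<k. \<gamma> c i)" using prod_edge_class[of e1 k n "\<lambda>c. \<gamma> c i"] e1(1) G by blast
    finally show ?thesis using edge_\<tau>_\<mu>(3)[OF e1(1) e1p i] by simp
  qed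
  define bad where "bad v \<longleftrightarrow> (\<exists>i<d. q v i \<noteq> \<gamma> (fst v) i * p v (\<sigma> i))" for v
  have few: "card {v \<in> W j. bad v} \<le> s" if j: "j < k" for j
  proof (rule ccontr)
    assume "\<not> ?thesis"
    then have ge: "s \<le> card {v \<in> W j. bad v}" by simp
    define A where "A c = (if c = j then {v \<in> W j. bad v} else U' c)" for c
    have AV: "A c \<subseteq> vertex_class n c" and AW: "A c \<subseteq> W c" for c
      using U'V U'W by (auto simp: A_def W_def)
    have As: "s \<le> card (A c)" if "c < k" for c using ge U'[OF that] by (simp add: A_def)
    obtain e where e: "e \<in> G" "\<forall>v\<in>e. v \<in> A (fst v)" using meets_boxesD[OF box AV As] by blast
    note ep = nopin[of e A, OF e(2) AW]
    have ec: "e \<in> complete_edges k n" using e(1) G by blast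
    have "j \<in> fst ` e" using edge_facts(3)[OF ec] j by (auto simp: bij_betw_def)
    then obtain u where u: "u \<in> e" "fst u = j" by blast
    have inj: "inj_on fst e" using edge_facts(3)[OF ec] by (simp add: bij_betw_def)
    have others: "w \<in> U' (fst w)" "fst w < k" if "w \<in> e - {u}" for w
    proof -
      have "fst w \<noteq> j" using that u inj by (auto dest: inj_onD)
      then show "w \<in> U' (fst w)" using e(2) that by (auto simp: A_def)
      show "fst w < k" using that edge_facts(1)[OF ec] by (auto simp: vertices_iff)
    qed
    have "bad u" using e(2) u by (auto simp: A_def)
    then obtain i where i: "i < d" "q u i \<noteq> \<gamma> (fst u) i * p u (\<sigma> i)" by (auto simp: bad_def)
    have "card {u} < card e" using edge_facts(4)[OF ec] k3 by simp
    then have "e - {u} \<noteq> {}" using card_mono[of "{u}" e] by force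
    then obtain w where w: "w \<in> e - {u}" by blast
    have "\<tau> u i = \<tau> w i" using edge_\<tau>_\<mu>(1)[OF e(1) ep u(1) _ i(1)] w by blast
    also have "\<dots> = \<sigma> i" using U\<tau>[of w "fst w" i] others[OF w] U'U i(1) by blast
    finally have tu: "\<tau> u i = \<sigma> i" .
    have fin: "finite e" by (rule edge_facts(2)[OF ec])
    have "1 = (\<Prod>v\<in>e. \<mu> v i)" using edge_\<tau>_\<mu>(3)[OF e(1) ep i(1)] by simp
    also have "\<dots> = \<mu> u i * (\<Prod>v\<in>e - {u}. \<gamma> (fst v) i)"
      unfolding prod.remove[OF fin u(1)]
      by (intro arg_cong2[where f = "(*)"] refl prod.cong \<gamma> others i(1))
    finally have m1: "\<mu> u i * (\<Prod>v\<in>e - {u}. \<gamma> (fst v) i) = 1" by simp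
    have m2: "\<gamma> (fst u) i * (\<Prod>v\<in>e - {u}. \<gamma> (fst v) i) = 1"
      using prod_edge_class[OF ec, of "\<lambda>c. \<gamma> c i"] \<gamma>1[OF i(1)] prod.remove[OF fin u(1), of "\<lambda>v. \<gamma> (fst v) i"]
      by simp
    have "(\<Prod>v\<in>e - {u}. \<gamma> (fst v) i) \<noteq> 0" using m1 by auto
    from mult_right_cancel[OF this, of "\<mu> u i" "\<gamma> (fst u) i"] have "\<mu> u i = \<gamma> (fst u) i"
      unfolding m1 m2 by simp
    then have "q u i = \<gamma> (fst u) i * p u (\<sigma> i)" using edge_\<tau>_\<mu>(5)[OF e(1) ep u(1) i(1)] tu by simp
    then show False using i(2) by simp
  qed
  have "{v \<in> vertices k n. bad v} \<subseteq> (\<Union>j\<in>{..<k}. {v \<in> W j. bad v}) \<union> pins"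
    by (auto simp: W_def vertices_def)
  then have "card {v \<in> vertices k n. bad v} \<le> card ((\<Union>j\<in>{..<k}. {v \<in> W j. bad v}) \<union> pins)"
    using finW card_pins(1) by (intro card_mono) auto
  also have "\<dots> \<le> card (\<Union>j\<in>{..<k}. {v \<in> W j. bad v}) + card pins" by (rule card_Un_le)
  also have "card (\<Union>j\<in>{..<k}. {v \<in> W j. bad v}) \<le> (\<Sum>j<k. card {v \<in> W j. bad v})"
    by (intro card_UN_le) simp
  also have "\<dots> \<le> (\<Sum>j<k. s)" using few by (intro sum_mono) simp
  finally have "card {v \<in> vertices k n. bad v} \<le> k * s + k * d" using card_pins(2) by simp
  then show ?thesis using \<sigma> \<gamma>1 unfolding bad_def by (intro exI[of _ \<sigma>] exI[of _ \<gamma>]) simp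
qed

text \<open>
  If the set of vertices where \<open>q\<close> is not the expected copy of \<open>p\<close> is nonempty, it has a vertex \<open>u\<close> with \<open>d\<close>
  edges whose other vertices are all as expected. The equations of these edges determine \<open>q u\<close>, because
  their links are independent.
\<close>

lemma congruent_everywhere:
  fixes \<iota> :: "'a \<Rightarrow> complex"
  assumes \<iota>: "\<iota> 0 = 0" "\<iota> 1 = 1" "inj \<iota>" "\<And>a b. \<iota> (a * b) = \<iota> a * \<iota> b"
    and box: "meets_boxes k n s G" and s: "1 \<le> s"
    and n: "colours k d * ((4 * d + 1) * s) + k * d \<le> n"
    and absorb: "absorbing k n d m G" and m: "k * s + k * d \<le> m" "m < n"
    and link: "link_independent k n d G p"
  shows "\<exists>\<sigma> \<gamma>. bij_betw \<sigma> {..<d} {..<d} \<and> (\<forall>i<d. (\<Prod>c<k. \<gamma> c i) = 1) \<and>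
    (\<forall>v\<in>vertices k n. \<forall>i<d. q v i = \<gamma> (fst v) i * p v (\<sigma> i))"
proof -
  obtain \<sigma> \<gamma> where \<sigma>: "bij_betw \<sigma> {..<d} {..<d}" and \<gamma>a: "\<forall>i<d. (\<Prod>c<k. \<gamma> c i) = 1"
    and few: "card {v \<in> vertices k n. \<exists>i<d. q v i \<noteq> \<gamma> (fst v) i * p v (\<sigma> i)} \<le> k * s + k * d"
    using almost_congruent[OF \<iota> box s n] by blast
  have \<gamma>: "(\<Prod>c<k. \<gamma> c i) = 1" if "i < d" for i using \<gamma>a that by blast
  define S where "S = {v \<in> vertices k n. \<exists>i<d. q v i \<noteq> \<gamma> (fst v) i * p v (\<sigma> i)}"
  have S: "finite S" "card S \<le> m" "S \<subseteq> vertices k n" using few m by (auto simp: S_def)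
  have "S = {}"
  proof (rule ccontr)
    assume ne: "S \<noteq> {}"
    have "card S < card (vertices k n)"
    proof -
      have "1 * n \<le> k * n" using k3 by (intro mult_right_mono) auto
      then show ?thesis using S(2) m(2) unfolding card_vertices by linarith
    qed
    then have "\<not> vertices k n \<subseteq> S" using card_mono[OF S(1), of "vertices k n"] by linarith
    then obtain v where v: "v \<in> vertices k n" "v \<notin> S" by blast
    have "S \<subseteq> vertices k n - {v}" using S(3) v by blast
    from absorb[unfolded absorbing_def, rule_format, OF v(1) this ne S(2)] obtain u where
      u: "u \<in> S" "d \<le> card {e \<in> G. e \<inter> insert v S = {u}}" by blast
    define E where "E = {e \<in> G. e \<inter> insert v S = {u}}"
    have uV: "u \<in> vertices k n" using u(1) S(3) by blast
    define \<rho> where "\<rho> = inv_into {..<d} \<sigma>"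
    \<comment> \<open>the deviation of \<open>u\<close> from its expected position, scaled and permuted back\<close>
    define c where "c j = (\<Prod>l\<in>{..<k} - {fst u}. \<gamma> l (\<rho> j)) * q u (\<rho> j) - p u j" for j
    have "(\<Sum>j<d. c j * (\<Prod>w\<in>e - {u}. p w j)) = 0" if e: "e \<in> E" for e
    proof -
      have eG: "e \<in> G" and ue: "u \<in> e" and rest: "\<And>w. w \<in> e - {u} \<Longrightarrow> w \<notin> S"
        using e by (auto simp: E_def)
      have ec: "e \<in> complete_edges k n" using eG G by blast
      note ef = edge_facts[OF ec]
      have split: "edge_value d x e = (\<Sum>i<d. x u i * (\<Prod>w\<in>e - {u}. x w i))" for x :: "vertex \<Rightarrow> nat \<Rightarrow> 'a"
        unfolding edge_value_def using ef(2) ue by (simp add: prod.remove)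
      have "bij_betw fst (e - {u}) ({..<k} - {fst u})"
        by (rule bij_betw_DiffI[OF ef(3)]) (use ue ef(1) in \<open>auto simp: bij_betw_def vertices_iff\<close>)
      then have \<gamma>e: "(\<Prod>w\<in>e - {u}. \<gamma> (fst w) i) = (\<Prod>l\<in>{..<k} - {fst u}. \<gamma> l i)" for i
        by (rule prod.reindex_bij_betw)
      have "(\<Prod>w\<in>e - {u}. q w i) = (\<Prod>l\<in>{..<k} - {fst u}. \<gamma> l i) * (\<Prod>w\<in>e - {u}. p w (\<sigma> i))"
        if i: "i < d" for i
      proof -
        have "q w i = \<gamma> (fst w) i * p w (\<sigma> i)" if "w \<in> e - {u}" for w
          using rest[OF that] that ef(1) i by (auto simp: S_def)
        then show ?thesis unfolding \<gamma>e[symmetric] by (simp flip: prod.distrib)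
      qed
      then have "edge_value d q e =
          (\<Sum>i<d. (\<lambda>j. ((\<Prod>l\<in>{..<k} - {fst u}. \<gamma> l (\<rho> j)) * q u (\<rho> j)) * (\<Prod>w\<in>e - {u}. p w j)) (\<sigma> i))"
        unfolding split using \<sigma>
        by (intro sum.cong) (auto simp: \<rho>_def bij_betw_def inv_into_f_f mult_ac)
      also have "\<dots> = (\<Sum>j<d. ((\<Prod>l\<in>{..<k} - {fst u}. \<gamma> l (\<rho> j)) * q u (\<rho> j)) * (\<Prod>w\<in>e - {u}. p w j))"
        by (rule sum.reindex_bij_betw[OF \<sigma>])
      finally show ?thesis using same[OF eG]
        by (simp add: split[of p] c_def left_diff_distrib sum_subtractf)
    qed
    note csum = this
    have E: "E \<subseteq> G" "d \<le> card E" "u \<in> e" if "e \<in> E" for e using u(2) that by (auto simp: E_def)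
    have "E \<subseteq> G" "d \<le> card E" using u(2) by (simp_all add: E_def)
    from link[unfolded link_independent_def, rule_format, OF uV this E(3) csum]
    have c0: "\<forall>j<d. c j = 0" by blast
    have "q u i = \<gamma> (fst u) i * p u (\<sigma> i)" if i: "i < d" for i
    proof -
      have "\<sigma> i < d" "\<rho> (\<sigma> i) = i" using \<sigma> i by (auto simp: \<rho>_def bij_betw_def inv_into_f_f)
      then have "(\<Prod>l\<in>{..<k} - {fst u}. \<gamma> l i) * q u i = p u (\<sigma> i)"
        using c0 by (auto simp: c_def)
      moreover have "\<gamma> (fst u) i * (\<Prod>l\<in>{..<k} - {fst u}. \<gamma> l i) = 1"
        using \<gamma>[OF i] uV prod.remove[of "{..<k}" "fst u" "\<lambda>l. \<gamma> l i"] by (auto simp: vertices_iff)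
      moreover have "\<gamma> (fst u) i * ((\<Prod>l\<in>{..<k} - {fst u}. \<gamma> l i) * q u i) =
          (\<gamma> (fst u) i * (\<Prod>l\<in>{..<k} - {fst u}. \<gamma> l i)) * q u i" by (simp only: mult.assoc)
      ultimately show ?thesis by (simp only: mult_1)
    qed
    then show False using u(1) by (auto simp: S_def)
  qed
  then have "\<forall>v\<in>vertices k n. \<forall>i<d. q v i = \<gamma> (fst v) i * p v (\<sigma> i)" by (auto simp: S_def)
  then show ?thesis using \<sigma> \<gamma>a by (intro exI[of _ \<sigma>] exI[of _ \<gamma>] conjI)
qed

end

section \<open>Global rigidity\<close>

lemma generic_nonzero:
  assumes "algebraically_independent (V \<times> {..<d}) (\<lambda>(v, j). p v j)" "v \<in> V" "j < d"
  shows "p v j \<noteq> 0"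
proof
  assume "p v j = 0"
  have "(\<lambda>x. x (v, j)) \<in> polyfun (V \<times> {..<d})" using assms by (intro polyfun_var) auto
  from polyfun_vanishes[OF assms(1) this, of "\<lambda>_. 1"] \<open>p v j = 0\<close> show False by simp
qed

text \<open>
  The links of distinct edges at \<open>u\<close> are distinct vertex sets, so their monomials are independent.
\<close>

lemma generic_link_independent:
  fixes p :: "vertex \<Rightarrow> nat \<Rightarrow> 'a::field_char_0"
  assumes ai: "algebraically_independent (vertices k n \<times> {..<d}) (\<lambda>(v, j). p v j)"
    and G: "G \<subseteq> complete_edges k n"
  shows "link_independent k n d G p"
  unfolding link_independent_def
proof (intro ballI allI impI)
  fix u E c j
  assume u: "u \<in> vertices k n" and E: "E \<subseteq> G" "d \<le> card E" "\<forall>e\<in>E. u \<in> e"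
    and c: "\<forall>e\<in>E. (\<Sum>j<d. c j * (\<Prod>w\<in>e - {u}. p w j)) = 0" and j: "j < d"
  from obtain_subset_with_card_n[OF E(2)] obtain E' where
    E': "E' \<subseteq> E" "card E' = d" "finite E'" by metis
  from ex_bij_betw_nat_finite[OF E'(3)] E'(2) obtain f where f: "bij_betw f {..<d} E'"
    by (auto simp: lessThan_atLeast0)
  have fE: "f a \<in> E" if "a < d" for a using f E'(1) that by (auto simp: bij_betw_def)
  define s where "s a = f a - {u}" for a
  have "\<forall>j<d. c j = 0"
  proof (rule generic_monomials_trivial_kernel[OF ai])
    show "inj_on s {..<d}"
    proof (rule inj_onI)
      fix a b assume ab: "a \<in> {..<d}" "b \<in> {..<d}" "s a = s b"
      have "f a = insert u (s a)" "f b = insert u (s b)" using fE ab E(3) by (auto simp: s_def)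
      then have "f a = f b" using ab by simp
      then show "a = b" using f ab by (auto simp: bij_betw_def dest: inj_onD)
    qed
    show "finite (s a)" "s a \<subseteq> vertices k n" if "a < d" for a
      using edge_facts(1,2)[of "f a" k n] fE[OF that] E(1) G by (auto simp: s_def)
    show "(\<Sum>j<d. (\<Prod>u\<in>s a. case (u, j) of (v, j) \<Rightarrow> p v j) * c j) = 0" if "a < d" for a
      using bspec[OF c fE[OF that]] by (simp add: s_def mult.commute)
  qed
  then show "c j = 0" using j by blast
qed

lemma generic_derivations:
  fixes p :: "vertex \<Rightarrow> nat \<Rightarrow> 'a::field_char_0"
  assumes ai: "algebraically_independent (V \<times> {..<d}) (\<lambda>(v, j). p v j)"
  shows "\<exists>\<delta>. \<forall>v j. derivation (\<delta> v j) \<and>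
    (\<forall>u\<in>V. \<forall>i<d. \<delta> v j (p u i) = (if u = v \<and> i = j then 1 else 0))"
proof -
  define P where "P v j D \<longleftrightarrow> derivation D \<and>
    (\<forall>u\<in>V. \<forall>i<d. D (p u i) = (if u = v \<and> i = j then 1 else 0))" for v j D
  have ex: "\<exists>D. P v j D" for v j
    using derivation_dual_to_coordinate[OF ai, of "(v, j)"] unfolding P_def by auto
  define \<delta> where "\<delta> v j = (SOME D. P v j D)" for v j
  have "P v j (\<delta> v j)" for v j unfolding \<delta>_def by (rule someI_ex[OF ex])
  then have "\<exists>\<delta>. \<forall>v j. P v j (\<delta> v j)" by (intro exI[of _ \<delta>]) simp
  then show ?thesis unfolding P_def .
qed

text \<open>
  The scalings \<open>h\<close> move the chosen coordinates of \<open>q\<close> to those of \<open>p\<close>; the last class compensates, so that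
  the edge values do not change.
\<close>

lemma congruent_of_same_values:
  fixes p q :: "vertex \<Rightarrow> nat \<Rightarrow> 'a::field_char_0" and \<iota> :: "'a \<Rightarrow> complex"
  assumes \<iota>: "\<iota> 0 = 0" "\<iota> 1 = 1" "inj \<iota>" "\<And>a b. \<iota> (a * b) = \<iota> a * \<iota> b"
    and k: "k \<ge> 3" and d: "d \<ge> 1" and G: "G \<subseteq> complete_edges k n"
    and ai: "algebraically_independent (vertices k n \<times> {..<d}) (\<lambda>(v, j). p v j)"
    and rigid: "vertex_redundantly_rigid k n d G p"
    and box: "meets_boxes k n s G" and s: "1 \<le> s"
    and n: "colours k d * ((4 * d + 1) * s) + k * d \<le> n"
    and absorb: "absorbing k n d m G" and m: "k * s + k * d \<le> m" "m < n"
    and same: "\<And>e. e \<in> G \<Longrightarrow> edge_value d q e = edge_value d p e"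
  shows "\<exists>\<sigma> \<gamma>. bij_betw \<sigma> {..<d} {..<d} \<and> (\<forall>i<d. (\<Prod>c<k. \<gamma> c i) = 1) \<and>
    (\<forall>v\<in>vertices k n. \<forall>i<d. q v i = \<gamma> (fst v) i * p v (\<sigma> i))"
proof -
  from generic_derivations[OF ai] obtain \<delta> where \<delta>: "\<forall>v j. derivation (\<delta> v j) \<and>
    (\<forall>u\<in>vertices k n. \<forall>i<d. \<delta> v j (p u i) = (if u = v \<and> i = j then 1 else 0))" by blast
  have \<delta>1: "derivation (\<delta> v j)" for v j using \<delta> by blast
  have \<delta>2: "\<delta> v j (p u i) = (if u = v \<and> i = j then 1 else 0)"
    if "u \<in> vertices k n" "i < d" for u i v j using \<delta> that by blast
  have nd: "n \<ge> d + 2"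
  proof -
    have "3 * d \<le> k * d" "3 * s \<le> k * s" using k by (intro mult_right_mono; simp)+
    then show ?thesis using d s m by linarith
  qed
  have p0: "p v j \<noteq> 0" if "v \<in> vertices k n" "j < d" for v j
    by (rule generic_nonzero[OF ai that])
  interpret E: equivalent_configurations k n d G p q \<delta>
    by unfold_locales (simp_all add: k d[simplified] nd[simplified] G p0 \<delta>1 \<delta>2 rigid same)
  define b where "b i j = (SOME u. u \<in> vertices k n \<and> fst u = i \<and> q u j \<noteq> 0)" for i j
  have b: "b i j \<in> vertices k n \<and> fst (b i j) = i \<and> q (b i j) j \<noteq> 0" if "i < k" "j < d" for i j
    using E.nonzero_coordinate[OF that] unfolding b_def Bex_def by (rule someI_ex)
  define g where "g i j = p (b i j) j / q (b i j) j" for i j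
  have g0: "g i j \<noteq> 0" if "i < k" "j < d" for i j
    using b[OF that] p0[of "b i j" j] that by (auto simp: g_def)
  define h where "h i j = (if i < k - 1 then g i j else 1 / (\<Prod>i<k - 1. g i j))" for i j
  have h0: "h i j \<noteq> 0" if "i < k" "j < d" for i j
    using g0 that by (auto simp: h_def)
  have h1: "(\<Prod>i<k. h i j) = 1" if j: "j < d" for j
  proof -
    have "(\<Prod>i<k. h i j) = (\<Prod>i<k - 1. h i j) * h (k - 1) j"
      using k prod.lessThan_Suc[of "\<lambda>i. h i j" "k - 1"] by simp
    also have "(\<Prod>i<k - 1. h i j) = (\<Prod>i<k - 1. g i j)" by (intro prod.cong) (auto simp: h_def)
    also have "(\<Prod>i<k - 1. g i j) * h (k - 1) j = 1" using g0 j by (simp add: h_def)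
    finally show ?thesis .
  qed
  define q' where "q' v j = h (fst v) j * q v j" for v j
  have same': "edge_value d q' e = edge_value d p e" if e: "e \<in> G" for e
  proof -
    have ec: "e \<in> complete_edges k n" using e G by blast
    have "edge_value d q' e = (\<Sum>j<d. (\<Prod>u\<in>e. h (fst u) j) * (\<Prod>u\<in>e. q u j))"
      by (simp add: edge_value_def q'_def prod.distrib)
    also have "\<dots> = edge_value d q e"
      unfolding edge_value_def
    proof (intro sum.cong refl)
      fix j assume "j \<in> {..<d}"
      then have "(\<Prod>u\<in>e. h (fst u) j) = 1" using prod_edge_class[OF ec, of "\<lambda>i. h i j"] h1 by simp
      then show "(\<Prod>u\<in>e. h (fst u) j) * (\<Prod>u\<in>e. q u j) = (\<Prod>u\<in>e. q u j)" by simp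
    qed
    finally show ?thesis using same[OF e] by simp
  qed
  have pin: "q' (b i j) j = p (b i j) j" if "i < k - 1" "j < d" for i j
    using b[of i j] that by (simp add: q'_def h_def g_def)
  interpret E': equivalent_configurations k n d G p q' \<delta>
    by unfold_locales (simp_all add: k d[simplified] nd[simplified] G p0 \<delta>1 \<delta>2 rigid same')
  interpret N: normalised_configurations k n d G p q' \<delta> b
    by unfold_locales (simp_all add: b pin)
  from N.congruent_everywhere[OF \<iota> box s n absorb m generic_link_independent[OF ai G]]
  obtain \<sigma> \<gamma> where \<sigma>\<gamma>: "bij_betw \<sigma> {..<d} {..<d}" "\<forall>i<d. (\<Prod>c<k. \<gamma> c i) = 1"
    "\<forall>v\<in>vertices k n. \<forall>i<d. q' v i = \<gamma> (fst v) i * p v (\<sigma> i)" by blast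
  have "q v i = (\<gamma> (fst v) i / h (fst v) i) * p v (\<sigma> i)" if v: "v \<in> vertices k n" "i < d" for v i
  proof -
    have "h (fst v) i \<noteq> 0" using v by (intro h0) (auto simp: vertices_iff)
    moreover have "h (fst v) i * q v i = \<gamma> (fst v) i * p v (\<sigma> i)"
      using \<sigma>\<gamma>(3)[rule_format, OF v] by (simp add: q'_def)
    ultimately show ?thesis by (simp add: field_simps)
  qed
  moreover have "(\<Prod>c<k. \<gamma> c i / h c i) = 1" if "i < d" for i
    using \<sigma>\<gamma>(2) h1[OF that] that by (simp add: prod_dividef)
  ultimately show ?thesis using \<sigma>\<gamma>(1)
    by (intro exI[of _ \<sigma>] exI[of _ "\<lambda>c i. \<gamma> c i / h c i"]) simp
qed

lemma foldr_diagonal: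
  fixes \<gamma> :: "nat \<Rightarrow> nat \<Rightarrow> 'a::field_char_0"
  shows "foldr (*) (map (\<lambda>c. Matrix.mat d d (\<lambda>(i, j). if i = j then \<gamma> c i else 0)) cs) (1\<^sub>m d) =
    Matrix.mat d d (\<lambda>(i, j). if i = j then prod_list (map (\<lambda>c. \<gamma> c i) cs) else 0)"
proof (induction cs)
  case Nil
  show ?case by (rule eq_matI) auto
next
  case (Cons a cs)
  have "(\<Sum>l = 0..<d. (if i = l then \<gamma> a i else 0) *
      (if l = j then prod_list (map (\<lambda>c. \<gamma> c l) cs) else 0)) =
      (if i = j then \<gamma> a i * prod_list (map (\<lambda>c. \<gamma> c i) cs) else 0)" if "i < d" "j < d" for i j
  proof -
    have "(\<Sum>l = 0..<d. (if i = l then \<gamma> a i else 0) *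
        (if l = j then prod_list (map (\<lambda>c. \<gamma> c l) cs) else 0)) =
        (\<Sum>l = 0..<d. if l = i then
           \<gamma> a i * (if i = j then prod_list (map (\<lambda>c. \<gamma> c i) cs) else 0) else 0)"
      by (intro sum.cong) auto
    then show ?thesis using that by simp
  qed
  then show ?case
    unfolding list.map foldr.simps comp_def Cons.IH
    by (intro eq_matI) (auto simp: scalar_prod_def)
qed

lemma congruent_configurationsI:
  fixes p q :: "'a::field_char_0 configuration"
  assumes p: "p \<in> configurations k n d" and q: "q \<in> configurations k n d"
    and \<sigma>: "bij_betw \<sigma> {..<d} {..<d}" and \<gamma>: "\<And>i. i < d \<Longrightarrow> (\<Prod>c<k. \<gamma> c i) = 1"
    and pq: "\<And>v i. v \<in> vertices k n \<Longrightarrow> i < d \<Longrightarrow> vec_index (q v) i = \<gamma> (fst v) i * vec_index (p v) (\<sigma> i)"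
  shows "congruent_configurations k n d p q"
proof -
  define \<rho> where "\<rho> j = (if j < d then inv_into {..<d} \<sigma> j else j)" for j
  have "bij_betw (inv_into {..<d} \<sigma>) {..<d} {..<d}" by (rule bij_betw_inv_into[OF \<sigma>])
  then have "bij_betw \<rho> {..<d} {..<d}"
    using bij_betw_cong[of "{..<d}" \<rho> "inv_into {..<d} \<sigma>"] by (simp add: \<rho>_def)
  then have \<rho>: "\<rho> permutes {..<d}" by (intro bij_imp_permutes) (auto simp: \<rho>_def)
  have \<rho>\<sigma>: "i = \<rho> j \<longleftrightarrow> j = \<sigma> i" if "i < d" "j < d" for i j
    using \<sigma> that by (auto simp: \<rho>_def bij_betw_def f_inv_into_f inv_into_f_f)
  have \<sigma>_less: "\<sigma> i < d" if "i < d" for i using \<sigma> that by (auto simp: bij_betw_def)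
  define S :: "'a Matrix.mat" where "S = Matrix.mat d d (\<lambda>(i, j). if i = \<rho> j then 1 else 0)"
  define D where "D c = Matrix.mat d d (\<lambda>(i, j). if i = j then \<gamma> c i else 0)" for c
  have \<gamma>0: "\<gamma> c i \<noteq> 0" if "c < k" "i < d" for c i
    using \<gamma>[OF that(2)] that(1) by (metis finite_lessThan lessThan_iff prod_zero_iff zero_neq_one)
  show ?thesis
    unfolding congruent_configurations_def
  proof (intro exI[of _ S] exI[of _ D] conjI allI impI ballI)
    show "permutation_matrix d S" using \<rho> by (auto simp: permutation_matrix_def S_def)
    fix c assume c: "c < k"
    show "D c \<in> carrier_mat d d" by (simp add: D_def)
    show "diagonal_mat (D c)" by (simp add: D_def diagonal_mat_def)
    have "det (D c) \<noteq> 0"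
    proof -
      have "upper_triangular (D c)" by (auto simp: D_def upper_triangular_def)
      then have "det (D c) = prod_list (diag_mat (D c))"
        by (rule det_upper_triangular[of _ d]) (simp add: D_def)
      also have "\<dots> = (\<Prod>i<d. \<gamma> c i)"
        by (simp add: diag_mat_def D_def prod.distinct_set_conv_list[symmetric] lessThan_atLeast0)
      finally show ?thesis using \<gamma>0[OF c] by simp
    qed
    moreover have Dc: "D c \<in> carrier_mat d d" by (simp add: D_def)
    ultimately obtain B where "B \<in> carrier_mat d d" "B * D c = 1\<^sub>m d" "D c * B = 1\<^sub>m d"
      using det_non_zero_imp_unit[of "D c" d] by (auto simp: Units_def ring_mat_def)
    then show "invertible_mat (D c)"
      using Dc unfolding invertible_mat_def inverts_mat_def by auto
    fix v assume v: "v \<in> vertex_class n c"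
    then have vV: "v \<in> vertices k n" "fst v = c" using c by (auto simp: vertex_class_iff vertices_iff)
    have dims: "dim_vec (p v) = d" "dim_vec (q v) = d" using p q vV by (auto simp: configurations_def)
    show "q v = D c *\<^sub>v (S *\<^sub>v p v)"
    proof (rule eq_vecI)
      fix i assume "i < dim_vec (D c *\<^sub>v (S *\<^sub>v p v))"
      then have i: "i < d" by (simp add: D_def)
      have Sp: "vec_index (S *\<^sub>v p v) l = vec_index (p v) (\<sigma> l)" if "l < d" for l
      proof -
        have "vec_index (S *\<^sub>v p v) l = (\<Sum>j = 0..<d. (if l = \<rho> j then 1 else 0) * vec_index (p v) j)"
          using that dims by (simp add: S_def scalar_prod_def)
        also have "\<dots> = (\<Sum>j = 0..<d. if j = \<sigma> l then vec_index (p v) j else 0)"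
          using \<rho>\<sigma>[OF that] by (intro sum.cong) auto
        finally show ?thesis using \<sigma>_less[OF that] by simp
      qed
      have "vec_index (D c *\<^sub>v (S *\<^sub>v p v)) i =
          (\<Sum>j = 0..<d. (if i = j then \<gamma> c i else 0) * vec_index (S *\<^sub>v p v) j)"
        unfolding D_def using i by (subst index_mult_mat_vec) (simp_all add: scalar_prod_def S_def)
      also have "\<dots> = (\<Sum>j = 0..<d. if j = i then \<gamma> c i * vec_index (S *\<^sub>v p v) i else 0)"
        by (intro sum.cong) auto
      also have "\<dots> = \<gamma> c i * vec_index (p v) (\<sigma> i)" using i Sp[OF i] by simp
      finally show "vec_index (q v) i = vec_index (D c *\<^sub>v (S *\<^sub>v p v)) i" using pq[OF vV(1) i] vV(2) by simp
    qed (simp add: D_def dims)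
  next
    have "prod_list (map (\<lambda>c. \<gamma> c i) [0..<k]) = 1" if "i < d" for i
      using \<gamma>[OF that] by (simp add: prod.distinct_set_conv_list[symmetric] lessThan_atLeast0)
    then show "foldr (*) (map D [0..<k]) (1\<^sub>m d) = 1\<^sub>m d"
      unfolding D_def foldr_diagonal by (intro eq_matI) auto
  qed
qed

text \<open>
  The embedding \<open>\<iota>\<close> into the complex numbers makes logarithms of the scaling factors available.
\<close>

theorem globally_rigidI:
  fixes \<iota> :: "'a::field_char_0 \<Rightarrow> complex"
  assumes \<iota>: "\<iota> 0 = 0" "\<iota> 1 = 1" "inj \<iota>" "\<And>a b. \<iota> (a * b) = \<iota> a * \<iota> b"
    and k: "k \<ge> 3" and d: "d \<ge> 1" and G: "G \<subseteq> complete_edges k n"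
    and rigid: "\<And>p :: vertex \<Rightarrow> nat \<Rightarrow> 'a.
      algebraically_independent (vertices k n \<times> {..<d}) (\<lambda>(v, j). p v j) \<Longrightarrow>
      vertex_redundantly_rigid k n d G p"
    and box: "meets_boxes k n s G" and s: "1 \<le> s"
    and n: "colours k d * ((4 * d + 1) * s) + k * d \<le> n"
    and absorb: "absorbing k n d m G" and m: "k * s + k * d \<le> m" "m < n"
  shows "globally_rigid TYPE('a) k n d G"
  unfolding globally_rigid_def globally_rigid_configuration_def
proof (intro allI impI ballI)
  fix p q :: "'a configuration"
  assume p: "p \<in> configurations k n d \<and> generic k n d p" and q: "q \<in> configurations k n d"
    and eq: "rigidity_map d G q = rigidity_map d G p"
  let ?p = "\<lambda>v. vec_index (p v)" and ?q = "\<lambda>v. vec_index (q v)"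
  have ai: "algebraically_independent (vertices k n \<times> {..<d}) (\<lambda>(v, j). ?p v j)"
    using p by (simp add: generic_def)
  have "edge_value d ?q e = edge_value d ?p e" if "e \<in> G" for e
  proof -
    have "rigidity_map d G q e = rigidity_map d G p e" using eq by simp
    then show ?thesis using that by (simp add: rigidity_map_def edge_value_def)
  qed
  note same = this
  have "\<exists>\<sigma> \<gamma>. bij_betw \<sigma> {..<d} {..<d} \<and> (\<forall>i<d. (\<Prod>c<k. \<gamma> c i) = 1) \<and>
      (\<forall>v\<in>vertices k n. \<forall>i<d. ?q v i = \<gamma> (fst v) i * ?p v (\<sigma> i))"
    by (rule congruent_of_same_values[OF \<iota> k d G ai rigid[OF ai] box s n absorb m]) (rule same)
  then obtain \<sigma> \<gamma> where "bij_betw \<sigma> {..<d} {..<d}" "\<forall>i<d. (\<Prod>c<k. \<gamma> c i) = 1"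
    "\<forall>v\<in>vertices k n. \<forall>i<d. ?q v i = \<gamma> (fst v) i * ?p v (\<sigma> i)" by (elim exE conjE)
  then show "congruent_configurations k n d p q"
    using p q by (intro congruent_configurationsI[of p k n d q \<sigma> \<gamma>]) simp_all
qed

section \<open>Closed edge sets of the generic rigidity matroid\<close>

definition generic_coordinates :: "nat \<Rightarrow> nat \<Rightarrow> nat \<Rightarrow> (vertex \<Rightarrow> nat \<Rightarrow> 'a::field_char_0) \<Rightarrow> bool" where
  "generic_coordinates k n d p \<longleftrightarrow>
     algebraically_independent (vertices k n \<times> {..<d}) (\<lambda>(v, j). p v j)"

text \<open>
  Quantifying over all generic points makes the closure of an edge set one definite set, to which a
  union bound over edge sets can refer. By \<open>closure_independent_of_point\<close> a single generic point decides.
\<close>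

definition rigidity_closure ::
    "'a::field_char_0 itself \<Rightarrow> nat \<Rightarrow> nat \<Rightarrow> nat \<Rightarrow> edge set \<Rightarrow> edge set" where
  "rigidity_closure F k n d B =
     {e \<in> complete_edges k n. \<forall>p :: vertex \<Rightarrow> nat \<Rightarrow> 'a. generic_coordinates k n d p \<longrightarrow>
        (\<forall>y. (\<forall>b\<in>B. jacobian_row d p y b = 0) \<longrightarrow> jacobian_row d p y e = 0)}"

definition row_coefficient :: "edge \<Rightarrow> vertex \<times> nat \<Rightarrow> (vertex \<times> nat \<Rightarrow> 'a::field) \<Rightarrow> 'a" where
  "row_coefficient e x p = (if fst x \<in> e then \<Prod>w\<in>e - {fst x}. p (w, snd x) else 0)"

lemma jacobian_row_coefficients:
  assumes "e \<in> complete_edges k n"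
  shows "jacobian_row d p y e =
    (\<Sum>x\<in>vertices k n \<times> {..<d}. row_coefficient e x (\<lambda>(v, j). p v j) * (\<lambda>(v, j). y v j) x)"
proof -
  have e: "e \<subseteq> vertices k n" by (rule edge_facts(1)[OF assms])
  have "(\<Sum>x\<in>vertices k n \<times> {..<d}. row_coefficient e x (\<lambda>(v, j). p v j) * (\<lambda>(v, j). y v j) x) =
      (\<Sum>u\<in>vertices k n. \<Sum>j<d. row_coefficient e (u, j) (\<lambda>(v, j). p v j) * y u j)"
    unfolding sum.cartesian_product by (intro sum.cong) auto
  also have "\<dots> = (\<Sum>u\<in>e. \<Sum>j<d. row_coefficient e (u, j) (\<lambda>(v, j). p v j) * y u j)"
    using e by (intro sum.mono_neutral_right) (auto simp: row_coefficient_def)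
  also have "\<dots> = (\<Sum>j<d. \<Sum>u\<in>e. y u j * (\<Prod>w\<in>e - {u}. p w j))"
    by (subst sum.swap) (auto simp: row_coefficient_def mult.commute intro!: sum.cong)
  finally show ?thesis by (simp add: jacobian_row_def)
qed

text \<open>
  The rows of the Jacobian are polynomial in the point, so \<open>generic_independence_transfer\<close> applies.
\<close>

lemma closure_independent_of_point:
  fixes p p' :: "vertex \<Rightarrow> nat \<Rightarrow> 'a::field_char_0"
  assumes p: "generic_coordinates k n d p" "generic_coordinates k n d p'"
    and e: "e \<in> complete_edges k n" "B \<subseteq> complete_edges k n"
    and cl: "\<And>y. (\<forall>b\<in>B. jacobian_row d p y b = 0) \<Longrightarrow> jacobian_row d p y e = 0"
    and y: "\<forall>b\<in>B. jacobian_row d p' y b = 0"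
  shows "jacobian_row d p' y e = 0"
proof (rule ccontr)
  assume ne: "jacobian_row d p' y e \<noteq> 0"
  let ?X = "vertices k n \<times> {..<d}"
  have BD: "b \<in> complete_edges k n" if "b \<in> B" for b using e(2) that by blast
  have "\<exists>c. (\<Sum>x\<in>?X. row_coefficient e x (\<lambda>(v, j). p v j) * c x) \<noteq> 0 \<and>
    (\<forall>b\<in>B. (\<Sum>x\<in>?X. row_coefficient b x (\<lambda>(v, j). p v j) * c x) = 0)"
  proof (rule generic_independence_transfer[where I = ?X and M = row_coefficient and X = ?X])
    show "algebraically_independent ?X (\<lambda>(v, j). p' v j)" "algebraically_independent ?X (\<lambda>(v, j). p v j)"
      using p by (simp_all add: generic_coordinates_def)
    show "finite ?X" by (intro finite_cartesian_product finite_vertices) simp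
    show "row_coefficient b x \<in> polyfun ?X" if "b \<in> insert e B" "x \<in> ?X" for b x
    proof -
      have b: "b \<subseteq> vertices k n" using that(1) e edge_facts(1) by blast
      have "(\<lambda>q. if fst x \<in> b then \<Prod>w\<in>b - {fst x}. q (w, snd x) else 0) \<in> polyfun ?X"
      proof (cases "fst x \<in> b")
        case True
        have "(\<lambda>q. \<Prod>w\<in>b - {fst x}. q (w, snd x)) \<in> polyfun ?X"
          using b that(2) by (intro polyfun_prod polyfun_var) auto
        then show ?thesis using True by simp
      qed (use polyfun_of_int[of 0 ?X] in simp)
      then show ?thesis by (simp add: row_coefficient_def[abs_def])
    qed
    show "(\<Sum>x\<in>?X. row_coefficient e x (\<lambda>(v, j). p' v j) * (\<lambda>(v, j). y v j) x) \<noteq> 0"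
      using ne unfolding jacobian_row_coefficients[OF e(1)] .
    show "(\<Sum>x\<in>?X. row_coefficient b x (\<lambda>(v, j). p' v j) * (\<lambda>(v, j). y v j) x) = 0" if "b \<in> B" for b
      using bspec[OF y that] unfolding jacobian_row_coefficients[OF BD[OF that]] .
  qed
  then obtain c where c: "(\<Sum>x\<in>?X. row_coefficient e x (\<lambda>(v, j). p v j) * c x) \<noteq> 0"
    "\<forall>b\<in>B. (\<Sum>x\<in>?X. row_coefficient b x (\<lambda>(v, j). p v j) * c x) = 0" by blast
  have row: "jacobian_row d p (\<lambda>v j. c (v, j)) b = (\<Sum>x\<in>?X. row_coefficient b x (\<lambda>(v, j). p v j) * c x)"
    if "b \<in> complete_edges k n" for b
    unfolding jacobian_row_coefficients[OF that] by (intro sum.cong) auto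
  have "\<forall>b\<in>B. jacobian_row d p (\<lambda>v j. c (v, j)) b = 0" using c(2) row[OF BD] by simp
  from cl[OF this] show False using c(1) row[OF e(1)] by simp
qed

text \<open>
  The rank of the rigidity matroid is at most the number \<open>d k n\<close> of coordinates, so every edge set
  lies in the closure of few of its edges.
\<close>

lemma small_spanning_subset:
  assumes G: "G \<subseteq> complete_edges k n" "finite G"
  shows "\<exists>B\<subseteq>G. card B \<le> d * k * n \<and> G \<subseteq> rigidity_closure TYPE('a::field_char_0) k n d B"
proof (cases "\<exists>p :: vertex \<Rightarrow> nat \<Rightarrow> 'a. generic_coordinates k n d p")
  case False
  then have "rigidity_closure TYPE('a) k n d {} = complete_edges k n" by (simp add: rigidity_closure_def)
  then show ?thesis using G by (intro exI[of _ "{}"]) simp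
next
  case True
  then obtain p :: "vertex \<Rightarrow> nat \<Rightarrow> 'a" where p: "generic_coordinates k n d p" by blast
  define spans where "spans B \<longleftrightarrow> B \<subseteq> G \<and>
    (\<forall>y. (\<forall>b\<in>B. jacobian_row d p y b = 0) \<longrightarrow> (\<forall>e\<in>G. jacobian_row d p y e = 0))" for B
  have "spans G" by (simp add: spans_def)
  define B where "B = arg_min card spans"
  have B: "spans B" and Bmin: "\<And>B'. spans B' \<Longrightarrow> card B \<le> card B'"
    unfolding B_def by (rule arg_min_natI[where P = spans and k = G, OF \<open>spans G\<close>], rule arg_min_nat_le)
  have BG: "B \<subseteq> G" using B by (simp add: spans_def)
  have finB: "finite B" using BG G(2) by (rule finite_subset)
  have ex: "\<exists>y. (\<forall>b'\<in>B - {b}. jacobian_row d p y b' = 0) \<and> jacobian_row d p y b \<noteq> 0" if b: "b \<in> B" for b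
  proof (rule ccontr)
    assume no: "\<not> ?thesis"
    have "spans (B - {b})"
      unfolding spans_def
    proof (intro conjI allI impI)
      show "B - {b} \<subseteq> G" using BG by blast
      fix y assume y: "\<forall>b'\<in>B - {b}. jacobian_row d p y b' = 0"
      then have "jacobian_row d p y b = 0" using no by blast
      then have "\<forall>b\<in>B. jacobian_row d p y b = 0" using y by blast
      then show "\<forall>e\<in>G. jacobian_row d p y e = 0" using B by (simp add: spans_def)
    qed
    from Bmin[OF this] show False using b finB by (metis card_Diff1_less not_le)
  qed
  let ?X = "vertices k n \<times> {..<d}"
  have finX: "finite ?X" by (intro finite_cartesian_product finite_vertices) simp
  have "card B \<le> card ?X"
  proof (rule ccontr)
    assume "\<not> ?thesis"
    then have "card ?X < card B" by simp
    from underdetermined_system[OF finB finX this,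
        of "\<lambda>x b. row_coefficient b x (\<lambda>(v, j). p v j)"] obtain c where
      c: "\<exists>b\<in>B. c b \<noteq> 0" "\<forall>x\<in>?X. (\<Sum>b\<in>B. row_coefficient b x (\<lambda>(v, j). p v j) * c b) = 0" by blast
    then obtain b where b: "b \<in> B" "c b \<noteq> 0" by blast
    from ex[OF b(1)] obtain y where y: "\<forall>b'\<in>B - {b}. jacobian_row d p y b' = 0"
      "jacobian_row d p y b \<noteq> 0" by blast
    have row: "jacobian_row d p y b' =
        (\<Sum>x\<in>?X. row_coefficient b' x (\<lambda>(v, j). p v j) * (\<lambda>(v, j). y v j) x)" if "b' \<in> B" for b'
      using BG G(1) that by (intro jacobian_row_coefficients) blast
    have "c b * jacobian_row d p y b = (\<Sum>b'\<in>B. c b' * jacobian_row d p y b')"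
      using y(1) by (subst sum.remove[OF finB b(1)]) simp
    also have "\<dots> = (\<Sum>b'\<in>B. \<Sum>x\<in>?X. (\<lambda>(v, j). y v j) x * (row_coefficient b' x (\<lambda>(v, j). p v j) * c b'))"
      by (intro sum.cong refl) (simp add: row sum_distrib_left mult_ac)
    also have "\<dots> = (\<Sum>x\<in>?X. \<Sum>b'\<in>B. (\<lambda>(v, j). y v j) x * (row_coefficient b' x (\<lambda>(v, j). p v j) * c b'))"
      by (rule sum.swap)
    also have "\<dots> = (\<Sum>x\<in>?X. (\<lambda>(v, j). y v j) x * (\<Sum>b'\<in>B. row_coefficient b' x (\<lambda>(v, j). p v j) * c b'))"
      by (simp only: sum_distrib_left)
    also have "\<dots> = 0" using c(2) by (intro sum.neutral) simp
    finally show False using b(2) y(2) by simp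
  qed
  also have "card ?X = d * k * n" by (simp add: card_cartesian_product card_vertices)
  finally have cB: "card B \<le> d * k * n" .
  have "e \<in> rigidity_closure TYPE('a) k n d B" if e: "e \<in> G" for e
    unfolding rigidity_closure_def
  proof (intro CollectI conjI allI impI)
    show ec: "e \<in> complete_edges k n" using e G(1) by blast
    fix p' :: "vertex \<Rightarrow> nat \<Rightarrow> 'a" and y
    assume p': "generic_coordinates k n d p'" and y: "\<forall>b\<in>B. jacobian_row d p' y b = 0"
    show "jacobian_row d p' y e = 0"
    proof (rule closure_independent_of_point[OF p p' ec _ _ y])
      show "B \<subseteq> complete_edges k n" using BG G(1) by blast
      show "jacobian_row d p y e = 0" if "\<forall>b\<in>B. jacobian_row d p y b = 0" for y
        using B that e by (simp add: spans_def)
    qed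
  qed
  then show ?thesis using BG cB by blast
qed

section \<open>Dense sets of edges are almost rigid\<close>

definition transversal :: "nat \<Rightarrow> (nat \<Rightarrow> nat) \<Rightarrow> edge" where
  "transversal k f = (\<lambda>i. (i, f i)) ` {..<k}"

text \<open>
  Classes are regarded as copies of the cyclic group of order \<open>n\<close>, and \<open>s\<close> as a translation.
\<close>

definition offset :: "nat \<Rightarrow> nat \<Rightarrow> (nat \<Rightarrow> nat) \<Rightarrow> (nat \<Rightarrow> nat) \<Rightarrow> nat \<Rightarrow> nat" where
  "offset k n s o' = (\<lambda>i\<in>{..<k}. (s i + o' i) mod n)"

lemma inj_transversal: "inj_on (transversal k) ({..<k} \<rightarrow>\<^sub>E A)"
proof (rule inj_onI)
  fix f g assume fg: "f \<in> {..<k} \<rightarrow>\<^sub>E A" "g \<in> {..<k} \<rightarrow>\<^sub>E A" "transversal k f = transversal k g"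
  show "f = g"
  proof (rule PiE_ext[OF fg(1,2)])
    fix i assume "i \<in> {..<k}"
    then have "(i, f i) \<in> transversal k g" using fg(3) by (auto simp: transversal_def)
    then show "f i = g i" by (auto simp: transversal_def)
  qed
qed

lemma complete_edges_eq: "complete_edges k n = transversal k ` ({..<k} \<rightarrow>\<^sub>E {..<n})"
proof (intro equalityI subsetI)
  fix e assume e: "e \<in> complete_edges k n"
  note ef = edge_facts[OF e]
  have ex: "\<exists>a. (i, a) \<in> e" if "i < k" for i
  proof -
    have "i \<in> fst ` e" using ef(3) that by (auto simp: bij_betw_def)
    then show ?thesis by auto
  qed
  have c: "(i, SOME a. (i, a) \<in> e) \<in> e" if "i < k" for i by (rule someI_ex[OF ex[OF that]])
  define f where "f = (\<lambda>i\<in>{..<k}. SOME a. (i, a) \<in> e)"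
  have sub: "transversal k f \<subseteq> e" using c by (auto simp: transversal_def f_def)
  have "card (transversal k f) = k"
    unfolding transversal_def by (subst card_image) (auto intro: inj_onI)
  then have "transversal k f = e" using ef(4) by (intro card_subset_eq[OF ef(2) sub]) simp
  moreover have "f \<in> {..<k} \<rightarrow>\<^sub>E {..<n}"
  proof (rule PiE_I)
    show "f i \<in> {..<n}" if "i \<in> {..<k}" for i
    proof -
      have "(i, f i) \<in> e" using c that by (simp add: f_def)
      then have "(i, f i) \<in> vertices k n" using ef(1) by blast
      then show ?thesis by (simp add: vertices_iff)
    qed
  qed (simp add: f_def)
  ultimately show "e \<in> transversal k ` ({..<k} \<rightarrow>\<^sub>E {..<n})" by blast
next
  fix e assume "e \<in> transversal k ` ({..<k} \<rightarrow>\<^sub>E {..<n})"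
  then obtain f where f: "f \<in> {..<k} \<rightarrow>\<^sub>E {..<n}" "e = transversal k f" by blast
  have less: "f i < n" if "i < k" for i using f(1) that by (auto simp: PiE_iff)
  have "e \<inter> vertex_class n i = {(i, f i)}" if "i < k" for i
    using less that by (auto simp: f(2) transversal_def vertex_class_iff)
  then show "e \<in> complete_edges k n"
    using less by (auto simp: complete_edges_def f(2) transversal_def vertices_iff)
qed

lemma card_complete_edges: "card (complete_edges k n) = n ^ k"
  unfolding complete_edges_eq by (simp add: card_image[OF inj_transversal] card_PiE)

lemma finite_complete_edges [simp]: "finite (complete_edges k n)"
  unfolding complete_edges_eq by (intro finite_imageI finite_PiE) auto

text \<open>
  For each \<open>x\<close> every edge arises from exactly one translation, so a random translation hits \<open>X\<close> with
  probability at most \<open>card X / n ^ k\<close>.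
\<close>

lemma averaged_offsets:
  assumes n: "n \<ge> 1" and X: "X \<subseteq> complete_edges k n" and I: "finite I"
  shows "\<exists>s\<in>{..<k} \<rightarrow>\<^sub>E {..<n}.
    n ^ k * card {x \<in> I. transversal k (offset k n s (off x)) \<in> X} \<le> card I * card X"
proof (rule ccontr)
  let ?S = "{..<k} \<rightarrow>\<^sub>E {..<n}"
  let ?P = "\<lambda>s x. transversal k (offset k n s (off x)) \<in> X"
  assume "\<not> ?thesis"
  then have gt: "card I * card X < n ^ k * card {x \<in> I. ?P s x}" if "s \<in> ?S" for s
    using that by force
  have S: "finite ?S" "card ?S = n ^ k" by (auto simp: finite_PiE card_PiE)
  have finX: "finite X" using finite_subset[OF X finite_complete_edges] .
  have ne: "?S \<noteq> {}" using n by (auto simp: PiE_eq_empty_iff lessThan_empty_iff)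
  have few: "card {s \<in> ?S. ?P s x} \<le> card X" for x
  proof (rule card_inj_on_le[OF _ _ finX])
    show "(\<lambda>s. transversal k (offset k n s (off x))) ` {s \<in> ?S. ?P s x} \<subseteq> X" by auto
    show "inj_on (\<lambda>s. transversal k (offset k n s (off x))) {s \<in> ?S. ?P s x}"
    proof (rule inj_onI)
      fix s s' assume s: "s \<in> {s \<in> ?S. ?P s x}" "s' \<in> {s \<in> ?S. ?P s x}"
        and eq: "transversal k (offset k n s (off x)) = transversal k (offset k n s' (off x))"
      have "offset k n t (off x) \<in> ?S" for t using n by (auto simp: offset_def)
      from inj_onD[OF inj_transversal eq this this]
      have oeq: "offset k n s (off x) = offset k n s' (off x)" .
      have sS: "s \<in> ?S" "s' \<in> ?S" using s by blast+
      show "s = s'"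
      proof (rule PiE_ext[OF sS])
        fix i assume i: "i \<in> {..<k}"
        have "(s i + off x i) mod n = (s' i + off x i) mod n"
          using fun_cong[OF oeq, of i] i by (simp add: offset_def)
        then have "s i mod n = s' i mod n"
          using cong_add_rcancel_nat[of "s i" "off x i" "s' i" n] by (simp add: cong_def)
        moreover have "s i < n" "s' i < n" using sS i by (auto simp: PiE_iff)
        ultimately show "s i = s' i" by simp
      qed
    qed
  qed
  have "n ^ k * (card I * card X) = (\<Sum>s\<in>?S. card I * card X)" using S by simp
  also have "\<dots> < (\<Sum>s\<in>?S. n ^ k * card {x \<in> I. ?P s x})"
    using S ne gt by (intro sum_strict_mono) auto
  also have "\<dots> = n ^ k * (\<Sum>s\<in>?S. \<Sum>x\<in>I. if ?P s x then 1 else 0)"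
    using I by (simp add: sum_distrib_left sum.If_cases Int_def)
  also have "(\<Sum>s\<in>?S. \<Sum>x\<in>I. if ?P s x then 1 else 0) = (\<Sum>x\<in>I. \<Sum>s\<in>?S. if ?P s x then 1 else (0::nat))"
    by (rule sum.swap)
  also have "\<dots> = (\<Sum>x\<in>I. card {s \<in> ?S. ?P s x})"
    using S by (simp add: sum.If_cases Int_def)
  also have "\<dots> \<le> (\<Sum>x\<in>I. card X)" using few by (intro sum_mono)
  finally show False by simp
qed

lemma jacobian_row_transversal:
  "jacobian_row d p y (transversal k f) =
    (\<Sum>j<d. \<Sum>i<k. y (i, f i) j * (\<Prod>i'\<in>{..<k} - {i}. p (i', f i') j))"
proof -
  have inj: "inj_on (\<lambda>i. (i, f i)) A" for A by (auto intro: inj_onI)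
  have "(\<Sum>u\<in>transversal k f. y u j * (\<Prod>w\<in>transversal k f - {u}. p w j)) =
      (\<Sum>i<k. y (i, f i) j * (\<Prod>i'\<in>{..<k} - {i}. p (i', f i') j))" for j
  proof -
    have "(\<Sum>u\<in>transversal k f. y u j * (\<Prod>w\<in>transversal k f - {u}. p w j)) =
        (\<Sum>i<k. y (i, f i) j * (\<Prod>w\<in>transversal k f - {(i, f i)}. p w j))"
      unfolding transversal_def by (simp add: sum.reindex[OF inj])
    also have "\<dots> = (\<Sum>i<k. y (i, f i) j * (\<Prod>i'\<in>{..<k} - {i}. p (i', f i') j))"
    proof (intro sum.cong refl)
      fix i assume "i \<in> {..<k}"
      have "transversal k f - {(i, f i)} = (\<lambda>i. (i, f i)) ` ({..<k} - {i})"
        by (auto simp: transversal_def)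
      then show "y (i, f i) j * (\<Prod>w\<in>transversal k f - {(i, f i)}. p w j) =
          y (i, f i) j * (\<Prod>i'\<in>{..<k} - {i}. p (i', f i') j)"
        by (simp add: prod.reindex[OF inj])
    qed
    finally show ?thesis .
  qed
  then show ?thesis by (simp add: jacobian_row_def)
qed

text \<open>
  The derivative of a tensor of rank \<open>d\<close> is tested against functionals dual to its factors on a
  block of \<open>d\<close> vertices in each class. A term in which the tensor factor of one class is differentiated
  still has dual pairs in \<open>k - 2 \<ge> 1\<close> further classes of the block, which isolate one direction.
\<close>

lemma rigidity_from_block:
  fixes p y :: "vertex \<Rightarrow> nat \<Rightarrow> 'a::field_char_0" and b :: "nat \<Rightarrow> nat \<Rightarrow> nat"
  assumes k: "k \<ge> 3" and p: "generic_coordinates k n d p"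
    and b: "\<And>i t. i < k \<Longrightarrow> t < d \<Longrightarrow> b i t < n" "\<And>i. i < k \<Longrightarrow> inj_on (b i) {..<d}"
    and H: "\<And>e. e \<in> H \<Longrightarrow> jacobian_row d p y e = 0"
    and block: "\<And>f. f \<in> {..<k} \<rightarrow>\<^sub>E {..<d} \<Longrightarrow> transversal k (\<lambda>i. b i (f i)) \<in> H"
  shows "\<exists>a. (\<forall>j<d. (\<Sum>i<k. a i j) = 0) \<and>
    (\<forall>u\<in>vertices k n. (\<forall>f\<in>({..<k} - {fst u}) \<rightarrow>\<^sub>E {..<d}.
        transversal k (\<lambda>i. if i = fst u then snd u else b i (f i)) \<in> H) \<longrightarrow>
      (\<forall>j<d. y u j = a (fst u) j * p u j))"
proof -
  have "\<exists>N. \<forall>l<d. \<forall>j<d. (\<Sum>t<d. N l t * p (i, b i t) j) = (if l = j then 1 else 0)" if i: "i < k" for i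
  proof (rule left_inverse_of_trivial_kernel)
    fix c assume c: "\<And>t. t < d \<Longrightarrow> (\<Sum>j<d. p (i, b i t) j * c j) = 0"
    show "\<forall>j<d. c j = 0"
    proof (rule generic_monomials_trivial_kernel[OF p[unfolded generic_coordinates_def]])
      show "inj_on (\<lambda>t. {(i, b i t)}) {..<d}" using b(2)[OF i] by (auto simp: inj_on_def)
      show "{(i, b i t)} \<subseteq> vertices k n" if "t < d" for t using b(1)[OF i that] i by (simp add: vertices_iff)
      show "(\<Sum>j<d. (\<Prod>u\<in>{(i, b i t)}. case (u, j) of (v, j) \<Rightarrow> p v j) * c j) = 0" if "t < d" for t
        using c[OF that] by simp
    qed simp
  qed
  then have "\<forall>i\<in>{..<k}. \<exists>N. \<forall>l<d. \<forall>j<d. (\<Sum>t<d. N l t * p (i, b i t) j) = (if l = j then 1 else 0)"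
    by simp
  from bchoice[OF this] obtain \<phi> where
    "\<forall>i\<in>{..<k}. \<forall>l<d. \<forall>j<d. (\<Sum>t<d. \<phi> i l t * p (i, b i t) j) = (if l = j then 1 else 0)" by blast
  then have dual: "(\<Sum>t<d. \<phi> i l t * p (i, b i t) j) = (if l = j then 1 else 0)"
    if "i < k" "l < d" "j < d" for i l j using that by simp
  define \<beta> where "\<beta> i l = (\<Sum>t<d. \<phi> i l t * y (i, b i t) l)" for i l
  \<comment> \<open>the only possible scaling rates: contracting the row of \<open>u\<close> gives \<open>y u l + (\<Sum>i'. \<beta> i' l) * p u l = 0\<close>\<close>
  define a where "a i l = - (\<Sum>i'\<in>{..<k} - {i}. \<beta> i' l)" for i l
  have y: "y u l = a (fst u) l * p u l"
    if u: "u \<in> vertices k n" and good: "\<And>f. f \<in> ({..<k} - {fst u}) \<rightarrow>\<^sub>E {..<d} \<Longrightarrow>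
        transversal k (\<lambda>i. if i = fst u then snd u else b i (f i)) \<in> H" and l: "l < d" for u l
  proof -
    define i where "i = fst u"
    define J where "J = {..<k} - {i}"
    have i: "i < k" using u by (simp add: i_def vertices_iff)
    have J: "finite J" "\<And>i'. i' \<in> J \<Longrightarrow> i' < k" by (auto simp: J_def)
    have J2: "J - {i'} \<noteq> {}" if "i' \<in> J" for i'
    proof
      assume "J - {i'} = {}"
      then have "J \<subseteq> {i'}" by blast
      then have "card J \<le> 1" using card_mono[of "{i'}" J] by simp
      moreover have "card J = k - 1" using i by (simp add: J_def)
      ultimately show False using k by simp
    qed
    define F where "F = J \<rightarrow>\<^sub>E {..<d}"
    define w where "w f = (\<Prod>i'\<in>J. \<phi> i' l (f i'))" for f
    define vt where "vt f i' = (if i' = i then u else (i', b i' (f i')))" for f i'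
    have swap: "(\<Sum>f\<in>F. \<Prod>i'\<in>J. g i' (f i')) = (\<Prod>i'\<in>J. \<Sum>t<d. g i' t)" for g :: "nat \<Rightarrow> nat \<Rightarrow> 'a"
      unfolding F_def by (rule prod_sum_PiE[symmetric]) (use J in auto)
    have own: "(\<Sum>f\<in>F. w f * (y u j * (\<Prod>i'\<in>J. p (vt f i') j))) = (if j = l then y u l else 0)"
      if j: "j < d" for j
    proof -
      have "(\<Sum>f\<in>F. w f * (y u j * (\<Prod>i'\<in>J. p (vt f i') j))) =
          y u j * (\<Sum>f\<in>F. \<Prod>i'\<in>J. \<phi> i' l (f i') * p (i', b i' (f i')) j)"
        unfolding sum_distrib_left
      proof (intro sum.cong refl)
        fix f
        have "(\<Prod>i'\<in>J. p (vt f i') j) = (\<Prod>i'\<in>J. p (i', b i' (f i')) j)"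
          by (intro prod.cong) (auto simp: vt_def J_def)
        then show "w f * (y u j * (\<Prod>i'\<in>J. p (vt f i') j)) =
            y u j * (\<Prod>i'\<in>J. \<phi> i' l (f i') * p (i', b i' (f i')) j)"
          by (simp add: w_def prod.distrib mult_ac)
      qed
      also have "\<dots> = y u j * (\<Prod>i'\<in>J. if l = j then 1 else 0)"
      proof -
        have "(\<Sum>f\<in>F. \<Prod>i'\<in>J. \<phi> i' l (f i') * p (i', b i' (f i')) j) =
            (\<Prod>i'\<in>J. \<Sum>t<d. \<phi> i' l t * p (i', b i' t) j)" by (rule swap)
        also have "\<dots> = (\<Prod>i'\<in>J. if l = j then 1 else 0)" by (intro prod.cong refl dual J(2) l j)
        finally show ?thesis by simp
      qed
      also have "\<dots> = (if j = l then y u l else 0)"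
      proof (cases "j = l")
        case False
        obtain i' where "i' \<in> J" using k i by (cases "i = 0") (auto simp: J_def intro: that[of 0] that[of 1])
        then show ?thesis using False J(1) by auto
      qed simp
      finally show ?thesis .
    qed
    have other: "(\<Sum>f\<in>F. w f * (y (vt f i') j * (\<Prod>i''\<in>{..<k} - {i'}. p (vt f i'') j))) =
        (if j = l then \<beta> i' l * p u l else 0)" if i': "i' \<in> J" and j: "j < d" for i' j
    proof -
      define g where "g i'' t = \<phi> i'' l t * (if i'' = i' then y (i'', b i'' t) j else p (i'', b i'' t) j)" for i'' t
      have "(\<Sum>f\<in>F. w f * (y (vt f i') j * (\<Prod>i''\<in>{..<k} - {i'}. p (vt f i'') j))) =
          p u j * (\<Sum>f\<in>F. \<Prod>i''\<in>J. g i'' (f i''))"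
        unfolding sum_distrib_left
      proof (intro sum.cong refl)
        fix f
        have e1: "{..<k} - {i'} = insert i (J - {i'})" using i i' by (auto simp: J_def)
        have iJ: "i \<notin> J - {i'}" by (simp add: J_def)
        have vi: "vt f i = u" by (simp add: vt_def)
        have vi': "vt f i' = (i', b i' (f i'))" using i' by (auto simp: vt_def J_def)
        have "(\<Prod>i''\<in>J - {i'}. p (vt f i'') j) = (\<Prod>i''\<in>J - {i'}. p (i'', b i'' (f i'')) j)"
          by (intro prod.cong) (auto simp: vt_def J_def)
        then have pr: "(\<Prod>i''\<in>{..<k} - {i'}. p (vt f i'') j) =
            p u j * (\<Prod>i''\<in>J - {i'}. p (i'', b i'' (f i'')) j)"
          unfolding e1 using J(1) iJ by (simp add: vi)
        have "(\<Prod>i''\<in>J. g i'' (f i'')) = g i' (f i') * (\<Prod>i''\<in>J - {i'}. g i'' (f i''))"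
          using J(1) i' by (rule prod.remove)
        also have "(\<Prod>i''\<in>J - {i'}. g i'' (f i'')) =
            (\<Prod>i''\<in>J - {i'}. \<phi> i'' l (f i'') * p (i'', b i'' (f i'')) j)"
          by (intro prod.cong) (auto simp: g_def)
        finally have gp: "(\<Prod>i''\<in>J. g i'' (f i'')) = \<phi> i' l (f i') * y (i', b i' (f i')) j *
            ((\<Prod>i''\<in>J - {i'}. \<phi> i'' l (f i'')) * (\<Prod>i''\<in>J - {i'}. p (i'', b i'' (f i'')) j))"
          by (simp add: g_def prod.distrib)
        have "w f = \<phi> i' l (f i') * (\<Prod>i''\<in>J - {i'}. \<phi> i'' l (f i''))"
          unfolding w_def using J(1) i' by (rule prod.remove)
        then show "w f * (y (vt f i') j * (\<Prod>i''\<in>{..<k} - {i'}. p (vt f i'') j)) =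
            p u j * (\<Prod>i''\<in>J. g i'' (f i''))"
          unfolding gp pr vi' by (simp add: mult_ac)
      qed
      also have "(\<Sum>f\<in>F. \<Prod>i''\<in>J. g i'' (f i'')) = (\<Prod>i''\<in>J. \<Sum>t<d. g i'' t)" by (rule swap)
      also have "\<dots> = (\<Sum>t<d. g i' t) * (\<Prod>i''\<in>J - {i'}. \<Sum>t<d. g i'' t)"
        using J(1) i' by (rule prod.remove)
      also have "(\<Prod>i''\<in>J - {i'}. \<Sum>t<d. g i'' t) = (\<Prod>i''\<in>J - {i'}. if l = j then 1 else 0)"
        using dual[OF J(2) l j] by (intro prod.cong) (auto simp: g_def)
      also have "\<dots> = (if j = l then 1 else 0)"
      proof (cases "j = l")
        case False
        have "card (J - {i'}) > 0" using J2[OF i'] J(1) by (simp only: card_gt_0_iff finite_Diff simp_thms)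
        then show ?thesis using False by simp
      qed simp
      also have "p u j * ((\<Sum>t<d. g i' t) * (if j = l then 1 else 0)) =
          (if j = l then \<beta> i' l * p u l else 0)"
        by (simp add: g_def \<beta>_def)
      finally show ?thesis .
    qed
    have vt_trans: "(i', (if i' = fst u then snd u else b i' (f i'))) = vt f i'" for f i'
      by (cases u) (auto simp: vt_def i_def)
    have "0 = (\<Sum>f\<in>F. w f * jacobian_row d p y (transversal k (\<lambda>i'. if i' = fst u then snd u else b i' (f i'))))"
    proof (intro sum.neutral[symmetric] ballI)
      fix f assume "f \<in> F"
      then have "f \<in> ({..<k} - {fst u}) \<rightarrow>\<^sub>E {..<d}" by (simp add: F_def J_def i_def)
      from H[OF good[OF this]]
      show "w f * jacobian_row d p y (transversal k (\<lambda>i'. if i' = fst u then snd u else b i' (f i'))) = 0"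
        by simp
    qed
    also have "\<dots> = (\<Sum>f\<in>F. \<Sum>j<d. \<Sum>i'<k. w f * (y (vt f i') j * (\<Prod>i''\<in>{..<k} - {i'}. p (vt f i'') j)))"
      unfolding jacobian_row_transversal vt_trans sum_distrib_left ..
    also have "\<dots> = (\<Sum>j<d. \<Sum>f\<in>F. \<Sum>i'<k. w f * (y (vt f i') j * (\<Prod>i''\<in>{..<k} - {i'}. p (vt f i'') j)))"
      by (rule sum.swap)
    also have "\<dots> = (\<Sum>j<d. \<Sum>i'<k. \<Sum>f\<in>F. w f * (y (vt f i') j * (\<Prod>i''\<in>{..<k} - {i'}. p (vt f i'') j)))"
      by (intro sum.cong refl sum.swap)
    also have "\<dots> = (\<Sum>j<d. if j = l then y u l + (\<Sum>i'\<in>J. \<beta> i' l * p u l) else 0)"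
    proof (intro sum.cong refl)
      fix j assume "j \<in> {..<d}"
      then have j: "j < d" by simp
      have "(\<Sum>i'<k. \<Sum>f\<in>F. w f * (y (vt f i') j * (\<Prod>i''\<in>{..<k} - {i'}. p (vt f i'') j))) =
          (\<Sum>f\<in>F. w f * (y (vt f i) j * (\<Prod>i''\<in>J. p (vt f i'') j))) +
          (\<Sum>i'\<in>J. \<Sum>f\<in>F. w f * (y (vt f i') j * (\<Prod>i''\<in>{..<k} - {i'}. p (vt f i'') j)))"
        unfolding J_def using i by (intro sum.remove) auto
      also have "(\<Sum>f\<in>F. w f * (y (vt f i) j * (\<Prod>i''\<in>J. p (vt f i'') j))) = (if j = l then y u l else 0)"
        using own[OF j] by (simp add: vt_def)
      also have "(\<Sum>i'\<in>J. \<Sum>f\<in>F. w f * (y (vt f i') j * (\<Prod>i''\<in>{..<k} - {i'}. p (vt f i'') j))) =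
          (\<Sum>i'\<in>J. if j = l then \<beta> i' l * p u l else 0)"
        by (intro sum.cong refl other j)
      finally show "(\<Sum>i'<k. \<Sum>f\<in>F. w f * (y (vt f i') j * (\<Prod>i''\<in>{..<k} - {i'}. p (vt f i'') j))) =
          (if j = l then y u l + (\<Sum>i'\<in>J. \<beta> i' l * p u l) else 0)" by simp
    qed
    also have "\<dots> = y u l + (\<Sum>i'\<in>J. \<beta> i' l) * p u l" using l by (simp add: sum_distrib_right)
    finally have "y u l + (\<Sum>i'\<in>J. \<beta> i' l) * p u l = 0" by simp
    then show ?thesis by (simp add: a_def J_def i_def eq_neg_iff_add_eq_0)
  qed
  \<comment> \<open>on the block itself, \<open>y\<close> is the scaling by \<open>a\<close>; hence the rates sum to 0\<close>
  have \<beta>a: "\<beta> i l = a i l" if i: "i < k" and l: "l < d" for i l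
  proof -
    have yb: "y (i, b i t) l = a i l * p (i, b i t) l" if t: "t < d" for t
    proof -
      have "y (i, b i t) l = a (fst (i, b i t)) l * p (i, b i t) l"
      proof (rule y[OF _ _ l])
        show "(i, b i t) \<in> vertices k n" using b(1)[OF i t] i by (simp add: vertices_iff)
        fix f assume f: "f \<in> ({..<k} - {fst (i, b i t)}) \<rightarrow>\<^sub>E {..<d}"
        have "(\<lambda>i'\<in>{..<k}. if i' = i then t else f i') \<in> {..<k} \<rightarrow>\<^sub>E {..<d}"
          using f t by (auto simp: PiE_iff)
        from block[OF this]
        have "transversal k (\<lambda>i'. b i' ((\<lambda>i'\<in>{..<k}. if i' = i then t else f i') i')) \<in> H" .
        also have "transversal k (\<lambda>i'. b i' ((\<lambda>i'\<in>{..<k}. if i' = i then t else f i') i')) =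
            transversal k (\<lambda>i'. if i' = fst (i, b i t) then snd (i, b i t) else b i' (f i'))"
          unfolding transversal_def by (intro image_cong) auto
        finally show "transversal k (\<lambda>i'. if i' = fst (i, b i t) then snd (i, b i t) else b i' (f i')) \<in> H" .
      qed
      then show ?thesis by simp
    qed
    have "\<beta> i l = a i l * (\<Sum>t<d. \<phi> i l t * p (i, b i t) l)"
      unfolding \<beta>_def sum_distrib_left by (intro sum.cong) (auto simp: yb)
    then show ?thesis using dual[OF i l l] by simp
  qed
  have "(\<Sum>i<k. a i l) = 0" if l: "l < d" for l
  proof -
    have "a 0 l = - (\<Sum>i\<in>{..<k} - {0}. a i l)"
      unfolding a_def[of 0] using \<beta>a l by (intro arg_cong[where f = uminus] sum.cong) auto
    then show ?thesis using k sum.remove[of "{..<k}" 0 "\<lambda>i. a i l"] by simp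
  qed
  then show ?thesis using y by (intro exI[of _ a]) blast
qed

text \<open>
  Translate a block of \<open>d\<close> vertices per class so that few of the edges between the block and a further
  vertex fall into the small set \<open>X\<close>. The edges inside the block are given weight \<open>n\<close> in the average, so
  that fewer than \<open>n\<close> failures mean none inside the block.
\<close>

lemma dense_flat_rigid:
  fixes p y :: "vertex \<Rightarrow> nat \<Rightarrow> 'a::field_char_0"
  assumes k: "k \<ge> 3" and d: "d \<ge> 1" and n: "d \<le> n" and p: "generic_coordinates k n d p"
    and X: "X \<subseteq> complete_edges k n"
    and H: "\<And>e. e \<in> complete_edges k n - X \<Longrightarrow> jacobian_row d p y e = 0"
    and m: "m < n" "(k * (n * d ^ (k - 1)) + d ^ k * n) * card X < n ^ k * (m + 1)"
  shows "\<exists>a. (\<forall>j<d. (\<Sum>i<k. a i j) = 0) \<and>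
    card {u \<in> vertices k n. \<exists>j<d. y u j \<noteq> a (fst u) j * p u j} \<le> m"
proof -
  define Off where "Off i = (\<Pi>\<^sub>E i'\<in>{..<k}. if i' = i then {..<n} else {..<d})" for i
  define Blk where "Blk = {..<k} \<rightarrow>\<^sub>E {..<d}"
  define I1 where "I1 = (SIGMA i:{..<k}. Off i)"
  define I2 where "I2 = Blk \<times> {..<n}"
  have finOff: "finite (Off i)" for i unfolding Off_def by (intro finite_PiE) auto
  have cOff: "card (Off i) = n * d ^ (k - 1)" if "i < k" for i
  proof -
    have "card (Off i) = (\<Prod>i'<k. card (if i' = i then {..<n} else {..<d}))"
      unfolding Off_def by (intro card_PiE) auto
    also have "\<dots> = n * (\<Prod>i'\<in>{..<k} - {i}. card (if i' = i then {..<n} else {..<d}))"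
      using that by (subst prod.remove[of _ i]) auto
    also have "(\<Prod>i'\<in>{..<k} - {i}. card (if i' = i then {..<n} else {..<d})) = (\<Prod>i'\<in>{..<k} - {i}. d)"
      by (intro prod.cong) auto
    finally show ?thesis using that by simp
  qed
  have finBlk: "finite Blk" "card Blk = d ^ k"
    unfolding Blk_def by (auto simp: card_PiE intro: finite_PiE)
  have fin: "finite I1" "finite I2" unfolding I1_def I2_def using finOff finBlk by auto
  have c1: "card I1 = k * (n * d ^ (k - 1))" unfolding I1_def using finOff cOff by simp
  have c2: "card I2 = d ^ k * n" unfolding I2_def using finBlk by (simp add: card_cartesian_product)
  define off where "off x = (case x of Inl (i, f) \<Rightarrow> f | Inr (f, t) \<Rightarrow> f)"
    for x :: "nat \<times> (nat \<Rightarrow> nat) + (nat \<Rightarrow> nat) \<times> nat"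
  define I where "I = I1 <+> I2"
  have finI: "finite I" and cI: "card I = k * (n * d ^ (k - 1)) + d ^ k * n"
    using fin c1 c2 by (simp_all add: I_def card_Plus)
  have n1: "n \<ge> 1" using n d by simp
  from averaged_offsets[OF n1 X finI, of off] obtain s where s: "s \<in> {..<k} \<rightarrow>\<^sub>E {..<n}"
    "n ^ k * card {x \<in> I. transversal k (offset k n s (off x)) \<in> X} \<le> card I * card X" by blast
  define bad where "bad = {x \<in> I. transversal k (offset k n s (off x)) \<in> X}"
  have finbad: "finite bad" using finI by (simp add: bad_def)
  have cbad: "card bad \<le> m"
  proof -
    have "n ^ k * card bad < n ^ k * (m + 1)" using s(2) m(2) unfolding bad_def cI by (rule le_less_trans)
    then have "card bad < m + 1" unfolding mult_less_cancel1 by blast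
    then show ?thesis by simp
  qed
  have toff: "offset k n s f \<in> {..<k} \<rightarrow>\<^sub>E {..<n}" for f using n1 by (auto simp: offset_def)
  have inH: "transversal k g \<in> complete_edges k n - X"
    if "\<And>i. i < k \<Longrightarrow> g i = offset k n s f i" "transversal k (offset k n s f) \<notin> X" for f g
  proof -
    have "transversal k g = transversal k (offset k n s f)"
      unfolding transversal_def using that(1) by (intro image_cong) auto
    then show ?thesis using that(2) toff by (auto simp: complete_edges_eq)
  qed
  define b where "b i t = (s i + t) mod n" for i t
  have bless: "b i t < n" for i t using n1 by (simp add: b_def)
  have binj: "inj_on (b i) {..<n}" for i
  proof (rule inj_onI)
    fix t t' assume t: "t \<in> {..<n}" "t' \<in> {..<n}" "b i t = b i t'"
    then have "t mod n = t' mod n" using cong_add_lcancel_nat[of "s i" t t' n] by (simp add: b_def cong_def)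
    then show "t = t'" using t by simp
  qed
  have boff: "b i (f i) = offset k n s f i" if "i < k" for f i using that by (simp add: b_def offset_def)
  have block: "transversal k (\<lambda>i. b i (f i)) \<in> complete_edges k n - X" if f: "f \<in> Blk" for f
  proof (rule inH[of _ f])
    show "transversal k (offset k n s f) \<notin> X"
    proof
      assume "transversal k (offset k n s f) \<in> X"
      then have "(\<lambda>t. Inr (f, t)) ` {..<n} \<subseteq> bad"
        using f by (auto simp: bad_def I_def I2_def off_def)
      then have "card ((\<lambda>t. Inr (f, t) :: nat \<times> (nat \<Rightarrow> nat) + (nat \<Rightarrow> nat) \<times> nat) ` {..<n}) \<le> card bad"
        using finbad by (intro card_mono)
      moreover have "card ((\<lambda>t. Inr (f, t) :: nat \<times> (nat \<Rightarrow> nat) + (nat \<Rightarrow> nat) \<times> nat) ` {..<n}) = n"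
        by (subst card_image) (auto intro: inj_onI)
      ultimately show False using cbad m(1) by simp
    qed
  qed (rule boff)
  have "\<exists>a. (\<forall>j<d. (\<Sum>i<k. a i j) = 0) \<and>
    (\<forall>u\<in>vertices k n. (\<forall>f\<in>({..<k} - {fst u}) \<rightarrow>\<^sub>E {..<d}.
        transversal k (\<lambda>i. if i = fst u then snd u else b i (f i)) \<in> complete_edges k n - X) \<longrightarrow>
      (\<forall>j<d. y u j = a (fst u) j * p u j))"
  proof (rule rigidity_from_block[OF k p _ _ H])
    show "inj_on (b i) {..<d}" for i using n by (intro inj_on_subset[OF binj]) auto
  qed (use bless block in \<open>simp_all add: Blk_def\<close>)
  then obtain a where a: "\<forall>j<d. (\<Sum>i<k. a i j) = 0"
    "\<forall>u\<in>vertices k n. (\<forall>f\<in>({..<k} - {fst u}) \<rightarrow>\<^sub>E {..<d}.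
        transversal k (\<lambda>i. if i = fst u then snd u else b i (f i)) \<in> complete_edges k n - X) \<longrightarrow>
      (\<forall>j<d. y u j = a (fst u) j * p u j)" by blast
  define S where "S = {u \<in> vertices k n. \<exists>j<d. y u j \<noteq> a (fst u) j * p u j}"
  have "\<exists>x\<in>bad. \<exists>f. x = Inl (fst u, f) \<and> snd u = b (fst u) (f (fst u)) \<and> f (fst u) < n" if u: "u \<in> S" for u
  proof -
    have uV: "fst u < k" "snd u < n" "u \<in> vertices k n" using u by (auto simp: S_def vertices_iff)
    from u a(2) obtain f where f: "f \<in> ({..<k} - {fst u}) \<rightarrow>\<^sub>E {..<d}"
      "transversal k (\<lambda>i. if i = fst u then snd u else b i (f i)) \<notin> complete_edges k n - X"
      unfolding S_def by blast
    have "b (fst u) ` {..<n} = {..<n}"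
      using bless by (intro endo_inj_surj binj) auto
    then obtain t where t: "t < n" "snd u = b (fst u) t" using uV(2) by (metis image_iff lessThan_iff)
    define f' where "f' = (\<lambda>i\<in>{..<k}. if i = fst u then t else f i)"
    have f'Off: "f' \<in> Off (fst u)" using f(1) t(1) by (auto simp: f'_def Off_def PiE_iff)
    have "transversal k (offset k n s f') \<in> X"
    proof (rule ccontr)
      assume nX: "transversal k (offset k n s f') \<notin> X"
      have "transversal k (\<lambda>i. if i = fst u then snd u else b i (f i)) \<in> complete_edges k n - X"
        by (rule inH[OF _ nX]) (auto simp: f'_def t(2) b_def offset_def)
      then show False using f(2) by simp
    qed
    then have "Inl (fst u, f') \<in> bad"
      using f'Off uV(1) by (auto simp: bad_def I_def I1_def off_def)
    moreover have "f' (fst u) = t" using uV(1) by (simp add: f'_def)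
    ultimately show ?thesis using t by (intro bexI[of _ "Inl (fst u, f')"]) auto
  qed
  then have "\<forall>u\<in>S. \<exists>x. x \<in> bad \<and> (\<exists>f. x = Inl (fst u, f) \<and> snd u = b (fst u) (f (fst u)) \<and> f (fst u) < n)"
    by blast
  from bchoice[OF this] obtain h where h:
    "\<forall>u\<in>S. h u \<in> bad \<and> (\<exists>f. h u = Inl (fst u, f) \<and> snd u = b (fst u) (f (fst u)) \<and> f (fst u) < n)" by blast
  have "card S \<le> card bad"
  proof (rule card_inj_on_le[OF _ _ finbad])
    show "h ` S \<subseteq> bad" using h by blast
    show "inj_on h S"
    proof (rule inj_onI)
      fix u v assume uv: "u \<in> S" "v \<in> S" "h u = h v"
      from bspec[OF h uv(1)] bspec[OF h uv(2)] uv(3) show "u = v" by (cases u; cases v) auto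
    qed
  qed
  then show ?thesis using a(1) cbad unfolding S_def by (intro exI[of _ a]) simp
qed

text \<open>
  By \<open>dense_flat_rigid\<close> a motion is a scaling except on a small set, and absorption removes the
  vertices of this set: subtracting the scaling leaves, on \<open>d\<close> suitable edges, a relation between the links
  of a single vertex. The hypothesis on \<open>B\<close> is the form in which the union bound over spanning sets
  delivers density.
\<close>

theorem vertex_redundantly_rigidI:
  fixes p :: "vertex \<Rightarrow> nat \<Rightarrow> 'a::field_char_0"
  assumes k: "k \<ge> 3" and d: "d \<ge> 1" and n: "d \<le> n" and p: "generic_coordinates k n d p"
    and G: "G \<subseteq> complete_edges k n" and G0: "G0 \<subseteq> G"
    and dense: "\<And>v B. v \<in> vertices k n \<Longrightarrow> B \<subseteq> {e \<in> G0. v \<notin> e} \<Longrightarrow> card B \<le> d * k * n \<Longrightarrow>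
      {e \<in> G0. v \<notin> e} \<subseteq> rigidity_closure TYPE('a) k n d B \<Longrightarrow>
      card (complete_edges k n - rigidity_closure TYPE('a) k n d B) \<le> D"
    and m: "m < n" "(k * (n * d ^ (k - 1)) + d ^ k * n) * D < n ^ k * (m + 1)"
    and absorb: "absorbing k n d m G"
  shows "vertex_redundantly_rigid k n d G p"
  unfolding vertex_redundantly_rigid_def
proof (intro ballI allI impI)
  fix v y assume v: "v \<in> vertices k n" and y: "\<forall>e\<in>G. v \<notin> e \<longrightarrow> jacobian_row d p y e = 0"
  have G0E: "{e \<in> G0. v \<notin> e} \<subseteq> complete_edges k n" using G G0 by blast
  from small_spanning_subset[OF this finite_subset[OF this finite_complete_edges], of d, where ?'a = 'a]
  obtain B where B: "B \<subseteq> {e \<in> G0. v \<notin> e}" "card B \<le> d * k * n"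
    "{e \<in> G0. v \<notin> e} \<subseteq> rigidity_closure TYPE('a) k n d B" by blast
  let ?X = "complete_edges k n - rigidity_closure TYPE('a) k n d B"
  have "\<exists>a. (\<forall>j<d. (\<Sum>i<k. a i j) = 0) \<and>
    card {u \<in> vertices k n. \<exists>j<d. y u j \<noteq> a (fst u) j * p u j} \<le> m"
  proof (rule dense_flat_rigid[OF k d n p _ _ m(1)])
    show "?X \<subseteq> complete_edges k n" by blast
    fix e assume "e \<in> complete_edges k n - ?X"
    then have e: "e \<in> rigidity_closure TYPE('a) k n d B" by blast
    have "\<forall>b\<in>B. jacobian_row d p y b = 0" using B(1) G0 y by blast
    then show "jacobian_row d p y e = 0" using e p unfolding rigidity_closure_def by blast
  next
    have "(k * (n * d ^ (k - 1)) + d ^ k * n) * card ?X \<le> (k * (n * d ^ (k - 1)) + d ^ k * n) * D"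
      by (rule mult_le_mono2[OF dense[OF v B]])
    then show "(k * (n * d ^ (k - 1)) + d ^ k * n) * card ?X < n ^ k * (m + 1)"
      using m(2) by (rule le_less_trans)
  qed
  then obtain a where a: "\<forall>j<d. (\<Sum>i<k. a i j) = 0"
    "card {u \<in> vertices k n. \<exists>j<d. y u j \<noteq> a (fst u) j * p u j} \<le> m" by blast
  define S where "S = {u \<in> vertices k n - {v}. \<exists>j<d. y u j \<noteq> a (fst u) j * p u j}"
  have "card S \<le> card {u \<in> vertices k n. \<exists>j<d. y u j \<noteq> a (fst u) j * p u j}"
    by (intro card_mono) (auto simp: S_def)
  then have cS: "card S \<le> m" using a(2) by simp
  have SV: "S \<subseteq> vertices k n - {v}" by (auto simp: S_def)
  have "S = {}"
  proof (rule ccontr)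
    assume ne: "S \<noteq> {}"
    from absorb[unfolded absorbing_def, rule_format, OF v SV ne cS] obtain u where
      u: "u \<in> S" "d \<le> card {e \<in> G. e \<inter> insert v S = {u}}" by blast
    define E where "E = {e \<in> G. e \<inter> insert v S = {u}}"
    have uv: "u \<in> vertices k n" "u \<noteq> v" using u(1) SV by auto
    define z where "z w j = y w j - a (fst w) j * p w j" for w j
    have EG: "E \<subseteq> G" "d \<le> card E" and uE: "\<And>e. e \<in> E \<Longrightarrow> u \<in> e" using u(2) by (auto simp: E_def)
    have zE: "(\<Sum>j<d. z u j * (\<Prod>w\<in>e - {u}. p w j)) = 0" if e: "e \<in> E" for e
    proof -
      have eG: "e \<in> G" and ue: "u \<in> e" and ve: "v \<notin> e" and eS: "\<And>w. w \<in> e \<Longrightarrow> w \<noteq> u \<Longrightarrow> w \<notin> S"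
        using e uv(2) by (auto simp: E_def)
      have ec: "e \<in> complete_edges k n" using eG G by blast
      note ef = edge_facts[OF ec]
      have "jacobian_row d p (\<lambda>w j. a (fst w) j * p w j) e = (\<Sum>j<d. \<Sum>w\<in>e. a (fst w) j * (\<Prod>w\<in>e. p w j))"
        unfolding jacobian_row_def
        by (intro sum.cong refl) (simp add: prod.remove[OF ef(2)] mult.assoc)
      also have "\<dots> = (\<Sum>j<d. (\<Sum>i<k. a i j) * (\<Prod>w\<in>e. p w j))"
        by (simp add: sum_edge_class[OF ec, symmetric] sum_distrib_right)
      also have "\<dots> = 0" using a(1) by simp
      finally have "jacobian_row d p z e = 0"
        unfolding z_def jacobian_diff using y eG ve by simp
      moreover have "jacobian_row d p z e = (\<Sum>j<d. z u j * (\<Prod>w\<in>e - {u}. p w j))"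
      proof (rule jacobian_single[OF ef(2) ue])
        fix w j assume w: "w \<in> e" "w \<noteq> u" and j: "j < d"
        have "w \<in> vertices k n" "w \<noteq> v" "w \<notin> S" using w ef(1) ve eS by auto
        then show "z w j = 0" using j by (auto simp: S_def z_def)
      qed
      ultimately show ?thesis by simp
    qed
    have li: "link_independent k n d G p"
      by (rule generic_link_independent[OF _ G]) (use p in \<open>simp add: generic_coordinates_def\<close>)
    have "z u j = 0" if "j < d" for j
      by (rule li[unfolded link_independent_def, rule_format, OF uv(1) EG uE zE that])
    then show False using u(1) by (auto simp: S_def z_def)
  qed
  then have "\<forall>u\<in>vertices k n - {v}. \<forall>j<d. y u j = a (fst u) j * p u j"
    unfolding S_def by blast
  then show "trivial_motion k d p (vertices k n - {v}) y"
    unfolding trivial_motion_def using a(1) by (intro exI[of _ a]) simp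
qed

section \<open>Random orderings\<close>

definition average_over_orderings :: "'e set \<Rightarrow> ('e list \<Rightarrow> real) \<Rightarrow> real" where
  "average_over_orderings A g = (\<Sum>es\<in>permutations_of_set A. g es) / fact (card A)"

lemma average_first_element:
  assumes "finite A" "A \<noteq> {}"
  shows "average_over_orderings A g =
    (\<Sum>x\<in>A. average_over_orderings (A - {x}) (\<lambda>xs. g (x # xs))) / card A"
proof -
  have "(\<Sum>es\<in>permutations_of_set A. g es) =
      (\<Sum>x\<in>A. \<Sum>es\<in>(#) x ` permutations_of_set (A - {x}). g es)"
    unfolding permutations_of_set_nonempty[OF assms(2)]
    using assms(1) by (intro sum.UNION_disjoint) auto
  also have "\<dots> = (\<Sum>x\<in>A. \<Sum>xs\<in>permutations_of_set (A - {x}). g (x # xs))"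
  proof (rule sum.cong[OF refl])
    fix x
    show "(\<Sum>es\<in>(#) x ` permutations_of_set (A - {x}). g es) =
        (\<Sum>xs\<in>permutations_of_set (A - {x}). g (x # xs))"
      by (subst sum.reindex) (auto intro: inj_onI)
  qed
  finally have s: "(\<Sum>es\<in>permutations_of_set A. g es) =
      (\<Sum>x\<in>A. \<Sum>xs\<in>permutations_of_set (A - {x}). g (x # xs))" .
  obtain c where c: "card A = Suc c" using assms by (cases "card A") auto
  have "average_over_orderings (A - {x}) (\<lambda>xs. g (x # xs)) =
      (\<Sum>xs\<in>permutations_of_set (A - {x}). g (x # xs)) / fact c" if "x \<in> A" for x
    using that assms(1) c by (simp add: average_over_orderings_def)
  then show ?thesis
    by (simp add: average_over_orderings_def s c flip: sum_divide_distrib)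
qed

lemma average_mono:
  assumes "\<And>es. es \<in> permutations_of_set A \<Longrightarrow> g es \<le> h es"
  shows "average_over_orderings A g \<le> average_over_orderings A h"
  unfolding average_over_orderings_def
  by (intro divide_right_mono sum_mono assms) auto

lemma average_cong:
  assumes "\<And>es. es \<in> permutations_of_set A \<Longrightarrow> g es = h es"
  shows "average_over_orderings A g = average_over_orderings A h"
  unfolding average_over_orderings_def using assms by (simp cong: sum.cong)

lemma average_cmult: "average_over_orderings A (\<lambda>es. c * g es) = c * average_over_orderings A g"
  by (simp add: average_over_orderings_def sum_distrib_left)

lemma average_sum: "average_over_orderings A (\<lambda>es. \<Sum>i\<in>I. g i es) = (\<Sum>i\<in>I. average_over_orderings A (g i))"
  unfolding average_over_orderings_def sum_divide_distrib[symmetric] by (subst sum.swap) simp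

lemma average_const: "finite A \<Longrightarrow> average_over_orderings A (\<lambda>_. c) = c"
  by (simp add: average_over_orderings_def)

lemma prob_eq_average:
  assumes "finite A"
  shows "measure_pmf.prob (pmf_of_set (permutations_of_set A)) {es. P es} =
    average_over_orderings A (\<lambda>es. of_bool (P es))"
proof -
  have "measure_pmf.prob (pmf_of_set (permutations_of_set A)) {es. P es} =
      card (permutations_of_set A \<inter> {es. P es}) / card (permutations_of_set A)"
    using assms by (intro measure_pmf_of_set) auto
  also have "real (card (permutations_of_set A \<inter> {es. P es})) =
      (\<Sum>es\<in>permutations_of_set A. of_bool (P es))"
    by (simp add: of_bool_def sum.If_cases)
  finally show ?thesis using assms by (simp add: average_over_orderings_def)
qed

text \<open>
  If each of \<open>m\<close> draws equals a given edge with probability at most \<open>1 / t\<close>, this bounds the probability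
  that \<open>f\<close> given edges are among the drawn ones.
\<close>

definition draw_bound :: "real \<Rightarrow> nat \<Rightarrow> nat \<Rightarrow> real" where
  "draw_bound t f m = fact f * (m choose f) / t ^ f"

lemma draw_bound_Suc:
  assumes "t > 0" "f > 0"
  shows "draw_bound t f (Suc m) = f / t * draw_bound t (f - 1) m + draw_bound t f m"
  using assms by (cases f) (simp_all add: draw_bound_def field_simps)

lemma draw_bound_nonneg: "t > 0 \<Longrightarrow> draw_bound t f m \<ge> 0"
  by (simp add: draw_bound_def)

lemma draw_bound_le:
  assumes "t > 0"
  shows "draw_bound t f m \<le> (m / t) ^ f"
proof -
  have "fact f * (m choose f) \<le> (m ^ f :: nat)" using binomial_fact_pow[of m f] by (simp add: mult.commute)
  then have "real (fact f * (m choose f)) \<le> real (m ^ f)" by (simp only: of_nat_le_iff)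
  then show ?thesis using assms by (simp add: draw_bound_def power_divide divide_right_mono)
qed

text \<open>
  The edges are drawn one at a time. As long as \<open>X\<close> is so large that the draws cannot exhaust it,
  each draw hits \<open>X\<close> with probability at least \<open>\<rho>\<close>, whatever happened before.
\<close>

lemma average_hits_misses:
  fixes \<rho> T t z :: real
  assumes "finite A" "F \<subseteq> A" "X \<subseteq> A" "F \<inter> X = {}" "m0 \<le> m1"
    and "m0 > 0 \<Longrightarrow> \<rho> * T + m0 \<le> card X" "card A \<le> T" "t + m1 \<le> card A"
    and t: "t > 0" and z: "0 \<le> z" "z \<le> 1" and \<rho>: "0 \<le> \<rho>" "\<rho> \<le> 1"
  shows "average_over_orderings A
      (\<lambda>es. of_bool (F \<subseteq> set (take m1 es)) * z ^ card (X \<inter> set (take m0 es)))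
    \<le> draw_bound t (card F) m1 * (1 - (1 - z) * \<rho>) ^ (m0 - card F)"
  using assms(1-8)
proof (induction m1 arbitrary: A F X m0)
  case 0
  show ?case
  proof (cases "F = {}")
    case True
    then show ?thesis using 0 by (simp add: average_const draw_bound_def)
  next
    case False
    then have "card F > 0" using 0 by (meson card_gt_0_iff finite_subset)
    then show ?thesis using False 0 by (simp add: average_const draw_bound_def binomial_eq_0)
  qed
next
  case (Suc m1)
  let ?f = "card F" and ?\<beta> = "1 - (1 - z) * \<rho>" and ?N = "real (card A)"
  have \<beta>: "0 \<le> ?\<beta>" "?\<beta> \<le> 1"
    using z \<rho> mult_le_one[of "1 - z" \<rho>] by auto
  have finF: "finite F" "finite X" using Suc.prems finite_subset by blast+
  have N: "?N > 0" "t \<le> ?N" using Suc.prems(8) t by auto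
  then have ne: "A \<noteq> {}" by auto
  define W where "W F X m1 m0 es = of_bool (F \<subseteq> set (take m1 es)) * z ^ card (X \<inter> set (take m0 es))"
    for F X :: "'a set" and m1 m0 es
  define w where "w x = (if x \<in> X \<and> m0 > 0 then z else 1)" for x
  have step: "W F X (Suc m1) m0 (x # xs) = w x * W (F - {x}) (X - {x}) m1 (m0 - 1) xs"
    if "x \<in> A" "xs \<in> permutations_of_set (A - {x})" for x xs
  proof -
    have x: "x \<notin> set xs" using that by (auto simp: permutations_of_set_def)
    have "F \<subseteq> set (take (Suc m1) (x # xs)) \<longleftrightarrow> F - {x} \<subseteq> set (take m1 xs)" by auto
    moreover have "z ^ card (X \<inter> set (take m0 (x # xs))) =
        w x * z ^ card ((X - {x}) \<inter> set (take (m0 - 1) xs))"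
    proof (cases m0)
      case (Suc m)
      have xt: "x \<notin> set (take m xs)" using x by (meson in_set_takeD)
      have "(X - {x}) \<inter> set (take m xs) = X \<inter> set (take m xs)" using xt by auto
      moreover have "X \<inter> set (take m0 (x # xs)) =
          (if x \<in> X then insert x (X \<inter> set (take m xs)) else X \<inter> set (take m xs))"
        using Suc by auto
      ultimately show ?thesis using Suc xt by (simp add: w_def)
    qed (simp add: w_def)
    ultimately show ?thesis by (simp add: W_def)
  qed
  have IH: "average_over_orderings (A - {x}) (W (F - {x}) (X - {x}) m1 (m0 - 1))
      \<le> draw_bound t (card (F - {x})) m1 * ?\<beta> ^ (m0 - 1 - card (F - {x}))" if x: "x \<in> A" for x
    unfolding W_def
  proof (rule Suc.IH)
    show "card (A - {x}) \<le> T" using Suc.prems(7) x Suc.prems(1) by simp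
    show "t + m1 \<le> card (A - {x})" using Suc.prems(1,8) x ne N by (simp add: card_Diff_singleton)
    show "\<rho> * T + (m0 - 1 :: nat) \<le> card (X - {x})" if "m0 - 1 > 0"
    proof -
      have "real (card X) - 1 \<le> card (X - {x})"
        using finF(2) by (cases "x \<in> X") (auto simp: card_Diff_singleton)
      then show ?thesis using Suc.prems(6) that by simp
    qed
  qed (use Suc.prems in auto)
  have "average_over_orderings A (W F X (Suc m1) m0) =
      (\<Sum>x\<in>A. w x * average_over_orderings (A - {x}) (W (F - {x}) (X - {x}) m1 (m0 - 1))) / ?N"
    unfolding average_first_element[OF Suc.prems(1) ne] average_cmult[symmetric]
    by (intro arg_cong2[where f = "(/)"] refl sum.cong average_cong step) auto
  also have "\<dots> \<le> (\<Sum>x\<in>A. w x * (draw_bound t (card (F - {x})) m1 * ?\<beta> ^ (m0 - 1 - card (F - {x})))) / ?N"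
    using IH z by (intro divide_right_mono sum_mono mult_left_mono) (auto simp: w_def)
  also have "(\<Sum>x\<in>A. w x * (draw_bound t (card (F - {x})) m1 * ?\<beta> ^ (m0 - 1 - card (F - {x})))) =
      (\<Sum>x\<in>F. draw_bound t (?f - 1) m1 * ?\<beta> ^ (m0 - 1 - (?f - 1))) +
      (\<Sum>x\<in>A - F. w x * (draw_bound t ?f m1 * ?\<beta> ^ (m0 - 1 - ?f)))" (is "_ = ?S1 + ?S2")
  proof -
    have "w x = 1" if "x \<in> F" for x using that Suc.prems(4) by (auto simp: w_def)
    then show ?thesis
      using Suc.prems(1,2) finF by (subst sum.subset_diff[of F A]) (simp_all add: add.commute)
  qed
  also have "?S1 = ?f * (draw_bound t (?f - 1) m1 * ?\<beta> ^ (m0 - 1 - (?f - 1)))" by simp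
  also have "?S2 = (\<Sum>x\<in>A - F. w x) * (draw_bound t ?f m1 * ?\<beta> ^ (m0 - 1 - ?f))"
    by (simp add: sum_distrib_right)
  finally have main: "average_over_orderings A (W F X (Suc m1) m0) \<le>
      ?f / ?N * (draw_bound t (?f - 1) m1 * ?\<beta> ^ (m0 - 1 - (?f - 1))) +
      (\<Sum>x\<in>A - F. w x) / ?N * (draw_bound t ?f m1 * ?\<beta> ^ (m0 - 1 - ?f))"
    by (simp add: add_divide_distrib)
  have w1: "w x \<le> 1" for x using z by (simp add: w_def)
  have AF: "real (card (A - F)) = ?N - ?f"
    using Suc.prems(1,2) finF card_mono[OF Suc.prems(1,2)] by (simp add: card_Diff_subset)
  have wsum: "(\<Sum>x\<in>A - F. w x) / ?N \<le> 1"
  proof -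
    have "(\<Sum>x\<in>A - F. w x) \<le> card (A - F)" using sum_mono[of "A - F" w "\<lambda>_. 1"] w1 by simp
    then show ?thesis using N AF by (simp add: divide_le_eq)
  qed
  have first: "?f / ?N * draw_bound t (?f - 1) m1 + draw_bound t ?f m1 \<le> draw_bound t ?f (Suc m1)"
  proof (cases "?f = 0")
    case True
    then show ?thesis by (simp add: draw_bound_def)
  next
    case False
    have "?f / ?N * draw_bound t (?f - 1) m1 \<le> ?f / t * draw_bound t (?f - 1) m1"
      using N t by (intro mult_right_mono divide_left_mono draw_bound_nonneg) auto
    then show ?thesis using draw_bound_Suc[OF t, of ?f m1] False by simp
  qed
  note nn = draw_bound_nonneg[OF t]
  have "average_over_orderings A (W F X (Suc m1) m0) \<le>
      draw_bound t ?f (Suc m1) * ?\<beta> ^ (m0 - ?f)"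
  proof (cases "m0 > ?f")
    case False
    have "average_over_orderings A (W F X (Suc m1) m0) \<le>
        ?f / ?N * (draw_bound t (?f - 1) m1 * 1) + 1 * (draw_bound t ?f m1 * 1)"
      using wsum \<beta> nn by (intro order_trans[OF main] add_mono mult_mono power_le_one)
        (auto intro!: mult_nonneg_nonneg divide_nonneg_nonneg sum_nonneg simp: w_def z)
    then show ?thesis using first False by simp
  next
    case True
    have wsum2: "(\<Sum>x\<in>A - F. w x) / ?N \<le> ?\<beta>"
    proof -
      have XA: "X \<subseteq> A - F" using Suc.prems(3,4) by blast
      have "(\<Sum>x\<in>A - F. w x) = (\<Sum>x\<in>X. w x) + (\<Sum>x\<in>A - F - X. w x)"
        using sum.subset_diff[OF XA, of w] Suc.prems(1) by simp
      also have "(\<Sum>x\<in>X. w x) = card X * z" using True by (simp add: w_def)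
      also have "(\<Sum>x\<in>A - F - X. w x) \<le> card (A - F - X)"
        using sum_mono[of "A - F - X" w "\<lambda>_. 1"] w1 by simp
      also have "real (card (A - F - X)) = ?N - ?f - card X"
        using AF card_mono[OF _ XA] finF Suc.prems(1) XA by (simp add: card_Diff_subset)
      finally have "(\<Sum>x\<in>A - F. w x) \<le> ?N - (1 - z) * card X" by (simp add: algebra_simps)
      also have "(1 - z) * (\<rho> * ?N) \<le> (1 - z) * card X"
      proof (rule mult_left_mono)
        have "\<rho> * ?N \<le> \<rho> * T" using Suc.prems(7) \<rho> by (intro mult_left_mono) auto
        then show "\<rho> * ?N \<le> card X" using Suc.prems(6) True by simp
      qed (use z in simp)
      then have "?N - (1 - z) * card X \<le> ?\<beta> * ?N" by (simp add: algebra_simps)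
      finally show ?thesis using N by (simp add: divide_le_eq)
    qed
    have pw: "?\<beta> * ?\<beta> ^ (m0 - 1 - ?f) = ?\<beta> ^ (m0 - ?f)"
      using True by (metis Suc_diff_Suc Suc_eq_plus1 diff_diff_left plus_1_eq_Suc power_Suc)
    have pw2: "?f / ?N * (draw_bound t (?f - 1) m1 * ?\<beta> ^ (m0 - 1 - (?f - 1))) =
        ?f / ?N * draw_bound t (?f - 1) m1 * ?\<beta> ^ (m0 - ?f)"
      by (cases "?f = 0") auto
    have "average_over_orderings A (W F X (Suc m1) m0) \<le>
        ?f / ?N * draw_bound t (?f - 1) m1 * ?\<beta> ^ (m0 - ?f) +
        ?\<beta> * (draw_bound t ?f m1 * ?\<beta> ^ (m0 - 1 - ?f))"
      using wsum2 nn \<beta> unfolding pw2[symmetric]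
      by (intro order_trans[OF main] add_mono mult_right_mono mult_nonneg_nonneg) auto
    also have "\<dots> = (?f / ?N * draw_bound t (?f - 1) m1 + draw_bound t ?f m1) * ?\<beta> ^ (m0 - ?f)"
      unfolding pw[symmetric] by (simp add: algebra_simps)
    also have "\<dots> \<le> draw_bound t ?f (Suc m1) * ?\<beta> ^ (m0 - ?f)"
      using first \<beta> by (intro mult_right_mono) auto
    finally show ?thesis .
  qed
  then show ?case unfolding W_def .
qed

lemma prob_draws_avoid:
  fixes \<rho> t :: real
  assumes "finite A" "F \<subseteq> A" "X \<subseteq> A" "F \<inter> X = {}" "m0 \<le> m1"
    and "\<rho> * card A + m0 \<le> card X" "t + m1 \<le> card A" "t > 0" "0 \<le> \<rho>" "\<rho> \<le> 1"
  shows "measure_pmf.prob (pmf_of_set (permutations_of_set A))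
      {es. F \<subseteq> set (take m1 es) \<and> X \<inter> set (take m0 es) = {}}
    \<le> draw_bound t (card F) m1 * (1 - \<rho>) ^ (m0 - card F)"
proof -
  have finX: "finite X" using assms(1,3) finite_subset by blast
  have "of_bool (F \<subseteq> set (take m1 es) \<and> X \<inter> set (take m0 es) = {}) =
      (of_bool (F \<subseteq> set (take m1 es)) * 0 ^ card (X \<inter> set (take m0 es)) :: real)" for es
    using finX by (auto simp: power_0_left)
  then show ?thesis
    unfolding prob_eq_average[OF assms(1)]
    using average_hits_misses[of A F X m0 m1 \<rho> "card A" t 0] assms by simp
qed

text \<open>
  Markov's inequality for the exponential moment with base \<open>exp (- 2)\<close>.
\<close>

lemma prob_draws_few:
  fixes \<rho> t r :: real
  assumes "finite A" "F \<subseteq> A" "X \<subseteq> A" "F \<inter> X = {}" "m0 \<le> m1"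
    and "\<rho> * card A + m0 \<le> card X" "t + m1 \<le> card A" "t > 0" "0 \<le> \<rho>" "\<rho> \<le> 1" and r: "r \<ge> 0"
  shows "measure_pmf.prob (pmf_of_set (permutations_of_set A))
      {es. F \<subseteq> set (take m1 es) \<and> card (X \<inter> set (take m0 es)) \<le> r}
    \<le> exp (2 * r) * (draw_bound t (card F) m1 * (1 - (1 - exp (- 2)) * \<rho>) ^ (m0 - card F))"
proof -
  have "of_bool (F \<subseteq> set (take m1 es) \<and> card (X \<inter> set (take m0 es)) \<le> r) \<le>
      exp (2 * r) * (of_bool (F \<subseteq> set (take m1 es)) * exp (- 2) ^ card (X \<inter> set (take m0 es)))" for es
  proof (cases "F \<subseteq> set (take m1 es) \<and> card (X \<inter> set (take m0 es)) \<le> r")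
    case True
    have "exp (2 * r) * exp (- 2) ^ card (X \<inter> set (take m0 es)) =
        exp (2 * (r - card (X \<inter> set (take m0 es))))"
      by (simp add: exp_of_nat_mult[symmetric] exp_add[symmetric] algebra_simps)
    also have "\<dots> \<ge> 1" using True by simp
    finally show ?thesis using True by simp
  qed auto
  then have "measure_pmf.prob (pmf_of_set (permutations_of_set A))
      {es. F \<subseteq> set (take m1 es) \<and> card (X \<inter> set (take m0 es)) \<le> r}
    \<le> exp (2 * r) * average_over_orderings A
      (\<lambda>es. of_bool (F \<subseteq> set (take m1 es)) * exp (- 2) ^ card (X \<inter> set (take m0 es)))"
    unfolding prob_eq_average[OF assms(1)] average_cmult[symmetric] by (intro average_mono)
  also have "\<dots> \<le> exp (2 * r) * (draw_bound t (card F) m1 * (1 - (1 - exp (- 2)) * \<rho>) ^ (m0 - card F))"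
    by (intro mult_left_mono average_hits_misses[where T = "card A"]) (use assms in auto)
  finally show ?thesis .
qed

lemma average_avoid:
  assumes "finite A" "X \<subseteq> A" "card X + m \<le> card A"
  shows "average_over_orderings A (\<lambda>es. of_bool (X \<inter> set (take m es) = {})) =
    (\<Prod>i<m. (real (card A) - card X - real i) / (real (card A) - real i))"
  using assms
proof (induction m arbitrary: A)
  case 0
  then show ?case by (simp add: average_const)
next
  case (Suc m)
  have ne: "A \<noteq> {}" using Suc.prems by auto
  have cA: "card A \<ge> 1" using Suc.prems by simp
  let ?N = "real (card A)"
  define P where "P = (\<Prod>i<m. (?N - card X - real (Suc i)) / (?N - real (Suc i)))"
  have step: "average_over_orderings (A - {x}) (\<lambda>xs. of_bool (X \<inter> set (take (Suc m) (x # xs)) = {})) =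
      (if x \<in> X then 0 else P)" if x: "x \<in> A" for x
  proof (cases "x \<in> X")
    case True
    then show ?thesis using Suc.prems(1) by (simp add: average_const)
  next
    case False
    have c: "card (A - {x}) = card A - 1" using x Suc.prems(1) by simp
    have "average_over_orderings (A - {x}) (\<lambda>xs. of_bool (X \<inter> set (take (Suc m) (x # xs)) = {})) =
        average_over_orderings (A - {x}) (\<lambda>xs. of_bool (X \<inter> set (take m xs) = {}))"
      using False by (intro average_cong) auto
    also have "\<dots> = (\<Prod>i<m. (real (card (A - {x})) - card X - real i) / (real (card (A - {x})) - real i))"
      using Suc.prems False c by (intro Suc.IH) auto
    also have "\<dots> = P"
      unfolding P_def c using cA by (intro prod.cong) (auto simp: algebra_simps of_nat_diff)
    finally show ?thesis using False by simp
  qed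
  have "average_over_orderings A (\<lambda>es. of_bool (X \<inter> set (take (Suc m) es) = {})) =
      (\<Sum>x\<in>A. if x \<in> X then 0 else P) / ?N"
    unfolding average_first_element[OF Suc.prems(1) ne]
    by (intro arg_cong2[where f = "(/)"] refl sum.cong step)
  also have "(\<Sum>x\<in>A. if x \<in> X then 0 else P) = (?N - card X) * P"
  proof -
    have fX: "finite X" using Suc.prems(1,2) finite_subset by blast
    have "(\<Sum>x\<in>A. if x \<in> X then 0 else P) = (\<Sum>x\<in>A - X. P)"
      using Suc.prems(1,2) by (intro sum.mono_neutral_cong_right) auto
    then show ?thesis
      using card_mono[OF Suc.prems(1,2)] by (simp add: card_Diff_subset[OF fX Suc.prems(2)] of_nat_diff)
  qed
  also have "(?N - card X) * P / ?N = (\<Prod>i<Suc m. (?N - card X - real i) / (?N - real i))"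
    unfolding P_def by (subst prod.lessThan_Suc_shift) simp
  finally show ?case .
qed

text \<open>
  Chebyshev's inequality. Missing two disjoint sets of the same size is negatively correlated,
  because \<open>(x - 2 a) x \<le> (x - a)\<^sup>2\<close>.
\<close>

lemma prob_all_hit:
  fixes X :: "'v \<Rightarrow> 'e set" and \<mu> :: real
  assumes A: "finite A" and V: "finite V" and X: "\<And>v. v \<in> V \<Longrightarrow> X v \<subseteq> A" "\<And>v. v \<in> V \<Longrightarrow> card (X v) = a"
    and disj: "\<And>v w. v \<in> V \<Longrightarrow> w \<in> V \<Longrightarrow> v \<noteq> w \<Longrightarrow> X v \<inter> X w = {}"
    and m: "2 * a + m < card A"
    and \<mu>: "\<mu> = card V * (\<Prod>i<m. (real (card A) - real a - real i) / (real (card A) - real i))" "\<mu> > 0"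
  shows "measure_pmf.prob (pmf_of_set (permutations_of_set A)) {es. \<forall>v\<in>V. X v \<inter> set (take m es) \<noteq> {}} \<le> 1 / \<mu>"
proof -
  let ?N = "real (card A)"
  define I where "I v es = (of_bool (X v \<inter> set (take m es) = {}) :: real)" for v es
  define Z where "Z es = (\<Sum>v\<in>V. I v es)" for es
  define \<pi>1 where "\<pi>1 = (\<Prod>i<m. (?N - real a - real i) / (?N - real i))"
  define \<pi>2 where "\<pi>2 = (\<Prod>i<m. (?N - 2 * real a - real i) / (?N - real i))"
  let ?E = "average_over_orderings A"
  have E1: "?E (I v) = \<pi>1" if "v \<in> V" for v
    unfolding I_def \<pi>1_def using average_avoid[OF A X(1)[OF that], of m] X(2)[OF that] m by simp
  have E2: "?E (\<lambda>es. I v es * I w es) = \<pi>2" if v: "v \<in> V" "w \<in> V" "v \<noteq> w" for v w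
  proof -
    have fin: "finite (X v)" "finite (X w)" using X(1) v A finite_subset by blast+
    have c: "card (X v \<union> X w) = 2 * a"
      using card_Un_disjoint[OF fin disj[OF v]] X(2) v by simp
    have "?E (\<lambda>es. I v es * I w es) = ?E (\<lambda>es. of_bool ((X v \<union> X w) \<inter> set (take m es) = {}))"
      unfolding I_def by (intro average_cong) (auto simp: Int_Un_distrib2)
    also have "\<dots> = \<pi>2"
      unfolding \<pi>2_def using average_avoid[OF A, of "X v \<union> X w" m] X(1) v c m by simp
    finally show ?thesis .
  qed
  have EZ: "?E Z = \<mu>"
    unfolding Z_def average_sum using E1 by (simp add: \<mu>(1) \<pi>1_def)
  have corr: "\<pi>2 \<le> \<pi>1\<^sup>2"
  proof -
    have "\<pi>2 \<le> (\<Prod>i<m. ((?N - real a - real i) / (?N - real i))\<^sup>2)"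
      unfolding \<pi>2_def
    proof (intro prod_mono conjI)
      fix i assume "i \<in> {..<m}"
      then have "real (2 * a + i) < ?N" using m by (simp only: of_nat_less_iff) simp
      then have pos: "?N - real i > 0" "?N - 2 * real a - real i \<ge> 0" by simp_all
      show "0 \<le> (?N - 2 * real a - real i) / (?N - real i)" using pos by simp
      have "(?N - 2 * real a - real i) * (?N - real i) \<le> (?N - real a - real i)\<^sup>2" by (simp add: power2_eq_square algebra_simps)
      then have "(?N - 2 * real a - real i) * (?N - real i) / (?N - real i)\<^sup>2 \<le> (?N - real a - real i)\<^sup>2 / (?N - real i)\<^sup>2"
        by (rule divide_right_mono) simp
      then show "(?N - 2 * real a - real i) / (?N - real i) \<le> ((?N - real a - real i) / (?N - real i))\<^sup>2"
        using pos by (simp add: power2_eq_square power_divide)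
    qed
    then show ?thesis by (simp add: \<pi>1_def prod_power_distrib)
  qed
  have "?E (\<lambda>es. (Z es)\<^sup>2) = (\<Sum>v\<in>V. \<Sum>w\<in>V. ?E (\<lambda>es. I v es * I w es))"
    unfolding Z_def power2_eq_square sum_product average_sum ..
  also have "\<dots> \<le> (\<Sum>v\<in>V. \<pi>1 + card V * \<pi>1\<^sup>2)"
  proof (intro sum_mono)
    fix v assume v: "v \<in> V"
    have "(\<Sum>w\<in>V. ?E (\<lambda>es. I v es * I w es)) =
        ?E (\<lambda>es. I v es * I v es) + (\<Sum>w\<in>V - {v}. ?E (\<lambda>es. I v es * I w es))"
      using V v by (rule sum.remove)
    also have "?E (\<lambda>es. I v es * I v es) = \<pi>1"
    proof -
      have "(\<lambda>es. I v es * I v es) = I v" by (rule ext) (simp add: I_def)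
      then show ?thesis using E1[OF v] by simp
    qed
    also have "(\<Sum>w\<in>V - {v}. ?E (\<lambda>es. I v es * I w es)) = (\<Sum>w\<in>V - {v}. \<pi>2)"
      using E2[OF v] by (intro sum.cong) auto
    also have "\<dots> \<le> (\<Sum>w\<in>V - {v}. \<pi>1\<^sup>2)" using corr by (intro sum_mono)
    also have "\<dots> \<le> card V * \<pi>1\<^sup>2" using V v by (simp add: card_Diff_singleton mult_right_mono)
    finally show "(\<Sum>w\<in>V. ?E (\<lambda>es. I v es * I w es)) \<le> \<pi>1 + card V * \<pi>1\<^sup>2" by simp
  qed
  also have "\<dots> = \<mu> + \<mu>\<^sup>2"
  proof -
    have "\<mu> = card V * \<pi>1" unfolding \<mu>(1) \<pi>1_def ..
    then show ?thesis by (simp add: power2_eq_square algebra_simps)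
  qed
  finally have EZ2: "?E (\<lambda>es. (Z es)\<^sup>2) \<le> \<mu> + \<mu>\<^sup>2" .
  have lin: "?E (\<lambda>es. g es + h es) = ?E g + ?E h" for g h
    by (simp add: average_over_orderings_def sum.distrib add_divide_distrib)
  have "\<mu>\<^sup>2 * measure_pmf.prob (pmf_of_set (permutations_of_set A)) {es. \<forall>v\<in>V. X v \<inter> set (take m es) \<noteq> {}}
      = ?E (\<lambda>es. \<mu>\<^sup>2 * of_bool (\<forall>v\<in>V. X v \<inter> set (take m es) \<noteq> {}))"
    unfolding prob_eq_average[OF A] average_cmult ..
  also have "\<dots> \<le> ?E (\<lambda>es. (Z es - \<mu>)\<^sup>2)"
  proof (rule average_mono)
    fix es
    show "\<mu>\<^sup>2 * of_bool (\<forall>v\<in>V. X v \<inter> set (take m es) \<noteq> {}) \<le> (Z es - \<mu>)\<^sup>2"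
    proof (cases "\<forall>v\<in>V. X v \<inter> set (take m es) \<noteq> {}")
      case True
      then have "Z es = 0" by (simp add: Z_def I_def)
      moreover have "of_bool (\<forall>v\<in>V. X v \<inter> set (take m es) \<noteq> {}) = (1::real)"
        unfolding of_bool_def by (rule if_P[OF True])
      ultimately show ?thesis by simp
    next
      case False
      have "of_bool (\<forall>v\<in>V. X v \<inter> set (take m es) \<noteq> {}) = (0::real)"
        unfolding of_bool_def by (rule if_not_P[OF False])
      then show ?thesis by (simp only: mult_zero_right zero_le_power2)
    qed
  qed
  also have "\<dots> = ?E (\<lambda>es. (Z es)\<^sup>2 + (- 2 * \<mu> * Z es + \<mu>\<^sup>2))"
    by (intro average_cong) (simp add: power2_eq_square algebra_simps)
  also have "\<dots> = ?E (\<lambda>es. (Z es)\<^sup>2) + (- 2 * \<mu> * ?E Z + \<mu>\<^sup>2)"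
    unfolding lin average_cmult average_const[OF A] ..
  also have "\<dots> \<le> \<mu>" using EZ2 by (simp add: EZ power2_eq_square)
  finally show ?thesis using \<mu>(2) by (simp add: power2_eq_square field_simps)
qed

section \<open>Small sets are absorbed\<close>

definition star :: "nat \<Rightarrow> nat \<Rightarrow> vertex \<Rightarrow> edge set" where
  "star k n v = {e \<in> complete_edges k n. v \<in> e}"

text \<open>
  A stuck set would force many edges to meet it at least twice. Vertices of low degree are too far
  apart to spoil the count; a stuck set consisting of such vertices only is excluded because
  removing \<open>v\<close> destroys at most one of their \<open>d + 1\<close> edges.
\<close>

lemma absorbingI:
  assumes G: "G \<subseteq> G1" "G1 \<subseteq> complete_edges k n" and k: "1 \<le> k"
    and deg: "\<And>v. v \<in> vertices k n \<Longrightarrow> d + 1 \<le> card {e \<in> G. v \<in> e}"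
    and high: "\<And>v. v \<in> vertices k n \<Longrightarrow> v \<notin> L \<Longrightarrow> h \<le> card {e \<in> G. v \<in> e}"
    and L1: "\<And>e u v. e \<in> G1 \<Longrightarrow> u \<in> e \<inter> L \<Longrightarrow> v \<in> e \<inter> L \<Longrightarrow> u = v"
    and L2: "\<And>e e' u v w. e \<in> G1 \<Longrightarrow> e' \<in> G1 \<Longrightarrow> e \<noteq> e' \<Longrightarrow> w \<in> e \<inter> e' \<Longrightarrow> u \<in> e \<inter> L \<Longrightarrow>
      v \<in> e' \<inter> L \<Longrightarrow> u \<noteq> v \<Longrightarrow> False"
    and L3: "\<And>e e' u w. e \<in> G1 \<Longrightarrow> e' \<in> G1 \<Longrightarrow> e \<noteq> e' \<Longrightarrow> w \<in> e \<inter> e' \<Longrightarrow> u \<in> e \<inter> e' \<Longrightarrow>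
      u \<in> L \<Longrightarrow> u = w"
    and sparse: "\<And>S. S \<subseteq> vertices k n \<Longrightarrow> S \<noteq> {} \<Longrightarrow> card S \<le> m + 1 \<Longrightarrow>
      card {e \<in> G1. 2 \<le> card (e \<inter> S)} * (2 * k) < (h - d) * card S"
  shows "absorbing k n d m G"
  unfolding absorbing_def
proof (intro ballI allI impI)
  fix v S assume v: "v \<in> vertices k n" and S: "S \<subseteq> vertices k n - {v}" "S \<noteq> {}" "card S \<le> m"
  have finG1: "finite G1" using finite_subset[OF G(2) finite_complete_edges] .
  have finG: "finite G" using finite_subset[OF G(1) finG1] .
  have finS: "finite S" using S(1) by (rule finite_subset[OF _ finite_Diff[OF finite_vertices]])
  show "\<exists>u\<in>S. d \<le> card {e \<in> G. e \<inter> insert v S = {u}}"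
  proof (rule ccontr)
    assume "\<not> ?thesis"
    then have stuck: "card {e \<in> G. e \<inter> insert v S = {u}} < d" if "u \<in> S" for u using that by force
    define H where "H = S - L"
    have HS: "H \<subseteq> S" "finite H" using finS by (auto simp: H_def)
    show False
    proof (cases "H = {}")
      case True
      then have SL: "S \<subseteq> L" by (auto simp: H_def)
      obtain u where u: "u \<in> S" using S(2) by blast
      define D where "D = {e \<in> G. u \<in> e} - {e \<in> G. e \<inter> insert v S = {u}}"
      have uV: "u \<in> vertices k n" "u \<noteq> v" using S(1) u by auto
      have vD: "v \<in> e" if "e \<in> D" for e
      proof -
        have e: "e \<in> G1" "u \<in> e" "e \<inter> insert v S \<noteq> {u}" using that G(1) by (auto simp: D_def)
        then obtain w where w: "w \<in> e" "w \<noteq> u" "w \<in> insert v S" using u by blast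
        have "w \<notin> S"
        proof
          assume "w \<in> S"
          then have "w = u" using L1[OF e(1), of w u] e(2) w(1) SL u by blast
          then show False using w(2) by simp
        qed
        then show ?thesis using w by auto
      qed
      have "card {e \<in> G. u \<in> e} - card {e \<in> G. e \<inter> insert v S = {u}} \<le> card D"
        unfolding D_def by (rule diff_card_le_card_Diff) (use finG in simp)
      then have "2 \<le> card D" using deg[OF uV(1)] stuck[OF u] by linarith
      then have "\<not> card D \<le> Suc 0" by simp
      moreover have "finite D" using finG by (simp add: D_def)
      ultimately obtain e e' where ee: "e \<in> D" "e' \<in> D" "e \<noteq> e'"
        using card_le_Suc0_iff_eq by blast
      have "u = v"
      proof (rule L3[OF _ _ ee(3)])
        show "e \<in> G1" "e' \<in> G1" using ee G(1) by (auto simp: D_def)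
        show "v \<in> e \<inter> e'" using vD ee by blast
        show "u \<in> e \<inter> e'" using ee by (auto simp: D_def)
        show "u \<in> L" using SL u by blast
      qed
      then show False using uV by simp
    next
      case False
      define S' where "S' = insert v H"
      define B where "B = {e \<in> G1. 2 \<le> card (e \<inter> S')}"
      have finB: "finite B" using finG1 by (simp add: B_def)
      have many: "h - d \<le> card {e \<in> B. u \<in> e}" if u: "u \<in> H" for u
      proof -
        have uS: "u \<in> S" "u \<notin> L" "u \<in> vertices k n" "u \<noteq> v" using u S(1) by (auto simp: H_def)
        define C where "C = {e \<in> G. u \<in> e \<and> e \<inter> L \<noteq> {}}"
        have CL: "card C \<le> 1"
        proof -
          have "e = e'" if e: "e \<in> C" "e' \<in> C" for e e'
          proof (rule ccontr)
            assume ne: "e \<noteq> e'"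
            from e obtain a b where ab: "a \<in> e \<inter> L" "b \<in> e' \<inter> L" by (auto simp: C_def)
            have eG: "e \<in> G1" "e' \<in> G1" "u \<in> e \<inter> e'" using e G(1) by (auto simp: C_def)
            show False
            proof (cases "a = b")
              case True
              then have "a = u" using L3[OF eG(1,2) ne eG(3), of a] ab by blast
              then show False using ab uS(2) by blast
            qed (use L2[OF eG(1,2) ne eG(3) ab] in blast)
          qed
          then show ?thesis using finG by (simp add: C_def card_le_Suc0_iff_eq)
        qed
        have "{e \<in> G. u \<in> e} \<subseteq> {e \<in> G. e \<inter> insert v S = {u}} \<union> C \<union> {e \<in> B. u \<in> e}"
        proof
          fix e assume "e \<in> {e \<in> G. u \<in> e}"
          then have e: "e \<in> G" "u \<in> e" by auto
          show "e \<in> {e \<in> G. e \<inter> insert v S = {u}} \<union> C \<union> {e \<in> B. u \<in> e}"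
          proof (cases "e \<inter> insert v S = {u} \<or> e \<in> C")
            case False
            then obtain w where w: "w \<in> e" "w \<noteq> u" "w \<in> insert v S" using e uS(1) by blast
            have "w \<notin> L" using False e w by (auto simp: C_def)
            then have "{u, w} \<subseteq> e \<inter> S'" using w e u by (auto simp: S'_def H_def)
            moreover have "finite (e \<inter> S')" using HS by (simp add: S'_def)
            ultimately have "card {u, w} \<le> card (e \<inter> S')" by (intro card_mono)
            then show ?thesis using e G(1) w(2) by (auto simp: B_def)
          qed (use e in auto)
        qed
        then have "card {e \<in> G. u \<in> e} \<le> card ({e \<in> G. e \<inter> insert v S = {u}} \<union> C \<union> {e \<in> B. u \<in> e})"
          using finG finB by (intro card_mono) (auto simp: C_def)
        also have "\<dots> \<le> card {e \<in> G. e \<inter> insert v S = {u}} + card C + card {e \<in> B. u \<in> e}"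
          by (intro order_trans[OF card_Un_le] add_mono card_Un_le order_refl)
        finally show ?thesis using high[OF uS(3,2)] stuck[OF uS(1)] CL by linarith
      qed
      have "(h - d) * card H = (\<Sum>u\<in>H. h - d)" by simp
      also have "\<dots> \<le> (\<Sum>u\<in>H. card {e \<in> B. u \<in> e})" using many by (intro sum_mono)
      also have "\<dots> = (\<Sum>e\<in>B. card {u \<in> H. u \<in> e})"
        using HS(2) finB by (intro sum_multicount_gen) auto
      also have "\<dots> \<le> (\<Sum>e\<in>B. k)"
      proof (intro sum_mono)
        fix e assume "e \<in> B"
        then have ec: "e \<in> complete_edges k n" using G(2) by (auto simp: B_def)
        have "card {u \<in> H. u \<in> e} \<le> card e" using edge_facts(2)[OF ec] by (intro card_mono) auto
        then show "card {u \<in> H. u \<in> e} \<le> k" using edge_facts(4)[OF ec] by simp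
      qed
      finally have 1: "(h - d) * card H \<le> card B * k" by simp
      have cS': "card S' \<le> card H + 1" using HS(2) by (simp add: S'_def card_insert_if)
      have H1: "1 \<le> card H" using False HS(2) by (simp add: Suc_leI card_gt_0_iff)
      have "card H \<le> card S" using HS finS by (intro card_mono)
      then have "card S' \<le> m + 1" using cS' S(3) by simp
      moreover have "S' \<subseteq> vertices k n" "S' \<noteq> {}" using S(1) v HS(1) by (auto simp: S'_def)
      ultimately have "card B * (2 * k) < (h - d) * card S'" using sparse unfolding B_def by blast
      also have "\<dots> \<le> (h - d) * (2 * card H)" using cS' H1 by (intro mult_le_mono2) simp
      finally show False using 1 by simp
    qed
  qed
qed

section \<open>Counting edges\<close>

text \<open>
  An edge through prescribed vertices in the classes \<open>I\<close> is free in the other classes.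
\<close>

lemma card_edges_through:
  assumes "I \<subseteq> {..<k}" "\<And>i. i \<in> I \<Longrightarrow> c i < n"
  shows "card {e \<in> complete_edges k n. \<forall>i\<in>I. (i, c i) \<in> e} = n ^ (k - card I)"
proof -
  have mem: "(i, a) \<in> transversal k f \<longleftrightarrow> i < k \<and> f i = a" for i a f by (auto simp: transversal_def)
  have "{e \<in> complete_edges k n. \<forall>i\<in>I. (i, c i) \<in> e} =
      transversal k ` (\<Pi>\<^sub>E i\<in>{..<k}. if i \<in> I then {c i} else {..<n})"
  proof (intro equalityI subsetI)
    fix e assume "e \<in> {e \<in> complete_edges k n. \<forall>i\<in>I. (i, c i) \<in> e}"
    then obtain f where f: "f \<in> {..<k} \<rightarrow>\<^sub>E {..<n}" "e = transversal k f" "\<forall>i\<in>I. (i, c i) \<in> e"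
      by (auto simp: complete_edges_eq)
    then have "f \<in> (\<Pi>\<^sub>E i\<in>{..<k}. if i \<in> I then {c i} else {..<n})"
      using mem by (auto simp: PiE_iff)
    then show "e \<in> transversal k ` (\<Pi>\<^sub>E i\<in>{..<k}. if i \<in> I then {c i} else {..<n})" using f(2) by blast
  next
    fix e assume "e \<in> transversal k ` (\<Pi>\<^sub>E i\<in>{..<k}. if i \<in> I then {c i} else {..<n})"
    then obtain f where f: "f \<in> (\<Pi>\<^sub>E i\<in>{..<k}. if i \<in> I then {c i} else {..<n})" "e = transversal k f" by blast
    have fi: "f i \<in> (if i \<in> I then {c i} else {..<n})" if "i < k" for i using PiE_mem[OF f(1)] that by blast
    have "f i < n" if "i < k" for i using fi[OF that] assms(2) by (auto split: if_splits)
    then have "f \<in> {..<k} \<rightarrow>\<^sub>E {..<n}" using f(1) by (auto simp: PiE_iff)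
    moreover have "\<forall>i\<in>I. (i, c i) \<in> e" using fi assms(1) by (fastforce simp: f(2) mem)
    ultimately show "e \<in> {e \<in> complete_edges k n. \<forall>i\<in>I. (i, c i) \<in> e}"
      using f(2) by (auto simp: complete_edges_eq)
  qed
  also have "card \<dots> = card (\<Pi>\<^sub>E i\<in>{..<k}. if i \<in> I then {c i} else {..<n})"
  proof (rule card_image)
    have "(\<Pi>\<^sub>E i\<in>{..<k}. if i \<in> I then {c i} else {..<n}) \<subseteq> {..<k} \<rightarrow>\<^sub>E UNIV" by (auto simp: PiE_iff)
    then show "inj_on (transversal k) (\<Pi>\<^sub>E i\<in>{..<k}. if i \<in> I then {c i} else {..<n})"
      by (rule inj_on_subset[OF inj_transversal])
  qed
  also have "\<dots> = (\<Prod>i<k. if i \<in> I then 1 else n)" by (subst card_PiE) (auto intro!: prod.cong)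
  also have "\<dots> = (\<Prod>i\<in>{..<k} - I. n)"
    by (rule prod.mono_neutral_cong_right) (use assms(1) in auto)
  also have "\<dots> = n ^ (k - card I)"
    using assms(1) by (simp add: card_Diff_subset finite_subset)
  finally show ?thesis .
qed

lemma card_star: "v \<in> vertices k n \<Longrightarrow> card (star k n v) = n ^ (k - 1)"
  using card_edges_through[of "{fst v}" k "\<lambda>_. snd v" n] by (simp add: star_def vertices_iff)

lemma card_star_Int:
  assumes "u \<in> vertices k n" "v \<in> vertices k n" "u \<noteq> v"
  shows "card (star k n u \<inter> star k n v) \<le> n ^ (k - 2)"
    and "fst u = fst v \<Longrightarrow> star k n u \<inter> star k n v = {}"
proof -
  show disj: "fst u = fst v \<Longrightarrow> star k n u \<inter> star k n v = {}"
  proof (rule ccontr)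
    assume "fst u = fst v" "star k n u \<inter> star k n v \<noteq> {}"
    then obtain e where e: "e \<in> complete_edges k n" "u \<in> e" "v \<in> e" by (auto simp: star_def)
    have "inj_on fst e" using edge_facts(3)[OF e(1)] by (simp add: bij_betw_def)
    then show False using \<open>fst u = fst v\<close> e assms(3) by (auto dest: inj_onD)
  qed
  show "card (star k n u \<inter> star k n v) \<le> n ^ (k - 2)"
  proof (cases "fst u = fst v")
    case False
    let ?c = "\<lambda>i. if i = fst u then snd u else snd v"
    have "star k n u \<inter> star k n v = {e \<in> complete_edges k n. \<forall>i\<in>{fst u, fst v}. (i, ?c i) \<in> e}"
      using False by (auto simp: star_def)
    also have "card \<dots> = n ^ (k - card {fst u, fst v})"
      using assms by (intro card_edges_through) (auto simp: vertices_iff)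
    finally show ?thesis using False by (simp add: numeral_2_eq_2)
  qed (use disj in simp)
qed

lemma finite_star [simp]: "finite (star k n v)"
  by (simp add: star_def)

lemma card_star_Un:
  assumes "u \<in> vertices k n" "v \<in> vertices k n" "u \<noteq> v"
  shows "2 * n ^ (k - 1) \<le> card (star k n u \<union> star k n v) + n ^ (k - 2)"
  using card_Un_Int[of "star k n u" "star k n v"] card_star[OF assms(1)] card_star[OF assms(2)]
    card_star_Int(1)[OF assms] by simp

lemma card_edges_meeting_twice:
  assumes "S \<subseteq> vertices k n"
  shows "card {e \<in> complete_edges k n. 2 \<le> card (e \<inter> S)} \<le> (card S)\<^sup>2 * n ^ (k - 2)"
proof -
  have finS: "finite S" using assms finite_subset finite_vertices by blast
  let ?P = "{(u, v) \<in> S \<times> S. u \<noteq> v}"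
  have finP: "finite ?P" by (rule finite_subset[of _ "S \<times> S"]) (use finS in auto)
  have "{e \<in> complete_edges k n. 2 \<le> card (e \<inter> S)} \<subseteq> (\<Union>(u, v)\<in>?P. star k n u \<inter> star k n v)"
  proof
    fix e assume e: "e \<in> {e \<in> complete_edges k n. 2 \<le> card (e \<inter> S)}"
    then have "finite (e \<inter> S)" "\<not> card (e \<inter> S) \<le> Suc 0" using finS by auto
    then obtain u v where "u \<in> e \<inter> S" "v \<in> e \<inter> S" "u \<noteq> v" using card_le_Suc0_iff_eq by blast
    then have "(u, v) \<in> ?P" "e \<in> star k n u \<inter> star k n v" using e by (auto simp: star_def)
    then show "e \<in> (\<Union>(u, v)\<in>?P. star k n u \<inter> star k n v)" by (intro UN_I[of "(u, v)"]) simp_all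
  qed
  then have "card {e \<in> complete_edges k n. 2 \<le> card (e \<inter> S)} \<le>
      card (\<Union>(u, v)\<in>?P. star k n u \<inter> star k n v)"
    using finP by (intro card_mono) auto
  also have "\<dots> \<le> (\<Sum>(u, v)\<in>?P. card (star k n u \<inter> star k n v))"
    using card_UN_le[OF finP, of "\<lambda>(u, v). star k n u \<inter> star k n v"] by (simp add: case_prod_unfold)
  also have "\<dots> \<le> (\<Sum>(u, v)\<in>?P. n ^ (k - 2))"
    using assms by (intro sum_mono) (auto intro!: card_star_Int(1))
  also have "\<dots> = card ?P * n ^ (k - 2)" by (simp add: case_prod_unfold)
  also have "\<dots> \<le> card (S \<times> S) * n ^ (k - 2)"
    using finS by (intro mult_le_mono1 card_mono) auto
  finally show ?thesis by (simp add: card_cartesian_product power2_eq_square)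
qed

section \<open>Exceptional events\<close>

lemma edge_ordering_prob:
  "measure_pmf.prob (edge_ordering k n) S =
    measure_pmf.prob (pmf_of_set (permutations_of_set (complete_edges k n))) S"
  by (simp add: edge_ordering_def)

lemma prob_union_le:
  assumes "finite I" "\<And>es. P es \<Longrightarrow> \<exists>i\<in>I. Q i es"
    and "\<And>i. i \<in> I \<Longrightarrow> measure_pmf.prob M {es. Q i es} \<le> b i"
  shows "measure_pmf.prob M {es. P es} \<le> (\<Sum>i\<in>I. b i)"
proof -
  have "measure_pmf.prob M {es. P es} \<le> measure_pmf.prob M (\<Union>i\<in>I. {es. Q i es})"
    using assms(2) by (intro measure_pmf.finite_measure_mono) auto
  also have "\<dots> \<le> (\<Sum>i\<in>I. measure_pmf.prob M {es. Q i es})"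
    using assms(1) by (intro measure_pmf.finite_measure_subadditive_finite) auto
  also have "\<dots> \<le> (\<Sum>i\<in>I. b i)" using assms(3) by (intro sum_mono)
  finally show ?thesis .
qed

lemma prob_mono: "(\<And>es. P es \<Longrightarrow> Q es) \<Longrightarrow> measure_pmf.prob M {es. P es} \<le> measure_pmf.prob M {es. Q es}"
  by (intro measure_pmf.finite_measure_mono) auto

lemma sum_over_subsets_by_card:
  fixes g :: "nat \<Rightarrow> real"
  assumes "finite E"
  shows "(\<Sum>B | B \<subseteq> E \<and> card B \<in> R. g (card B)) = (\<Sum>r\<in>R \<inter> {..card E}. (card E choose r) * g r)"
proof -
  let ?S = "{B. B \<subseteq> E \<and> card B \<in> R}"
  have fin: "finite ?S" by (rule finite_subset[of _ "Pow E"]) (use assms in auto)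
  have "(\<Sum>B\<in>?S. g (card B)) = (\<Sum>r\<in>R \<inter> {..card E}. \<Sum>B\<in>{B \<in> ?S. card B = r}. g (card B))"
    by (rule sum.group[symmetric]) (use fin assms card_mono in auto)
  also have "\<dots> = (\<Sum>r\<in>R \<inter> {..card E}. (card E choose r) * g r)"
  proof (intro sum.cong refl)
    fix r assume r: "r \<in> R \<inter> {..card E}"
    have "{B \<in> ?S. card B = r} = {B. B \<subseteq> E \<and> card B = r}" using r by auto
    then show "(\<Sum>B\<in>{B \<in> ?S. card B = r}. g (card B)) = (card E choose r) * g r"
      by (simp add: n_subsets[OF assms])
  qed
  finally show ?thesis .
qed

text \<open>
  The factor by which the rate in \<open>prob_draws_few\<close> falls short of the rate in \<open>prob_draws_avoid\<close>.
\<close>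

definition \<xi> :: real where "\<xi> = 1 - exp (- 2)"

lemma prob_small_degree:
  fixes \<rho> :: real
  assumes "m1 \<le> n ^ k" "m1 < n ^ k" "\<rho> * n ^ k + m1 \<le> n ^ (k - 1)" "0 \<le> \<rho>" "\<rho> \<le> 1"
  shows "measure_pmf.prob (edge_ordering k n)
      {es. \<exists>v\<in>vertices k n. card (star k n v \<inter> set (take m1 es)) \<le> d}
    \<le> k * n * (exp (2 * d) * (1 - \<xi> * \<rho>) ^ m1)"
proof -
  have "measure_pmf.prob (edge_ordering k n)
      {es. \<exists>v\<in>vertices k n. card (star k n v \<inter> set (take m1 es)) \<le> d}
    \<le> (\<Sum>v\<in>vertices k n. exp (2 * d) * (1 - \<xi> * \<rho>) ^ m1)"
  proof (rule prob_union_le[OF finite_vertices])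
    fix v assume v: "v \<in> vertices k n"
    have "measure_pmf.prob (pmf_of_set (permutations_of_set (complete_edges k n)))
        {es. {} \<subseteq> set (take m1 es) \<and> card (star k n v \<inter> set (take m1 es)) \<le> real d}
      \<le> exp (2 * real d) * (draw_bound (real (n ^ k - m1)) (card ({} :: edge set)) m1 *
          (1 - (1 - exp (- 2)) * \<rho>) ^ (m1 - card ({} :: edge set)))"
      by (rule prob_draws_few) (use assms card_star[OF v] in \<open>auto simp: star_def card_complete_edges\<close>)
    then show "measure_pmf.prob (edge_ordering k n) {es. card (star k n v \<inter> set (take m1 es)) \<le> d}
        \<le> exp (2 * d) * (1 - \<xi> * \<rho>) ^ m1"
      by (simp add: edge_ordering_prob draw_bound_def \<xi>_def)
  qed auto
  then show ?thesis by (simp add: card_vertices)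
qed

text \<open>
  There are at most \<open>2 ^ (k * n)\<close> boxes, each containing at least \<open>s ^ k\<close> edges.
\<close>

lemma prob_missed_box:
  fixes \<rho> :: real
  assumes "m < n ^ k" "\<rho> * n ^ k + m \<le> s ^ k" "0 \<le> \<rho>" "\<rho> \<le> 1"
  shows "measure_pmf.prob (edge_ordering k n) {es. \<not> meets_boxes k n s (set (take m es))}
    \<le> 2 ^ (k * n) * (1 - \<rho>) ^ m"
proof -
  define Bx where "Bx = {A \<in> (\<Pi>\<^sub>E i\<in>{..<k}. Pow (vertex_class n i)). \<forall>i<k. s \<le> card (A i)}"
  have finV: "finite (vertex_class n i)" for i by (simp add: vertex_class_def)
  have finP: "finite (\<Pi>\<^sub>E i\<in>{..<k}. Pow (vertex_class n i))" using finV by (intro finite_PiE) auto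
  then have fin: "finite Bx" by (simp add: Bx_def)
  have "card Bx \<le> card (\<Pi>\<^sub>E i\<in>{..<k}. Pow (vertex_class n i))"
    using finP by (intro card_mono) (auto simp: Bx_def)
  also have "\<dots> = (\<Prod>i<k. 2 ^ n)" using finV by (simp add: card_PiE card_Pow vertex_class_def)
  also have "\<dots> = 2 ^ (k * n)" by (simp add: mult.commute flip: power_mult)
  finally have cB: "card Bx \<le> 2 ^ (k * n)" .
  define X where "X A = {e \<in> complete_edges k n. e \<subseteq> (\<Union>i<k. A i)}" for A :: "nat \<Rightarrow> vertex set"
  have "measure_pmf.prob (edge_ordering k n) {es. \<not> meets_boxes k n s (set (take m es))}
    \<le> (\<Sum>A\<in>Bx. (1 - \<rho>) ^ m)"
  proof (rule prob_union_le[OF fin])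
    fix A assume A: "A \<in> Bx"
    have AV: "A i \<subseteq> vertex_class n i" "s \<le> card (A i)" if "i < k" for i
      using A that by (auto simp: Bx_def PiE_iff)
    have "s ^ k = (\<Prod>i<k. s)" by simp
    also have "\<dots> \<le> (\<Prod>i<k. card (snd ` A i))"
    proof (intro prod_mono conjI)
      fix i assume "i \<in> {..<k}"
      then have i: "i < k" by simp
      have "inj_on snd (A i)" using AV(1)[OF i] by (auto simp: inj_on_def vertex_class_def)
      then show "s \<le> card (snd ` A i)" using AV(2)[OF i] by (simp add: card_image)
    qed simp
    also have "\<dots> = card (\<Pi>\<^sub>E i\<in>{..<k}. snd ` A i)" by (simp add: card_PiE)
    also have "\<dots> = card (transversal k ` (\<Pi>\<^sub>E i\<in>{..<k}. snd ` A i))"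
    proof (rule card_image[symmetric])
      have "(\<Pi>\<^sub>E i\<in>{..<k}. snd ` A i) \<subseteq> {..<k} \<rightarrow>\<^sub>E UNIV" by (auto simp: PiE_iff)
      then show "inj_on (transversal k) (\<Pi>\<^sub>E i\<in>{..<k}. snd ` A i)" by (rule inj_on_subset[OF inj_transversal])
    qed
    also have "\<dots> \<le> card (X A)"
    proof (rule card_mono)
      show "finite (X A)" by (simp add: X_def)
      show "transversal k ` (\<Pi>\<^sub>E i\<in>{..<k}. snd ` A i) \<subseteq> X A"
      proof
        fix e assume "e \<in> transversal k ` (\<Pi>\<^sub>E i\<in>{..<k}. snd ` A i)"
        then obtain f where f: "f \<in> (\<Pi>\<^sub>E i\<in>{..<k}. snd ` A i)" "e = transversal k f" by blast
        have fi: "(i, f i) \<in> A i" "f i < n" if i: "i < k" for i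
        proof -
          have "f i \<in> snd ` A i" using PiE_mem[OF f(1)] i by simp
          then obtain v where v: "v \<in> A i" "f i = snd v" by blast
          then have "v = (i, f i)" using AV(1)[OF i] by (cases v) (auto simp: vertex_class_def)
          then show "(i, f i) \<in> A i" using v by simp
          then show "f i < n" using AV(1)[OF i] by (auto simp: vertex_class_def)
        qed
        have "f \<in> {..<k} \<rightarrow>\<^sub>E {..<n}" using f(1) fi(2) by (auto simp: PiE_iff)
        then have "e \<in> complete_edges k n" using f(2) by (auto simp: complete_edges_eq)
        moreover have "e \<subseteq> (\<Union>i<k. A i)" using fi(1) by (auto simp: f(2) transversal_def)
        ultimately show "e \<in> X A" by (simp add: X_def)
      qed
    qed
    finally have "s ^ k \<le> card (X A)" .
    then have "real s ^ k \<le> real (card (X A))" by (metis of_nat_le_iff of_nat_power)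
    then have cX: "\<rho> * real n ^ k + real m \<le> real (card (X A))" using assms(2) by linarith
    have "measure_pmf.prob (pmf_of_set (permutations_of_set (complete_edges k n)))
        {es. {} \<subseteq> set (take m es) \<and> X A \<inter> set (take m es) = {}}
      \<le> draw_bound (real (n ^ k - m)) (card ({} :: edge set)) m * (1 - \<rho>) ^ (m - card ({} :: edge set))"
      by (rule prob_draws_avoid) (use assms cX in \<open>auto simp: X_def card_complete_edges\<close>)
    then show "measure_pmf.prob (edge_ordering k n) {es. X A \<inter> set (take m es) = {}} \<le> (1 - \<rho>) ^ m"
      by (simp add: edge_ordering_prob draw_bound_def)
  next
    fix es assume "\<not> meets_boxes k n s (set (take m es))"
    then obtain A where A: "\<forall>i<k. A i \<subseteq> vertex_class n i \<and> s \<le> card (A i)"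
      "\<forall>e\<in>set (take m es). \<not> e \<subseteq> (\<Union>i<k. A i)" unfolding meets_boxes_def by blast
    have U: "(\<Union>i<k. restrict A {..<k} i) = (\<Union>i<k. A i)" by auto
    show "\<exists>A\<in>Bx. X A \<inter> set (take m es) = {}"
    proof (rule bexI[of _ "restrict A {..<k}"])
      show "restrict A {..<k} \<in> Bx" using A(1) by (auto simp: Bx_def)
      show "X (restrict A {..<k}) \<inter> set (take m es) = {}" unfolding X_def U using A(2) by blast
    qed
  qed
  also have "\<dots> = card Bx * (1 - \<rho>) ^ m" by simp
  also have "\<dots> \<le> 2 ^ (k * n) * (1 - \<rho>) ^ m"
  proof (rule mult_right_mono)
    have "real (card Bx) \<le> real (2 ^ (k * n))" using cB by (simp only: of_nat_le_iff)
    then show "real (card Bx) \<le> 2 ^ (k * n)" by simp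
  qed (use assms in simp)
  finally show ?thesis .
qed

text \<open>
  If the closure of a small set \<open>B\<close> of drawn edges misses a fraction \<open>\<rho>\<close> of all edges, then it is
  unlikely that all further draws stay inside the closure. There are few choices of \<open>B\<close>.
\<close>

lemma prob_sparse_closure:
  fixes cl :: "edge set \<Rightarrow> edge set" and \<rho> :: real
  assumes "2 * m \<le> n ^ k" "1 \<le> n" "\<rho> * n ^ k + m + n ^ (k - 1) \<le> D" "0 < \<rho>" "\<rho> \<le> 1"
  shows "measure_pmf.prob (edge_ordering k n)
      {es. \<exists>v\<in>vertices k n. \<exists>B\<subseteq>{e \<in> set (take m es). v \<notin> e}. card B \<le> R \<and>
         {e \<in> set (take m es). v \<notin> e} \<subseteq> cl B \<and> D < card (complete_edges k n - cl B)}
    \<le> k * n * ((4 / \<rho>) ^ R * (1 - \<rho> / 2) ^ m)"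
proof -
  let ?E = "complete_edges k n" and ?T = "n ^ k"
  define t where "t = real (?T - m)"
  have T1: "?T \<ge> 1" using assms(2) by simp
  have t: "t > 0" "real ?T \<le> 2 * t" "t + m = ?T"
  proof -
    have "real (2 * m) \<le> real ?T" "real 1 \<le> real ?T" using assms(1) T1 by (simp_all only: of_nat_le_iff)
    moreover have "t = real ?T - real m" unfolding t_def using assms(1) by (intro of_nat_diff) simp
    ultimately show "t > 0" "real ?T \<le> 2 * t" "t + m = ?T" by (simp_all del: of_nat_power)
  qed
  define bd where "bd r = draw_bound t r m * (1 - \<rho>) ^ (m - r)" for r
  have one: "measure_pmf.prob (edge_ordering k n)
      {es. \<exists>B\<subseteq>{e \<in> set (take m es). v \<notin> e}. card B \<le> R \<and>
         {e \<in> set (take m es). v \<notin> e} \<subseteq> cl B \<and> D < card (?E - cl B)}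
    \<le> (4 / \<rho>) ^ R * (1 - \<rho> / 2) ^ m" if v: "v \<in> vertices k n" for v
  proof -
    define Q where "Q B es \<longleftrightarrow> B \<subseteq> set (take m es) \<and> (\<forall>e\<in>B. v \<notin> e) \<and>
         {e \<in> set (take m es). v \<notin> e} \<subseteq> cl B \<and> D < card (?E - cl B)" for B es
    have "measure_pmf.prob (edge_ordering k n)
      {es. \<exists>B\<subseteq>{e \<in> set (take m es). v \<notin> e}. card B \<le> R \<and>
         {e \<in> set (take m es). v \<notin> e} \<subseteq> cl B \<and> D < card (?E - cl B)} =
      measure_pmf.prob (edge_ordering k n)
      {es. es \<in> permutations_of_set ?E \<and> (\<exists>B\<subseteq>{e \<in> set (take m es). v \<notin> e}. card B \<le> R \<and>
         {e \<in> set (take m es). v \<notin> e} \<subseteq> cl B \<and> D < card (?E - cl B))}"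
      by (intro measure_pmf.finite_measure_eq_AE) (auto simp: edge_ordering_def AE_measure_pmf_iff set_pmf_of_set)
    also have "\<dots> \<le> (\<Sum>B | B \<subseteq> ?E \<and> card B \<in> {..R}. bd (card B))"
    proof (rule prob_union_le[where Q = Q])
      show "finite {B. B \<subseteq> ?E \<and> card B \<in> {..R}}" by (rule finite_subset[of _ "Pow ?E"]) auto
    next
      fix es assume es: "es \<in> permutations_of_set ?E \<and> (\<exists>B\<subseteq>{e \<in> set (take m es). v \<notin> e}. card B \<le> R \<and>
         {e \<in> set (take m es). v \<notin> e} \<subseteq> cl B \<and> D < card (?E - cl B))"
      then obtain B where B: "B \<subseteq> {e \<in> set (take m es). v \<notin> e}" "card B \<le> R"
         "{e \<in> set (take m es). v \<notin> e} \<subseteq> cl B" "D < card (?E - cl B)" by blast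
      have "set (take m es) \<subseteq> ?E" using es by (auto simp: permutations_of_set_def dest: in_set_takeD)
      then have "B \<in> {B. B \<subseteq> ?E \<and> card B \<in> {..R}}" using B by auto
      moreover have "Q B es" using B by (auto simp: Q_def)
      ultimately show "\<exists>B\<in>{B. B \<subseteq> ?E \<and> card B \<in> {..R}}. Q B es" by blast
    next
      fix B assume B: "B \<in> {B. B \<subseteq> ?E \<and> card B \<in> {..R}}"
      define X where "X = {e \<in> ?E. v \<notin> e} - cl B"
      show "measure_pmf.prob (edge_ordering k n) {es. Q B es} \<le> bd (card B)"
      proof (cases "B \<subseteq> cl B \<and> D < card (?E - cl B)")
        case True
        have "?E - cl B \<subseteq> X \<union> star k n v" by (auto simp: X_def star_def)
        then have "card (?E - cl B) \<le> card (X \<union> star k n v)" by (intro card_mono) (auto simp: X_def)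
        also have "\<dots> \<le> card X + n ^ (k - 1)" using card_Un_le[of X "star k n v"] card_star[OF v] by simp
        finally have "D < card X + n ^ (k - 1)" using True by linarith
        then have "real D < real (card X) + real n ^ (k - 1)" by (metis of_nat_less_iff of_nat_add of_nat_power)
        then have cX: "\<rho> * real n ^ k + real m \<le> real (card X)" using assms(3) by simp
        have "measure_pmf.prob (edge_ordering k n) {es. Q B es} \<le>
            measure_pmf.prob (edge_ordering k n) {es. B \<subseteq> set (take m es) \<and> X \<inter> set (take m es) = {}}"
          by (rule prob_mono) (auto simp: Q_def X_def)
        also have "\<dots> \<le> draw_bound t (card B) m * (1 - \<rho>) ^ (m - card B)"
          unfolding edge_ordering_prob
          by (rule prob_draws_avoid) (use B True cX t assms in \<open>auto simp: X_def card_complete_edges\<close>)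
        finally show ?thesis by (simp add: bd_def)
      next
        case False
        have "\<not> Q B es" for es using False by (auto simp: Q_def)
        then show ?thesis using draw_bound_nonneg[OF t(1)] assms by (simp add: bd_def)
      qed
    qed
    also have "\<dots> = (\<Sum>r\<in>{..R} \<inter> {..?T}. (?T choose r) * bd r)"
      unfolding sum_over_subsets_by_card[OF finite_complete_edges] card_complete_edges ..
    also have "\<dots> \<le> (\<Sum>r\<in>{..R} \<inter> {..?T}. (4 / \<rho>) ^ R * ((m choose r) * (\<rho> / 2) ^ r * (1 - \<rho>) ^ (m - r)))"
    proof (rule sum_mono)
      fix r assume r: "r \<in> {..R} \<inter> {..?T}"
      have "real ((?T choose r) * fact r) \<le> real (?T ^ r)"
        using binomial_fact_pow[of ?T r] by (simp only: of_nat_le_iff)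
      also have "\<dots> = real ?T ^ r" by simp
      also have "\<dots> \<le> (2 * t) ^ r" using t(2) by (intro power_mono) auto
      finally have "real (?T choose r) * fact r / t ^ r \<le> (2 * t) ^ r / t ^ r"
        using t(1) by (intro divide_right_mono) auto
      also have "\<dots> = 2 ^ r" using t(1) by (simp add: power_mult_distrib)
      finally have 1: "real (?T choose r) * fact r / t ^ r \<le> 2 ^ r" .
      have "(2::real) ^ r = (4 / \<rho>) ^ r * (\<rho> / 2) ^ r"
        using assms(4) by (simp flip: power_mult_distrib)
      also have "\<dots> \<le> (4 / \<rho>) ^ R * (\<rho> / 2) ^ r"
        using r assms(4,5) by (intro mult_right_mono power_increasing) (auto simp: field_simps)
      finally have 2: "(2::real) ^ r \<le> (4 / \<rho>) ^ R * (\<rho> / 2) ^ r" .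
      have "(?T choose r) * bd r = real (?T choose r) * fact r / t ^ r * ((m choose r) * (1 - \<rho>) ^ (m - r))"
        by (simp add: bd_def draw_bound_def)
      also have "\<dots> \<le> (4 / \<rho>) ^ R * (\<rho> / 2) ^ r * ((m choose r) * (1 - \<rho>) ^ (m - r))"
        using 1 2 assms(5) by (intro mult_right_mono) auto
      finally show "(?T choose r) * bd r \<le>
          (4 / \<rho>) ^ R * ((m choose r) * (\<rho> / 2) ^ r * (1 - \<rho>) ^ (m - r))" by (simp add: mult_ac)
    qed
    also have "\<dots> = (4 / \<rho>) ^ R * (\<Sum>r\<in>{..R} \<inter> {..?T}. (m choose r) * (\<rho> / 2) ^ r * (1 - \<rho>) ^ (m - r))"
      by (simp only: sum_distrib_left)
    also have "(\<Sum>r\<in>{..R} \<inter> {..?T}. (m choose r) * (\<rho> / 2) ^ r * (1 - \<rho>) ^ (m - r)) \<le>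
        (\<Sum>r\<le>m. (m choose r) * (\<rho> / 2) ^ r * (1 - \<rho>) ^ (m - r))"
    proof -
      have "(\<Sum>r\<in>{..R} \<inter> {..?T}. (m choose r) * (\<rho> / 2) ^ r * (1 - \<rho>) ^ (m - r)) =
          (\<Sum>r\<in>{..R} \<inter> {..?T} \<inter> {..m}. (m choose r) * (\<rho> / 2) ^ r * (1 - \<rho>) ^ (m - r))"
        by (intro sum.mono_neutral_right) (auto simp: binomial_eq_0 not_le)
      also have "\<dots> \<le> (\<Sum>r\<le>m. (m choose r) * (\<rho> / 2) ^ r * (1 - \<rho>) ^ (m - r))"
        using assms(4,5) by (intro sum_mono2) auto
      finally show ?thesis .
    qed
    also have "(\<Sum>r\<le>m. (m choose r) * (\<rho> / 2) ^ r * (1 - \<rho>) ^ (m - r)) = (1 - \<rho> / 2) ^ m"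
      using binomial_ring[of "\<rho> / 2" "1 - \<rho>" m] by (simp add: field_simps)
    finally show ?thesis using assms(4) by (simp add: mult_left_mono)
  qed
  have "measure_pmf.prob (edge_ordering k n)
      {es. \<exists>v\<in>vertices k n. \<exists>B\<subseteq>{e \<in> set (take m es). v \<notin> e}. card B \<le> R \<and>
         {e \<in> set (take m es). v \<notin> e} \<subseteq> cl B \<and> D < card (?E - cl B)}
    \<le> (\<Sum>v\<in>vertices k n. (4 / \<rho>) ^ R * (1 - \<rho> / 2) ^ m)"
    by (rule prob_union_le[OF finite_vertices _ one]) auto
  then show ?thesis by (simp add: card_vertices)
qed

lemma power_fact_le_exp: "0 \<le> x \<Longrightarrow> x ^ r / fact r \<le> exp (x::real)"
proof -
  assume x: "0 \<le> x"
  have "sum (\<lambda>i. x ^ i /\<^sub>R fact i) {r} \<le> suminf (\<lambda>i. x ^ i /\<^sub>R fact i)"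
    by (intro sum_le_suminf summable_exp_generic) (simp_all add: x)
  then show ?thesis by (simp add: exp_def divide_inverse mult.commute)
qed

text \<open>
  A union bound over the vertex sets \<open>S\<close> and over the sets of \<open>r (card S)\<close> edges that meet \<open>S\<close> twice.
\<close>

lemma prob_dense_small_set:
  fixes r :: "nat \<Rightarrow> nat"
  assumes "2 * m \<le> n ^ k" "1 \<le> n" "2 \<le> k"
  shows "measure_pmf.prob (edge_ordering k n)
      {es. \<exists>S\<subseteq>vertices k n. S \<noteq> {} \<and> card S \<le> M \<and>
        r (card S) \<le> card {e \<in> set (take m es). 2 \<le> card (e \<inter> S)}}
    \<le> (\<Sum>s\<in>{1..M}. (k * n) ^ s * ((2 * s\<^sup>2 * m / n\<^sup>2) ^ r s / fact (r s)))"
proof -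
  let ?E = "complete_edges k n" and ?T = "n ^ k"
  define t where "t = real (?T - m)"
  have T1: "?T \<ge> 1" using assms(2) by simp
  have t: "t > 0" "real ?T \<le> 2 * t" "t + m = ?T"
  proof -
    have "real (2 * m) \<le> real ?T" "real 1 \<le> real ?T" using assms(1) T1 by (simp_all only: of_nat_le_iff)
    moreover have "t = real ?T - real m" unfolding t_def using assms(1) by (intro of_nat_diff) simp
    ultimately show "t > 0" "real ?T \<le> 2 * t" "t + m = ?T" by (simp_all del: of_nat_power)
  qed
  define bd where "bd s = (2 * s\<^sup>2 * m / n\<^sup>2) ^ r s / fact (r s)" for s :: nat
  define Qs where "Qs S = {e \<in> ?E. 2 \<le> card (e \<inter> S)}" for S
  have one: "measure_pmf.prob (edge_ordering k n)
      {es. es \<in> permutations_of_set ?E \<and> r (card S) \<le> card {e \<in> set (take m es). 2 \<le> card (e \<inter> S)}} \<le> bd (card S)"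
    if S: "S \<subseteq> vertices k n" for S
  proof -
    let ?s = "card S" and ?r = "r (card S)"
    have finQ: "finite (Qs S)" by (simp add: Qs_def)
    have cQ: "card (Qs S) \<le> ?s\<^sup>2 * n ^ (k - 2)" unfolding Qs_def by (rule card_edges_meeting_twice[OF S])
    have "measure_pmf.prob (edge_ordering k n)
      {es. es \<in> permutations_of_set ?E \<and> ?r \<le> card {e \<in> set (take m es). 2 \<le> card (e \<inter> S)}} \<le>
      (\<Sum>F | F \<subseteq> Qs S \<and> card F \<in> {?r}. draw_bound t ?r m)"
    proof (rule prob_union_le[where Q = "\<lambda>F es. F \<subseteq> set (take m es)"])
      show "finite {F. F \<subseteq> Qs S \<and> card F \<in> {?r}}" by (rule finite_subset[of _ "Pow (Qs S)"]) (use finQ in auto)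
    next
      fix es assume es: "es \<in> permutations_of_set ?E \<and> ?r \<le> card {e \<in> set (take m es). 2 \<le> card (e \<inter> S)}"
      then have "?r \<le> card {e \<in> set (take m es). 2 \<le> card (e \<inter> S)}" by blast
      then obtain F where F: "F \<subseteq> {e \<in> set (take m es). 2 \<le> card (e \<inter> S)}" "card F = ?r"
        by (rule obtain_subset_with_card_n)
      have "set (take m es) \<subseteq> ?E" using es by (auto simp: permutations_of_set_def dest: in_set_takeD)
      then have "F \<in> {F. F \<subseteq> Qs S \<and> card F \<in> {?r}}" using F by (auto simp: Qs_def)
      then show "\<exists>F\<in>{F. F \<subseteq> Qs S \<and> card F \<in> {?r}}. F \<subseteq> set (take m es)" using F(1) by blast
    next
      fix F assume F: "F \<in> {F. F \<subseteq> Qs S \<and> card F \<in> {?r}}"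
      have "measure_pmf.prob (pmf_of_set (permutations_of_set ?E))
          {es. F \<subseteq> set (take m es) \<and> {} \<inter> set (take 0 es) = {}} \<le>
          draw_bound t (card F) m * (1 - 0) ^ (0 - card F)"
        by (rule prob_draws_avoid) (use F t in \<open>auto simp: Qs_def card_complete_edges\<close>)
      then show "measure_pmf.prob (edge_ordering k n) {es. F \<subseteq> set (take m es)} \<le> draw_bound t ?r m"
        using F by (simp add: edge_ordering_prob)
    qed
    also have "\<dots> = (card (Qs S) choose ?r) * draw_bound t ?r m"
      using n_subsets[OF finQ, of ?r] by simp
    also have "\<dots> \<le> (real (card (Qs S)) ^ ?r / fact ?r) * (m / t) ^ ?r"
    proof (rule mult_mono)
      have "real ((card (Qs S) choose ?r) * fact ?r) \<le> real (card (Qs S) ^ ?r)"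
        using binomial_fact_pow[of "card (Qs S)" ?r] by (simp only: of_nat_le_iff)
      then show "real (card (Qs S) choose ?r) \<le> real (card (Qs S)) ^ ?r / fact ?r"
        by (simp add: pos_le_divide_eq)
    qed (use draw_bound_le[OF t(1)] draw_bound_nonneg[OF t(1)] in auto)
    also have "\<dots> = (card (Qs S) * (m / t)) ^ ?r / fact ?r" by (simp add: power_mult_distrib power_divide)
    also have "\<dots> \<le> bd ?s"
    proof -
      have "k = 2 + (k - 2)" using assms(3) by simp
      then have "n ^ k = n ^ (2 + (k - 2))" by (rule arg_cong)
      then have "n ^ k = n\<^sup>2 * n ^ (k - 2)" by (simp only: power_add)
      then have Tk: "real ?T = (real n)\<^sup>2 * real n ^ (k - 2)" by (metis of_nat_mult of_nat_power)
      have mt: "real m / t \<le> real m / (real ?T / 2)" 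
      proof (rule divide_left_mono)
        have "0 < real ?T" using assms(2) by simp
        then show "0 < t * (real ?T / 2)" using t(1) by (intro mult_pos_pos) (simp_all del: of_nat_power)
      qed (use t(2) in \<open>simp_all del: of_nat_power\<close>)
      have "real (card (Qs S)) \<le> real (?s\<^sup>2 * n ^ (k - 2))" using cQ by (simp only: of_nat_le_iff)
      then have "card (Qs S) * (m / t) \<le> real (?s\<^sup>2 * n ^ (k - 2)) * (real m / (real ?T / 2))"
        using mt t(1) by (intro mult_mono) auto
      also have "\<dots> = 2 * (real ?s)\<^sup>2 * m / (real n)\<^sup>2"
        unfolding Tk using assms(2) by (simp add: field_simps)
      finally have "card (Qs S) * (m / t) \<le> 2 * (real ?s)\<^sup>2 * m / (real n)\<^sup>2" .
      then have "(card (Qs S) * (m / t)) ^ ?r \<le> (2 * (real ?s)\<^sup>2 * m / (real n)\<^sup>2) ^ ?r"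
        using t(1) by (intro power_mono) auto
      then show ?thesis by (simp add: bd_def divide_right_mono)
    qed
    finally show ?thesis .
  qed
  have "measure_pmf.prob (edge_ordering k n)
      {es. \<exists>S\<subseteq>vertices k n. S \<noteq> {} \<and> card S \<le> M \<and>
        r (card S) \<le> card {e \<in> set (take m es). 2 \<le> card (e \<inter> S)}} =
    measure_pmf.prob (edge_ordering k n)
      {es. es \<in> permutations_of_set ?E \<and> (\<exists>S\<subseteq>vertices k n. S \<noteq> {} \<and> card S \<le> M \<and>
        r (card S) \<le> card {e \<in> set (take m es). 2 \<le> card (e \<inter> S)})}"
    by (intro measure_pmf.finite_measure_eq_AE) (auto simp: edge_ordering_def AE_measure_pmf_iff set_pmf_of_set)
  also have "\<dots> \<le> (\<Sum>S | S \<subseteq> vertices k n \<and> card S \<in> {1..M}. bd (card S))"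
  proof (rule prob_union_le[OF _ _ one])
    show "finite {S. S \<subseteq> vertices k n \<and> card S \<in> {1..M}}"
      by (rule finite_subset[of _ "Pow (vertices k n)"]) auto
  next
    fix es assume "es \<in> permutations_of_set ?E \<and> (\<exists>S\<subseteq>vertices k n. S \<noteq> {} \<and> card S \<le> M \<and>
        r (card S) \<le> card {e \<in> set (take m es). 2 \<le> card (e \<inter> S)})"
    then obtain S where S: "es \<in> permutations_of_set ?E" "S \<subseteq> vertices k n" "S \<noteq> {}" "card S \<le> M"
        "r (card S) \<le> card {e \<in> set (take m es). 2 \<le> card (e \<inter> S)}" by blast
    have "finite S" using S(2) finite_subset finite_vertices by blast
    then have "card S \<in> {1..M}" using S(3,4) by (simp add: Suc_leI card_gt_0_iff)
    then show "\<exists>S\<in>{S. S \<subseteq> vertices k n \<and> card S \<in> {1..M}}.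
        es \<in> permutations_of_set ?E \<and> r (card S) \<le> card {e \<in> set (take m es). 2 \<le> card (e \<inter> S)}"
      using S by blast
  qed auto
  also have "\<dots> = (\<Sum>s\<in>{1..M} \<inter> {..k * n}. (k * n choose s) * bd s)"
    unfolding sum_over_subsets_by_card[OF finite_vertices] card_vertices ..
  also have "\<dots> \<le> (\<Sum>s\<in>{1..M} \<inter> {..k * n}. (k * n) ^ s * bd s)"
  proof (intro sum_mono mult_right_mono)
    fix s assume "s \<in> {1..M} \<inter> {..k * n}"
    then have "k * n choose s \<le> (k * n) ^ s" by (intro binomial_le_pow) auto
    then show "real (k * n choose s) \<le> real ((k * n) ^ s)" by (simp only: of_nat_le_iff)
  qed (simp add: bd_def)
  also have "\<dots> \<le> (\<Sum>s\<in>{1..M}. (k * n) ^ s * bd s)"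
    by (intro sum_mono2) (auto simp: bd_def)
  finally show ?thesis by (simp add: bd_def)
qed

definition low_degree :: "nat \<Rightarrow> nat \<Rightarrow> nat \<Rightarrow> real \<Rightarrow> edge list \<Rightarrow> vertex \<Rightarrow> bool" where
  "low_degree k n m r es v \<longleftrightarrow> real (card (star k n v \<inter> set (take m es))) \<le> r"

text \<open>
  The edges of \<open>F\<close> are removed from \<open>Y\<close> to make the two sets disjoint, which explains the summand 2.
\<close>

lemma prob_drawn_and_few:
  fixes \<rho> r :: real
  assumes m: "m0 \<le> m1" "2 * m1 \<le> n ^ k" and n: "1 \<le> n"
    and F: "F \<subseteq> complete_edges k n" "card F \<le> 2" and Y: "Y \<subseteq> complete_edges k n"
    and \<rho>: "\<rho> * n ^ k + m0 + 2 \<le> card Y" "0 \<le> \<rho>" "\<rho> \<le> 1" and r: "0 \<le> r"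
  shows "measure_pmf.prob (edge_ordering k n)
      {es. F \<subseteq> set (take m1 es) \<and> card (Y \<inter> set (take m0 es)) \<le> r}
    \<le> (2 * real m1 / real n ^ k) ^ card F * (exp (2 * r) * (1 - \<xi> * \<rho>) ^ (m0 - 2))"
proof -
  let ?E = "complete_edges k n"
  define t where "t = real (n ^ k - m1)"
  have "real (2 * m1) \<le> real (n ^ k)" using m(2) by (simp only: of_nat_le_iff)
  then have m2: "2 * real m1 \<le> real n ^ k" by simp
  have n0: "0 < real n ^ k" using n by simp
  have "t = real (n ^ k) - real m1" unfolding t_def using m(2) by (intro of_nat_diff) simp
  then have "t = real n ^ k - real m1" by simp
  then have t: "t > 0" "real n ^ k / 2 \<le> t" "t + real m1 = real n ^ k" "0 < real n ^ k"
    using m2 n0 by linarith+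
  have fin: "finite F" "finite Y" using F(1) Y finite_subset finite_complete_edges by blast+
  define X where "X = Y - F"
  have "card Y - card F \<le> card X" unfolding X_def by (rule diff_card_le_card_Diff[OF fin(1)])
  then have "card Y \<le> card X + 2" using F(2) by linarith
  then have "real (card Y) \<le> real (card X) + 2" by linarith
  then have cX: "\<rho> * real n ^ k + real m0 \<le> real (card X)" using \<rho>(1) by linarith
  have \<beta>: "0 \<le> 1 - \<xi> * \<rho>" "1 - \<xi> * \<rho> \<le> 1"
    using \<rho>(2,3) mult_le_one[of \<xi> \<rho>] by (auto simp: \<xi>_def)
  have "measure_pmf.prob (edge_ordering k n)
      {es. F \<subseteq> set (take m1 es) \<and> card (Y \<inter> set (take m0 es)) \<le> r} \<le>
    measure_pmf.prob (edge_ordering k n)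
      {es. F \<subseteq> set (take m1 es) \<and> card (X \<inter> set (take m0 es)) \<le> r}"
  proof (rule prob_mono)
    fix es assume es: "F \<subseteq> set (take m1 es) \<and> card (Y \<inter> set (take m0 es)) \<le> r"
    have "card (X \<inter> set (take m0 es)) \<le> card (Y \<inter> set (take m0 es))"
      by (intro card_mono) (auto simp: X_def)
    then show "F \<subseteq> set (take m1 es) \<and> card (X \<inter> set (take m0 es)) \<le> r" using es by linarith
  qed
  also have "\<dots> \<le> exp (2 * r) * (draw_bound t (card F) m1 * (1 - (1 - exp (- 2)) * \<rho>) ^ (m0 - card F))"
    unfolding edge_ordering_prob
  proof (rule prob_draws_few)
    show "X \<subseteq> ?E" "F \<inter> X = {}" using Y by (auto simp: X_def)
    show "\<rho> * real (card ?E) + real m0 \<le> real (card X)" "t + real m1 \<le> real (card ?E)"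
      using cX t(3) by (simp_all add: card_complete_edges)
    show "0 < t" by (rule t(1))
  qed (use m F(1) \<rho>(2,3) r in auto)
  also have "\<dots> \<le> exp (2 * r) * ((2 * real m1 / real n ^ k) ^ card F * (1 - \<xi> * \<rho>) ^ (m0 - 2))"
  proof -
    have "0 < t * (real n ^ k / 2)" using t(1,4) by simp
    then have "m1 / t \<le> m1 / (real n ^ k / 2)" by (intro divide_left_mono t(2)) auto
    then have "(m1 / t) ^ card F \<le> (2 * real m1 / real n ^ k) ^ card F"
      using t(1) by (intro power_mono) (auto simp: mult.commute)
    then have "draw_bound t (card F) m1 \<le> (2 * real m1 / real n ^ k) ^ card F"
      using draw_bound_le[OF t(1), of "card F" m1] by linarith
    moreover have "(1 - \<xi> * \<rho>) ^ (m0 - card F) \<le> (1 - \<xi> * \<rho>) ^ (m0 - 2)"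
      using \<beta> F(2) by (intro power_decreasing) auto
    ultimately have "draw_bound t (card F) m1 * (1 - \<xi> * \<rho>) ^ (m0 - card F) \<le>
        (2 * real m1 / real n ^ k) ^ card F * (1 - \<xi> * \<rho>) ^ (m0 - 2)"
      using \<beta>(1) t(4) by (intro mult_mono) auto
    then have "exp (2 * r) * (draw_bound t (card F) m1 * (1 - \<xi> * \<rho>) ^ (m0 - card F)) \<le>
        exp (2 * r) * ((2 * real m1 / real n ^ k) ^ card F * (1 - \<xi> * \<rho>) ^ (m0 - 2))"
      by (intro mult_left_mono) auto
    then show ?thesis by (simp only: \<xi>_def)
  qed
  finally show ?thesis by (simp add: mult_ac)
qed

lemma card_Sigma_le:
  assumes "finite A" "\<And>a. a \<in> A \<Longrightarrow> finite (B a)" "\<And>a. a \<in> A \<Longrightarrow> card (B a) \<le> b"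
  shows "card (Sigma A B) \<le> card A * b"
proof -
  have "card (Sigma A B) = (\<Sum>a\<in>A. card (B a))" using assms by simp
  also have "\<dots> \<le> (\<Sum>a\<in>A. b)" using assms(3) by (intro sum_mono)
  finally show ?thesis by simp
qed

context
  fixes k n m0 m1 :: nat and r \<rho>1 \<rho>2 :: real
  assumes k: "k \<ge> 2" and n: "1 \<le> n" and m: "m0 \<le> m1" "2 * m1 \<le> n ^ k" and r: "0 \<le> r"
    and \<rho>1: "\<rho>1 * real n ^ k + m0 + 2 \<le> real n ^ (k - 1)" "0 \<le> \<rho>1" "\<rho>1 \<le> 1"
    and \<rho>2: "\<rho>2 * real n ^ k + m0 + 2 + real n ^ (k - 2) \<le> 2 * real n ^ (k - 1)" "0 \<le> \<rho>2" "\<rho>2 \<le> 1"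
begin

text \<open>
  The stars of \<open>u\<close> and \<open>v\<close> are almost disjoint, so together they have almost twice the size of one star.
\<close>

lemma prob_drawn_low_pair:
  assumes F: "F \<subseteq> complete_edges k n" "card F \<le> 2" and uv: "u \<in> vertices k n" "v \<in> vertices k n" "u \<noteq> v"
  shows "measure_pmf.prob (edge_ordering k n)
      {es. F \<subseteq> set (take m1 es) \<and> low_degree k n m0 r es u \<and> low_degree k n m0 r es v}
    \<le> (2 * real m1 / real n ^ k) ^ card F * (exp (4 * r) * (1 - \<xi> * \<rho>2) ^ (m0 - 2))"
proof -
  let ?Y = "star k n u \<union> star k n v"
  have "real (2 * n ^ (k - 1)) \<le> real (card ?Y + n ^ (k - 2))"
    using card_star_Un[OF uv] by (simp only: of_nat_le_iff)
  then have cY: "\<rho>2 * real n ^ k + real m0 + 2 \<le> real (card ?Y)" using \<rho>2(1) by simp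
  have "measure_pmf.prob (edge_ordering k n)
      {es. F \<subseteq> set (take m1 es) \<and> low_degree k n m0 r es u \<and> low_degree k n m0 r es v} \<le>
    measure_pmf.prob (edge_ordering k n)
      {es. F \<subseteq> set (take m1 es) \<and> card (?Y \<inter> set (take m0 es)) \<le> 2 * r}"
  proof (rule prob_mono)
    fix es assume es: "F \<subseteq> set (take m1 es) \<and> low_degree k n m0 r es u \<and> low_degree k n m0 r es v"
    have "card (?Y \<inter> set (take m0 es)) \<le> card (star k n u \<inter> set (take m0 es)) + card (star k n v \<inter> set (take m0 es))"
      unfolding Int_Un_distrib2 by (rule card_Un_le)
    then show "F \<subseteq> set (take m1 es) \<and> card (?Y \<inter> set (take m0 es)) \<le> 2 * r"
      using es unfolding low_degree_def by linarith
  qed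
  also have "\<dots> \<le> (2 * real m1 / real n ^ k) ^ card F * (exp (2 * (2 * r)) * (1 - \<xi> * \<rho>2) ^ (m0 - 2))"
    by (rule prob_drawn_and_few[OF m n F _ cY \<rho>2(2,3)]) (use r in \<open>auto simp: star_def\<close>)
  finally show ?thesis by simp
qed

lemma pairs_factor: "real n ^ k * real n ^ (k - 1) * (2 * real m1 / real n ^ k)\<^sup>2 = 4 * real m1 ^ 2 / n"
  and triples_factor: "real n ^ k * real n ^ (k - 2) * (2 * real m1 / real n ^ k)\<^sup>2 = 4 * real m1 ^ 2 / real n ^ 2"
proof -
  obtain c where c: "k = Suc (Suc c)" using that[of "k - 2"] k by simp
  show "real n ^ k * real n ^ (k - 1) * (2 * real m1 / real n ^ k)\<^sup>2 = 4 * real m1 ^ 2 / n"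
    "real n ^ k * real n ^ (k - 2) * (2 * real m1 / real n ^ k)\<^sup>2 = 4 * real m1 ^ 2 / real n ^ 2"
    using n by (simp_all add: c power2_eq_square divide_simps)
qed

lemma prob_two_low_in_edge:
  "measure_pmf.prob (edge_ordering k n) {es. \<exists>e\<in>complete_edges k n. \<exists>u\<in>e. \<exists>v\<in>e. u \<noteq> v \<and>
      e \<in> set (take m1 es) \<and> low_degree k n m0 r es u \<and> low_degree k n m0 r es v}
    \<le> 2 * real k ^ 2 * m1 * (exp (4 * r) * (1 - \<xi> * \<rho>2) ^ (m0 - 2))"
proof -
  let ?I = "SIGMA e:complete_edges k n. e \<times> e"
  let ?b = "(2 * real m1 / real n ^ k) * (exp (4 * r) * (1 - \<xi> * \<rho>2) ^ (m0 - 2))"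
  have b0: "0 \<le> ?b" using \<rho>2(2,3) mult_le_one[of \<xi> \<rho>2] by (auto simp: \<xi>_def)
  have fin: "finite ?I" using edge_facts(2) by (intro finite_SigmaI) auto
  have "card ?I \<le> card (complete_edges k n) * k\<^sup>2"
    using edge_facts(2,4) by (intro card_Sigma_le) (auto simp: card_cartesian_product power2_eq_square)
  then have cI: "card ?I \<le> n ^ k * k\<^sup>2" by (simp add: card_complete_edges)
  have "measure_pmf.prob (edge_ordering k n) {es. \<exists>e\<in>complete_edges k n. \<exists>u\<in>e. \<exists>v\<in>e. u \<noteq> v \<and>
      e \<in> set (take m1 es) \<and> low_degree k n m0 r es u \<and> low_degree k n m0 r es v} \<le> (\<Sum>i\<in>?I. ?b)"
  proof (rule prob_union_le[OF fin, where Q = "\<lambda>(e, u, v) es. u \<noteq> v \<and> {e} \<subseteq> set (take m1 es) \<and>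
      low_degree k n m0 r es u \<and> low_degree k n m0 r es v"])
    fix es assume "\<exists>e\<in>complete_edges k n. \<exists>u\<in>e. \<exists>v\<in>e. u \<noteq> v \<and>
      e \<in> set (take m1 es) \<and> low_degree k n m0 r es u \<and> low_degree k n m0 r es v"
    then obtain e u v where "e \<in> complete_edges k n" "u \<in> e" "v \<in> e" "u \<noteq> v"
      "e \<in> set (take m1 es)" "low_degree k n m0 r es u" "low_degree k n m0 r es v" by blast
    then show "\<exists>i\<in>?I. (\<lambda>(e, u, v) es. u \<noteq> v \<and> {e} \<subseteq> set (take m1 es) \<and>
      low_degree k n m0 r es u \<and> low_degree k n m0 r es v) i es"
      by (intro bexI[of _ "(e, u, v)"]) auto
  next
    fix i assume i: "i \<in> ?I"
    obtain e u v where euv: "i = (e, u, v)" by (cases i) auto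
    have e: "e \<in> complete_edges k n" "u \<in> e" "v \<in> e" using i euv by auto
    have V: "u \<in> vertices k n" "v \<in> vertices k n" using edge_facts(1)[OF e(1)] e by auto
    show "measure_pmf.prob (edge_ordering k n) {es. (\<lambda>(e, u, v) es. u \<noteq> v \<and> {e} \<subseteq> set (take m1 es) \<and>
      low_degree k n m0 r es u \<and> low_degree k n m0 r es v) i es} \<le> ?b"
    proof (cases "u = v")
      case False
      then show ?thesis using prob_drawn_low_pair[of "{e}" u v] V e by (simp add: euv)
    qed (use b0 in \<open>simp add: euv\<close>)
  qed
  also have "\<dots> = card ?I * ?b" by simp
  also have "\<dots> \<le> real (n ^ k * k\<^sup>2) * ?b"
    by (rule mult_right_mono[OF _ b0]) (use cI in \<open>simp only: of_nat_le_iff\<close>)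
  also have "\<dots> = 2 * real k ^ 2 * m1 * (exp (4 * r) * (1 - \<xi> * \<rho>2) ^ (m0 - 2))"
    using n by (simp add: field_simps)
  finally show ?thesis .
qed

lemma prob_two_low_in_path:
  "measure_pmf.prob (edge_ordering k n) {es. \<exists>e\<in>complete_edges k n. \<exists>w\<in>e. \<exists>e'\<in>star k n w.
      \<exists>u\<in>e. \<exists>v\<in>e'. e \<noteq> e' \<and> u \<noteq> v \<and> {e, e'} \<subseteq> set (take m1 es) \<and>
      low_degree k n m0 r es u \<and> low_degree k n m0 r es v}
    \<le> 4 * real k ^ 3 * (real m1)\<^sup>2 / real n * (exp (4 * r) * (1 - \<xi> * \<rho>2) ^ (m0 - 2))"
proof -
  let ?I = "SIGMA e:complete_edges k n. SIGMA w:e. SIGMA e':star k n w. e \<times> e'"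
  let ?c = "exp (4 * r) * (1 - \<xi> * \<rho>2) ^ (m0 - 2)"
  let ?b = "(2 * real m1 / real n ^ k)\<^sup>2 * ?c"
  have c0: "0 \<le> ?c" using \<rho>2(2,3) mult_le_one[of \<xi> \<rho>2] by (auto simp: \<xi>_def)
  have b0: "0 \<le> ?b" using c0 by simp
  have fin: "finite ?I" using edge_facts(2) by (intro finite_SigmaI) (auto simp: star_def)
  have "card ?I \<le> card (complete_edges k n) * (k * (n ^ (k - 1) * k\<^sup>2))"
  proof (rule card_Sigma_le)
    fix e assume e: "e \<in> complete_edges k n"
    note ef = edge_facts[OF e]
    show "finite (SIGMA w:e. SIGMA e':star k n w. e \<times> e')"
      using ef(2) edge_facts(2) by (intro finite_SigmaI) (auto simp: star_def)
    have "card (SIGMA w:e. SIGMA e':star k n w. e \<times> e') \<le> card e * (n ^ (k - 1) * k\<^sup>2)"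
    proof (rule card_Sigma_le[OF ef(2)])
      fix w assume "w \<in> e"
      then have w: "w \<in> vertices k n" using ef(1) by auto
      show "finite (SIGMA e':star k n w. e \<times> e')"
        using ef(2) edge_facts(2) by (intro finite_SigmaI) (auto simp: star_def)
      have "card (SIGMA e':star k n w. e \<times> e') \<le> card (star k n w) * k\<^sup>2"
        using ef(2,4) edge_facts(2,4)
        by (intro card_Sigma_le) (auto simp: star_def card_cartesian_product power2_eq_square)
      then show "card (SIGMA e':star k n w. e \<times> e') \<le> n ^ (k - 1) * k\<^sup>2" by (simp add: card_star[OF w])
    qed
    then show "card (SIGMA w:e. SIGMA e':star k n w. e \<times> e') \<le> k * (n ^ (k - 1) * k\<^sup>2)" by (simp add: ef(4))
  qed simp
  then have cI: "card ?I \<le> n ^ k * (k * (n ^ (k - 1) * k\<^sup>2))" by (simp add: card_complete_edges)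
  have "measure_pmf.prob (edge_ordering k n) {es. \<exists>e\<in>complete_edges k n. \<exists>w\<in>e. \<exists>e'\<in>star k n w.
      \<exists>u\<in>e. \<exists>v\<in>e'. e \<noteq> e' \<and> u \<noteq> v \<and> {e, e'} \<subseteq> set (take m1 es) \<and>
      low_degree k n m0 r es u \<and> low_degree k n m0 r es v} \<le> (\<Sum>i\<in>?I. ?b)"
  proof (rule prob_union_le[OF fin, where Q = "\<lambda>(e, w, e', u, v) es. e \<noteq> e' \<and> u \<noteq> v \<and>
      {e, e'} \<subseteq> set (take m1 es) \<and> low_degree k n m0 r es u \<and> low_degree k n m0 r es v"])
    fix es assume "\<exists>e\<in>complete_edges k n. \<exists>w\<in>e. \<exists>e'\<in>star k n w. \<exists>u\<in>e. \<exists>v\<in>e'. e \<noteq> e' \<and> u \<noteq> v \<and>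
      {e, e'} \<subseteq> set (take m1 es) \<and> low_degree k n m0 r es u \<and> low_degree k n m0 r es v"
    then obtain e w e' u v where "e \<in> complete_edges k n" "w \<in> e" "e' \<in> star k n w" "u \<in> e" "v \<in> e'"
      "e \<noteq> e'" "u \<noteq> v" "{e, e'} \<subseteq> set (take m1 es)" "low_degree k n m0 r es u" "low_degree k n m0 r es v"
      by (elim bexE conjE) (rule that, assumption+)
    then show "\<exists>i\<in>?I. (\<lambda>(e, w, e', u, v) es. e \<noteq> e' \<and> u \<noteq> v \<and>
      {e, e'} \<subseteq> set (take m1 es) \<and> low_degree k n m0 r es u \<and> low_degree k n m0 r es v) i es"
      by (intro bexI[of _ "(e, w, e', u, v)"]) (simp_all only: mem_Sigma_iff case_prod_conv mem_Times_iff fst_conv snd_conv simp_thms)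
  next
    fix i assume i: "i \<in> ?I"
    obtain e w e' u v where euv: "i = (e, w, e', u, v)" by (cases i) auto
    have e: "e \<in> complete_edges k n" "e' \<in> complete_edges k n" "u \<in> e" "v \<in> e'"
      using i by (auto simp: euv star_def)
    have V: "u \<in> vertices k n" "v \<in> vertices k n"
      using edge_facts(1)[OF e(1)] edge_facts(1)[OF e(2)] e by auto
    show "measure_pmf.prob (edge_ordering k n) {es. (\<lambda>(e, w, e', u, v) es. e \<noteq> e' \<and> u \<noteq> v \<and>
      {e, e'} \<subseteq> set (take m1 es) \<and> low_degree k n m0 r es u \<and> low_degree k n m0 r es v) i es} \<le> ?b"
    proof (cases "u = v \<or> e = e'")
      case False
      then show ?thesis using prob_drawn_low_pair[of "{e, e'}" u v] V e by (simp add: euv power2_eq_square)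
    next
      case True
      then have "{es. (\<lambda>(e, w, e', u, v) es. e \<noteq> e' \<and> u \<noteq> v \<and> {e, e'} \<subseteq> set (take m1 es) \<and>
          low_degree k n m0 r es u \<and> low_degree k n m0 r es v) i es} = {}" by (auto simp: euv)
      then show ?thesis using b0 by simp
    qed
  qed
  also have "\<dots> = card ?I * ?b" by simp
  also have "\<dots> \<le> real (n ^ k * (k * (n ^ (k - 1) * k\<^sup>2))) * ?b"
    by (rule mult_right_mono[OF _ b0]) (use cI in \<open>simp only: of_nat_le_iff\<close>)
  also have "\<dots> = real k ^ 3 * (real n ^ k * real n ^ (k - 1) * (2 * real m1 / real n ^ k)\<^sup>2) * ?c"
    by (simp add: power2_eq_square power3_eq_cube mult_ac)
  also have "\<dots> = 4 * real k ^ 3 * (real m1)\<^sup>2 / real n * ?c" unfolding pairs_factor by simp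
  finally show ?thesis .
qed

lemma prob_low_in_two_edges:
  "measure_pmf.prob (edge_ordering k n) {es. \<exists>e\<in>complete_edges k n. \<exists>u\<in>e. \<exists>w\<in>e - {u}.
      \<exists>e'\<in>star k n u \<inter> star k n w. e \<noteq> e' \<and> {e, e'} \<subseteq> set (take m1 es) \<and> low_degree k n m0 r es u}
    \<le> 4 * real k ^ 2 * (real m1)\<^sup>2 / (real n)\<^sup>2 * (exp (2 * r) * (1 - \<xi> * \<rho>1) ^ (m0 - 2))"
proof -
  let ?I = "SIGMA e:complete_edges k n. SIGMA u:e. SIGMA w:e - {u}. star k n u \<inter> star k n w"
  let ?c = "exp (2 * r) * (1 - \<xi> * \<rho>1) ^ (m0 - 2)"
  let ?b = "(2 * real m1 / real n ^ k)\<^sup>2 * ?c"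
  have c0: "0 \<le> ?c" using \<rho>1(2,3) mult_le_one[of \<xi> \<rho>1] by (auto simp: \<xi>_def)
  have b0: "0 \<le> ?b" using c0 by simp
  have fin: "finite ?I" using edge_facts(2) by (intro finite_SigmaI) auto
  have "card ?I \<le> card (complete_edges k n) * (k * (k * n ^ (k - 2)))"
  proof (rule card_Sigma_le)
    fix e assume e: "e \<in> complete_edges k n"
    note ef = edge_facts[OF e]
    show "finite (SIGMA u:e. SIGMA w:e - {u}. star k n u \<inter> star k n w)"
      using ef(2) by (intro finite_SigmaI) auto
    have "card (SIGMA u:e. SIGMA w:e - {u}. star k n u \<inter> star k n w) \<le> card e * (k * n ^ (k - 2))"
    proof (rule card_Sigma_le[OF ef(2)])
      fix u assume u: "u \<in> e"
      show "finite (SIGMA w:e - {u}. star k n u \<inter> star k n w)" using ef(2) by (intro finite_SigmaI) auto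
      have "card (SIGMA w:e - {u}. star k n u \<inter> star k n w) \<le> card (e - {u}) * n ^ (k - 2)"
        using ef(1,2) u by (intro card_Sigma_le card_star_Int(1)) auto
      also have "\<dots> \<le> k * n ^ (k - 2)"
        using card_mono[of e "e - {u}"] ef(2,4) by (intro mult_le_mono1) auto
      finally show "card (SIGMA w:e - {u}. star k n u \<inter> star k n w) \<le> k * n ^ (k - 2)" .
    qed
    then show "card (SIGMA u:e. SIGMA w:e - {u}. star k n u \<inter> star k n w) \<le> k * (k * n ^ (k - 2))"
      by (simp add: ef(4))
  qed simp
  then have cI: "card ?I \<le> n ^ k * (k * (k * n ^ (k - 2)))" by (simp add: card_complete_edges)
  have "measure_pmf.prob (edge_ordering k n) {es. \<exists>e\<in>complete_edges k n. \<exists>u\<in>e. \<exists>w\<in>e - {u}.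
      \<exists>e'\<in>star k n u \<inter> star k n w. e \<noteq> e' \<and> {e, e'} \<subseteq> set (take m1 es) \<and> low_degree k n m0 r es u}
      \<le> (\<Sum>i\<in>?I. ?b)"
  proof (rule prob_union_le[OF fin, where Q = "\<lambda>(e, u, w, e') es. e \<noteq> e' \<and>
      {e, e'} \<subseteq> set (take m1 es) \<and> low_degree k n m0 r es u"])
    fix es assume "\<exists>e\<in>complete_edges k n. \<exists>u\<in>e. \<exists>w\<in>e - {u}.
      \<exists>e'\<in>star k n u \<inter> star k n w. e \<noteq> e' \<and> {e, e'} \<subseteq> set (take m1 es) \<and> low_degree k n m0 r es u"
    then obtain e u w e' where "e \<in> complete_edges k n" "u \<in> e" "w \<in> e - {u}"
      "e' \<in> star k n u \<inter> star k n w" "e \<noteq> e'" "{e, e'} \<subseteq> set (take m1 es)" "low_degree k n m0 r es u"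
      by blast
    then show "\<exists>i\<in>?I. (\<lambda>(e, u, w, e') es. e \<noteq> e' \<and>
      {e, e'} \<subseteq> set (take m1 es) \<and> low_degree k n m0 r es u) i es"
      by (intro bexI[of _ "(e, u, w, e')"]) simp_all
  next
    fix i assume i: "i \<in> ?I"
    obtain e u w e' where euv: "i = (e, u, w, e')" by (cases i) auto
    have e: "e \<in> complete_edges k n" "e' \<in> complete_edges k n" "u \<in> e"
      using i by (auto simp: euv star_def)
    have V: "u \<in> vertices k n" using edge_facts(1)[OF e(1)] e by auto
    have cu: "\<rho>1 * real n ^ k + real m0 + 2 \<le> real (card (star k n u))" using \<rho>1(1) by (simp add: card_star[OF V])
    show "measure_pmf.prob (edge_ordering k n) {es. (\<lambda>(e, u, w, e') es. e \<noteq> e' \<and>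
      {e, e'} \<subseteq> set (take m1 es) \<and> low_degree k n m0 r es u) i es} \<le> ?b"
    proof (cases "e = e'")
      case False
      have "measure_pmf.prob (edge_ordering k n)
          {es. {e, e'} \<subseteq> set (take m1 es) \<and> card (star k n u \<inter> set (take m0 es)) \<le> r}
        \<le> (2 * real m1 / real n ^ k) ^ card {e, e'} * ?c"
        by (rule prob_drawn_and_few[OF m n _ _ _ cu \<rho>1(2,3) r]) (use e False in \<open>auto simp: star_def\<close>)
      then show ?thesis using False by (simp add: euv low_degree_def power2_eq_square)
    next
      case True
      then have "{es. (\<lambda>(e, u, w, e') es. e \<noteq> e' \<and>
          {e, e'} \<subseteq> set (take m1 es) \<and> low_degree k n m0 r es u) i es} = {}" by (auto simp: euv)
      then show ?thesis using b0 by simp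
    qed
  qed
  also have "\<dots> = card ?I * ?b" by simp
  also have "\<dots> \<le> real (n ^ k * (k * (k * n ^ (k - 2)))) * ?b"
    by (rule mult_right_mono[OF _ b0]) (use cI in \<open>simp only: of_nat_le_iff\<close>)
  also have "\<dots> = real k ^ 2 * (real n ^ k * real n ^ (k - 2) * (2 * real m1 / real n ^ k)\<^sup>2) * ?c"
    by (simp add: power2_eq_square mult_ac)
  also have "\<dots> = 4 * real k ^ 2 * (real m1)\<^sup>2 / (real n)\<^sup>2 * ?c" unfolding triples_factor by simp
  finally show ?thesis .
qed

end

section \<open>Good orderings\<close>

lemma degree_in_eq_star: "G \<subseteq> complete_edges k n \<Longrightarrow> {e \<in> G. v \<in> e} = star k n v \<inter> G"
  by (auto simp: star_def)

lemma min_degree_ge_iff: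
  assumes "G \<subseteq> complete_edges k n" "1 \<le> k" "1 \<le> n"
  shows "s \<le> min_degree k n G \<longleftrightarrow> (\<forall>v\<in>vertices k n. s \<le> card (star k n v \<inter> G))"
proof -
  have "(0, 0) \<in> vertices k n" using assms(2,3) by (auto simp: vertices_def vertex_class_def)
  then have "vertices k n \<noteq> {}" by blast
  then have "s \<le> min_degree k n G \<longleftrightarrow> (\<forall>v\<in>vertices k n. s \<le> degree_in G v)"
    unfolding min_degree_def using finite_vertices by (subst Min_ge_iff) auto
  then show ?thesis by (simp add: degree_in_def degree_in_eq_star[OF assms(1)])
qed

text \<open>
  The exceptional events. The first three say that vertices of low degree at time \<open>m0\<close> are close to each
  other, or lie on a short cycle, in the graph at time \<open>m1\<close>.
\<close>

definition two_low_in_edge where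
  "two_low_in_edge k n m0 m1 r es \<longleftrightarrow> (\<exists>e\<in>complete_edges k n. \<exists>u\<in>e. \<exists>v\<in>e. u \<noteq> v \<and>
      e \<in> set (take m1 es) \<and> low_degree k n m0 r es u \<and> low_degree k n m0 r es v)"

definition two_low_in_path where
  "two_low_in_path k n m0 m1 r es \<longleftrightarrow> (\<exists>e\<in>complete_edges k n. \<exists>w\<in>e. \<exists>e'\<in>star k n w.
      \<exists>u\<in>e. \<exists>v\<in>e'. e \<noteq> e' \<and> u \<noteq> v \<and> {e, e'} \<subseteq> set (take m1 es) \<and>
      low_degree k n m0 r es u \<and> low_degree k n m0 r es v)"

definition low_in_two_edges where
  "low_in_two_edges k n m0 m1 r es \<longleftrightarrow> (\<exists>e\<in>complete_edges k n. \<exists>u\<in>e. \<exists>w\<in>e - {u}.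
      \<exists>e'\<in>star k n u \<inter> star k n w. e \<noteq> e' \<and> {e, e'} \<subseteq> set (take m1 es) \<and> low_degree k n m0 r es u)"

definition dense_small_set where
  "dense_small_set k n m1 M g es \<longleftrightarrow> (\<exists>S\<subseteq>vertices k n. S \<noteq> {} \<and> card S \<le> M \<and>
        g (card S) \<le> card {e \<in> set (take m1 es). 2 \<le> card (e \<inter> S)})"

definition sparse_closure where
  "sparse_closure k n m0 cl R D es \<longleftrightarrow>
    (\<exists>v\<in>vertices k n. \<exists>B\<subseteq>{e \<in> set (take m0 es). v \<notin> e}. card B \<le> R \<and>
       {e \<in> set (take m0 es). v \<notin> e} \<subseteq> cl B \<and> D < card (complete_edges k n - cl B))"

text \<open>
  Outside the exceptional events the stopping time lies between \<open>m0\<close> and \<open>m1\<close>, so the stopped graph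
  contains the graph at time \<open>m0\<close> and is contained in the graph at time \<open>m1\<close>.
\<close>

lemma stopped_process_globally_rigid:
  fixes \<iota> :: "'a::field_char_0 \<Rightarrow> complex" and r :: real
  assumes \<iota>: "\<iota> 0 = 0" "\<iota> 1 = 1" "inj \<iota>" "\<And>a b. \<iota> (a * b) = \<iota> a * \<iota> b"
    and k: "k \<ge> 3" and d: "d \<ge> 1"
    and es: "es \<in> permutations_of_set (complete_edges k n)"
    and isolated: "\<not> (\<forall>v\<in>vertex_class n 0. star k n v \<inter> set (take m0 es) \<noteq> {})"
    and degree: "\<not> (\<exists>v\<in>vertices k n. card (star k n v \<inter> set (take m1 es)) \<le> d)"
    and box: "meets_boxes k n s (set (take m0 es))"
    and closure: "\<not> sparse_closure k n m0 (rigidity_closure TYPE('a) k n d) (d * k * n) D es"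
    and low: "\<not> two_low_in_edge k n m0 m1 r es" "\<not> two_low_in_path k n m0 m1 r es"
      "\<not> low_in_two_edges k n m0 m1 r es"
    and sparse: "\<not> dense_small_set k n m1 (m + 1) g es"
    and n: "d \<le> n" "m < n" "1 \<le> s" "colours k d * ((4 * d + 1) * s) + k * d \<le> n" "k * s + k * d \<le> m"
    and D: "(k * (n * d ^ (k - 1)) + d ^ k * n) * D < n ^ k * (m + 1)"
    and h: "real h \<le> r" "\<And>c s. 1 \<le> s \<Longrightarrow> c < g s \<Longrightarrow> c * (2 * k) < (h - d) * s"
  shows "globally_rigid TYPE('a) k n d (process_graph es (min_degree_time k n (d + 1) es))"
proof -
  define M where "M = min_degree_time k n (d + 1) es"
  have n1: "1 \<le> k" "1 \<le> n" using k d n(1) by auto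
  have graph: "process_graph es i \<subseteq> complete_edges k n" for i
    using es by (auto simp: process_graph_def permutations_of_set_def dest: in_set_takeD)
  note degrees = min_degree_ge_iff[OF graph n1]
  have mono: "process_graph es i \<subseteq> process_graph es j" if "i \<le> j" for i j
    unfolding process_graph_def using that by (rule set_take_subset_set_take)
  have fin: "finite (process_graph es i)" for i by (simp add: process_graph_def)
  have m1: "d + 1 \<le> min_degree k n (process_graph es m1)"
    unfolding degrees using degree by (force simp: process_graph_def)
  have "M \<le> m1" unfolding M_def min_degree_time_def using m1 by (rule Least_le)
  have dM: "d + 1 \<le> min_degree k n (process_graph es M)"
    unfolding M_def min_degree_time_def using m1 by (rule LeastI)
  have degM: "d + 1 \<le> card (star k n v \<inter> process_graph es M)" if "v \<in> vertices k n" for v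
    using dM that unfolding degrees by blast
  have "m0 < M"
  proof (rule ccontr)
    assume "\<not> m0 < M"
    then have sub: "process_graph es M \<subseteq> process_graph es m0" by (intro mono) simp
    obtain v where v: "v \<in> vertex_class n 0" "star k n v \<inter> set (take m0 es) = {}" using isolated by blast
    have vV: "v \<in> vertices k n" using v(1) n1 by (auto simp: vertices_def)
    have "star k n v \<inter> process_graph es M = {}" using sub v(2) by (auto simp: process_graph_def)
    then show False using degM[OF vV] by simp
  qed
  define G where "G = process_graph es M"
  define G0 where "G0 = process_graph es m0"
  define G1 where "G1 = process_graph es m1"
  have sub: "G0 \<subseteq> G" "G \<subseteq> G1" unfolding G_def G0_def G1_def using \<open>m0 < M\<close> \<open>M \<le> m1\<close> by (auto intro!: mono)
  have GE: "G \<subseteq> complete_edges k n" "G1 \<subseteq> complete_edges k n" using graph by (auto simp: G_def G1_def)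
  have finG: "finite G" using fin by (simp add: G_def)
  define L where "L = {v. low_degree k n m0 r es v}"
  have abs: "absorbing k n d m G"
  proof (rule absorbingI[OF sub(2) GE(2) n1(1), where L = L and h = h])
    fix v assume v: "v \<in> vertices k n"
    show "d + 1 \<le> card {e \<in> G. v \<in> e}"
      using degM[OF v] unfolding degree_in_eq_star[OF GE(1)] by (simp add: G_def)
    assume "v \<notin> L"
    then have "r < real (card (star k n v \<inter> G0))"
      by (simp add: L_def low_degree_def G0_def process_graph_def)
    moreover have "card (star k n v \<inter> G0) \<le> card (star k n v \<inter> G)"
      using sub(1) finG by (intro card_mono) auto
    ultimately have "real h \<le> real (card (star k n v \<inter> G))" using h(1) by linarith
    then show "h \<le> card {e \<in> G. v \<in> e}" unfolding degree_in_eq_star[OF GE(1)] by simp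
  next
    fix e u v assume "e \<in> G1" "u \<in> e \<inter> L" "v \<in> e \<inter> L"
    then have e: "e \<in> complete_edges k n" "e \<in> set (take m1 es)" "u \<in> e" "v \<in> e"
      "low_degree k n m0 r es u" "low_degree k n m0 r es v"
      using GE(2) by (auto simp: L_def G1_def process_graph_def)
    show "u = v"
    proof (rule ccontr)
      assume "u \<noteq> v"
      then have "two_low_in_edge k n m0 m1 r es" unfolding two_low_in_edge_def
        using e by (intro bexI[of _ e] bexI[of _ u] bexI[of _ v] conjI)
      then show False using low(1) by contradiction
    qed
  next
    fix e e' u v w assume "e \<in> G1" "e' \<in> G1" "e \<noteq> e'" "w \<in> e \<inter> e'" "u \<in> e \<inter> L" "v \<in> e' \<inter> L" "u \<noteq> v"
    then have e: "e \<in> complete_edges k n" "e' \<in> star k n w" "w \<in> e" "u \<in> e" "v \<in> e'" "e \<noteq> e'" "u \<noteq> v"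
      "{e, e'} \<subseteq> set (take m1 es)" "low_degree k n m0 r es u" "low_degree k n m0 r es v"
      using GE(2) by (auto simp: L_def G1_def process_graph_def star_def)
    have "two_low_in_path k n m0 m1 r es" unfolding two_low_in_path_def
      using e by (intro bexI[of _ e] bexI[of _ w] bexI[of _ e'] bexI[of _ u] bexI[of _ v] conjI)
    then show False using low(2) by contradiction
  next
    fix e e' u w assume "e \<in> G1" "e' \<in> G1" "e \<noteq> e'" "w \<in> e \<inter> e'" "u \<in> e \<inter> e'" "u \<in> L"
    then have e: "e \<in> complete_edges k n" "e' \<in> star k n u \<inter> star k n w" "w \<in> e" "u \<in> e" "e \<noteq> e'"
      "{e, e'} \<subseteq> set (take m1 es)" "low_degree k n m0 r es u"
      using GE(2) by (auto simp: L_def G1_def process_graph_def star_def)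
    show "u = w"
    proof (rule ccontr)
      assume "u \<noteq> w"
      then have "w \<in> e - {u}" using e(3) by blast
      then have "low_in_two_edges k n m0 m1 r es" unfolding low_in_two_edges_def
        using e by (intro bexI[of _ e] bexI[of _ u] bexI[of _ w] bexI[of _ e'] conjI)
      then show False using low(3) by contradiction
    qed
  next
    fix S assume S: "S \<subseteq> vertices k n" "S \<noteq> {}" "card S \<le> m + 1"
    have "\<not> g (card S) \<le> card {e \<in> set (take m1 es). 2 \<le> card (e \<inter> S)}"
      using sparse S unfolding dense_small_set_def by blast
    moreover have "1 \<le> card S"
      using S(2) finite_subset[OF S(1) finite_vertices] by (simp add: Suc_leI card_gt_0_iff)
    ultimately show "card {e \<in> G1. 2 \<le> card (e \<inter> S)} * (2 * k) < (h - d) * card S"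
      using h(2) by (simp add: G1_def process_graph_def)
  qed
  have "globally_rigid TYPE('a) k n d G"
  proof (rule globally_rigidI[OF \<iota> k d GE(1) _ _ n(3,4) abs n(5,2)])
    fix p :: "vertex \<Rightarrow> nat \<Rightarrow> 'a"
    assume "algebraically_independent (vertices k n \<times> {..<d}) (\<lambda>(v, j). p v j)"
    then have gen: "generic_coordinates k n d p" by (simp add: generic_coordinates_def)
    show "vertex_redundantly_rigid k n d G p"
    proof (rule vertex_redundantly_rigidI[OF k d n(1) gen GE(1) sub(1) _ n(2) D abs])
      fix v B assume "v \<in> vertices k n" "B \<subseteq> {e \<in> G0. v \<notin> e}" "card B \<le> d * k * n"
        "{e \<in> G0. v \<notin> e} \<subseteq> rigidity_closure TYPE('a) k n d B"
      then have B: "v \<in> vertices k n" "B \<subseteq> {e \<in> set (take m0 es). v \<notin> e}" "card B \<le> d * k * n"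
        "{e \<in> set (take m0 es). v \<notin> e} \<subseteq> rigidity_closure TYPE('a) k n d B"
        by (simp_all add: G0_def process_graph_def)
      show "card (complete_edges k n - rigidity_closure TYPE('a) k n d B) \<le> D"
      proof (rule ccontr)
        assume "\<not> ?thesis"
        then have "sparse_closure k n m0 (rigidity_closure TYPE('a) k n d) (d * k * n) D es"
          unfolding sparse_closure_def using B by (intro bexI[of _ v] exI[of _ B] conjI) simp_all
        then show False using closure by contradiction
      qed
    qed
  next
    show "meets_boxes k n s G"
      using box sub(1) unfolding meets_boxes_def G0_def process_graph_def by blast
  qed
  then show ?thesis by (simp add: G_def M_def)
qed

section \<open>Asymptotic estimates\<close>

lemma nat_floor_bounds:
  fixes x :: real
  assumes "0 \<le> x"
  shows "real (nat \<lfloor>x\<rfloor>) \<le> x" "x - 1 \<le> real (nat \<lfloor>x\<rfloor>)"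
  using assms by linarith+

lemma prob_tendsto_zeroI:
  assumes "\<forall>\<^sub>F n in sequentially. measure_pmf.prob (X n) (A n) \<le> f n" "f \<longlonglongrightarrow> 0"
  shows "(\<lambda>n. measure_pmf.prob (X n) (A n)) \<longlonglongrightarrow> 0"
  by (rule tendsto_sandwich[OF _ assms(1) tendsto_const assms(2)]) (simp add: measure_nonneg)

lemma one_minus_power_le_exp:
  fixes x y :: real
  assumes "0 \<le> x" "x \<le> 1" "y \<le> real m"
  shows "(1 - x) ^ m \<le> exp (- (x * y))"
proof -
  have "(1 - x) ^ m \<le> exp (- x) ^ m" using assms exp_ge_add_one_self[of "- x"] by (intro power_mono) auto
  also have "\<dots> = exp (- (x * real m))" by (simp add: mult.commute flip: exp_of_nat_mult)
  also have "\<dots> \<le> exp (- (x * y))" using assms by (simp add: mult_left_mono)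
  finally show ?thesis .
qed

lemma \<xi>_bounds: "3 / 4 \<le> \<xi>" "\<xi> \<le> 1"
proof -
  have "(2::real)\<^sup>2 \<le> exp 1 ^ 2" using exp_ge_add_one_self[of "1::real"] by (intro power_mono) auto
  also have "\<dots> = exp (2::real)" by (simp flip: exp_of_nat_mult)
  finally have "exp (- 2 :: real) \<le> 1 / 4" by (simp add: exp_minus field_simps)
  then show "3 / 4 \<le> \<xi>" by (simp add: \<xi>_def)
qed (simp add: \<xi>_def)

lemma tail_power_le_exp:
  fixes \<rho> y :: real
  assumes "0 \<le> \<rho>" "\<rho> \<le> 1" "y \<le> real m"
  shows "(1 - \<xi> * \<rho>) ^ m \<le> exp (- (3 / 4 * \<rho> * y))"
proof -
  have "\<xi> * \<rho> \<le> 1" using assms \<xi>_bounds by (intro mult_le_one) auto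
  moreover have "3 / 4 * \<rho> \<le> \<xi> * \<rho>" using assms \<xi>_bounds by (intro mult_right_mono) auto
  ultimately have "(1 - \<xi> * \<rho>) ^ m \<le> (1 - 3 / 4 * \<rho>) ^ m" by (intro power_mono) auto
  also have "\<dots> \<le> exp (- (3 / 4 * \<rho> * y))" using assms by (intro one_minus_power_le_exp) auto
  finally show ?thesis .
qed

lemma tail_base_nonneg: "0 \<le> \<rho> \<Longrightarrow> \<rho> \<le> 1 \<Longrightarrow> 0 \<le> 1 - \<xi> * \<rho>"
  using mult_le_one[of \<xi> \<rho>] \<xi>_bounds by simp

text \<open>
  At time \<open>early n\<close> a class still has about \<open>n powr (1/10)\<close> isolated vertices. At time \<open>late n\<close> a given
  vertex has degree at most \<open>d\<close> with probability at most about \<open>n powr (- 3/2)\<close>, by the bound with rate \<open>\<xi> \<ge> 3/4\<close>.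
  The two fractions are the proportions of edges in one star and in two stars, minus a margin that
  covers the edges drawn already.
\<close>

definition early :: "nat \<Rightarrow> nat" where "early n = nat \<lfloor>9 / 10 * real n * ln (real n)\<rfloor>"
definition late :: "nat \<Rightarrow> nat" where "late n = nat \<lfloor>2 * real n * ln (real n)\<rfloor>"
definition star_fraction :: "nat \<Rightarrow> real" where "star_fraction n = 1 / n - 3 * ln n / n\<^sup>2"
definition pair_fraction :: "nat \<Rightarrow> real" where "pair_fraction n = 2 / n - 4 * ln n / n\<^sup>2"

lemma early_late_bounds:
  assumes "1 \<le> n"
  shows "real (early n) \<le> 9 / 10 * real n * ln n" "9 / 10 * real n * ln n - 1 \<le> real (early n)"
    "real (late n) \<le> 2 * real n * ln n" "2 * real n * ln n - 1 \<le> real (late n)" "early n \<le> late n"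
proof -
  have L: "0 \<le> ln (real n)" using assms by simp
  show "real (early n) \<le> 9 / 10 * real n * ln n" "9 / 10 * real n * ln n - 1 \<le> real (early n)"
    unfolding early_def by (rule nat_floor_bounds, use L in simp)+
  show "real (late n) \<le> 2 * real n * ln n" "2 * real n * ln n - 1 \<le> real (late n)"
    unfolding late_def by (rule nat_floor_bounds, use L in simp)+
  show "early n \<le> late n" unfolding early_def late_def
    using L by (intro nat_mono floor_mono mult_right_mono) auto
qed

lemma power_splits:
  fixes n k :: nat
  assumes "k \<ge> 3" "1 \<le> n"
  shows "real n ^ k = (real n)\<^sup>2 * real n ^ (k - 2)" "real n ^ (k - 1) = real n * real n ^ (k - 2)"
    "real n \<le> real n ^ (k - 2)"
proof -
  obtain c where c: "k = Suc (Suc (Suc c))" using that[of "k - 3"] assms(1) by simp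
  show "real n ^ k = (real n)\<^sup>2 * real n ^ (k - 2)" "real n ^ (k - 1) = real n * real n ^ (k - 2)"
    by (simp_all add: c power2_eq_square)
  have "1 \<le> real n ^ c" using assms(2) by simp
  then show "real n \<le> real n ^ (k - 2)" using mult_left_mono[of 1 "real n ^ c" "real n"] by (simp add: c)
qed

lemma eventually_fractions:
  assumes "k \<ge> 3"
  shows "\<forall>\<^sub>F n in sequentially. 1 \<le> n \<and> 2 \<le> ln (real n) \<and> 2 * late n < n ^ k \<and>
    star_fraction n * real n ^ k + real (early n) + 2 \<le> real n ^ (k - 1) \<and>
    star_fraction n * real n ^ k + real (late n) \<le> real n ^ (k - 1) \<and>
    0 \<le> star_fraction n \<and> star_fraction n \<le> 1 \<and>
    pair_fraction n * real n ^ k + real (early n) + 2 + real n ^ (k - 2) \<le> 2 * real n ^ (k - 1) \<and>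
    0 \<le> pair_fraction n \<and> pair_fraction n \<le> 1"
proof -
  have "\<forall>\<^sub>F n::nat in sequentially. 2 \<le> ln (real n)" by real_asymp
  moreover have "\<forall>\<^sub>F n::nat in sequentially. 8 * ln (real n) \<le> real n" by real_asymp
  moreover have "\<forall>\<^sub>F n::nat in sequentially. 2 \<le> n" by (rule eventually_ge_at_top)
  ultimately show ?thesis
  proof eventually_elim
    fix n :: nat
    assume L: "2 \<le> ln (real n)" "8 * ln (real n) \<le> real n" and n: "2 \<le> n"
    define X where "X = real n ^ (k - 2)"
    have n1: "1 \<le> n" and n2: "real n \<ge> 2" using n by simp_all
    note P = power_splits[OF assms n1, folded X_def]
    note B = early_late_bounds[OF n1]
    have X: "ln n * real n \<le> ln n * X" using P(3) L by (intro mult_left_mono) auto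
    have nL: "2 * 2 \<le> real n * ln n" using L n2 by (intro mult_mono) auto
    have XL: "2 * X \<le> ln n * X" using L P(3) n2 by (intro mult_right_mono) auto
    have s: "star_fraction n * real n ^ k = real n * X - 3 * (ln n * X)"
      unfolding star_fraction_def P(1) using n2 by (simp add: field_simps power2_eq_square)
    have p: "pair_fraction n * real n ^ k = 2 * (real n * X) - 4 * (ln n * X)"
      unfolding pair_fraction_def P(1) using n2 by (simp add: field_simps power2_eq_square)
    have "4 * (real n * ln n) * 2 \<le> real n * real n" using L n2 mult_left_mono[of "8 * ln n" n n] by simp
    also have "\<dots> \<le> real n * X" using P(3) n2 by (intro mult_left_mono) auto
    also have "\<dots> \<le> real n * (real n * X)" using n2 P(3) mult_right_mono[of 1 "real n" X] by (intro mult_left_mono) auto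
    also have "\<dots> = real n ^ k" by (simp add: P(1) power2_eq_square)
    finally have "2 * real (late n) < real n ^ k" using B(3) nL by simp
    then have "real (2 * late n) < real (n ^ k)" by simp
    then have l: "2 * late n < n ^ k" by (simp only: of_nat_less_iff)
    have b: "real (early n) \<le> 9 / 10 * (real n * ln n)" "real (late n) \<le> 2 * (real n * ln n)"
      using B by simp_all
    have comm: "real n * ln n = ln n * real n" by simp
    have "3 * ln n / (real n)\<^sup>2 \<le> 1 / n" "4 * ln n / (real n)\<^sup>2 \<le> 2 / n"
      using L n2 by (simp_all add: field_simps power2_eq_square)
    moreover have "1 / real n \<le> 1" "2 / real n \<le> 1" using n2 by simp_all
    moreover have "0 \<le> 3 * ln n / (real n)\<^sup>2" "0 \<le> 4 * ln n / (real n)\<^sup>2" using L by simp_all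
    ultimately have f: "0 \<le> star_fraction n" "star_fraction n \<le> 1" "0 \<le> pair_fraction n" "pair_fraction n \<le> 1"
      unfolding star_fraction_def pair_fraction_def by linarith+
    show "1 \<le> n \<and> 2 \<le> ln (real n) \<and> 2 * late n < n ^ k \<and>
      star_fraction n * real n ^ k + real (early n) + 2 \<le> real n ^ (k - 1) \<and>
      star_fraction n * real n ^ k + real (late n) \<le> real n ^ (k - 1) \<and>
      0 \<le> star_fraction n \<and> star_fraction n \<le> 1 \<and>
      pair_fraction n * real n ^ k + real (early n) + 2 + real n ^ (k - 2) \<le> 2 * real n ^ (k - 1) \<and>
      0 \<le> pair_fraction n \<and> pair_fraction n \<le> 1"
      unfolding s p P(2) X_def[symmetric]
      using n1 L l f b X nL XL comm by (intro conjI) linarith+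
  qed
qed

text \<open>
  The threshold \<open>ln n / 50\<close> for low degrees costs a factor \<open>n powr (4/50)\<close>, while two stars contribute
  \<open>n powr (- 2 * 3/4 * 9/10)\<close>. The product beats the factor of order \<open>n ln n\<close> for the choice of the edge.
\<close>

lemma two_low_in_edge_null:
  assumes k: "k \<ge> 3"
  shows "(\<lambda>n. measure_pmf.prob (edge_ordering k n)
    {es. two_low_in_edge k n (early n) (late n) (ln n / 50) es}) \<longlonglongrightarrow> 0"
proof (rule prob_tendsto_zeroI)
  define f where "f n = 2 * real n * ln n *
    (exp (4 * (ln n / 50)) * exp (- (3 / 4 * (2 / real n - 4 * ln n / (real n)\<^sup>2) * (9 / 10 * real n * ln n - 3))))" for n :: nat
  have "f \<longlonglongrightarrow> 0" unfolding f_def by real_asymp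
  then show "(\<lambda>n. 2 * real k ^ 2 * f n) \<longlonglongrightarrow> 0" by (rule tendsto_mult_right_zero)
  show "\<forall>\<^sub>F n in sequentially. measure_pmf.prob (edge_ordering k n)
    {es. two_low_in_edge k n (early n) (late n) (ln n / 50) es} \<le> 2 * real k ^ 2 * f n"
    using eventually_fractions[OF k]
  proof eventually_elim
    fix n assume n: "1 \<le> n \<and> 2 \<le> ln (real n) \<and> 2 * late n < n ^ k \<and>
      star_fraction n * real n ^ k + real (early n) + 2 \<le> real n ^ (k - 1) \<and>
      star_fraction n * real n ^ k + real (late n) \<le> real n ^ (k - 1) \<and>
      0 \<le> star_fraction n \<and> star_fraction n \<le> 1 \<and>
      pair_fraction n * real n ^ k + real (early n) + 2 + real n ^ (k - 2) \<le> 2 * real n ^ (k - 1) \<and>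
      0 \<le> pair_fraction n \<and> pair_fraction n \<le> 1"
    then have n1: "1 \<le> n" by simp
    note B = early_late_bounds[OF n1]
    have e2: "9 / 10 * real n * ln n - 3 \<le> real (early n - 2)" using B(2) by linarith
    have "measure_pmf.prob (edge_ordering k n) {es. two_low_in_edge k n (early n) (late n) (ln n / 50) es}
      \<le> 2 * real k ^ 2 * real (late n) * (exp (4 * (ln n / 50)) * (1 - \<xi> * pair_fraction n) ^ (early n - 2))"
      unfolding two_low_in_edge_def
      by (rule prob_two_low_in_edge[where ?\<rho>1.0 = "star_fraction n"]) (use n k B in auto)
    also have "\<dots> \<le> 2 * real k ^ 2 * (2 * real n * ln n) * (exp (4 * (ln n / 50)) *
        exp (- (3 / 4 * pair_fraction n * (9 / 10 * real n * ln n - 3))))"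
      using n B e2 tail_base_nonneg[of "pair_fraction n"] by (intro mult_mono tail_power_le_exp) auto
    finally show "measure_pmf.prob (edge_ordering k n) {es. two_low_in_edge k n (early n) (late n) (ln n / 50) es}
      \<le> 2 * real k ^ 2 * f n" by (simp add: f_def pair_fraction_def mult.assoc)
  qed
qed

lemma two_low_in_path_null:
  assumes k: "k \<ge> 3"
  shows "(\<lambda>n. measure_pmf.prob (edge_ordering k n)
    {es. two_low_in_path k n (early n) (late n) (ln n / 50) es}) \<longlonglongrightarrow> 0"
proof (rule prob_tendsto_zeroI)
  define f where "f n = (2 * real n * ln n)\<^sup>2 / n *
    (exp (4 * (ln n / 50)) * exp (- (3 / 4 * (2 / real n - 4 * ln n / (real n)\<^sup>2) * (9 / 10 * real n * ln n - 3))))" for n :: nat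
  have "f \<longlonglongrightarrow> 0" unfolding f_def by real_asymp
  then show "(\<lambda>n. 4 * real k ^ 3 * f n) \<longlonglongrightarrow> 0" by (rule tendsto_mult_right_zero)
  show "\<forall>\<^sub>F n in sequentially. measure_pmf.prob (edge_ordering k n)
    {es. two_low_in_path k n (early n) (late n) (ln n / 50) es} \<le> 4 * real k ^ 3 * f n"
    using eventually_fractions[OF k]
  proof eventually_elim
    case (elim n)
    then have n1: "1 \<le> n" by simp
    note B = early_late_bounds[OF n1]
    have e2: "9 / 10 * real n * ln n - 3 \<le> real (early n - 2)" using B(2) by linarith
    have "measure_pmf.prob (edge_ordering k n) {es. two_low_in_path k n (early n) (late n) (ln n / 50) es}
      \<le> 4 * real k ^ 3 * (real (late n))\<^sup>2 / n * (exp (4 * (ln n / 50)) * (1 - \<xi> * pair_fraction n) ^ (early n - 2))"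
      unfolding two_low_in_path_def
      by (rule prob_two_low_in_path[where ?\<rho>1.0 = "star_fraction n"]) (use elim k B in auto)
    also have "\<dots> \<le> 4 * real k ^ 3 * (2 * real n * ln n)\<^sup>2 / n * (exp (4 * (ln n / 50)) *
        exp (- (3 / 4 * pair_fraction n * (9 / 10 * real n * ln n - 3))))"
      using elim B e2 tail_base_nonneg[of "pair_fraction n"] by (intro mult_mono divide_right_mono power_mono tail_power_le_exp) auto
    finally show ?case by (simp add: f_def pair_fraction_def mult.assoc)
  qed
qed

text \<open>
  One star contributes only \<open>n powr (- 3/4 * 9/10)\<close>, but pairs of edges with two common vertices are rarer
  by a factor \<open>n\<close> than pairs with one.
\<close>

lemma low_in_two_edges_null:
  assumes k: "k \<ge> 3"
  shows "(\<lambda>n. measure_pmf.prob (edge_ordering k n)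
    {es. low_in_two_edges k n (early n) (late n) (ln n / 50) es}) \<longlonglongrightarrow> 0"
proof (rule prob_tendsto_zeroI)
  define f where "f n = (2 * real n * ln n)\<^sup>2 / (real n)\<^sup>2 *
    (exp (2 * (ln n / 50)) * exp (- (3 / 4 * (1 / real n - 3 * ln n / (real n)\<^sup>2) * (9 / 10 * real n * ln n - 3))))" for n :: nat
  have "f \<longlonglongrightarrow> 0" unfolding f_def by real_asymp
  then show "(\<lambda>n. 4 * real k ^ 2 * f n) \<longlonglongrightarrow> 0" by (rule tendsto_mult_right_zero)
  show "\<forall>\<^sub>F n in sequentially. measure_pmf.prob (edge_ordering k n)
    {es. low_in_two_edges k n (early n) (late n) (ln n / 50) es} \<le> 4 * real k ^ 2 * f n"
    using eventually_fractions[OF k]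
  proof eventually_elim
    case (elim n)
    then have n1: "1 \<le> n" by simp
    note B = early_late_bounds[OF n1]
    have e2: "9 / 10 * real n * ln n - 3 \<le> real (early n - 2)" using B(2) by linarith
    have "measure_pmf.prob (edge_ordering k n) {es. low_in_two_edges k n (early n) (late n) (ln n / 50) es}
      \<le> 4 * real k ^ 2 * (real (late n))\<^sup>2 / (real n)\<^sup>2 * (exp (2 * (ln n / 50)) * (1 - \<xi> * star_fraction n) ^ (early n - 2))"
      unfolding low_in_two_edges_def
      by (rule prob_low_in_two_edges[where ?\<rho>2.0 = "pair_fraction n"]) (use elim k B in auto)
    also have "\<dots> \<le> 4 * real k ^ 2 * (2 * real n * ln n)\<^sup>2 / (real n)\<^sup>2 * (exp (2 * (ln n / 50)) *
        exp (- (3 / 4 * star_fraction n * (9 / 10 * real n * ln n - 3))))"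
      using elim B e2 tail_base_nonneg[of "star_fraction n"] by (intro mult_mono divide_right_mono power_mono tail_power_le_exp) auto
    finally show ?case by (simp add: f_def star_fraction_def mult.assoc)
  qed
qed

lemma small_degree_null:
  assumes k: "k \<ge> 3"
  shows "(\<lambda>n. measure_pmf.prob (edge_ordering k n)
    {es. \<exists>v\<in>vertices k n. card (star k n v \<inter> set (take (late n) es)) \<le> d}) \<longlonglongrightarrow> 0"
proof (rule prob_tendsto_zeroI)
  define f where "f n = real n *
    exp (- (3 / 4 * (1 / real n - 3 * ln n / (real n)\<^sup>2) * (2 * real n * ln n - 1)))" for n :: nat
  have "f \<longlonglongrightarrow> 0" unfolding f_def by real_asymp
  then show "(\<lambda>n. k * exp (2 * real d) * f n) \<longlonglongrightarrow> 0" by (rule tendsto_mult_right_zero)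
  show "\<forall>\<^sub>F n in sequentially. measure_pmf.prob (edge_ordering k n)
    {es. \<exists>v\<in>vertices k n. card (star k n v \<inter> set (take (late n) es)) \<le> d} \<le> k * exp (2 * real d) * f n"
    using eventually_fractions[OF k]
  proof eventually_elim
    case (elim n)
    then have n1: "1 \<le> n" by simp
    note B = early_late_bounds[OF n1]
    have "measure_pmf.prob (edge_ordering k n)
        {es. \<exists>v\<in>vertices k n. card (star k n v \<inter> set (take (late n) es)) \<le> d}
      \<le> real (k * n) * (exp (real (2 * d)) * (1 - \<xi> * star_fraction n) ^ late n)"
      using prob_small_degree[where ?m1.0 = "late n" and n = n and k = k and \<rho> = "star_fraction n" and d = d]
        elim by simp
    also have "\<dots> \<le> real (k * n) * (exp (real (2 * d)) * exp (- (3 / 4 * star_fraction n * (2 * real n * ln n - 1))))"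
      using elim B by (intro mult_left_mono tail_power_le_exp) auto
    finally show ?case by (simp add: f_def star_fraction_def mult_ac)
  qed
qed

text \<open>
  The expected number of isolated vertices is at least \<open>n exp (- (y + 2 y\<^sup>2) early n)\<close>, where \<open>y\<close> is
  slightly larger than \<open>1 / n\<close>.
\<close>

lemma no_isolated_vertex_null:
  assumes k: "k \<ge> 3"
  shows "(\<lambda>n. measure_pmf.prob (edge_ordering k n)
    {es. \<forall>v\<in>vertex_class n 0. star k n v \<inter> set (take (early n) es) \<noteq> {}}) \<longlonglongrightarrow> 0"
proof (rule prob_tendsto_zeroI)
  define y where "y n = real n / ((real n)\<^sup>2 - ln n)" for n :: nat
  show "(\<lambda>n. exp ((y n + 2 * (y n)\<^sup>2) * (9 / 10 * real n * ln n)) / real n) \<longlonglongrightarrow> 0"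
    unfolding y_def by real_asymp
  have "\<forall>\<^sub>F n::nat in sequentially. 0 \<le> y n \<and> y n \<le> 1 / 2 \<and> 4 * ln n \<le> real n \<and> 2 \<le> ln n \<and> 4 \<le> real n"
    unfolding y_def by (intro eventually_conj; real_asymp)
  moreover have "\<forall>\<^sub>F n::nat in sequentially. 4 \<le> n" by (rule eventually_ge_at_top)
  ultimately show "\<forall>\<^sub>F n in sequentially. measure_pmf.prob (edge_ordering k n)
    {es. \<forall>v\<in>vertex_class n 0. star k n v \<inter> set (take (early n) es) \<noteq> {}} \<le>
    exp ((y n + 2 * (y n)\<^sup>2) * (9 / 10 * real n * ln n)) / real n"
  proof eventually_elim
    fix n :: nat
    assume ev: "0 \<le> y n \<and> y n \<le> 1 / 2 \<and> 4 * ln n \<le> real n \<and> 2 \<le> ln n \<and> 4 \<le> real n" and n4: "4 \<le> n"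
    define X where "X = real n ^ (k - 2)"
    define Y where "Y = y n"
    have n1: "1 \<le> n" using n4 by simp
    note P = power_splits[OF k n1, folded X_def]
    note B = early_late_bounds[OF n1]
    have Y: "0 \<le> Y" "Y \<le> 1 / 2" using ev by (simp_all add: Y_def)
    let ?T = "real (card (complete_edges k n))" and ?a = "n ^ (k - 1)"
    have T: "?T = (real n)\<^sup>2 * X" by (simp add: card_complete_edges P(1))
    have a: "real ?a = real n * X" using P(2) by (simp only: of_nat_power)
    have X4: "4 \<le> X" "0 < X" using P(3) ev by linarith+
    have LX: "real n * ln n \<le> ln n * X" using P(3) ev mult_left_mono[of "real n" X "ln n"] by (simp add: mult.commute)
    have "0 \<le> real n * ln n" "real (early n) \<le> 9 / 10 * (real n * ln n)" using ev B(1) by simp_all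
    then have m0: "real (early n) \<le> ln n * X" using LX by linarith
    have L2: "4 * ln n * real n \<le> real n * real n" using ev by (intro mult_right_mono) auto
    have "4 * real n \<le> real n * real n" using ev by (intro mult_right_mono) auto
    moreover have "ln n * 4 \<le> ln n * real n" using ev by (intro mult_left_mono) auto
    ultimately have L3: "2 * real n + ln n < (real n)\<^sup>2" using L2 ev unfolding power2_eq_square by linarith
    then have "(2 * real n + ln n) * X < (real n)\<^sup>2 * X" using X4 by simp
    then have "real (2 * ?a + early n) < real (card (complete_edges k n))"
      using m0 unfolding T of_nat_add of_nat_mult a by (simp add: algebra_simps)
    then have cond: "2 * ?a + early n < card (complete_edges k n)" by (simp only: of_nat_less_iff)
    have fac: "exp (- Y - 2 * Y\<^sup>2) \<le> (?T - real ?a - real i) / (?T - real i)" if i: "i < early n" for i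
    proof -
      have "0 < (real n)\<^sup>2 - ln n" using L3 ev by linarith
      then have pos: "0 < ((real n)\<^sup>2 - ln n) * X" using X4 by simp
      moreover have le: "((real n)\<^sup>2 - ln n) * X \<le> ?T - real i" using i m0 unfolding T by (simp add: algebra_simps)
      ultimately have pi: "0 < ?T - real i" by linarith
      have "real ?a / (?T - real i) \<le> real ?a / (((real n)\<^sup>2 - ln n) * X)"
        by (rule divide_left_mono[OF le _ mult_pos_pos[OF pi pos]]) simp
      also have "\<dots> = Y" unfolding a Y_def y_def using X4 by simp
      finally have "1 - Y \<le> 1 - real ?a / (?T - real i)" by simp
      also have "\<dots> = (?T - real ?a - real i) / (?T - real i)" using pi by (simp add: field_simps)
      finally have "1 - Y \<le> (?T - real ?a - real i) / (?T - real i)" .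
      moreover have "exp (- Y - 2 * Y\<^sup>2) \<le> exp (ln (1 - Y))"
        using ln_one_minus_pos_lower_bound[OF Y] by simp
      ultimately show ?thesis using Y by simp
    qed
    define \<mu> where "\<mu> = real (card (vertex_class n 0)) *
      (\<Prod>i<early n. (?T - real ?a - real i) / (?T - real i))"
    have cV: "card (vertex_class n 0) = n" by (simp add: vertex_class_def card_cartesian_product_singleton)
    have "(\<Prod>i<early n. exp (- Y - 2 * Y\<^sup>2)) \<le> (\<Prod>i<early n. (?T - real ?a - real i) / (?T - real i))"
      using fac by (intro prod_mono) auto
    then have \<mu>_ge: "real n * exp (- Y - 2 * Y\<^sup>2) ^ early n \<le> \<mu>"
      unfolding \<mu>_def cV by (intro mult_left_mono) auto
    have pos: "0 < real n * exp (- Y - 2 * Y\<^sup>2) ^ early n" using n1 by simp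
    then have \<mu>0: "0 < \<mu>" using \<mu>_ge by linarith
    have "measure_pmf.prob (edge_ordering k n)
      {es. \<forall>v\<in>vertex_class n 0. star k n v \<inter> set (take (early n) es) \<noteq> {}} \<le> 1 / \<mu>"
      unfolding edge_ordering_prob
    proof (rule prob_all_hit[OF finite_complete_edges _ _ _ _ cond \<mu>_def])
      show "finite (vertex_class n 0)" by (simp add: vertex_class_def)
      fix v assume v: "v \<in> vertex_class n 0"
      show "star k n v \<subseteq> complete_edges k n" by (auto simp: star_def)
      have "v \<in> vertices k n" using v k by (auto simp: vertices_def)
      then show "card (star k n v) = ?a" by (rule card_star)
      fix w assume w: "w \<in> vertex_class n 0" "v \<noteq> w"
      show "star k n v \<inter> star k n w = {}"
      proof (rule ccontr)
        assume "\<not> ?thesis"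
        then obtain e where e: "e \<in> complete_edges k n" "v \<in> e" "w \<in> e" by (auto simp: star_def)
        then have "card (e \<inter> vertex_class n 0) = 1" using k by (simp add: complete_edges_def)
        then obtain u where "e \<inter> vertex_class n 0 = {u}" by (rule card_1_singletonE)
        moreover have "v \<in> e \<inter> vertex_class n 0" "w \<in> e \<inter> vertex_class n 0" using e v w by simp_all
        ultimately show False using w(2) by simp
      qed
    next
      show "0 < \<mu>" by (rule \<mu>0)
    qed
    also have "\<dots> \<le> 1 / (real n * exp (- Y - 2 * Y\<^sup>2) ^ early n)"
      by (rule divide_left_mono[OF \<mu>_ge _ mult_pos_pos[OF \<mu>0 pos]]) simp
    also have "\<dots> = exp ((Y + 2 * Y\<^sup>2) * real (early n)) / real n"
    proof -
      have "exp (- Y - 2 * Y\<^sup>2) ^ early n = exp (- ((Y + 2 * Y\<^sup>2) * real (early n)))"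
        by (simp add: algebra_simps flip: exp_of_nat_mult)
      then show ?thesis by (simp only: exp_minus divide_inverse inverse_mult_distrib inverse_inverse_eq mult_1 mult.commute)
    qed
    also have "\<dots> \<le> exp ((Y + 2 * Y\<^sup>2) * (9 / 10 * real n * ln n)) / real n"
    proof (rule divide_right_mono)
      have "(Y + 2 * Y\<^sup>2) * real (early n) \<le> (Y + 2 * Y\<^sup>2) * (9 / 10 * real n * ln n)"
        by (rule mult_left_mono[OF B(1)]) (use Y in simp)
      then show "exp ((Y + 2 * Y\<^sup>2) * real (early n)) \<le> exp ((Y + 2 * Y\<^sup>2) * (9 / 10 * real n * ln n))"
        by (simp only: exp_le_cancel_iff)
    qed simp
    finally show "measure_pmf.prob (edge_ordering k n)
      {es. \<forall>v\<in>vertex_class n 0. star k n v \<inter> set (take (early n) es) \<noteq> {}} \<le>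
      exp ((y n + 2 * (y n)\<^sup>2) * (9 / 10 * real n * ln n)) / real n" by (simp add: Y_def)
  qed
qed

text \<open>
  A union bound over exponentially many objects is harmless against a failure probability that decays
  like \<open>exp (- \<sigma> n ln n)\<close>.
\<close>

lemma exp_linear_beats_log:
  fixes A \<sigma> :: real
  assumes "0 < \<sigma>"
  shows "(\<lambda>n::nat. real n * exp (A * n - \<sigma> * (9 / 10 * real n * ln n - 1))) \<longlonglongrightarrow> 0"
  using assms by real_asymp

lemma missed_box_null:
  fixes \<epsilon> :: real
  assumes k: "k \<ge> 3" and \<epsilon>: "0 < \<epsilon>" "\<epsilon> \<le> 1"
  shows "(\<lambda>n. measure_pmf.prob (edge_ordering k n)
    {es. \<not> meets_boxes k n (nat \<lceil>\<epsilon> * n\<rceil>) (set (take (early n) es))}) \<longlonglongrightarrow> 0"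
proof (rule prob_tendsto_zeroI)
  define \<rho> where "\<rho> = \<epsilon> ^ k / 2"
  have \<rho>: "0 < \<rho>" "\<rho> \<le> 1" using \<epsilon> power_le_one[of \<epsilon> k] by (auto simp: \<rho>_def)
  show "(\<lambda>n::nat. real n * exp (real k * real n - \<rho> * (9 / 10 * real n * ln n - 1))) \<longlonglongrightarrow> 0"
    by (rule exp_linear_beats_log[OF \<rho>(1)])
  have "\<forall>\<^sub>F n::nat in sequentially. ln n \<le> \<rho> * real n" using \<rho>(1) by real_asymp
  then show "\<forall>\<^sub>F n in sequentially. measure_pmf.prob (edge_ordering k n)
    {es. \<not> meets_boxes k n (nat \<lceil>\<epsilon> * n\<rceil>) (set (take (early n) es))} \<le>
    real n * exp (real k * real n - \<rho> * (9 / 10 * real n * ln n - 1))"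
    using eventually_fractions[OF k]
  proof eventually_elim
    case (elim n)
    then have n1: "1 \<le> n" by simp
    note B = early_late_bounds[OF n1] and P = power_splits[OF k n1]
    have "real (early n) \<le> real n * ln n" using B(1) elim by simp
    also have "\<dots> \<le> real n * (\<rho> * real n)" using elim by (intro mult_left_mono) auto
    also have "\<dots> = \<rho> * ((real n)\<^sup>2 * 1)" by (simp add: power2_eq_square)
    also have "\<dots> \<le> \<rho> * ((real n)\<^sup>2 * real n ^ (k - 2))"
      using \<rho> P(3) n1 by (intro mult_left_mono) auto
    also have "\<dots> = \<rho> * real n ^ k" by (simp add: P(1))
    finally have "\<rho> * real n ^ k + real (early n) \<le> (\<epsilon> * n) ^ k"
      by (simp add: \<rho>_def power_mult_distrib)
    also have "\<dots> \<le> real (nat \<lceil>\<epsilon> * n\<rceil>) ^ k" using \<epsilon> by (intro power_mono) (auto simp: real_nat_ceiling_ge)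
    finally have "measure_pmf.prob (edge_ordering k n)
        {es. \<not> meets_boxes k n (nat \<lceil>\<epsilon> * n\<rceil>) (set (take (early n) es))} \<le> 2 ^ (k * n) * (1 - \<rho>) ^ early n"
      by (intro prob_missed_box) (use elim B(5) \<rho> in simp_all)
    also have "\<dots> \<le> exp 1 ^ (k * n) * exp (- (\<rho> * (9 / 10 * real n * ln n - 1)))"
      using \<rho> B(2) exp_ge_add_one_self[of "1::real"]
      by (intro mult_mono power_mono one_minus_power_le_exp) auto
    also have "\<dots> = 1 * exp (real k * real n - \<rho> * (9 / 10 * real n * ln n - 1))"
    proof -
      have "exp (1::real) ^ (k * n) = exp (real k * real n)" using exp_of_nat_mult[of "k * n" "1::real"] by simp
      then show ?thesis by (simp only: exp_diff exp_minus divide_inverse mult_1)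
    qed
    also have "\<dots> \<le> real n * exp (real k * real n - \<rho> * (9 / 10 * real n * ln n - 1))"
      using n1 by (intro mult_right_mono) auto
    finally show ?case .
  qed
qed

lemma sparse_closure_null:
  fixes \<delta> :: real
  assumes k: "k \<ge> 3" and \<delta>: "0 < \<delta>" "\<delta> \<le> 1"
  shows "(\<lambda>n. measure_pmf.prob (edge_ordering k n)
    {es. sparse_closure k n (early n) (cl n) (c * n) (nat \<lfloor>\<delta> * real n ^ k\<rfloor>) es}) \<longlonglongrightarrow> 0"
proof (rule prob_tendsto_zeroI)
  define \<rho> where "\<rho> = \<delta> / 2"
  have \<rho>: "0 < \<rho>" "\<rho> \<le> 1" using \<delta> by (auto simp: \<rho>_def)
  have "(\<lambda>n::nat. real n * exp (ln (4 / \<rho>) * c * n - \<rho> / 2 * (9 / 10 * real n * ln n - 1))) \<longlonglongrightarrow> 0"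
    using \<rho> by (intro exp_linear_beats_log) simp
  then show "(\<lambda>n::nat. k * (real n * exp (ln (4 / \<rho>) * c * n - \<rho> / 2 * (9 / 10 * real n * ln n - 1)))) \<longlonglongrightarrow> 0"
    by (rule tendsto_mult_right_zero)
  have "\<forall>\<^sub>F n::nat in sequentially. real n * ln n + real n + 1 \<le> \<rho> * (real n)\<^sup>2" using \<rho>(1) by real_asymp
  then show "\<forall>\<^sub>F n in sequentially. measure_pmf.prob (edge_ordering k n)
    {es. sparse_closure k n (early n) (cl n) (c * n) (nat \<lfloor>\<delta> * real n ^ k\<rfloor>) es} \<le>
    k * (real n * exp (ln (4 / \<rho>) * c * n - \<rho> / 2 * (9 / 10 * real n * ln n - 1)))"
    using eventually_fractions[OF k]
  proof eventually_elim
    case (elim n)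
    then have n1: "1 \<le> n" by simp
    note B = early_late_bounds[OF n1] and P = power_splits[OF k n1]
    define X where "X = real n ^ (k - 2)"
    have X1: "1 \<le> X" using P(3) n1 by (simp add: X_def)
    have "real (early n) \<le> real n * ln n" using B(1) elim by simp
    then have "real (early n) + 1 \<le> (real n * ln n + 1) * 1" by simp
    also have "\<dots> \<le> (real n * ln n + 1) * X" using X1 elim by (intro mult_left_mono) auto
    finally have "real (early n) + 1 + real n * X \<le> (real n * ln n + real n + 1) * X"
      by (simp add: algebra_simps)
    also have "\<dots> \<le> \<rho> * (real n)\<^sup>2 * X" using X1 elim by (intro mult_right_mono) auto
    finally have "real (early n) + 1 + real n ^ (k - 1) \<le> \<rho> * real n ^ k"
      unfolding P(1) P(2) by (simp add: X_def mult.assoc)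
    moreover have "\<delta> * real n ^ k - 1 \<le> real (nat \<lfloor>\<delta> * real n ^ k\<rfloor>)"
      by (rule nat_floor_bounds) (use \<delta> in simp)
    moreover have "\<delta> * real n ^ k = 2 * (\<rho> * real n ^ k)" by (simp add: \<rho>_def)
    ultimately have "\<rho> * real n ^ k + real (early n) + real n ^ (k - 1) \<le> real (nat \<lfloor>\<delta> * real n ^ k\<rfloor>)"
      by linarith
    then have "measure_pmf.prob (edge_ordering k n)
        {es. sparse_closure k n (early n) (cl n) (c * n) (nat \<lfloor>\<delta> * real n ^ k\<rfloor>) es}
      \<le> k * n * ((4 / \<rho>) ^ (c * n) * (1 - \<rho> / 2) ^ early n)"
      unfolding sparse_closure_def
      using prob_sparse_closure[where cl = "cl n" and m = "early n" and n = n and k = k and \<rho> = \<rho>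
          and R = "c * n" and D = "nat \<lfloor>\<delta> * real n ^ k\<rfloor>"] elim B(5) \<rho> by simp
    also have "\<dots> \<le> k * n * ((4 / \<rho>) ^ (c * n) * exp (- (\<rho> / 2 * (9 / 10 * real n * ln n - 1))))"
      using \<rho> B(2) by (intro mult_left_mono one_minus_power_le_exp) auto
    also have "(4 / \<rho>) ^ (c * n) = exp (ln (4 / \<rho>)) ^ (c * n)" using \<rho> by simp
    also have "\<dots> = exp (ln (4 / \<rho>) * c * n)"
      unfolding exp_of_nat_mult[symmetric] by (intro arg_cong[of _ _ exp]) simp
    finally show ?case by (simp only: exp_diff exp_minus divide_inverse mult.assoc of_nat_mult)
  qed
qed

text \<open>
  The denominator cancels the constant in the estimate for crowded sets, and \<open>exp (- 600 k)\<close> makes the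
  probability of a crowded set of size \<open>s\<close> at most \<open>n powr (- 3 s)\<close>, against \<open>(k n) ^ s\<close> sets.
\<close>

definition expansion :: "nat \<Rightarrow> real" where
  "expansion k = exp (- (600 * real k)) / (800 * exp 1 * real k)"

lemma expansion_bounds:
  assumes "1 \<le> k"
  shows "0 < expansion k" "expansion k \<le> 1"
proof -
  have "1 * 1 \<le> (800 * exp 1) * real k" using assms exp_ge_add_one_self[of "1::real"] by (intro mult_mono) auto
  moreover have "exp (- (600 * real k)) \<le> 1" by simp
  ultimately have "exp (- (600 * real k)) \<le> 800 * exp 1 * real k" "0 < 800 * exp 1 * real k" by linarith+
  then show "expansion k \<le> 1" unfolding expansion_def by (simp only: divide_le_eq_1_pos)
qed (use assms in \<open>simp add: expansion_def\<close>)

text \<open>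
  The number of edges that a stuck set of size \<open>s\<close> would force: \<open>ln n / 100\<close> at each vertex, divided by \<open>2 k\<close>
  as in \<open>absorbingI\<close>.
\<close>

definition crowding :: "nat \<Rightarrow> nat \<Rightarrow> nat \<Rightarrow> nat" where
  "crowding k n s = nat \<lceil>ln n * s / (200 * real k)\<rceil>"

lemma dense_small_set_null:
  assumes k: "k \<ge> 3"
  shows "(\<lambda>n. measure_pmf.prob (edge_ordering k n)
    {es. dense_small_set k n (late n) (nat \<lfloor>expansion k * n / 2\<rfloor> + 1) (crowding k n) es}) \<longlonglongrightarrow> 0"
proof (rule prob_tendsto_zeroI)
  define \<eta> where "\<eta> = expansion k"
  have \<eta>: "0 < \<eta>" "800 * exp 1 * real k * \<eta> = exp (- (600 * real k))" "\<eta> \<le> 1"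
    using k expansion_bounds[of k] by (simp_all add: \<eta>_def expansion_def)
  have "(\<lambda>n::nat. real k * (1 / real n)) \<longlonglongrightarrow> 0" by (intro tendsto_mult_right_zero) real_asymp
  then show "(\<lambda>n::nat. real k / real n) \<longlonglongrightarrow> 0" by simp
  have "\<forall>\<^sub>F n::nat in sequentially. 1 \<le> \<eta> * real n / 2" using \<eta>(1) by real_asymp
  moreover have "\<forall>\<^sub>F n::nat in sequentially. k \<le> n" by (rule eventually_ge_at_top)
  ultimately show "\<forall>\<^sub>F n in sequentially. measure_pmf.prob (edge_ordering k n)
    {es. dense_small_set k n (late n) (nat \<lfloor>expansion k * n / 2\<rfloor> + 1) (crowding k n) es} \<le> real k / real n"
    using eventually_fractions[OF k]
  proof eventually_elim
    case (elim n)
    then have n1: "1 \<le> n" and L: "2 \<le> ln (real n)" by auto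
    have n2: "n \<noteq> 1" using L by auto
    note B = early_late_bounds[OF n1]
    define M where "M = nat \<lfloor>\<eta> * n / 2\<rfloor> + 1"
    have "real (nat \<lfloor>\<eta> * n / 2\<rfloor>) \<le> \<eta> * n / 2" by (rule nat_floor_bounds) (use \<eta> in simp)
    then have M: "real M \<le> \<eta> * n" using elim(1) by (simp add: M_def)
    have nk: "k \<le> n" by (rule elim(2))
    have kn: "real k / (real n)\<^sup>2 \<le> 1"
    proof -
      have "real k \<le> real n * 1" using nk by simp
      also have "\<dots> \<le> real n * real n" using n1 by (intro mult_left_mono) auto
      finally show ?thesis using n1 by (simp add: power2_eq_square)
    qed
    have small: "real ((k * n) ^ s) * ((2 * (real s)\<^sup>2 * late n / (real n)\<^sup>2) ^ crowding k n s / fact (crowding k n s))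
        \<le> real k / (real n)\<^sup>2" if s: "s \<in> {1..M}" for s
    proof -
      define r where "r = crowding k n s"
      define x where "x = 2 * (real s)\<^sup>2 * late n / (real n)\<^sup>2"
      have s1: "1 \<le> s" and sM: "real s \<le> \<eta> * n" using s M by auto
      define q where "q = ln n * s / (200 * real k)"
      have q: "0 < q" using L s1 k by (simp add: q_def)
      have rq: "q \<le> real r" unfolding r_def crowding_def q_def by (rule real_nat_ceiling_ge)
      then have r0: "0 < real r" using q by linarith
      have x0: "0 \<le> x" by (simp add: x_def)
      have "x \<le> 2 * (real s)\<^sup>2 * (2 * real n * ln n) / (real n)\<^sup>2"
        unfolding x_def using B(3) by (intro divide_right_mono mult_left_mono) auto
      also have "\<dots> = 4 * (real s)\<^sup>2 * ln n / n" using n1 by (simp add: power2_eq_square)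
      finally have x: "x \<le> 4 * (real s)\<^sup>2 * ln n / n" .
      have "exp 1 * x / r \<le> exp 1 * (4 * (real s)\<^sup>2 * ln n / n) / q"
        using x x0 rq q L n1 by (intro frac_le mult_left_mono) auto
      also have "\<dots> = 800 * exp 1 * real k * (s / n)"
        using n2 L s1 k n1 by (simp add: q_def power2_eq_square)
      also have "\<dots> \<le> 800 * exp 1 * real k * \<eta>"
        using sM n1 by (intro mult_left_mono) (auto simp: field_simps)
      finally have base: "exp 1 * x / r \<le> exp (- (600 * real k))" unfolding \<eta>(2) .
      have "x ^ r / fact r = (x / r) ^ r * (real r ^ r / fact r)" using r0 by (simp add: power_divide)
      also have "\<dots> \<le> (x / r) ^ r * exp (real r)"
        using x0 by (intro mult_left_mono power_fact_le_exp) auto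
      also have "\<dots> = (exp 1 * x / r) ^ r"
        by (simp add: power_mult_distrib power_divide flip: exp_of_nat_mult)
      also have "\<dots> \<le> exp (- (600 * real k)) ^ r" using base x0 by (intro power_mono) auto
      also have "\<dots> = exp (- (600 * real k * r))" by (simp add: mult_ac flip: exp_of_nat_mult)
      also have "\<dots> \<le> exp (- (600 * real k * q))" using rq by (simp add: mult_left_mono)
      also have "600 * real k * q = real (3 * s) * ln n" using k by (simp add: q_def)
      also have "exp (- (real (3 * s) * ln n)) = inverse (exp (ln n) ^ (3 * s))"
        by (simp only: exp_minus exp_of_nat_mult)
      also have "\<dots> = (1 / real n ^ 3) ^ s" using n1 by (simp add: power_mult power_inverse divide_inverse)
      finally have "real ((k * n) ^ s) * (x ^ r / fact r) \<le> real ((k * n) ^ s) * (1 / real n ^ 3) ^ s"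
        by (rule mult_left_mono) simp
      also have "\<dots> = (real k / (real n)\<^sup>2) ^ s"
        using n1 by (simp add: power2_eq_square power3_eq_cube flip: power_mult_distrib)
      also have "\<dots> \<le> (real k / (real n)\<^sup>2) ^ 1" using s1 kn by (intro power_decreasing) auto
      finally show ?thesis by (simp add: x_def r_def)
    qed
    have "measure_pmf.prob (edge_ordering k n) {es. dense_small_set k n (late n) M (crowding k n) es} \<le>
      (\<Sum>s\<in>{1..M}. real ((k * n) ^ s) *
        ((2 * (real s)\<^sup>2 * late n / (real n)\<^sup>2) ^ crowding k n s / fact (crowding k n s)))"
      unfolding dense_small_set_def
      using prob_dense_small_set[where m = "late n" and n = n and k = k and M = M and r = "crowding k n"]
        elim k by simp
    also have "\<dots> \<le> (\<Sum>s\<in>{1..M}. real k / (real n)\<^sup>2)" by (intro sum_mono small)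
    also have "\<dots> = real M * (real k / (real n)\<^sup>2)" by simp
    also have "\<dots> \<le> real n * (real k / (real n)\<^sup>2)"
    proof (rule mult_right_mono)
      have "\<eta> * real n \<le> 1 * real n" using \<eta>(3) by (intro mult_right_mono) auto
      then show "real M \<le> real n" using M by simp
    qed simp
    also have "\<dots> = real k / real n" using n1 by (simp add: power2_eq_square)
    finally show ?case by (simp add: M_def \<eta>_def)
  qed
qed

section \<open>The graph at the stopping time\<close>

text \<open>
  The size up to which sets are absorbed. The ratios below are so small that the boxes of side
  \<open>box_ratio k d * n\<close> and the defect of the closure leave exceptional sets of at most this size.
\<close>

definition flexible_size :: "nat \<Rightarrow> nat \<Rightarrow> nat" where
  "flexible_size k n = nat \<lfloor>expansion k * n / 2\<rfloor>"

definition box_ratio :: "nat \<Rightarrow> nat \<Rightarrow> real" where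
  "box_ratio k d = expansion k / (4 * real k * (real (colours k d * (4 * d + 1)) + 1))"

definition defect_ratio :: "nat \<Rightarrow> nat \<Rightarrow> real" where
  "defect_ratio k d = expansion k / (2 * real (k * d ^ (k - 1) + d ^ k))"

lemma ratio_bounds:
  assumes "k \<ge> 3" "d \<ge> 1"
  shows "0 < box_ratio k d" "box_ratio k d \<le> 1" "0 < defect_ratio k d" "defect_ratio k d \<le> 1"
proof -
  have e: "0 < expansion k" "expansion k \<le> 1" using expansion_bounds[of k] assms by auto
  have "1 * 1 \<le> (4 * real k) * (real (colours k d * (4 * d + 1)) + 1)" using assms by (intro mult_mono) auto
  then have c1: "expansion k \<le> 4 * real k * (real (colours k d * (4 * d + 1)) + 1)"
    "0 < 4 * real k * (real (colours k d * (4 * d + 1)) + 1)" using e by linarith+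
  show "0 < box_ratio k d" unfolding box_ratio_def using e(1) c1(2) by (rule divide_pos_pos)
  show "box_ratio k d \<le> 1" unfolding box_ratio_def using c1 by (simp only: divide_le_eq_1_pos)
  have "1 \<le> d ^ k" using assms by simp
  then have "1 \<le> k * d ^ (k - 1) + d ^ k" by linarith
  then have "real 1 \<le> real (k * d ^ (k - 1) + d ^ k)" by (simp only: of_nat_le_iff)
  moreover define z where "z = 2 * real (k * d ^ (k - 1) + d ^ k)"
  ultimately have z: "expansion k \<le> z" "0 < z" using e by simp_all
  show "0 < defect_ratio k d" unfolding defect_ratio_def z_def[symmetric] using e(1) z(2) by (rule divide_pos_pos)
  show "defect_ratio k d \<le> 1" unfolding defect_ratio_def z_def[symmetric] using z by (simp only: divide_le_eq_1_pos)
qed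

lemma eventually_sizes:
  assumes k: "k \<ge> 3" and d: "d \<ge> 1"
  shows "\<forall>\<^sub>F n in sequentially. d \<le> n \<and> flexible_size k n < n \<and> 1 \<le> nat \<lceil>box_ratio k d * n\<rceil> \<and>
    colours k d * ((4 * d + 1) * nat \<lceil>box_ratio k d * n\<rceil>) + k * d \<le> n \<and>
    k * nat \<lceil>box_ratio k d * n\<rceil> + k * d \<le> flexible_size k n \<and>
    (k * (n * d ^ (k - 1)) + d ^ k * n) * nat \<lfloor>defect_ratio k d * real n ^ k\<rfloor> < n ^ k * (flexible_size k n + 1)"
proof -
  define \<eta> where "\<eta> = expansion k"
  define \<epsilon> where "\<epsilon> = box_ratio k d"
  define C where "C = real (colours k d * (4 * d + 1))"
  define c where "c = real (k * d ^ (k - 1) + d ^ k)"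
  have e: "0 < \<eta>" "\<eta> \<le> 1" using expansion_bounds[of k] k by (auto simp: \<eta>_def)
  note rb = ratio_bounds[OF k d]
  have \<epsilon>: "0 < \<epsilon>" using rb(1) by (simp add: \<epsilon>_def)
  have C: "0 \<le> C" by (simp add: C_def)
  have \<epsilon>e: "4 * (real k * \<epsilon>) * (C + 1) = \<eta>"
  proof -
    have "4 * (K * (E / (4 * K * Z))) * Z = E" if "K \<noteq> 0" "Z \<noteq> 0" for K Z E :: real
      using that by simp
    moreover have kC: "real k \<noteq> 0" "C + 1 \<noteq> 0" using k C by auto
    ultimately show ?thesis
      unfolding \<epsilon>_def box_ratio_def \<eta>_def C_def[symmetric] by blast
  qed
  have k\<epsilon>: "2 * (real k * \<epsilon>) < \<eta>"
    using \<epsilon>e e(1) k \<epsilon> C mult_left_mono[of 1 "C + 1" "4 * (real k * \<epsilon>)"] by simp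
  have "\<epsilon> * C \<le> (real k * \<epsilon>) * (C + 1)" using k \<epsilon> C by (intro mult_mono) auto
  then have C\<epsilon>: "2 * (C * \<epsilon>) \<le> 1" using \<epsilon>e e by (simp add: mult.commute)
  have c: "0 < c" "2 * c * defect_ratio k d = \<eta>"
  proof -
    have "0 < d ^ k" using d by simp
    then have "0 < k * d ^ (k - 1) + d ^ k" by linarith
    then show "0 < c" unfolding c_def by (simp only: of_nat_0_less_iff)
    then show "2 * c * defect_ratio k d = \<eta>" unfolding defect_ratio_def c_def[symmetric] \<eta>_def by simp
  qed
  have "\<forall>\<^sub>F n::nat in sequentially. real d + 2 * C + 2 * real (k * d) + 1 \<le> real n" by real_asymp
  moreover have "\<forall>\<^sub>F n::nat in sequentially. real k + real (k * d) + 1 \<le> (\<eta> / 2 - real k * \<epsilon>) * real n"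
  proof -
    have "0 < \<eta> / 2 - real k * \<epsilon>" using k\<epsilon> by simp
    then show ?thesis by real_asymp
  qed
  ultimately show ?thesis
  proof eventually_elim
    case (elim n)
    define s where "s = nat \<lceil>\<epsilon> * n\<rceil>"
    define m where "m = flexible_size k n"
    define D where "D = nat \<lfloor>defect_ratio k d * real n ^ k\<rfloor>"
    have n0: "0 < real n" using elim(1) C by linarith
    have "0 < \<epsilon> * n" using \<epsilon> n0 by simp
    then have s: "1 \<le> s" "real s \<le> \<epsilon> * n + 1" unfolding s_def by linarith+
    have m: "real m \<le> \<eta> * n / 2" "\<eta> * n / 2 - 1 \<le> real m" "\<eta> * n / 2 < real m + 1"
      unfolding m_def flexible_size_def \<eta>_def[symmetric] using e(1) n0
      by (auto intro!: nat_floor_bounds) linarith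
    have D: "real D \<le> defect_ratio k d * real n ^ k"
      unfolding D_def by (rule nat_floor_bounds) (use rb in simp)
    have "\<eta> * n \<le> 1 * real n" using e(2) by (intro mult_right_mono) auto
    then have "m < n" using m(1) n0 by linarith
    moreover have "d \<le> n" using elim(1) C by linarith
    moreover have "colours k d * ((4 * d + 1) * s) + k * d \<le> n"
    proof -
      have "C * s \<le> C * (\<epsilon> * n + 1)" using s(2) C by (rule mult_left_mono)
      moreover have "2 * (C * \<epsilon>) * n \<le> 1 * real n" using C\<epsilon> by (intro mult_right_mono) auto
      ultimately have "C * s + real (k * d) \<le> real n" using elim(1) by (simp add: algebra_simps)
      moreover have "C * s = real (colours k d * ((4 * d + 1) * s))" by (simp add: C_def algebra_simps)
      ultimately have "real (colours k d * ((4 * d + 1) * s) + k * d) \<le> real n" by simp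
      then show ?thesis by (simp only: of_nat_le_iff)
    qed
    moreover have "k * s + k * d \<le> m"
    proof -
      have "real k * s \<le> real k * (\<epsilon> * n + 1)" using s(2) by (intro mult_left_mono) auto
      then have "real (k * s + k * d) \<le> real m" using elim(2) m(2) by (simp add: algebra_simps)
      then show ?thesis by (simp only: of_nat_le_iff)
    qed
    moreover have "(k * (n * d ^ (k - 1)) + d ^ k * n) * D < n ^ k * (m + 1)"
    proof -
      have "real ((k * (n * d ^ (k - 1)) + d ^ k * n) * D) = c * n * D" by (simp add: c_def algebra_simps)
      also have "\<dots> \<le> c * n * (defect_ratio k d * real n ^ k)" using c(1) D by (intro mult_left_mono) auto
      also have "\<dots> = (2 * c * defect_ratio k d) * n / 2 * real n ^ k" by simp
      also have "\<dots> = \<eta> * n / 2 * real n ^ k" by (simp only: c(2))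
      also have "\<dots> < (real m + 1) * real n ^ k" using m(3) n0 by (intro mult_strict_right_mono) auto
      also have "\<dots> = real (n ^ k * (m + 1))" by (simp add: algebra_simps)
      finally show ?thesis by (simp only: of_nat_less_iff)
    qed
    ultimately show ?case using s(1) unfolding s_def m_def D_def \<epsilon>_def by blast
  qed
qed

lemma eventually_high_degree:
  "\<forall>\<^sub>F n::nat in sequentially. real (nat \<lfloor>ln n / 50\<rfloor>) \<le> ln n / 50 \<and>
    (\<forall>c s. 1 \<le> s \<longrightarrow> c < crowding k n s \<longrightarrow> c * (2 * k) < (nat \<lfloor>ln n / 50\<rfloor> - d) * s)" if k: "1 \<le> k"
proof -
  have "\<forall>\<^sub>F n::nat in sequentially. ln n / 100 \<ge> 1 + real d \<and> 0 < ln (real n)"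
    by (intro eventually_conj; real_asymp)
  then show ?thesis
  proof eventually_elim
    case (elim n)
    define h where "h = nat \<lfloor>ln n / 50\<rfloor>"
    have h: "real h \<le> ln n / 50" "ln n / 50 - 1 \<le> real h"
      unfolding h_def by (rule nat_floor_bounds, use elim in simp)+
    then have hd: "ln n / 100 \<le> real (h - d)" using elim by linarith
    have "c * (2 * k) < (h - d) * s" if s: "1 \<le> s" "c < crowding k n s" for c s
    proof -
      have "int c < \<lceil>ln n * s / (200 * real k)\<rceil>" using s(2) unfolding crowding_def by linarith
      then have "real c < ln n * s / (200 * real k)" by linarith
      then have "real c * (200 * real k) < ln n * s" using k by (simp add: pos_less_divide_eq)
      then have "real c * (2 * real k) < ln n / 100 * s" by simp
      also have "\<dots> \<le> real (h - d) * s" using hd by (intro mult_right_mono) auto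
      finally have "real (c * (2 * k)) < real ((h - d) * s)" by simp
      then show ?thesis by (simp only: of_nat_less_iff)
    qed
    then show ?case using h(1) by (simp add: h_def)
  qed
qed

text \<open>
  Finitely many events of vanishing probability may be excluded.
\<close>

lemma aas_not_bad:
  assumes "\<And>b. b \<in> set bs \<Longrightarrow> (\<lambda>n. measure_pmf.prob (X n) {x. b n x}) \<longlonglongrightarrow> 0"
    and "\<forall>\<^sub>F n in sequentially. \<forall>x\<in>set_pmf (X n). (\<forall>b\<in>set bs. \<not> b n x) \<longrightarrow> P n (g n x)"
  shows "asymptotically_almost_surely (\<lambda>n. map_pmf (g n) (X n)) P"
proof -
  let ?s = "\<lambda>n. \<Sum>b\<leftarrow>bs. measure_pmf.prob (X n) {x. b n x}"
  have s0: "?s \<longlonglongrightarrow> 0" using assms(1)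
  proof (induction bs)
    case (Cons b bs)
    then show ?case using tendsto_add[of "\<lambda>n. measure_pmf.prob (X n) {x. b n x}" 0] by simp
  qed simp
  have bad: "measure_pmf.prob (X n) {x. \<exists>b\<in>set bs. b n x} \<le> ?s n" for n
  proof (induction bs)
    case (Cons b bs)
    have "measure_pmf.prob (X n) {x. \<exists>b\<in>set (b # bs). b n x} =
        measure_pmf.prob (X n) ({x. b n x} \<union> {x. \<exists>b\<in>set bs. b n x})"
      by (intro arg_cong[of _ _ "measure_pmf.prob (X n)"]) auto
    also have "\<dots> \<le> measure_pmf.prob (X n) {x. b n x} + measure_pmf.prob (X n) {x. \<exists>b\<in>set bs. b n x}"
      by (rule measure_Un_le) auto
    finally show ?case using Cons by simp
  qed simp
  have lim: "(\<lambda>n. 1 - ?s n) \<longlonglongrightarrow> 1" using tendsto_diff[OF tendsto_const s0, of 1] by simp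
  have lower: "\<forall>\<^sub>F n in sequentially. 1 - ?s n \<le> measure_pmf.prob (map_pmf (g n) (X n)) {G. P n G}"
    using assms(2)
  proof eventually_elim
    case (elim n)
    have "1 - ?s n \<le> 1 - measure_pmf.prob (X n) {x. \<exists>b\<in>set bs. b n x}" using bad[of n] by simp
    also have "\<dots> = measure_pmf.prob (X n) (- {x. \<exists>b\<in>set bs. b n x})"
      using measure_pmf.prob_compl[of "{x. \<exists>b\<in>set bs. b n x}" "X n"] by (simp add: Compl_eq_Diff_UNIV)
    also have "\<dots> = measure_pmf.prob (X n) (- {x. \<exists>b\<in>set bs. b n x} \<inter> set_pmf (X n))"
      by (simp only: measure_Int_set_pmf)
    also have "\<dots> \<le> measure_pmf.prob (X n) (g n -` {G. P n G})"
      using elim by (intro measure_pmf.finite_measure_mono) auto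
    finally show ?case by simp
  qed
  have upper: "\<forall>\<^sub>F n in sequentially. measure_pmf.prob (map_pmf (g n) (X n)) {G. P n G} \<le> 1"
    by (intro always_eventually allI measure_pmf.prob_le_1)
  show ?thesis
    unfolding asymptotically_almost_surely_def by (rule tendsto_sandwich[OF lower upper lim tendsto_const])
qed

theorem random_stopped_graph_globally_rigid:
  fixes \<iota> :: "'a::field_char_0 \<Rightarrow> complex"
  assumes \<iota>: "\<iota> 0 = 0" "\<iota> 1 = 1" "inj \<iota>" "\<And>a b. \<iota> (a * b) = \<iota> a * \<iota> b"
    and k: "k \<ge> 3" and d: "d \<ge> 1"
  shows "asymptotically_almost_surely (\<lambda>n. stopped_graph k n (d + 1)) (\<lambda>n G. globally_rigid TYPE('a) k n d G)"
proof -
  define s where "s n = nat \<lceil>box_ratio k d * real n\<rceil>" for n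
  define D where "D n = nat \<lfloor>defect_ratio k d * real n ^ k\<rfloor>" for n
  let ?r = "\<lambda>n. ln (real n) / 50" and ?cl = "\<lambda>n. rigidity_closure TYPE('a) k n d"
  define bs where "bs =
    [\<lambda>n es. \<forall>v\<in>vertex_class n 0. star k n v \<inter> set (take (early n) es) \<noteq> {},
     \<lambda>n es. \<exists>v\<in>vertices k n. card (star k n v \<inter> set (take (late n) es)) \<le> d,
     \<lambda>n es. \<not> meets_boxes k n (s n) (set (take (early n) es)),
     \<lambda>n. sparse_closure k n (early n) (?cl n) (d * k * n) (D n),
     \<lambda>n. two_low_in_edge k n (early n) (late n) (?r n),
     \<lambda>n. two_low_in_path k n (early n) (late n) (?r n),
     \<lambda>n. low_in_two_edges k n (early n) (late n) (?r n),
     \<lambda>n. dense_small_set k n (late n) (flexible_size k n + 1) (crowding k n)]"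
  show ?thesis unfolding stopped_graph_def
  proof (rule aas_not_bad[where bs = bs])
    note rb = ratio_bounds[OF k d]
    have "list_all (\<lambda>b. (\<lambda>n. measure_pmf.prob (edge_ordering k n) {x. b n x}) \<longlonglongrightarrow> 0) bs"
      unfolding bs_def list.pred_inject s_def D_def flexible_size_def
      by (intro conjI; rule list.pred_inject(1) no_isolated_vertex_null[OF k] small_degree_null[OF k, of d]
        missed_box_null[OF k rb(1,2)] sparse_closure_null[OF k rb(3,4), of ?cl "d * k"]
        two_low_in_edge_null[OF k] two_low_in_path_null[OF k] low_in_two_edges_null[OF k]
        dense_small_set_null[OF k])
    then show "\<And>b. b \<in> set bs \<Longrightarrow> (\<lambda>n. measure_pmf.prob (edge_ordering k n) {x. b n x}) \<longlonglongrightarrow> 0"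
      by (simp add: list_all_iff)
  next
    have k1: "1 \<le> k" using k by simp
    show "\<forall>\<^sub>F n in sequentially. \<forall>es\<in>set_pmf (edge_ordering k n). (\<forall>b\<in>set bs. \<not> b n es) \<longrightarrow>
        globally_rigid TYPE('a) k n d (process_graph es (min_degree_time k n (d + 1) es))"
      using eventually_sizes[OF k d] eventually_high_degree[OF k1, of d]
    proof eventually_elim
      case (elim n)
      show ?case
      proof (intro ballI impI)
        fix es assume es: "es \<in> set_pmf (edge_ordering k n)" and good: "\<forall>b\<in>set bs. \<not> b n es"
        have "es \<in> permutations_of_set (complete_edges k n)"
          using es by (simp add: edge_ordering_def set_pmf_of_set)
        then show "globally_rigid TYPE('a) k n d (process_graph es (min_degree_time k n (d + 1) es))"
          by (rule stopped_process_globally_rigid[OF \<iota> k d, where ?m0.0 = "early n" and ?m1.0 = "late n" and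
            s = "s n" and D = "D n" and r = "?r n" and m = "flexible_size k n" and g = "crowding k n" and
            h = "nat \<lfloor>ln (real n) / 50\<rfloor>"])
            (use good elim in \<open>simp_all add: bs_def s_def D_def\<close>)
      qed
    qed
  qed
qed

theorem theorem6p10:
  fixes k d :: nat
  assumes "k \<ge> 3" and "d \<ge> 1"
  shows "asymptotically_almost_surely (\<lambda>n. stopped_graph k n (d + 1))
           (\<lambda>n G. globally_rigid TYPE(real) k n d G)
       \<and> asymptotically_almost_surely (\<lambda>n. stopped_graph k n (d + 1))
           (\<lambda>n G. globally_rigid TYPE(complex) k n d G)"
proof
  show "asymptotically_almost_surely (\<lambda>n. stopped_graph k n (d + 1))
      (\<lambda>n G. globally_rigid TYPE(real) k n d G)"
    by (rule random_stopped_graph_globally_rigid[where \<iota> = complex_of_real, OF _ _ _ _ assms])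
      (auto intro: injI)
  show "asymptotically_almost_surely (\<lambda>n. stopped_graph k n (d + 1))
      (\<lambda>n G. globally_rigid TYPE(complex) k n d G)"
    by (rule random_stopped_graph_globally_rigid[where \<iota> = "\<lambda>z. z", OF _ _ _ _ assms]) auto
qed

end
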